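(* For every $\epsilon>0$ there is a constant $C_\epsilon>0$, depending on $\epsilon$ but not on $\delta$, such that for all small $0<\delta<1$ and all functions $f$ on $\mathbb R^3$ whose Fourier transform is supported in $\Gamma_\delta$, $$\|f\|_{L^4(\mathbb R^3)}\le C_\epsilon\,\delta^{-\frac1{16}-\epsilon}\,\|S_\delta f\|_{L^4(\mathbb R^3)}.$$
   Context: $\Gamma=\{(\xi,\tau)\in\mathbb R^2\times\mathbb R:\tau=|\xi|,\ 1\le\tau\le2\}$ is a truncated light cone in $\mathbb R^3$, and for small $0<\delta<1$, $\Gamma_\delta$ is the $\delta$-neighborhood of $\Gamma$. The set $\Gamma_\delta$ is partitioned into $O(\delta^{-1/2})$ sectors $\Theta=\{(\xi,\tau)\in\Gamma_\delta:\xi/|\xi|\in\theta\}$, where $\theta$ runs over a partition of the unit circle into arcs of angular length comparable to $\delta^{1/2}$; $\mathbf\Pi_\delta$ denotes the collection of these sectors. Each $\Theta$ is comparable to a rectangular box of dimensions about $1\times\delta^{1/2}\times\delta$, and $k\Theta$ denotes the $k$-dilate of that box about its center. Fix Schwartz functions $\Xi_\Theta$ such that each $\widehat\Xi_\Theta$ is a bump function supported in the neighborhood $2\Theta$ of $\Theta$ and adapted to it (after an affine map sending the box of $\Theta$ to the unit cube, all derivatives are bounded uniformly in $\Theta$ and $\delta$), and $\{\widehat\Xi_\Theta\}_{\Theta\in\mathbf\Pi_\delta}$ is a partition of unity of $\Gamma_\delta$, i.e. $\sum_\Theta\widehat\Xi_\Theta=1$ on $\Gamma_\delta$. Put $f_\Theta=f*\Xi_\Theta$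 and $$S_\delta f=\Big(\sum_{\Theta\in\mathbf\Pi_\delta}|f_\Theta|^2\Big)^{1/2}.$$ *)

theory Defs
  imports "HOL-Analysis.Analysis"
begin

type_synonym spacetime = "(real^2) \<times> real"

section \<open>Smooth and Schwartz functions\<close>

text \<open>For a list of basis vectors this is the iterated partial derivative, the head of the list
  being differentiated last; lists of basis vectors play the role of multi-indices.\<close>

primrec partial_derivs ::
  "'a::euclidean_space list \<Rightarrow> ('a \<Rightarrow> 'b::real_normed_vector) \<Rightarrow> 'a \<Rightarrow> 'b" where
  "partial_derivs [] f = f"
| "partial_derivs (v # vs) f = (\<lambda>x. frechet_derivative (partial_derivs vs f) (at x) v)"

definition smooth :: "('a::euclidean_space \<Rightarrow> 'b::real_normed_vector) \<Rightarrow> bool" where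
  "smooth f \<longleftrightarrow> (\<forall>vs. set vs \<subseteq> Basis \<longrightarrow> partial_derivs vs f differentiable_on UNIV)"

definition schwartz :: "('a::euclidean_space \<Rightarrow> complex) \<Rightarrow> bool" where
  "schwartz f \<longleftrightarrow> smooth f \<and>
     (\<forall>vs n. set vs \<subseteq> Basis \<longrightarrow> bounded (range (\<lambda>x. norm x ^ n *\<^sub>R partial_derivs vs f x)))"

definition test_function :: "('a::euclidean_space \<Rightarrow> complex) \<Rightarrow> bool" where
  "test_function \<phi> \<longleftrightarrow> smooth \<phi> \<and> compact (closure {x. \<phi> x \<noteq> 0})"

section \<open>Fourier transform, convolution and Lebesgue norms\<close>

definition fourier :: "('a::euclidean_space \<Rightarrow> complex) \<Rightarrow> 'a \<Rightarrow> complex" where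
  "fourier f \<xi> = (LINT x|lborel. cis (- 2 * pi * (x \<bullet> \<xi>)) * f x)"

definition convolution ::
  "('a::euclidean_space \<Rightarrow> complex) \<Rightarrow> ('a \<Rightarrow> complex) \<Rightarrow> 'a \<Rightarrow> complex" where
  "convolution f g x = (LINT y|lborel. f y * g (x - y))"

text \<open>The functions that define a tempered distribution by integration. All \<open>L\<^sup>p\<close> functions with
  \<open>p \<ge> 1\<close> are of this kind, and so is, up to a null set, every tempered distribution whose Fourier
  transform has compact support.\<close>

definition tempered_function :: "('a::euclidean_space \<Rightarrow> complex) \<Rightarrow> bool" where
  "tempered_function f \<longleftrightarrow> f \<in> borel_measurable lborel \<and>
     (\<exists>N::nat. integrable lborel (\<lambda>x. f x / of_real ((1 + norm x) ^ N)))"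

text \<open>The Fourier transform of \<open>f\<close>, as the distribution \<open>\<phi> \<mapsto> \<integral> f * fourier \<phi>\<close>, vanishes on the
  complement of the (closed) set \<open>A\<close>.\<close>

definition fourier_supported_in :: "('a::euclidean_space \<Rightarrow> complex) \<Rightarrow> 'a set \<Rightarrow> bool" where
  "fourier_supported_in f A \<longleftrightarrow>
     (\<forall>\<phi>. test_function \<phi> \<and> closure {\<xi>. \<phi> \<xi> \<noteq> 0} \<inter> A = {} \<longrightarrow>
          (LINT x|lborel. f x * fourier \<phi> x) = 0)"

text \<open>Valued in the extended half-line; the value is \<open>\<infinity>\<close> when the function is not in \<open>L\<^sup>p\<close>.\<close>

definition Lp_norm :: "real \<Rightarrow> ('a::euclidean_space \<Rightarrow> 'b::real_normed_vector) \<Rightarrow> ennreal" where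
  "Lp_norm p f =
     (let I = (\<integral>\<^sup>+ x. ennreal (norm (f x) powr p) \<partial>lborel)
      in if I = \<infinity> then \<infinity> else ennreal (enn2real I powr (1 / p)))"

section \<open>The truncated cone and its sectors\<close>

definition cone :: "spacetime set" where
  "cone = {(\<xi>, \<tau>). \<tau> = norm \<xi> \<and> 1 \<le> \<tau> \<and> \<tau> \<le> 2}"

definition cone_nbhd :: "real \<Rightarrow> spacetime set" where
  "cone_nbhd \<delta> = (\<Union>p\<in>cone. cball p \<delta>)"

text \<open>Endpoints may or may not belong to the arc, so that arcs can partition the circle.\<close>

definition arc_of_length :: "real \<Rightarrow> (real^2) set \<Rightarrow> bool" where
  "arc_of_length l \<theta> \<longleftrightarrow> 0 < l \<and> l \<le> 2 * pi \<and>
     (\<exists>a I. {a<..<a + l} \<subseteq> I \<and> I \<subseteq> {a..a + l} \<and> \<theta> = (\<lambda>t. vector [cos t, sin t]) ` I)"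

definition arc_partition :: "real \<Rightarrow> real \<Rightarrow> (real^2) set set \<Rightarrow> bool" where
  "arc_partition K \<delta> P \<longleftrightarrow> finite P \<and> partition_on (sphere 0 1) P \<and>
     (\<forall>\<theta>\<in>P. \<exists>l. sqrt \<delta> / K \<le> l \<and> l \<le> K * sqrt \<delta> \<and> arc_of_length l \<theta>)"

definition sector :: "real \<Rightarrow> (real^2) set \<Rightarrow> spacetime set" where
  "sector \<delta> \<theta> = {(\<xi>, \<tau>). (\<xi>, \<tau>) \<in> cone_nbhd \<delta> \<and> \<xi> /\<^sub>R norm \<xi> \<in> \<theta>}"

definition sectors :: "real \<Rightarrow> (real^2) set set \<Rightarrow> spacetime set set" where
  "sectors \<delta> P = sector \<delta> ` P"

section \<open>Rectangular boxes\<close>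

text \<open>A box is given by its center and three edge vectors, which \<open>comparable_box\<close> requires to be
  orthogonal; \<open>box_map\<close> sends the unit cube centered at the origin onto the box.\<close>

datatype rbox = RBox (center: spacetime) (edge1: spacetime) (edge2: spacetime) (edge3: spacetime)

definition box_map :: "rbox \<Rightarrow> real^3 \<Rightarrow> spacetime" where
  "box_map B t = center B + (t $ 1) *\<^sub>R edge1 B + (t $ 2) *\<^sub>R edge2 B + (t $ 3) *\<^sub>R edge3 B"

definition dilate :: "real \<Rightarrow> rbox \<Rightarrow> spacetime set" where
  "dilate k B = box_map B ` {t. \<forall>i. \<bar>t $ i\<bar> \<le> k / 2}"

definition comparable_box :: "real \<Rightarrow> real \<Rightarrow> spacetime set \<Rightarrow> rbox \<Rightarrow> bool" where
  "comparable_box K \<delta> \<Theta> B \<longleftrightarrow>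
     edge1 B \<bullet> edge2 B = 0 \<and> edge1 B \<bullet> edge3 B = 0 \<and> edge2 B \<bullet> edge3 B = 0 \<and>
     1 / K \<le> norm (edge1 B) \<and> norm (edge1 B) \<le> K \<and>
     sqrt \<delta> / K \<le> norm (edge2 B) \<and> norm (edge2 B) \<le> K * sqrt \<delta> \<and>
     \<delta> / K \<le> norm (edge3 B) \<and> norm (edge3 B) \<le> K * \<delta> \<and>
     dilate (1 / K) B \<subseteq> \<Theta> \<and> \<Theta> \<subseteq> dilate 1 B"

section \<open>The square function\<close>

text \<open>The data are families indexed by the scale \<open>\<delta>\<close>, \<open>0 < \<delta> < \<delta>\<^sub>0\<close>: a partition \<open>arcs \<delta>\<close> of the
  circle, a box \<open>B \<delta> \<Theta>\<close> for each sector and a function \<open>\<Xi> \<delta> \<Theta>\<close> for each sector. The implied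
  constants do not depend on \<open>\<delta>\<close> or on the sector.\<close>

definition sector_decomposition ::
  "real \<Rightarrow> (real \<Rightarrow> (real^2) set set) \<Rightarrow> (real \<Rightarrow> spacetime set \<Rightarrow> rbox) \<Rightarrow> bool" where
  "sector_decomposition \<delta>\<^sub>0 arcs B \<longleftrightarrow>
     (\<exists>K\<ge>1. \<forall>\<delta>\<in>{0<..<\<delta>\<^sub>0}. arc_partition K \<delta> (arcs \<delta>) \<and>
        (\<forall>\<Theta>\<in>sectors \<delta> (arcs \<delta>). comparable_box K \<delta> \<Theta> (B \<delta> \<Theta>)))"

definition adapted_partition_of_unity ::
  "real \<Rightarrow> (real \<Rightarrow> (real^2) set set) \<Rightarrow> (real \<Rightarrow> spacetime set \<Rightarrow> rbox)
    \<Rightarrow> (real \<Rightarrow> spacetime set \<Rightarrow> spacetime \<Rightarrow> complex) \<Rightarrow> bool" where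
  "adapted_partition_of_unity \<delta>\<^sub>0 arcs B \<Xi> \<longleftrightarrow>
     (\<forall>\<delta>\<in>{0<..<\<delta>\<^sub>0}. \<forall>\<Theta>\<in>sectors \<delta> (arcs \<delta>).
        schwartz (\<Xi> \<delta> \<Theta>) \<and>
        closure {p. fourier (\<Xi> \<delta> \<Theta>) p \<noteq> 0} \<subseteq> dilate 2 (B \<delta> \<Theta>)) \<and>
     (\<forall>vs. set vs \<subseteq> Basis \<longrightarrow>
        (\<exists>A. \<forall>\<delta>\<in>{0<..<\<delta>\<^sub>0}. \<forall>\<Theta>\<in>sectors \<delta> (arcs \<delta>). \<forall>t.
           cmod (partial_derivs vs (\<lambda>s. fourier (\<Xi> \<delta> \<Theta>) (box_map (B \<delta> \<Theta>) s)) t) \<le> A)) \<and>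
     (\<forall>\<delta>\<in>{0<..<\<delta>\<^sub>0}. \<forall>p\<in>cone_nbhd \<delta>.
        (\<Sum>\<Theta>\<in>sectors \<delta> (arcs \<delta>). fourier (\<Xi> \<delta> \<Theta>) p) = 1)"

definition square_function ::
  "spacetime set set \<Rightarrow> (spacetime set \<Rightarrow> spacetime \<Rightarrow> complex)
    \<Rightarrow> (spacetime \<Rightarrow> complex) \<Rightarrow> spacetime \<Rightarrow> real" where
  "square_function S \<Xi> f x = sqrt (\<Sum>\<Theta>\<in>S. (cmod (convolution f (\<Xi> \<Theta>) x))\<^sup>2)"

end

theory Submission
  imports Defs "HOL-Probability.Probability" "HOL-Computational_Algebra.Polynomial"
begin

text \<open>The high-low frequency method of Guth, Wang and Zhang, in a simplified form. Let the frequencies lie near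
  the curves \<open>\<lambda> (1, t, t\<^sup>2)\<close>, split them into \<open>2\<^sup>n\<close> sectors according to \<open>t\<close>, and let \<open>X v\<close> be the integral of the
  square of the sum of \<open>|F|\<^sup>2\<close> over the \<open>2\<^sup>v\<close> dyadic blocks \<open>F\<close> of sectors; so \<open>X 0\<close> is the fourth power of the \<open>L\<^sup>4\<close> norm
  and \<open>X n\<close> that of the square function. The functions \<open>|F|\<^sup>2\<close> have their frequencies in planks, and these overlap
  so little that \<open>X v\<close> is at most \<open>O(n)\<close> times the sum, over the dyadic nodes of levels \<open>u \<le> v\<close>, of the square
  integrals of averages of the partial sums of \<open>|F|\<^sup>2\<close> over dual boxes. If \<open>u\<close> is small, the averaging makes the
  blocks of level \<open>v + \<kappa>\<close> almost orthogonal pointwise. If \<open>u\<close> is large and \<open>\<lambda>\<close> varies by at most \<open>16 powr (- \<kappa>)\<close>, the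
  problem is that of a parabola, where products of two blocks are almost orthogonal. In both cases one gets
  \<open>X v \<le> O(n\<^sup>2) X (v + \<kappa>)\<close>. With \<open>n = 32 \<kappa>\<close>, the 32 steps cost a power of \<open>n\<close>, and cutting the cone into
  \<open>16 ^ \<kappa>\<close> slices on which \<open>\<lambda>\<close> is almost constant costs \<open>16 ^ (4 \<kappa>) = 2 powr (n / 2)\<close>, about \<open>\<delta> powr (- 1 / 4)\<close>, in \<open>X 0\<close>.

  A tempered \<open>f\<close> is reached through \<open>f \<psi>(\<eta> x)\<close>, where \<open>\<psi>\<close> is rapidly decreasing and has compactly supported
  Fourier transform. That \<open>f\<close> is the sum of its pieces \<open>f * \<Xi>\<^sub>\<Theta>\<close> holds because \<open>1 - \<Sum> fourier \<Xi>\<^sub>\<Theta>\<close> vanishes to infinite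
  order at the frequencies of \<open>f\<close>, which beats the polynomial growth of the integral of \<open>|f \<psi>(\<eta> x)|\<close>.\<close>

section \<open>Fourier inversion\<close>

text \<open>The border between the two cases comes from two scale conditions. Averaging over the box
  dual to the plank of a node of level \<open>u\<close> keeps only frequencies of transversal size
  about \<open>2 ^ u / 4 ^ v\<close>; this separates blocks of level \<open>w\<close>, which have
  length \<open>1 / 2 ^ w\<close>, as soon as \<open>w + u \<le> 2 * v\<close>. The parabola
  argument, inside a node of length \<open>s = 1 / 2 ^ u\<close> with blocks of length
  \<open>h = 1 / 2 ^ w\<close>, tolerates a variation \<mu> of \<lambda> with
  \<open>\<mu> * s\<^sup>2 \<le> h\<^sup>2\<close>; for \<open>\<mu> = 1 / 16 ^ \<kappa>\<close>
  this reads \<open>w \<le> u + 2 * \<kappa>\<close>. With \<open>w = v + \<kappa>\<close> the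
  conditions become \<open>u + \<kappa> \<le> v\<close> and \<open>v \<le> u + \<kappa>\<close>, so
  every \<open>u\<close> satisfies one of them. The slices are cut once, before the iteration, and
  their cost is not multiplied from step to step. The constant of a step, on the other hand, is
  raised to the number of steps, which therefore must not grow with \<open>n\<close>: the step
  \<open>\<kappa>\<close> has to be a fixed fraction of \<open>n\<close>. With
  \<open>n = m * \<kappa>\<close> the slices cost \<open>2 powr (16 * n / m)\<close> in
  \<open>X 0\<close>, and the fourth root divides the resulting exponent of \<delta> by 4:
  \<open>m = 32\<close> is the choice that leads to 1/16.\<close>

lemma measurable_cis [measurable]: "cis \<in> borel_measurable borel"
  by (intro borel_measurable_continuous_onI continuous_intros)

lemma integral_affine:
  fixes f :: "'a::euclidean_space \<Rightarrow> 'b::{banach, second_countable_topology}"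
  assumes [measurable]: "f \<in> borel_measurable borel" and c: "c \<noteq> 0"
  shows "(\<integral>x. f x \<partial>lborel) = \<bar>c\<bar> ^ DIM('a) *\<^sub>R (\<integral>x. f (t + c *\<^sub>R x) \<partial>lborel)"
  by (subst lborel_affine[OF c, of t]) (simp add: integral_density integral_distr)

lemma integrable_affine:
  fixes f :: "'a::euclidean_space \<Rightarrow> 'b::{banach, second_countable_topology}"
  assumes f: "integrable lborel f" and c: "c \<noteq> 0"
  shows "integrable lborel (\<lambda>x. f (t + c *\<^sub>R x))"
proof -
  have [measurable]: "f \<in> borel_measurable borel" using f by simp
  have "integrable (density (distr lborel borel (\<lambda>x. t + c *\<^sub>R x)) (\<lambda>_. ennreal (\<bar>c\<bar> ^ DIM('a)))) f"
    using f lborel_affine[OF c, of t] by (simp add: ennreal_power)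
  then have "integrable lborel (\<lambda>x. \<bar>c\<bar> ^ DIM('a) *\<^sub>R f (t + c *\<^sub>R x))"
    by (subst (asm) integrable_density) (auto simp: integrable_distr_eq)
  then have "integrable lborel (\<lambda>x. inverse (\<bar>c\<bar> ^ DIM('a)) *\<^sub>R \<bar>c\<bar> ^ DIM('a) *\<^sub>R f (t + c *\<^sub>R x))"
    by (rule integrable_scaleR_right)
  then show ?thesis using c by simp
qed

lemma integrable_cis_mult [simp]:
  fixes f :: "'a::euclidean_space \<Rightarrow> complex"
  assumes f: "integrable lborel f" and [measurable]: "u \<in> borel_measurable borel"
  shows "integrable lborel (\<lambda>x. cis (u x) * f x)"
proof -
  have [measurable]: "f \<in> borel_measurable borel" using f by auto
  show ?thesis using f by (rule Bochner_Integration.integrable_bound) (auto simp: norm_mult)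
qed

lemma integrable_pair_mult:
  fixes f :: "'a::euclidean_space \<Rightarrow> complex" and g :: "'b::euclidean_space \<Rightarrow> complex"
  assumes f: "integrable lborel f" and g: "integrable lborel g"
    and K [measurable]: "(\<lambda>(x, y). K x y) \<in> borel_measurable (borel \<Otimes>\<^sub>M borel)"
    and bd: "\<And>x y. cmod (K x y) \<le> 1"
  shows "integrable (lborel \<Otimes>\<^sub>M lborel) (\<lambda>(x, y). f x * g y * K x y)"
proof -
  have [measurable]: "f \<in> borel_measurable borel" "g \<in> borel_measurable borel" using f g by auto
  have "integrable (lborel \<Otimes>\<^sub>M lborel) (\<lambda>(x, y). f x * g y)"
  proof (rule lborel_pair.Fubini_integrable)
    show "(\<lambda>(x, y). f x * g y) \<in> borel_measurable (lborel \<Otimes>\<^sub>M lborel)" by measurable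
    show "integrable lborel (\<lambda>x. \<integral>y. norm (case (x, y) of (x, y) \<Rightarrow> f x * g y) \<partial>lborel)"
      using f by (simp add: norm_mult)
    show "AE x in lborel. integrable lborel (\<lambda>y. case (x, y) of (x, y) \<Rightarrow> f x * g y)"
      using g by simp
  qed
  then show ?thesis
    by (rule Bochner_Integration.integrable_bound)
       (measurable, auto simp: norm_mult intro!: AE_I2 mult_right_le_one_le bd)
qed

text \<open>A kernel bounded by 1 leaves \<open>f x * g y * K x y\<close> integrable on the product
  space, so no decay of \<open>K\<close> is required. The exchanges of integrals in Gauss summation,
  inversion and Parseval's identity are of this form.\<close>

lemma fubini_kernel:
  fixes f :: "'a::euclidean_space \<Rightarrow> complex" and g :: "'b::euclidean_space \<Rightarrow> complex"
  assumes f: "integrable lborel f" and g: "integrable lborel g"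
    and K: "(\<lambda>(x, y). K x y) \<in> borel_measurable (borel \<Otimes>\<^sub>M borel)"
    and bd: "\<And>x y. cmod (K x y) \<le> 1"
  shows "(\<integral>x. f x * (\<integral>y. g y * K x y \<partial>lborel) \<partial>lborel) = (\<integral>y. g y * (\<integral>x. f x * K x y \<partial>lborel) \<partial>lborel)"
proof -
  have "(\<integral>y. (\<integral>x. f x * g y * K x y \<partial>lborel) \<partial>lborel) = (\<integral>x. (\<integral>y. f x * g y * K x y \<partial>lborel) \<partial>lborel)"
    by (rule lborel_pair.Fubini_integral[OF integrable_pair_mult[OF assms]])
  moreover have "(\<integral>x. f x * g y * K x y \<partial>lborel) = g y * (\<integral>x. f x * K x y \<partial>lborel)" for y
    by (subst integral_mult_right_zero[symmetric]) (simp add: ac_simps)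
  moreover have "(\<integral>y. f x * g y * K x y \<partial>lborel) = f x * (\<integral>y. g y * K x y \<partial>lborel)" for x
    by (simp add: mult.assoc)
  ultimately show ?thesis by simp
qed

lemma
  fixes h :: "'a::euclidean_space \<Rightarrow> real \<Rightarrow> complex"
  assumes h: "\<And>b. b \<in> Basis \<Longrightarrow> integrable lborel (h b)"
  shows integrable_prod_Basis: "integrable lborel (\<lambda>x::'a. \<Prod>b\<in>Basis. h b (x \<bullet> b))"
    and integral_prod_Basis:
      "(\<integral>x. (\<Prod>b\<in>Basis. h b (x \<bullet> b)) \<partial>(lborel :: 'a measure)) = (\<Prod>b\<in>Basis. \<integral>t. h b t \<partial>lborel)"
proof -
  interpret product_sigma_finite "\<lambda>_::'a. lborel :: real measure" ..
  have [measurable]: "b \<in> Basis \<Longrightarrow> h b \<in> borel_measurable borel" for b using h by auto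
  have "integrable (\<Pi>\<^sub>M b\<in>(Basis::'a set). lborel) (\<lambda>x. \<Prod>b\<in>Basis. h b (x b))"
    by (rule product_integrable_prod) (auto simp: h)
  then show "integrable lborel (\<lambda>x::'a. \<Prod>b\<in>Basis. h b (x \<bullet> b))"
    unfolding lborel_eq[where 'a='a]
    by (subst integrable_distr_eq) (simp_all add: inner_sum_left_Basis cong: prod.cong)
  have "(\<integral>x. (\<Prod>b\<in>Basis. h b (x b)) \<partial>(\<Pi>\<^sub>M b\<in>(Basis::'a set). lborel)) = (\<Prod>b\<in>Basis. \<integral>t. h b t \<partial>lborel)"
    by (rule product_integral_prod) (auto simp: h)
  then show "(\<integral>x. (\<Prod>b\<in>Basis. h b (x \<bullet> b)) \<partial>(lborel :: 'a measure)) = (\<Prod>b\<in>Basis. \<integral>t. h b t \<partial>lborel)"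
    unfolding lborel_eq[where 'a='a]
    by (subst integral_distr) (simp_all add: inner_sum_left_Basis cong: prod.cong)
qed

lemma cis_inner_prod:
  fixes x y :: "'a::euclidean_space"
  shows "cis (c * (x \<bullet> y)) = (\<Prod>b\<in>Basis. cis (c * (x \<bullet> b * (y \<bullet> b))))"
  by (subst euclidean_inner) (simp add: cis_conv_exp sum_distrib_left exp_sum of_real_sum algebra_simps)

lemma fourier_prod_Basis:
  fixes h :: "'a::euclidean_space \<Rightarrow> real \<Rightarrow> complex"
  assumes h: "\<And>b. b \<in> Basis \<Longrightarrow> integrable lborel (h b)"
  shows "fourier (\<lambda>x::'a. \<Prod>b\<in>Basis. h b (x \<bullet> b)) \<xi> = (\<Prod>b\<in>Basis. fourier (h b) (\<xi> \<bullet> b))"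
proof -
  have "integrable lborel (\<lambda>t. cis (- 2 * pi * (t * (\<xi> \<bullet> b))) * h b t)" if "b \<in> Basis" for b
    by (intro integrable_cis_mult h that) measurable
  from integral_prod_Basis[OF this] show ?thesis
    unfolding fourier_def by (subst cis_inner_prod) (simp add: prod.distrib)
qed

lemma cmod_fourier_le: "cmod (fourier f \<xi>) \<le> (\<integral>x. cmod (f x) \<partial>lborel)"
  unfolding fourier_def
  by (rule order.trans[OF integral_norm_bound]) (simp add: norm_mult)

lemma continuous_fourier:
  assumes f: "integrable lborel f"
  shows "continuous_on UNIV (fourier f)"
  unfolding continuous_on_sequentially
proof safe
  have [measurable]: "f \<in> borel_measurable borel" using f by auto
  fix X :: "nat \<Rightarrow> 'a" and x assume "X \<longlonglongrightarrow> x"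
  then have "(\<lambda>n. fourier f (X n)) \<longlonglongrightarrow> fourier f x"
    unfolding fourier_def
    by (intro integral_dominated_convergence[where w="\<lambda>x. cmod (f x)"])
       (use f in \<open>auto simp: norm_mult cis_conv_exp intro!: tendsto_intros AE_I2\<close>)
  then show "(fourier f \<circ> X) \<longlonglongrightarrow> fourier f x" by (simp add: o_def)
qed

text \<open>The characteristic function of the standard normal law, rescaled: \<open>c\<close> is
  the factor for which \<open>std_normal_density (c * s)\<close> is the Gaussian
  \<open>exp (- (pi * \<epsilon>\<^sup>2 * s\<^sup>2))\<close> up to
  \<open>1 / sqrt (2 * pi)\<close>.\<close>

lemma
  fixes \<epsilon> :: real
  assumes e: "\<epsilon> > 0"
  shows integrable_gauss1: "integrable lborel (\<lambda>t::real. complex_of_real (exp (- (pi * \<epsilon>\<^sup>2 * t\<^sup>2))))"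
    and fourier_gauss1: "fourier (\<lambda>t::real. complex_of_real (exp (- (pi * \<epsilon>\<^sup>2 * t\<^sup>2)))) x
      = of_real (exp (- (pi * x\<^sup>2 / \<epsilon>\<^sup>2)) / \<epsilon>)"
proof -
  define c where "c = \<epsilon> * sqrt (2 * pi)"
  have c0: "c > 0" using e by (simp add: c_def)
  have sd: "std_normal_density (c * s) = exp (- (pi * \<epsilon>\<^sup>2 * s\<^sup>2)) / sqrt (2 * pi)" for s
    by (simp add: std_normal_density_def c_def power_mult_distrib field_simps)
  have "integrable lborel (\<lambda>s. sqrt (2 * pi) * std_normal_density (0 + c * s))"
    using c0 by (intro integrable_mult_right lborel_integrable_real_affine) auto
  then have "integrable lborel (\<lambda>s::real. exp (- (pi * \<epsilon>\<^sup>2 * s\<^sup>2)))"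
    by (simp add: sd)
  then show "integrable lborel (\<lambda>t::real. complex_of_real (exp (- (pi * \<epsilon>\<^sup>2 * t\<^sup>2))))"
    by (rule integrable_of_real)
  define t where "t = - (sqrt (2 * pi) * x / \<epsilon>)"
  have "complex_of_real (exp (- (t\<^sup>2) / 2)) = char std_normal_distribution t"
    by (simp add: char_std_normal_distribution)
  also have "\<dots> = (\<integral>u. std_normal_density u *\<^sub>R iexp (t * u) \<partial>lborel)"
    unfolding char_def by (subst integral_density) auto
  also have "\<dots> = c *\<^sub>R (\<integral>s. std_normal_density (c * s) *\<^sub>R iexp (t * (c * s)) \<partial>lborel)"
    using c0 by (subst lborel_integral_real_affine[of c _ 0]) auto
  also have "(\<lambda>s. std_normal_density (c * s) *\<^sub>R iexp (t * (c * s)))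
     = (\<lambda>s. complex_of_real (1 / sqrt (2 * pi)) * (cis (- 2 * pi * (s \<bullet> x)) * complex_of_real (exp (- (pi * \<epsilon>\<^sup>2 * s\<^sup>2)))))"
  proof
    fix s
    have "t * (c * s) = - 2 * pi * (s \<bullet> x)"
      using e by (simp add: t_def c_def field_simps flip: power2_eq_square)
    then show "std_normal_density (c * s) *\<^sub>R iexp (t * (c * s)) = complex_of_real (1 / sqrt (2 * pi)) * (cis (- 2 * pi * (s \<bullet> x)) * complex_of_real (exp (- (pi * \<epsilon>\<^sup>2 * s\<^sup>2))))"
      by (simp only: sd) (simp add: cis_conv_exp scaleR_conv_of_real)
  qed
  also have "c *\<^sub>R (\<integral>s. complex_of_real (1 / sqrt (2 * pi)) * (cis (- 2 * pi * (s \<bullet> x)) * complex_of_real (exp (- (pi * \<epsilon>\<^sup>2 * s\<^sup>2)))) \<partial>lborel)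
     = \<epsilon> *\<^sub>R fourier (\<lambda>t::real. complex_of_real (exp (- (pi * \<epsilon>\<^sup>2 * t\<^sup>2)))) x"
    unfolding integral_mult_right_zero fourier_def by (simp add: c_def scaleR_conv_of_real)
  finally have *: "\<epsilon> *\<^sub>R fourier (\<lambda>t::real. complex_of_real (exp (- (pi * \<epsilon>\<^sup>2 * t\<^sup>2)))) x = complex_of_real (exp (- (t\<^sup>2) / 2))" ..
  have "t\<^sup>2 / 2 = pi * x\<^sup>2 / \<epsilon>\<^sup>2"
    using e by (simp add: t_def power_mult_distrib power_divide)
  with * e show "fourier (\<lambda>t::real. complex_of_real (exp (- (pi * \<epsilon>\<^sup>2 * t\<^sup>2)))) x
      = of_real (exp (- (pi * x\<^sup>2 / \<epsilon>\<^sup>2)) / \<epsilon>)"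
    by (simp add: scaleR_conv_of_real field_simps)
qed

definition gauss :: "real \<Rightarrow> 'a::euclidean_space \<Rightarrow> complex" where
  "gauss \<epsilon> x = of_real (exp (- (pi * \<epsilon>\<^sup>2 * (norm x)\<^sup>2)))"

lemma gauss_prod: "gauss \<epsilon> (x::'a::euclidean_space) = (\<Prod>b\<in>Basis. of_real (exp (- (pi * \<epsilon>\<^sup>2 * (x \<bullet> b)\<^sup>2))))"
proof -
  have "(norm x)\<^sup>2 = (\<Sum>b\<in>Basis. (x \<bullet> b)\<^sup>2)"
    by (subst power2_norm_eq_inner, subst euclidean_inner) (simp add: power2_eq_square)
  then show ?thesis
    unfolding gauss_def by (simp add: sum_distrib_left exp_sum flip: sum_negf)
qed

lemma measurable_gauss [measurable]: "gauss \<epsilon> \<in> borel_measurable borel"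
  unfolding gauss_def by measurable

lemma integrable_gauss: "\<epsilon> > 0 \<Longrightarrow> integrable lborel (gauss \<epsilon>)"
  unfolding gauss_prod[abs_def] by (intro integrable_prod_Basis integrable_gauss1)

lemma fourier_gauss:
  fixes x :: "'a::euclidean_space"
  assumes e: "\<epsilon> > 0"
  shows "fourier (gauss \<epsilon>) x = gauss 1 (x /\<^sub>R \<epsilon>) / of_real (\<epsilon> ^ DIM('a))"
proof -
  have "fourier (gauss \<epsilon>) x = (\<Prod>b\<in>Basis. of_real (exp (- (pi * (x \<bullet> b)\<^sup>2 / \<epsilon>\<^sup>2)) / \<epsilon>))"
    unfolding gauss_prod[abs_def] using e
    by (subst fourier_prod_Basis) (auto simp: integrable_gauss1 fourier_gauss1)
  also have "\<dots> = gauss 1 (x /\<^sub>R \<epsilon>) / of_real (\<epsilon> ^ DIM('a))"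
    unfolding gauss_prod by (simp add: prod_dividef power_mult_distrib field_simps)
  finally show ?thesis .
qed

lemma integral_gauss: "(\<integral>x. gauss 1 (x::'a::euclidean_space) \<partial>lborel) = 1"
  using fourier_gauss[of 1 "0::'a"] by (simp add: fourier_def gauss_def)

lemma cmod_gauss: "cmod (gauss \<epsilon> x) = exp (- (pi * \<epsilon>\<^sup>2 * (norm x)\<^sup>2))"
  by (simp add: gauss_def)

lemma cmod_gauss_le: "cmod (gauss \<epsilon> x) \<le> 1"
  by (simp add: gauss_def)

text \<open>Gauss summation: damping the inversion integral by \<open>gauss \<epsilon>\<close>
  amounts to averaging \<open>f\<close> around \<open>x\<close> at scale \<epsilon> against a
  Gaussian of mass 1. Pointwise inversion and the integrability of nonnegative transforms come from
  letting \<epsilon> tend to 0 on the two sides.\<close>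

lemma fourier_gauss_sum:
  fixes f :: "'a::euclidean_space \<Rightarrow> complex"
  assumes f: "integrable lborel f" and e: "\<epsilon> > 0"
  shows "(\<integral>\<xi>. fourier f \<xi> * gauss \<epsilon> \<xi> * cis (2 * pi * (x \<bullet> \<xi>)) \<partial>lborel) = (\<integral>z. f (x + \<epsilon> *\<^sub>R z) * gauss 1 z \<partial>lborel)"
proof -
  have [measurable]: "f \<in> borel_measurable borel" using f by auto
  have "(\<integral>\<xi>. fourier f \<xi> * gauss \<epsilon> \<xi> * cis (2 * pi * (x \<bullet> \<xi>)) \<partial>lborel)
    = (\<integral>\<xi>. gauss \<epsilon> \<xi> * (\<integral>y. f y * cis (2 * pi * ((x - y) \<bullet> \<xi>)) \<partial>lborel) \<partial>lborel)"
  proof (rule Bochner_Integration.integral_cong)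
    fix \<xi> :: 'a
    have "fourier f \<xi> * cis (2 * pi * (x \<bullet> \<xi>)) = (\<integral>y. f y * cis (2 * pi * ((x - y) \<bullet> \<xi>)) \<partial>lborel)"
      unfolding fourier_def
      by (subst integral_mult_left_zero[symmetric])
         (auto intro!: Bochner_Integration.integral_cong simp: cis_mult inner_diff_left algebra_simps)
    then show "fourier f \<xi> * gauss \<epsilon> \<xi> * cis (2 * pi * (x \<bullet> \<xi>)) = gauss \<epsilon> \<xi> * (\<integral>y. f y * cis (2 * pi * ((x - y) \<bullet> \<xi>)) \<partial>lborel)"
      by (simp add: mult.assoc mult.commute mult.left_commute)
  qed simp
  also have "\<dots> = (\<integral>y. f y * (\<integral>\<xi>. gauss \<epsilon> \<xi> * cis (2 * pi * ((x - y) \<bullet> \<xi>)) \<partial>lborel) \<partial>lborel)"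
    using e f by (intro fubini_kernel integrable_gauss) auto
  also have "(\<lambda>y. \<integral>\<xi>. gauss \<epsilon> \<xi> * cis (2 * pi * ((x - y) \<bullet> \<xi>)) \<partial>lborel) = (\<lambda>y. fourier (gauss \<epsilon>) (y - x))"
    unfolding fourier_def
    by (auto intro!: Bochner_Integration.integral_cong ext simp: inner_diff_left inner_diff_right inner_commute algebra_simps)
  also have "(\<integral>y. f y * fourier (gauss \<epsilon>) (y - x) \<partial>lborel)
     = \<epsilon> ^ DIM('a) *\<^sub>R (\<integral>z. f (x + \<epsilon> *\<^sub>R z) * (gauss 1 z / of_real (\<epsilon> ^ DIM('a))) \<partial>lborel)"
    unfolding fourier_gauss[OF e]
    using e by (subst integral_affine[of _ \<epsilon> x]) auto
  also have "\<dots> = (\<integral>z. f (x + \<epsilon> *\<^sub>R z) * gauss 1 z \<partial>lborel)"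
    using e by (simp add: scaleR_conv_of_real)
  finally show ?thesis .
qed

lemma integrable_fourier_gauss:
  fixes f :: "'a::euclidean_space \<Rightarrow> complex"
  assumes f: "integrable lborel f" and e: "\<epsilon> > 0"
  shows "integrable lborel (\<lambda>\<xi>. fourier f \<xi> * gauss \<epsilon> \<xi> * cis (2 * pi * (x \<bullet> \<xi>)))"
proof -
  have [measurable]: "fourier f \<in> borel_measurable borel"
    by (intro borel_measurable_continuous_onI continuous_fourier f)
  show ?thesis
    by (rule Bochner_Integration.integrable_bound[OF integrable_mult_right[OF integrable_gauss[OF e], of "\<integral>x. cmod (f x) \<partial>lborel"]])
       (auto simp: norm_mult intro!: AE_I2 mult_right_mono order.trans[OF cmod_fourier_le])
qed

lemma gauss_mollifier_tendsto:
  fixes f :: "'a::euclidean_space \<Rightarrow> complex"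
  assumes [measurable]: "f \<in> borel_measurable borel" and bd: "\<And>x. cmod (f x) \<le> B"
    and c: "isCont f x"
  shows "(\<lambda>n. \<integral>z. f (x + (1 / real (Suc n)) *\<^sub>R z) * gauss 1 z \<partial>lborel) \<longlonglongrightarrow> f x"
proof -
  have "(\<lambda>n. \<integral>z. f (x + (1 / real (Suc n)) *\<^sub>R z) * gauss 1 z \<partial>lborel) \<longlonglongrightarrow> (\<integral>z. f x * gauss 1 z \<partial>(lborel :: 'a measure))"
  proof (rule integral_dominated_convergence[where w="\<lambda>z. B * cmod (gauss 1 z)"])
    show "AE z in lborel. (\<lambda>n. f (x + (1 / real (Suc n)) *\<^sub>R z) * gauss 1 z) \<longlonglongrightarrow> f x * gauss 1 z"
    proof (intro AE_I2 tendsto_mult tendsto_const isCont_tendsto_compose[OF c])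
      fix z :: 'a
      have "(\<lambda>n. x + (1 / real (Suc n)) *\<^sub>R z) \<longlonglongrightarrow> x + 0 *\<^sub>R z"
        by (intro tendsto_intros LIMSEQ_Suc[OF lim_1_over_n, unfolded o_def])
      then show "(\<lambda>n. x + (1 / real (Suc n)) *\<^sub>R z) \<longlonglongrightarrow> x" by simp
    qed
    show "integrable lborel (\<lambda>z::'a. B * cmod (gauss 1 z))"
      using integrable_gauss[of 1] by auto
  qed (auto simp: norm_mult intro!: mult_right_mono bd)
  then show ?thesis by (simp add: integral_gauss)
qed

lemma gauss_tendsto_1: "(\<lambda>n. gauss (1 / real (Suc n)) \<xi>) \<longlonglongrightarrow> 1"
proof -
  have "(\<lambda>n. complex_of_real (exp (- (pi * (1 / real (Suc n))\<^sup>2 * (norm \<xi>)\<^sup>2)))) \<longlonglongrightarrow> complex_of_real (exp (- (pi * 0\<^sup>2 * (norm \<xi>)\<^sup>2)))"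
    by (intro tendsto_intros LIMSEQ_Suc[OF lim_1_over_n, unfolded o_def])
  then show ?thesis by (simp add: gauss_def)
qed

lemma fourier_gauss_lim:
  fixes f :: "'a::euclidean_space \<Rightarrow> complex"
  assumes f: "integrable lborel f" and F: "integrable lborel (fourier f)"
  shows "(\<lambda>n. \<integral>\<xi>. fourier f \<xi> * gauss (1 / real (Suc n)) \<xi> * cis (2 * pi * (x \<bullet> \<xi>)) \<partial>lborel)
    \<longlonglongrightarrow> (\<integral>\<xi>. fourier f \<xi> * cis (2 * pi * (x \<bullet> \<xi>)) \<partial>lborel)"
proof (rule integral_dominated_convergence[where w="\<lambda>\<xi>. cmod (fourier f \<xi>)"])
  have [measurable]: "fourier f \<in> borel_measurable borel" using F by auto
  show "(\<lambda>\<xi>. fourier f \<xi> * cis (2 * pi * (x \<bullet> \<xi>))) \<in> borel_measurable lborel" by measurable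
  show "(\<lambda>\<xi>. fourier f \<xi> * gauss (1 / real (Suc n)) \<xi> * cis (2 * pi * (x \<bullet> \<xi>))) \<in> borel_measurable lborel" for n by measurable
  show "AE \<xi> in lborel. (\<lambda>n. fourier f \<xi> * gauss (1 / real (Suc n)) \<xi> * cis (2 * pi * (x \<bullet> \<xi>))) \<longlonglongrightarrow> fourier f \<xi> * cis (2 * pi * (x \<bullet> \<xi>))"
  proof (rule AE_I2)
    fix \<xi> :: 'a
    have "(\<lambda>n. fourier f \<xi> * gauss (1 / real (Suc n)) \<xi> * cis (2 * pi * (x \<bullet> \<xi>))) \<longlonglongrightarrow> fourier f \<xi> * 1 * cis (2 * pi * (x \<bullet> \<xi>))"
      by (intro tendsto_mult tendsto_const gauss_tendsto_1)
    then show "(\<lambda>n. fourier f \<xi> * gauss (1 / real (Suc n)) \<xi> * cis (2 * pi * (x \<bullet> \<xi>))) \<longlonglongrightarrow> fourier f \<xi> * cis (2 * pi * (x \<bullet> \<xi>))" by simp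
  qed
  show "AE \<xi> in lborel. cmod (fourier f \<xi> * gauss (1 / real (Suc n)) \<xi> * cis (2 * pi * (x \<bullet> \<xi>))) \<le> cmod (fourier f \<xi>)" for n
    by (auto simp: norm_mult intro!: mult_right_le_one_le cmod_gauss_le)
qed (use F in auto)

theorem fourier_inversion:
  fixes f :: "'a::euclidean_space \<Rightarrow> complex"
  assumes f: "integrable lborel f" and F: "integrable lborel (fourier f)"
    and bd: "\<And>x. cmod (f x) \<le> B" and c: "isCont f x"
  shows "f x = (\<integral>\<xi>. fourier f \<xi> * cis (2 * pi * (x \<bullet> \<xi>)) \<partial>lborel)"
proof (rule LIMSEQ_unique)
  show "(\<lambda>n. \<integral>z. f (x + (1 / real (Suc n)) *\<^sub>R z) * gauss 1 z \<partial>lborel) \<longlonglongrightarrow> f x"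
    by (rule gauss_mollifier_tendsto[OF _ bd c]) (use f in auto)
  show "(\<lambda>n. \<integral>z. f (x + (1 / real (Suc n)) *\<^sub>R z) * gauss 1 z \<partial>lborel) \<longlonglongrightarrow> (\<integral>\<xi>. fourier f \<xi> * cis (2 * pi * (x \<bullet> \<xi>)) \<partial>lborel)"
    using fourier_gauss_lim[OF f F, of x] by (simp add: fourier_gauss_sum[OF f])
qed

text \<open>Positivity replaces absolute convergence. At the origin the Gauss means of the transform
  are averages of \<open>f\<close>, hence at most \<open>B\<close>, and Fatou's lemma carries this
  bound over to the integral of \<open>r\<close>. The application is the autocorrelation of an
  indicator function, whose transform is a square.\<close>

theorem integrable_fourier_nonneg:
  fixes f :: "'a::euclidean_space \<Rightarrow> complex"
  assumes f: "integrable lborel f" and r: "\<And>\<xi>. fourier f \<xi> = of_real (r \<xi>)" and r0: "\<And>\<xi>. r \<xi> \<ge> 0"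
    and bd: "\<And>x. cmod (f x) \<le> B" and c: "isCont f 0"
  shows "integrable lborel (fourier f)"
proof -
  have [measurable]: "fourier f \<in> borel_measurable borel"
    by (intro borel_measurable_continuous_onI continuous_fourier f)
  have "r = (\<lambda>\<xi>. Re (fourier f \<xi>))" by (simp add: r)
  then have [measurable]: "r \<in> borel_measurable borel" by simp
  define g where "g n \<xi> = r \<xi> * exp (- (pi * (1 / real (Suc n))\<^sup>2 * (norm \<xi>)\<^sup>2))" for n \<xi>
  have gC: "complex_of_real (g n \<xi>) = fourier f \<xi> * gauss (1 / real (Suc n)) \<xi> * cis (2 * pi * (0 \<bullet> \<xi>))" for n \<xi>
    by (simp add: g_def r gauss_def)
  have gi: "integrable lborel (g n)" for n
    using integrable_fourier_gauss[OF f, of "1 / real (Suc n)" 0] unfolding gC[symmetric] by (simp add: complex_of_real_integrable_eq)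
  have gv: "(\<integral>\<xi>. g n \<xi> \<partial>lborel) \<le> B" for n
  proof -
    have "complex_of_real (\<integral>\<xi>. g n \<xi> \<partial>lborel) = (\<integral>\<xi>. complex_of_real (g n \<xi>) \<partial>lborel)"
      by simp
    also have "\<dots> = (\<integral>z. f (0 + (1 / real (Suc n)) *\<^sub>R z) * gauss 1 z \<partial>lborel)"
      unfolding gC by (rule fourier_gauss_sum[OF f]) simp
    finally have "\<bar>\<integral>\<xi>. g n \<xi> \<partial>lborel\<bar> = cmod (\<integral>z. f (0 + (1 / real (Suc n)) *\<^sub>R z) * gauss 1 z \<partial>lborel)"
      by (metis norm_of_real)
    also have "\<dots> \<le> (\<integral>z. cmod (f (0 + (1 / real (Suc n)) *\<^sub>R z) * gauss 1 z) \<partial>lborel)"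
      by (rule integral_norm_bound)
    also have "\<dots> \<le> (\<integral>z. B * cmod (gauss 1 (z::'a)) \<partial>lborel)"
    proof (rule integral_mono)
      have i: "integrable lborel (\<lambda>z. B * cmod (gauss 1 (z::'a)))" using integrable_gauss[of 1] by auto
      then show "integrable lborel (\<lambda>z. B * cmod (gauss 1 (z::'a)))" .
      have [measurable]: "f \<in> borel_measurable borel" using f by auto
      show "integrable lborel (\<lambda>z. cmod (f (0 + (1 / real (Suc n)) *\<^sub>R z) * gauss 1 z))"
        by (rule Bochner_Integration.integrable_bound[OF i])
           (auto simp: norm_mult intro!: AE_I2 mult_right_mono bd order.trans[OF bd abs_ge_self] simp: abs_mult)
    qed (auto simp: norm_mult intro!: mult_right_mono bd)
    also have "\<dots> = B"
    proof -
      have "complex_of_real (\<integral>z. cmod (gauss 1 (z::'a)) \<partial>lborel) = (\<integral>z. gauss 1 (z::'a) \<partial>lborel)"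
        by (simp add: cmod_gauss gauss_def flip: integral_complex_of_real)
      then have "(\<integral>z. cmod (gauss 1 (z::'a)) \<partial>lborel) = 1"
        unfolding integral_gauss using of_real_eq_1_iff by blast
      then show ?thesis by simp
    qed
    finally show ?thesis by simp
  qed
  have "(\<integral>\<^sup>+\<xi>. ennreal (r \<xi>) \<partial>lborel) = (\<integral>\<^sup>+\<xi>. liminf (\<lambda>n. ennreal (g n \<xi>)) \<partial>lborel)"
  proof (rule nn_integral_cong)
    fix \<xi> :: 'a
    have "(\<lambda>n. g n \<xi>) \<longlonglongrightarrow> r \<xi> * exp (- (pi * 0\<^sup>2 * (norm \<xi>)\<^sup>2))"
      unfolding g_def by (intro tendsto_intros LIMSEQ_Suc[OF lim_1_over_n, unfolded o_def])
    then have "(\<lambda>n. ennreal (g n \<xi>)) \<longlonglongrightarrow> ennreal (r \<xi>)" by (intro tendsto_ennrealI) simp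
    then show "ennreal (r \<xi>) = liminf (\<lambda>n. ennreal (g n \<xi>))"
      by (simp add: tendsto_iff_Liminf_eq_Limsup)
  qed
  also have "\<dots> \<le> liminf (\<lambda>n. \<integral>\<^sup>+\<xi>. ennreal (g n \<xi>) \<partial>lborel)"
    by (rule nn_integral_liminf) (simp add: g_def)
  also have "\<dots> \<le> ennreal B"
  proof (rule Liminf_le)
    show "eventually (\<lambda>n. (\<integral>\<^sup>+\<xi>. ennreal (g n \<xi>) \<partial>lborel) \<le> ennreal B) sequentially"
    proof (intro always_eventually allI)
      fix n
      have "g n \<xi> \<ge> 0" for \<xi> by (simp add: g_def r0)
      then have "(\<integral>\<^sup>+\<xi>. ennreal (g n \<xi>) \<partial>lborel) = ennreal (\<integral>\<xi>. g n \<xi> \<partial>lborel)"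
        by (intro nn_integral_eq_integral gi) auto
      then show "(\<integral>\<^sup>+\<xi>. ennreal (g n \<xi>) \<partial>lborel) \<le> ennreal B" using gv by (simp add: ennreal_leI)
    qed
  qed simp
  finally have "(\<integral>\<^sup>+\<xi>. ennreal (r \<xi>) \<partial>lborel) < \<infinity>" by (simp add: le_less_trans less_top)
  then have "integrable lborel r" by (intro integrableI_nonneg) (auto simp: r0)
  then show ?thesis unfolding r[abs_def] by (rule integrable_of_real)
qed

lemma measurable_fourier:
  "integrable lborel f \<Longrightarrow> fourier f \<in> borel_measurable borel"
  by (intro borel_measurable_continuous_onI continuous_fourier)

section \<open>Inversion almost everywhere\<close>

lemma AE_notin_frontier_convex:
  fixes S :: "'a::euclidean_space set"
  assumes "convex S"
  shows "AE x in lborel. x \<notin> frontier S"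
proof -
  have "frontier S \<in> null_sets lebesgue"
    using negligible_convex_frontier[OF assms] by (simp add: negligible_iff_null_sets)
  then have "frontier S \<in> null_sets lborel"
    by (subst (asm) null_sets_completion_iff) auto
  then show ?thesis by (rule AE_not_in)
qed

lemma isCont_indicator_off_frontier:
  assumes "x \<notin> frontier S"
  shows "isCont (indicator S :: _ \<Rightarrow> complex) x"
proof -
  have "isCont (\<lambda>y. complex_of_real (indicator S y)) x"
    using assms isCont_indicator[of x S] by (intro continuous_intros) simp
  then show ?thesis by (simp add: of_real_indicator)
qed

text \<open>Boxes form an intersection-stable generator of the Borel sets, so Dynkin's argument
  extends the vanishing of the integrals to all Borel sets. Complements need the integral over the
  whole space, which is a limit over growing boxes.\<close>

lemma AE_eq_0_of_box_integrals:
  fixes h :: "'a::euclidean_space \<Rightarrow> complex"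
  assumes h: "integrable lborel h"
    and box: "\<And>a b. (\<integral>x. indicator (box a b) x *\<^sub>R h x \<partial>lborel) = 0"
  shows "AE x in lborel. h x = 0"
proof -
  have [measurable]: "h \<in> borel_measurable borel" using h by auto
  have hi: "integrable lborel (\<lambda>x. indicator A x *\<^sub>R h x)" if "A \<in> sets borel" for A
    using h that by (intro integrable_mult_indicator) auto
  have lim: "(\<lambda>n. \<integral>x. indicator (box (- (real n *\<^sub>R One)) (real n *\<^sub>R One)) x *\<^sub>R h x \<partial>lborel) \<longlonglongrightarrow> (\<integral>x. h x \<partial>lborel)"
  proof (rule integral_dominated_convergence[where w="\<lambda>x. cmod (h x)"])
    show "AE x in lborel. (\<lambda>n. indicator (box (- (real n *\<^sub>R One)) (real n *\<^sub>R One)) x *\<^sub>R h x) \<longlonglongrightarrow> h x"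
    proof (rule AE_I2)
      fix x :: 'a
      have "\<exists>N. \<forall>n\<ge>N. x \<in> box (- (real n *\<^sub>R One)) (real n *\<^sub>R One)"
      proof -
        obtain N where N: "norm x < real N" using reals_Archimedean2 by blast
        have "x \<in> box (- (real n *\<^sub>R One)) (real n *\<^sub>R One)" if "n \<ge> N" for n
        proof -
          have "\<bar>x \<bullet> b\<bar> < real n" if "b \<in> Basis" for b
            using Basis_le_norm[OF that, of x] N \<open>n \<ge> N\<close> by linarith
          then show ?thesis by (auto simp: box_def abs_less_iff minus_less_iff)
        qed
        then show ?thesis by blast
      qed
      then have "eventually (\<lambda>n. indicator (box (- (real n *\<^sub>R One)) (real n *\<^sub>R One)) x *\<^sub>R h x = h x) sequentially"
        unfolding eventually_sequentially by (metis indicator_simps(1) scaleR_one)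
      then show "(\<lambda>n. indicator (box (- (real n *\<^sub>R One)) (real n *\<^sub>R One)) x *\<^sub>R h x) \<longlonglongrightarrow> h x"
        by (rule tendsto_eventually)
    qed
  qed (use h in \<open>auto simp: indicator_def\<close>)
  have tot: "(\<integral>x. h x \<partial>lborel) = 0"
    using lim unfolding box by (simp add: LIMSEQ_const_iff)
  have all: "(\<integral>x. indicator A x *\<^sub>R h x \<partial>lborel) = 0" if A: "A \<in> sets borel" for A
  proof -
    let ?G = "range (\<lambda>(a, b). box a b :: 'a set)"
    have G: "Int_stable ?G" by (auto simp: Int_stable_def box_Int_box)
    have sub: "?G \<subseteq> Pow UNIV" by simp
    have "A \<in> sigma_sets UNIV ?G" using A by (simp add: borel_eq_box)
    from G sub this show ?thesis
    proof (induct rule: sigma_sets_induct_disjoint)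
      case (basic A)
      then obtain a b where "A = box a b" by auto
      then show ?case using box by simp
    next
      case empty then show ?case by simp
    next
      case (compl A)
      have [measurable]: "A \<in> sets borel" using compl by (simp add: borel_eq_box)
      have "(\<integral>x. indicator (UNIV - A) x *\<^sub>R h x \<partial>lborel) = (\<integral>x. h x - indicator A x *\<^sub>R h x \<partial>lborel)"
        by (rule Bochner_Integration.integral_cong) (auto simp: indicator_def)
      also have "\<dots> = 0" using compl hi[of A] h tot by simp
      finally show ?case by simp
    next
      case (union A)
      have [measurable]: "A i \<in> sets borel" for i using union by (auto simp: borel_eq_box)
      have "set_lebesgue_integral lborel (\<Union>i. A i) h = (\<Sum>i. set_lebesgue_integral lborel (A i) h)"
        using union by (intro lebesgue_integral_countable_add) (auto simp: disjoint_family_on_def set_integrable_def intro!: hi)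
      then show ?case using union by (simp add: set_lebesgue_integral_def)
    qed
  qed
  show ?thesis
    by (rule sigma_finite_measure.density_zero[OF sigma_finite_lborel h])
       (use all in \<open>auto simp: set_lebesgue_integral_def\<close>)
qed

text \<open>Without continuity of \<open>f\<close> the Gauss means need not converge at a prescribed
  point. The identity is therefore tested against indicators of boxes, and the mollification is
  moved from \<open>f\<close> to the indicator, where it converges off the boundary of the box, a
  null set.\<close>

theorem fourier_inversion_AE:
  fixes f :: "'a::euclidean_space \<Rightarrow> complex"
  assumes f: "integrable lborel f" and F: "integrable lborel (fourier f)"
  shows "AE x in lborel. f x = (\<integral>\<xi>. fourier f \<xi> * cis (2 * pi * (x \<bullet> \<xi>)) \<partial>lborel)"
proof -
  have [measurable]: "f \<in> borel_measurable borel" "fourier f \<in> borel_measurable borel" using f F by auto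
  define h where "h x = (\<integral>\<xi>. fourier f \<xi> * cis (2 * pi * (x \<bullet> \<xi>)) \<partial>lborel)" for x
  define C where "C = (\<integral>\<xi>. cmod (fourier f \<xi>) \<partial>lborel)"
  have hb: "cmod (h x) \<le> C" for x
    unfolding h_def C_def by (rule order.trans[OF integral_norm_bound]) (simp add: norm_mult)
  have [measurable]: "h \<in> borel_measurable borel"
    unfolding h_def by measurable
  have bi: "integrable lborel (indicator (box a b) :: 'a \<Rightarrow> complex)" for a b
    by (rule integrable_real_indicator[THEN integrable_of_real, of _ _, where 'a=complex, simplified of_real_indicator])
       (use emeasure_lborel_box_finite[of a b] in auto)
  have key: "(\<integral>x. indicator (box a b) x * h x \<partial>lborel) = (\<integral>x. indicator (box a b) x * f x \<partial>lborel)" for a b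
  proof -
    define q :: "'a \<Rightarrow> complex" where "q = indicator (box a b)"
    have q: "integrable lborel q" and [measurable]: "q \<in> borel_measurable borel" unfolding q_def by (auto intro: bi)
    have [measurable]: "fourier q \<in> borel_measurable borel" by (rule measurable_fourier[OF q])
    define G where "G \<xi> = (\<integral>x. q x * cis (2 * pi * (x \<bullet> \<xi>)) \<partial>lborel)" for \<xi>
    have Gf: "G \<xi> = fourier q (- \<xi>)" for \<xi>
      unfolding G_def fourier_def by (auto intro!: Bochner_Integration.integral_cong)
    have [measurable]: "G \<in> borel_measurable borel"
      unfolding G_def by measurable
    define m where "m n x = (\<integral>z. q (x + (1 / real (Suc n)) *\<^sub>R z) * gauss 1 z \<partial>lborel)" for n x
    define CG where "CG = (\<integral>x. cmod (q x) \<partial>lborel)"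
    have Gb: "cmod (G \<xi>) \<le> CG" for \<xi> unfolding Gf CG_def by (rule cmod_fourier_le)
    have 1: "(\<integral>x. q x * h x \<partial>lborel) = (\<integral>\<xi>. fourier f \<xi> * G \<xi> \<partial>lborel)"
      unfolding h_def G_def by (rule fubini_kernel[OF q F]) auto
    have 2: "(\<lambda>n. \<integral>\<xi>. fourier f \<xi> * (G \<xi> * gauss (1 / real (Suc n)) \<xi>) \<partial>lborel) \<longlonglongrightarrow> (\<integral>\<xi>. fourier f \<xi> * G \<xi> \<partial>lborel)"
    proof (rule integral_dominated_convergence[where w="\<lambda>\<xi>. cmod (fourier f \<xi>) * CG"])
      show "AE \<xi> in lborel. (\<lambda>n. fourier f \<xi> * (G \<xi> * gauss (1 / real (Suc n)) \<xi>)) \<longlonglongrightarrow> fourier f \<xi> * G \<xi>"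
      proof (rule AE_I2)
        fix \<xi> :: 'a
        have "(\<lambda>n. fourier f \<xi> * (G \<xi> * gauss (1 / real (Suc n)) \<xi>)) \<longlonglongrightarrow> fourier f \<xi> * (G \<xi> * 1)"
          by (intro tendsto_mult tendsto_const gauss_tendsto_1)
        then show "(\<lambda>n. fourier f \<xi> * (G \<xi> * gauss (1 / real (Suc n)) \<xi>)) \<longlonglongrightarrow> fourier f \<xi> * G \<xi>" by simp
      qed
      show "AE \<xi> in lborel. cmod (fourier f \<xi> * (G \<xi> * gauss (1 / real (Suc n)) \<xi>)) \<le> cmod (fourier f \<xi>) * CG" for n
        unfolding norm_mult
        by (intro AE_I2 mult_left_mono order.trans[OF mult_right_le_one_le Gb] cmod_gauss_le) auto
    qed (use F in auto)
    have 3: "(\<integral>\<xi>. fourier f \<xi> * (G \<xi> * gauss (1 / real (Suc n)) \<xi>) \<partial>lborel) = (\<integral>x. f x * m n x \<partial>lborel)" for n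
    proof -
      let ?e = "1 / real (Suc n)"
      have Gg: "integrable lborel (\<lambda>\<xi>. G \<xi> * gauss ?e \<xi>)"
        by (rule Bochner_Integration.integrable_bound[OF integrable_mult_right[OF integrable_gauss[of ?e], of CG]])
           (auto simp: norm_mult intro!: AE_I2 mult_right_mono order.trans[OF Gb])
      have "(\<integral>\<xi>. fourier f \<xi> * (G \<xi> * gauss ?e \<xi>) \<partial>lborel)
         = (\<integral>\<xi>. (G \<xi> * gauss ?e \<xi>) * (\<integral>x. f x * cis (- 2 * pi * (x \<bullet> \<xi>)) \<partial>lborel) \<partial>lborel)"
        by (simp add: fourier_def mult.commute)
      also have "\<dots> = (\<integral>x. f x * (\<integral>\<xi>. (G \<xi> * gauss ?e \<xi>) * cis (- 2 * pi * (x \<bullet> \<xi>)) \<partial>lborel) \<partial>lborel)"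
        by (rule fubini_kernel[OF Gg f]) auto
      also have "(\<lambda>x. \<integral>\<xi>. (G \<xi> * gauss ?e \<xi>) * cis (- 2 * pi * (x \<bullet> \<xi>)) \<partial>lborel) = m n"
      proof
        fix x
        have "(\<integral>\<xi>. (G \<xi> * gauss ?e \<xi>) * cis (- 2 * pi * (x \<bullet> \<xi>)) \<partial>lborel)
           = (\<integral>\<xi>. fourier q \<xi> * gauss ?e \<xi> * cis (2 * pi * (x \<bullet> \<xi>)) \<partial>lborel)"
          by (subst integral_affine[of _ "-1" 0]) (auto simp: Gf gauss_def)
        also have "\<dots> = m n x" unfolding m_def by (rule fourier_gauss_sum[OF q]) simp
        finally show "(\<integral>\<xi>. (G \<xi> * gauss ?e \<xi>) * cis (- 2 * pi * (x \<bullet> \<xi>)) \<partial>lborel) = m n x" .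
      qed
      finally show ?thesis .
    qed
    have 4: "(\<lambda>n. \<integral>x. f x * m n x \<partial>lborel) \<longlonglongrightarrow> (\<integral>x. f x * q x \<partial>lborel)"
    proof (rule integral_dominated_convergence[where w="\<lambda>x. cmod (f x)"])
      show "AE x in lborel. (\<lambda>n. f x * m n x) \<longlonglongrightarrow> f x * q x"
        using AE_notin_frontier_convex[OF convex_box(2)[of a b]]
      proof eventually_elim
        case (elim x)
        have "m n x = (\<integral>z. q (x + (1 / real (Suc n)) *\<^sub>R z) * gauss 1 z \<partial>lborel)" for n by (simp add: m_def)
        moreover have "isCont q x" unfolding q_def by (rule isCont_indicator_off_frontier[OF elim])
        moreover have "cmod (q y) \<le> 1" for y by (simp add: q_def indicator_def)
        ultimately have "(\<lambda>n. m n x) \<longlonglongrightarrow> q x"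
          unfolding m_def by (intro gauss_mollifier_tendsto[where B=1]) auto
        then show ?case by (intro tendsto_mult tendsto_const)
      qed
      have "cmod (m n x) \<le> 1" for n x
      proof -
        have "cmod (m n x) \<le> (\<integral>z. cmod (q (x + (1 / real (Suc n)) *\<^sub>R z) * gauss 1 z) \<partial>lborel)"
          unfolding m_def by (rule integral_norm_bound)
        also have "\<dots> \<le> (\<integral>z. cmod (gauss 1 (z::'a)) \<partial>lborel)"
          using integrable_gauss[of 1, where 'a='a]
          by (intro integral_mono') (auto simp: norm_mult q_def indicator_def)
        also have "\<dots> = 1"
        proof -
          have "complex_of_real (\<integral>z. cmod (gauss 1 (z::'a)) \<partial>lborel) = (\<integral>z. gauss 1 (z::'a) \<partial>lborel)"
            by (simp add: cmod_gauss gauss_def flip: integral_complex_of_real)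
          then show ?thesis unfolding integral_gauss using of_real_eq_1_iff by blast
        qed
        finally show ?thesis .
      qed
      then show "AE x in lborel. cmod (f x * m n x) \<le> cmod (f x)" for n
        by (auto simp: norm_mult intro!: mult_right_le_one_le)
      show "(\<lambda>x. f x * m n x) \<in> borel_measurable lborel" for n unfolding m_def by measurable
    qed (use f in auto)
    have "(\<integral>x. q x * h x \<partial>lborel) = (\<integral>x. f x * q x \<partial>lborel)"
      unfolding 1 by (rule LIMSEQ_unique[OF 2[unfolded 3] 4])
    then show ?thesis by (simp add: q_def mult.commute)
  qed
  \<comment> \<open>\<open>h\<close> is only known to be bounded, so \<open>f - h\<close> is
    restricted to a large box to become integrable. The intersection of two boxes is again a box,
    which makes \<open>key\<close> applicable.\<close>
  have "AE x in lborel. indicator (box (- (real n *\<^sub>R One)) (real n *\<^sub>R One)) x * (f x - h x) = 0" for n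
  proof (rule AE_eq_0_of_box_integrals)
    let ?B = "box (- (real n *\<^sub>R One)) (real n *\<^sub>R One) :: 'a set"
    have i1: "integrable lborel (\<lambda>x. indicator (box a b) x * h x)" for a b :: 'a
      by (rule Bochner_Integration.integrable_bound[OF integrable_mult_right[OF bi[of a b], of "of_real C"]])
         (auto simp: norm_mult indicator_def intro!: AE_I2 order.trans[OF hb])
    have i2: "integrable lborel (\<lambda>x. indicator (box a b) x * f x)" for a b :: 'a
      by (rule Bochner_Integration.integrable_bound[OF f]) (auto simp: indicator_def)
    show "integrable lborel (\<lambda>x. indicator ?B x * (f x - h x))"
      unfolding right_diff_distrib by (intro Bochner_Integration.integrable_diff i1 i2)
    fix a b :: 'a
    obtain c d where cd: "box a b \<inter> ?B = box c d" unfolding box_Int_box by blast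
    have "(\<integral>x. indicator (box a b) x *\<^sub>R (indicator ?B x * (f x - h x)) \<partial>lborel)
       = (\<integral>x. indicator (box c d) x * f x - indicator (box c d) x * h x \<partial>lborel)"
      unfolding cd[symmetric] by (rule Bochner_Integration.integral_cong) (auto simp: indicator_def)
    also have "\<dots> = 0" by (subst Bochner_Integration.integral_diff[OF i2 i1]) (simp add: key)
    finally show "(\<integral>x. indicator (box a b) x *\<^sub>R (indicator ?B x * (f x - h x)) \<partial>lborel) = 0" .
  qed
  then have "AE x in lborel. \<forall>n. indicator (box (- (real n *\<^sub>R One)) (real n *\<^sub>R One)) x * (f x - h x) = 0"
    by (subst AE_all_countable) blast
  then show ?thesis
  proof eventually_elim
    case (elim x)
    obtain n where "x \<in> box (- (real n *\<^sub>R One)) (real n *\<^sub>R One)"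
      using UN_box_eq_UNIV by blast
    with elim[rule_format, of n] show ?case unfolding h_def by simp
  qed
qed

section \<open>Averaging kernels adapted to a convex body\<close>

lemma integrable_indicator_bounded:
  fixes S :: "'a::euclidean_space set"
  assumes "S \<in> sets borel" "bounded S"
  shows "integrable lborel (indicator S :: 'a \<Rightarrow> complex)"
proof -
  obtain B where "S \<subseteq> cball 0 B" using assms(2) unfolding bounded_iff by (auto simp: subset_iff)
  then have "emeasure lborel S \<le> emeasure lborel (cball (0::'a) B)"
    using assms(1) by (intro emeasure_mono) auto
  also have "\<dots> < \<infinity>" by (rule emeasure_lborel_cball_finite)
  finally have "integrable lborel (indicator S :: 'a \<Rightarrow> real)"
    using assms(1) by (intro integrable_real_indicator) auto
  then have "integrable lborel (\<lambda>x. complex_of_real (indicator S x))" by (rule integrable_of_real)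
  then show ?thesis by (simp add: of_real_indicator)
qed

text \<open>Up to a constant, \<open>w\<close> is the squared modulus of the Fourier transform of the indicator function of \<open>Q\<close>.\<close>

theorem averaging_kernel_exists:
  fixes Q :: "'a::euclidean_space set"
  assumes Q: "open Q" "convex Q" "bounded Q" and sym: "\<And>x. x \<in> Q \<Longrightarrow> - x \<in> Q" and Q0: "0 \<in> Q"
  shows "\<exists>w. integrable lborel w \<and> (\<forall>x. 0 \<le> w x) \<and> (\<integral>x. w x \<partial>lborel) = (1::real) \<and>
    (\<forall>\<xi>. fourier (\<lambda>x. complex_of_real (w x)) \<xi> = of_real (measure lborel {y\<in>Q. y + \<xi> \<in> Q} / measure lborel Q)) \<and>
    (\<forall>\<xi>. (1/2) *\<^sub>R \<xi> \<notin> Q \<longrightarrow> fourier (\<lambda>x. complex_of_real (w x)) \<xi> = 0) \<and>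
    (\<forall>\<xi>\<in>Q. 1 / 2 ^ DIM('a) \<le> cmod (fourier (\<lambda>x. complex_of_real (w x)) \<xi>))"
proof -
  have [measurable]: "Q \<in> sets borel" using Q by auto
  define q :: "'a \<Rightarrow> complex" where "q = indicator Q"
  have q [measurable]: "q \<in> borel_measurable borel" and qi: "integrable lborel q"
    unfolding q_def using Q by (auto intro!: integrable_indicator_bounded)
  have q01: "cmod (q x) \<le> 1" for x by (auto simp: q_def indicator_def)
  define Q2 where "Q2 = (\<lambda>x. 2 *\<^sub>R x) ` Q"
  have Q2: "x \<in> Q2 \<longleftrightarrow> (1/2) *\<^sub>R x \<in> Q" for x
  proof
    assume "(1/2) *\<^sub>R x \<in> Q"
    then have "2 *\<^sub>R ((1/2) *\<^sub>R x) \<in> Q2" unfolding Q2_def by blast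
    then show "x \<in> Q2" by simp
  qed (auto simp: Q2_def)
  have Q2': "(\<lambda>x. (1/2) *\<^sub>R x) -` Q = Q2" using Q2 by auto
  have [measurable]: "Q2 \<in> sets borel"
    unfolding Q2'[symmetric] using measurable_sets_borel[of "\<lambda>x. (1/2) *\<^sub>R x" borel Q] by simp
  have Q2b: "bounded Q2" unfolding Q2_def by (rule bounded_scaling) fact
  define H where "H x = (\<integral>y. q (y + x) * q y \<partial>lborel)" for x
  \<comment> \<open>Half the difference of two points of a symmetric convex set lies in the set.
    Hence the autocorrelation \<open>H\<close> of \<open>q\<close> is supported in the double
    \<open>Q2\<close> of \<open>Q\<close>.\<close>
  have mid: "(1/2) *\<^sub>R x \<in> Q" if "y + x \<in> Q" "y \<in> Q" for x y
  proof -
    have "(1/2) *\<^sub>R (y + x) + (1/2) *\<^sub>R (- y) \<in> Q"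
      using Q(2) that sym by (intro convexD) auto
    then show ?thesis by (simp add: algebra_simps)
  qed
  have Hz: "H x = 0" if "(1/2) *\<^sub>R x \<notin> Q" for x
  proof -
    have "q (y + x) * q y = 0" for y using mid[of y x] that by (auto simp: q_def indicator_def)
    then show ?thesis unfolding H_def by (simp only: Bochner_Integration.integral_zero)
  qed
  define V where "V = (\<integral>y. cmod (q y) \<partial>lborel)"
  have qq: "q y * q y = q y" "q y = of_real (cmod (q y))" for y by (auto simp: q_def indicator_def)
  have H0: "H 0 = of_real V" unfolding H_def V_def by (simp add: qq(1) flip: integral_complex_of_real qq(2))
  have VQ: "V = measure lborel Q"
  proof -
    have "cmod (q y) = indicator Q y" for y by (auto simp: q_def indicator_def)
    then show ?thesis unfolding V_def by simp
  qed
  have V0: "V > 0"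
  proof -
    have "emeasure lborel Q \<noteq> 0" "emeasure lborel Q < \<infinity>"
      using emeasure_bounded_finite[OF Q(3)] open_not_negligible[OF Q(1)] Q0
      by (auto simp: negligible_iff_null_sets null_sets_completion_iff null_sets_def)
    then show ?thesis unfolding VQ by (simp add: measure_def enn2real_positive_iff less_top zero_less_iff_neq_zero)
  qed
  \<comment> \<open>\<open>q\<close> jumps only on the frontier of \<open>Q\<close>, a null set
    because \<open>Q\<close> is convex; off it dominated convergence applies. Continuity of
    \<open>H\<close> is what makes its inversion formula hold at every point.\<close>
  have Hc: "isCont H x" for x
    unfolding continuous_at_sequentially
  proof safe
    fix X assume X: "X \<longlonglongrightarrow> x"
    have "(\<lambda>n. H (X n)) \<longlonglongrightarrow> H x" unfolding H_def
    proof (rule integral_dominated_convergence[where w="\<lambda>y. cmod (q y)"])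
      show "AE y in lborel. (\<lambda>n. q (y + X n) * q y) \<longlonglongrightarrow> q (y + x) * q y"
      proof -
        have "AE y in lborel. x + y \<notin> frontier Q"
        proof -
          have "AE y in distr lborel borel ((+) x). y \<notin> frontier Q"
            unfolding lborel_distr_plus by (rule AE_notin_frontier_convex[OF Q(2)])
          moreover have "{y. y \<notin> frontier Q} \<in> sets borel"
            by (simp add: Collect_neg_eq frontier_closed borel_closed sets.compl_sets flip: space_borel)
          ultimately show ?thesis by (subst (asm) AE_distr_iff) auto
        qed
        then show ?thesis
        proof eventually_elim
          case (elim y)
          have "isCont q (y + x)" unfolding q_def using elim by (intro isCont_indicator_off_frontier) (simp add: add.commute)
          then show ?case using X by (intro tendsto_mult tendsto_const isCont_tendsto_compose[of _ q] tendsto_intros)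
        qed
      qed
      show "AE y in lborel. norm (q (y + X n) * q y) \<le> cmod (q y)" for n
        by (auto simp: norm_mult intro!: mult_left_le_one_le q01)
    qed (use qi in auto)
    then show "(H \<circ> X) \<longlonglongrightarrow> H x" by (simp add: o_def)
  qed
  have Hb: "cmod (H x) \<le> V" for x
  proof -
    have "cmod (H x) \<le> (\<integral>y. cmod (q (y + x) * q y) \<partial>lborel)" unfolding H_def by (rule integral_norm_bound)
    also have "\<dots> \<le> V" unfolding V_def using qi
      by (intro integral_mono') (auto simp: norm_mult intro!: mult_left_le_one_le q01)
    finally show ?thesis .
  qed
  have Hm [measurable]: "H \<in> borel_measurable borel" unfolding H_def by measurable
  have Hi: "integrable lborel H"
  proof (rule Bochner_Integration.integrable_bound[OF integrable_mult_right[OF integrable_indicator_bounded[of Q2], of "of_real V"]])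
    show "AE x in lborel. norm (H x) \<le> norm (of_real V * indicator Q2 x :: complex)"
    proof (rule AE_I2)
      fix x show "norm (H x) \<le> norm (of_real V * indicator Q2 x :: complex)"
        using Hb[of x] Hz[of x] V0 by (cases "x \<in> Q2") (auto simp: Q2)
    qed
  qed (use Q2b in auto)
  have HF: "fourier H \<xi> = of_real ((cmod (fourier q \<xi>))\<^sup>2)" for \<xi>
  proof -
    have "fourier H \<xi> = (\<integral>x. indicator Q2 x * (\<integral>y. q y * (q (y + x) * cis (- 2 * pi * (x \<bullet> \<xi>))) \<partial>lborel) \<partial>lborel)"
      unfolding fourier_def
    proof (rule Bochner_Integration.integral_cong)
      fix x
      have "(\<integral>y. q y * (q (y + x) * cis (- 2 * pi * (x \<bullet> \<xi>))) \<partial>lborel) = cis (- 2 * pi * (x \<bullet> \<xi>)) * H x"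
        unfolding H_def by (subst integral_mult_right_zero[symmetric]) (simp add: ac_simps)
      then show "cis (- 2 * pi * (x \<bullet> \<xi>)) * H x = indicator Q2 x * (\<integral>y. q y * (q (y + x) * cis (- 2 * pi * (x \<bullet> \<xi>))) \<partial>lborel)"
        using Hz[of x] Q2[of x] by (auto simp: indicator_def)
    qed simp
    also have "\<dots> = (\<integral>y. q y * (\<integral>x. indicator Q2 x * (q (y + x) * cis (- 2 * pi * (x \<bullet> \<xi>))) \<partial>lborel) \<partial>lborel)"
      by (rule fubini_kernel[OF integrable_indicator_bounded qi]) (auto simp: Q2b norm_mult q01)
    also have "\<dots> = (\<integral>y. q y * (cis (2 * pi * (y \<bullet> \<xi>)) * fourier q \<xi>) \<partial>lborel)"
    proof (rule Bochner_Integration.integral_cong)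
      fix y
      show "q y * (\<integral>x. indicator Q2 x * (q (y + x) * cis (- 2 * pi * (x \<bullet> \<xi>))) \<partial>lborel) = q y * (cis (2 * pi * (y \<bullet> \<xi>)) * fourier q \<xi>)"
      proof (cases "y \<in> Q")
        case True
        have "indicator Q2 x * q (y + x) = q (y + x)" for x
          using mid[OF _ True, of x] Q2[of x] by (auto simp: q_def indicator_def)
        then have "(\<integral>x. indicator Q2 x * (q (y + x) * cis (- 2 * pi * (x \<bullet> \<xi>))) \<partial>lborel) = (\<integral>x. q (y + x) * cis (- 2 * pi * (x \<bullet> \<xi>)) \<partial>lborel)"
          by (simp only: mult.assoc[symmetric])
        also have "\<dots> = (\<integral>x. q x * cis (- 2 * pi * ((x - y) \<bullet> \<xi>)) \<partial>lborel)"
          by (subst integral_affine[of "\<lambda>x. q x * cis (- 2 * pi * ((x - y) \<bullet> \<xi>))" 1 y]) auto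
        also have "\<dots> = cis (2 * pi * (y \<bullet> \<xi>)) * fourier q \<xi>"
          unfolding fourier_def
          by (subst integral_mult_right_zero[symmetric])
             (auto intro!: Bochner_Integration.integral_cong simp: cis_mult inner_diff_left algebra_simps)
        finally show ?thesis by simp
      qed (simp add: q_def)
    qed simp
    also have "\<dots> = fourier q \<xi> * (\<integral>y. q y * cis (2 * pi * (y \<bullet> \<xi>)) \<partial>lborel)"
      by (subst integral_mult_right_zero[symmetric]) (simp add: ac_simps)
    also have "(\<integral>y. q y * cis (2 * pi * (y \<bullet> \<xi>)) \<partial>lborel) = cnj (fourier q \<xi>)"
    proof -
      have cq: "cnj (q y) = q y" for y by (simp add: q_def indicator_def)
      show ?thesis unfolding fourier_def Bochner_Integration.integral_cnj[symmetric]
        by (simp add: cq cis_cnj mult.commute)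
    qed
    finally show ?thesis by (metis complex_norm_square of_real_power)
  qed
  have FHi: "integrable lborel (fourier H)"
    by (rule integrable_fourier_nonneg[OF Hi HF _ Hb Hc]) simp
  have inv: "H x = (\<integral>\<xi>. fourier H \<xi> * cis (2 * pi * (x \<bullet> \<xi>)) \<partial>lborel)" for x
    by (rule fourier_inversion[OF Hi FHi Hb Hc])
  define w where "w \<xi> = (cmod (fourier q \<xi>))\<^sup>2 / V" for \<xi>
  have wH: "complex_of_real (w \<xi>) = fourier H \<xi> / of_real V" for \<xi> by (simp add: w_def HF)
  have wF: "fourier (\<lambda>x. complex_of_real (w x)) \<xi> = H (- \<xi>) / of_real V" for \<xi>
    unfolding wH fourier_def[of "\<lambda>x. fourier H x / complex_of_real V"] inv[of "- \<xi>"]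
    by (subst integral_divide_zero[symmetric])
       (auto intro!: Bochner_Integration.integral_cong simp: inner_commute mult.commute)
  have Hsym: "H (- x) = H x" for x
    unfolding H_def
    by (subst integral_affine[of _ 1 x]) (auto simp: mult.commute add.commute)
  have wi: "integrable lborel w"
    using FHi unfolding HF[abs_def] w_def by (simp add: complex_of_real_integrable_eq del: of_real_power)
  moreover have "(\<integral>x. w x \<partial>lborel) = 1"
  proof -
    have "complex_of_real (\<integral>x. w x \<partial>lborel) = fourier (\<lambda>x. complex_of_real (w x)) 0"
      by (simp add: fourier_def)
    also have "\<dots> = 1" using V0 by (simp add: wF H0)
    finally show ?thesis using of_real_eq_1_iff by blast
  qed
  moreover have "1 / 2 ^ DIM('a) \<le> cmod (fourier (\<lambda>x. complex_of_real (w x)) \<xi>)" if "\<xi> \<in> Q" for \<xi>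
  proof -
    \<comment> \<open>If \<open>2 *\<^sub>R z - \<xi>\<close> lies in \<open>Q\<close>, so do
      \<open>z\<close> and \<open>z - \<xi>\<close>, being its midpoints with \<open>\<xi>\<close>
      and \<open>- \<xi>\<close>. Such \<open>z\<close> fill a half-size copy of \<open>Q\<close>,
      whence the factor \<open>1 / 2 ^ DIM('a)\<close>.\<close>
    have "V / 2 ^ DIM('a) = (\<integral>z. cmod (q ((- \<xi>) + 2 *\<^sub>R z)) \<partial>lborel)"
      unfolding V_def by (subst integral_affine[of _ 2 "- \<xi>"]) auto
    also have "\<dots> \<le> (\<integral>z. cmod (q (z + - \<xi>) * q z) \<partial>lborel)"
    proof (rule integral_mono)
      show "integrable lborel (\<lambda>z. cmod (q ((- \<xi>) + 2 *\<^sub>R z)))"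
        using integrable_affine[OF qi, of 2 "- \<xi>"] by auto
      show "integrable lborel (\<lambda>z. cmod (q (z + - \<xi>) * q z))"
        by (rule Bochner_Integration.integrable_bound[OF qi]) (auto simp: norm_mult intro!: AE_I2 mult_left_le_one_le q01)
      fix z
      show "cmod (q ((- \<xi>) + 2 *\<^sub>R z)) \<le> cmod (q (z + - \<xi>) * q z)"
      proof (cases "(- \<xi>) + 2 *\<^sub>R z \<in> Q")
        case True
        have "(1/2) *\<^sub>R ((- \<xi>) + 2 *\<^sub>R z) + (1/2) *\<^sub>R \<xi> \<in> Q"
          by (rule convexD[OF Q(2) True that]) auto
        moreover have "(1/2) *\<^sub>R ((- \<xi>) + 2 *\<^sub>R z) + (1/2) *\<^sub>R (- \<xi>) \<in> Q"
          by (rule convexD[OF Q(2) True sym[OF that]]) auto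
        moreover have "(1/2) *\<^sub>R ((- \<xi>) + 2 *\<^sub>R z) + (1/2) *\<^sub>R \<xi> = z"
          by (simp add: algebra_simps)
        moreover have "(1/2) *\<^sub>R ((- \<xi>) + 2 *\<^sub>R z) + (1/2) *\<^sub>R (- \<xi>) = z + - \<xi>"
          by (simp add: algebra_simps flip: scaleR_add_left)
        ultimately show ?thesis using True by (simp add: q_def)
      qed (simp add: q_def)
    qed
    also have "\<dots> = cmod (H (- \<xi>))"
    proof -
      have "q (z + - \<xi>) * q z = of_real (cmod (q (z + - \<xi>) * q z))" for z by (auto simp: q_def indicator_def)
      then have "H (- \<xi>) = of_real (\<integral>z. cmod (q (z + - \<xi>) * q z) \<partial>lborel)"
        unfolding H_def by (metis (no_types, lifting) Bochner_Integration.integral_cong integral_complex_of_real)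
      then show ?thesis by (simp only: norm_of_real) (simp add: integral_nonneg_AE)
    qed
    finally show ?thesis using V0 by (simp add: wF norm_divide field_simps)
  qed
  moreover have "fourier (\<lambda>x. complex_of_real (w x)) \<xi> = of_real (measure lborel {y\<in>Q. y + \<xi> \<in> Q} / measure lborel Q)" for \<xi>
  proof -
    have "H \<xi> = (\<integral>y. complex_of_real (indicator {y\<in>Q. y + \<xi> \<in> Q} y) \<partial>lborel)"
      unfolding H_def by (rule Bochner_Integration.integral_cong) (auto simp: q_def indicator_def)
    also have "\<dots> = of_real (measure lborel {y\<in>Q. y + \<xi> \<in> Q})"
      unfolding integral_complex_of_real by simp
    finally show ?thesis by (simp add: wF Hsym VQ)
  qed
  moreover have "0 \<le> w x" for x using V0 by (simp add: w_def)
  moreover have "fourier (\<lambda>x. complex_of_real (w x)) \<xi> = 0" if "(1/2) *\<^sub>R \<xi> \<notin> Q" for \<xi>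
    using Hz[OF that] by (simp add: wF Hsym)
  ultimately show ?thesis by (intro exI[of _ w]) blast
qed

section \<open>Band-limited functions and averages\<close>

text \<open>Band-limited functions for which the integrals below converge and the identities hold at
  every point. The class is closed under sums, products, conjugation, modulation and averaging
  against probability measures. By continuity a member with vanishing transform is zero everywhere,
  so information about spectra turns into pointwise cancellation.\<close>

definition nice :: "('a::euclidean_space \<Rightarrow> complex) \<Rightarrow> bool" where
  "nice f \<longleftrightarrow> continuous_on UNIV f \<and> bounded (range f) \<and> integrable lborel f \<and> bounded {\<xi>. fourier f \<xi> \<noteq> 0}"

lemma niceI:
  assumes "continuous_on UNIV f" "\<And>x. cmod (f x) \<le> B" "integrable lborel f" "\<And>\<xi>. R < norm \<xi> \<Longrightarrow> fourier f \<xi> = 0"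
  shows "nice f"
  unfolding nice_def
proof (intro conjI assms)
  show "bounded (range f)" using assms(2) by (auto simp: bounded_iff)
  have "{\<xi>. fourier f \<xi> \<noteq> 0} \<subseteq> cball 0 R" using assms(4) by (auto simp: not_less[symmetric])
  then show "bounded {\<xi>. fourier f \<xi> \<noteq> 0}" using bounded_subset bounded_cball by blast
qed

lemma niceE:
  assumes "nice f"
  obtains B R where "\<And>x. cmod (f x) \<le> B" "\<And>\<xi>. fourier f \<xi> \<noteq> 0 \<Longrightarrow> norm \<xi> \<le> R" "B \<ge> 0"
proof -
  obtain B where B: "cmod (f x) \<le> B" for x using assms by (auto simp: nice_def bounded_iff)
  moreover obtain R where "fourier f \<xi> \<noteq> 0 \<Longrightarrow> norm \<xi> \<le> R" for \<xi>
    using assms by (auto simp: nice_def bounded_iff)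
  moreover have "B \<ge> 0" using norm_ge_zero order.trans B by blast
  ultimately show thesis using that by blast
qed

lemma nice_cont: "nice f \<Longrightarrow> continuous_on UNIV f"
  and nice_isCont: "nice f \<Longrightarrow> isCont f x"
  and nice_integrable: "nice f \<Longrightarrow> integrable lborel f"
  and nice_measurable: "nice f \<Longrightarrow> f \<in> borel_measurable borel"
  unfolding nice_def by (auto simp: continuous_on_eq_continuous_at intro!: borel_measurable_continuous_onI)

lemma nice_integrable_fourier:
  assumes "nice f"
  shows "integrable lborel (fourier f)"
proof -
  obtain B R where R: "\<And>\<xi>. fourier f \<xi> \<noteq> 0 \<Longrightarrow> norm \<xi> \<le> R" using assms by (rule niceE) blast
  define C where "C = (\<integral>x. cmod (f x) \<partial>lborel)"
  show ?thesis
  proof (rule Bochner_Integration.integrable_bound[OF integrable_mult_right[OF integrable_indicator_bounded[of "cball 0 R"], of "of_real C"]])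
    show "fourier f \<in> borel_measurable lborel" using measurable_fourier[OF nice_integrable[OF assms]] by simp
    have C: "cmod (fourier f \<xi>) \<le> C" for \<xi> unfolding C_def by (rule cmod_fourier_le)
    show "AE \<xi> in lborel. norm (fourier f \<xi>) \<le> norm (of_real C * indicator (cball 0 R) \<xi> :: complex)"
    proof (rule AE_I2)
      fix \<xi> show "norm (fourier f \<xi>) \<le> norm (of_real C * indicator (cball 0 R) \<xi> :: complex)"
        using C[of \<xi>] R[of \<xi>] by (cases "fourier f \<xi> = 0") (auto simp: indicator_def)
    qed
  qed auto
qed

lemma nice_inversion:
  assumes "nice f"
  shows "f x = (\<integral>\<xi>. fourier f \<xi> * cis (2 * pi * (x \<bullet> \<xi>)) \<partial>lborel)"
proof -
  obtain B R where "\<And>x. cmod (f x) \<le> B" using assms by (rule niceE) blast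
  then show ?thesis
    by (rule fourier_inversion[OF nice_integrable[OF assms] nice_integrable_fourier[OF assms] _ nice_isCont[OF assms]])
qed

lemma nice_eq_0I: "nice f \<Longrightarrow> (\<And>\<xi>. fourier f \<xi> = 0) \<Longrightarrow> f x = 0"
  by (subst nice_inversion) auto

lemma nice_integrable_mult:
  assumes "nice f" "nice g"
  shows "integrable lborel (\<lambda>x. f x * g x)"
proof -
  obtain B R where B: "\<And>x. cmod (f x) \<le> B" "B \<ge> 0" using assms(1) by (rule niceE) blast
  have [measurable]: "f \<in> borel_measurable borel" "g \<in> borel_measurable borel"
    using assms nice_measurable by auto
  show ?thesis
    by (rule Bochner_Integration.integrable_bound[OF integrable_mult_right[OF nice_integrable[OF assms(2)], of "of_real B"]])
       (use B in \<open>auto simp: norm_mult intro!: AE_I2 mult_right_mono\<close>)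
qed

lemma parseval:
  assumes "nice f" "nice g"
  shows "(\<integral>x. f x * cnj (g x) \<partial>lborel) = (\<integral>\<xi>. fourier f \<xi> * cnj (fourier g \<xi>) \<partial>lborel)"
proof -
  have cg: "integrable lborel (\<lambda>x. cnj (g x))" using nice_integrable[OF assms(2)] by simp
  have "(\<integral>x. f x * cnj (g x) \<partial>lborel) = (\<integral>x. cnj (g x) * (\<integral>\<xi>. fourier f \<xi> * cis (2 * pi * (x \<bullet> \<xi>)) \<partial>lborel) \<partial>lborel)"
    unfolding nice_inversion[OF assms(1), symmetric] by (simp only: mult.commute)
  also have "\<dots> = (\<integral>\<xi>. fourier f \<xi> * (\<integral>x. cnj (g x) * cis (2 * pi * (x \<bullet> \<xi>)) \<partial>lborel) \<partial>lborel)"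
    by (rule fubini_kernel[OF cg nice_integrable_fourier[OF assms(1)]]) auto
  also have "(\<lambda>\<xi>. \<integral>x. cnj (g x) * cis (2 * pi * (x \<bullet> \<xi>)) \<partial>lborel) = (\<lambda>\<xi>. cnj (fourier g \<xi>))"
    unfolding fourier_def Bochner_Integration.integral_cnj[symmetric]
    by (simp add: cis_cnj mult.commute)
  finally show ?thesis .
qed

lemma plancherel:
  assumes "nice f"
  shows "(\<integral>x. (cmod (f x))\<^sup>2 \<partial>lborel) = (\<integral>\<xi>. (cmod (fourier f \<xi>))\<^sup>2 \<partial>lborel)"
proof -
  have "complex_of_real (\<integral>x. (cmod (f x))\<^sup>2 \<partial>lborel) = complex_of_real (\<integral>\<xi>. (cmod (fourier f \<xi>))\<^sup>2 \<partial>lborel)"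
    unfolding integral_complex_of_real[symmetric] complex_norm_square by (rule parseval[OF assms assms])
  then show ?thesis by (simp only: of_real_eq_iff)
qed

lemma nice_integrable_square:
  assumes "nice f"
  shows "integrable lborel (\<lambda>x. (cmod (f x))\<^sup>2)" "integrable lborel (\<lambda>\<xi>. (cmod (fourier f \<xi>))\<^sup>2)"
proof -
  have "integrable lborel (\<lambda>x. f x * f x)" by (intro nice_integrable_mult assms)
  from integrable_norm[OF this] show "integrable lborel (\<lambda>x. (cmod (f x))\<^sup>2)"
    by (simp add: norm_mult power2_eq_square)
  define C where "C = (\<integral>x. cmod (f x) \<partial>lborel)"
  have C: "cmod (fourier f \<xi>) \<le> C" for \<xi> unfolding C_def by (rule cmod_fourier_le)
  have C0: "C \<ge> 0" unfolding C_def by simp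
  show "integrable lborel (\<lambda>\<xi>. (cmod (fourier f \<xi>))\<^sup>2)"
    by (rule Bochner_Integration.integrable_bound[OF integrable_mult_right[OF nice_integrable_fourier[OF assms], of "of_real C"]])
       (use C C0 measurable_fourier[OF nice_integrable[OF assms]] in \<open>auto simp: norm_mult power2_eq_square intro!: AE_I2 mult_right_mono\<close>)
qed

lemma nice_cnj:
  assumes "nice f"
  shows "nice (\<lambda>x. cnj (f x))" "fourier (\<lambda>x. cnj (f x)) \<xi> = cnj (fourier f (- \<xi>))"
proof -
  have F: "fourier (\<lambda>x. cnj (f x)) \<xi> = cnj (fourier f (- \<xi>))" for \<xi>
    unfolding fourier_def Bochner_Integration.integral_cnj[symmetric] by (simp add: cis_cnj)
  then show "fourier (\<lambda>x. cnj (f x)) \<xi> = cnj (fourier f (- \<xi>))" .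
  obtain B R where B: "\<And>x. cmod (f x) \<le> B" "\<And>\<xi>. fourier f \<xi> \<noteq> 0 \<Longrightarrow> norm \<xi> \<le> R" using assms by (rule niceE) blast
  show "nice (\<lambda>x. cnj (f x))"
  proof (rule niceI[where B=B and R=R])
    show "continuous_on UNIV (\<lambda>x. cnj (f x))" by (intro continuous_intros nice_cont assms)
    show "fourier (\<lambda>x. cnj (f x)) \<xi> = 0" if "R < norm \<xi>" for \<xi>
      using B(2)[of "- \<xi>"] that unfolding F by auto
  qed (use B nice_integrable[OF assms] in auto)
qed

lemma fourier_mult:
  assumes "nice f" "nice g"
  shows "fourier (\<lambda>x. f x * g x) \<xi> = (\<integral>\<eta>. fourier g \<eta> * fourier f (\<xi> - \<eta>) \<partial>lborel)"
proof -
  have fi: "integrable lborel f" by (rule nice_integrable) fact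
  have "fourier (\<lambda>x. f x * g x) \<xi> = (\<integral>x. (cis (- 2 * pi * (x \<bullet> \<xi>)) * f x) * (\<integral>\<eta>. fourier g \<eta> * cis (2 * pi * (x \<bullet> \<eta>)) \<partial>lborel) \<partial>lborel)"
    unfolding fourier_def[of "\<lambda>x. f x * g x"] nice_inversion[OF assms(2), symmetric] by (simp only: mult.assoc)
  also have "\<dots> = (\<integral>\<eta>. fourier g \<eta> * (\<integral>x. (cis (- 2 * pi * (x \<bullet> \<xi>)) * f x) * cis (2 * pi * (x \<bullet> \<eta>)) \<partial>lborel) \<partial>lborel)"
    by (rule fubini_kernel[OF integrable_cis_mult[OF fi] nice_integrable_fourier[OF assms(2)]]) auto
  also have "(\<lambda>\<eta>. \<integral>x. (cis (- 2 * pi * (x \<bullet> \<xi>)) * f x) * cis (2 * pi * (x \<bullet> \<eta>)) \<partial>lborel) = (\<lambda>\<eta>. fourier f (\<xi> - \<eta>))"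
  proof
    fix \<eta>
    have "(cis (- 2 * pi * (x \<bullet> \<xi>)) * f x) * cis (2 * pi * (x \<bullet> \<eta>)) = cis (- 2 * pi * (x \<bullet> (\<xi> - \<eta>))) * f x" for x
    proof -
      have "cis (- 2 * pi * (x \<bullet> \<xi>)) * cis (2 * pi * (x \<bullet> \<eta>)) = cis (- 2 * pi * (x \<bullet> (\<xi> - \<eta>)))"
        by (simp add: cis_mult inner_diff_right algebra_simps)
      then show ?thesis by (simp only: mult.assoc mult.commute mult.left_commute)
    qed
    then show "(\<integral>x. (cis (- 2 * pi * (x \<bullet> \<xi>)) * f x) * cis (2 * pi * (x \<bullet> \<eta>)) \<partial>lborel) = fourier f (\<xi> - \<eta>)"
      unfolding fourier_def by (simp only:)
  qed
  finally show ?thesis .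
qed

text \<open>A spectrum is here the set of points where the transform is nonzero, not its closure.
  The integrand of the convolution formula vanishes identically off the sumset, so the inclusion of
  spectra is exact.\<close>

lemma fourier_mult_nonzeroD:
  assumes "nice f" "nice g" "fourier (\<lambda>x. f x * g x) \<xi> \<noteq> 0"
  obtains p q where "\<xi> = p + q" "fourier f p \<noteq> 0" "fourier g q \<noteq> 0"
proof (rule ccontr)
  assume "\<not> thesis"
  then have *: "fourier g \<eta> * fourier f (\<xi> - \<eta>) = 0" for \<eta>
    using that[of "\<xi> - \<eta>" \<eta>] by auto
  have "fourier (\<lambda>x. f x * g x) \<xi> = 0"
    unfolding fourier_mult[OF assms(1,2)] by (simp only: * Bochner_Integration.integral_zero)
  with assms(3) show False by simp
qed

lemma nice_mult:
  assumes "nice f" "nice g"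
  shows "nice (\<lambda>x. f x * g x)"
proof -
  obtain B R where B: "\<And>x. cmod (f x) \<le> B" "\<And>\<xi>. fourier f \<xi> \<noteq> 0 \<Longrightarrow> norm \<xi> \<le> R" "B \<ge> 0" using assms(1) by (rule niceE) blast
  obtain B' R' where B': "\<And>x. cmod (g x) \<le> B'" "\<And>\<xi>. fourier g \<xi> \<noteq> 0 \<Longrightarrow> norm \<xi> \<le> R'" using assms(2) by (rule niceE) blast
  show ?thesis
  proof (rule niceI[where B="B * B'" and R="R + R'"])
    show "continuous_on UNIV (\<lambda>x. f x * g x)" by (intro continuous_intros nice_cont assms)
    show "cmod (f x * g x) \<le> B * B'" for x unfolding norm_mult using B B' by (intro mult_mono) auto
    show "integrable lborel (\<lambda>x. f x * g x)" by (intro nice_integrable_mult assms)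
    show "fourier (\<lambda>x. f x * g x) \<xi> = 0" if "R + R' < norm \<xi>" for \<xi>
    proof (rule ccontr)
      assume "fourier (\<lambda>x. f x * g x) \<xi> \<noteq> 0"
      then obtain p q where "\<xi> = p + q" "fourier f p \<noteq> 0" "fourier g q \<noteq> 0"
        using fourier_mult_nonzeroD[OF assms] by blast
      then have "norm \<xi> \<le> R + R'" using B(2)[of p] B'(2)[of q] norm_triangle_ineq[of p q] by simp
      with that show False by simp
    qed
  qed
qed

lemma fourier_add:
  assumes "integrable lborel f" "integrable lborel g"
  shows "fourier (\<lambda>x. f x + g x) \<xi> = fourier f \<xi> + fourier g \<xi>"
  unfolding fourier_def distrib_left
  by (intro Bochner_Integration.integral_add integrable_cis_mult assms) measurable

lemma fourier_sum:
  assumes "\<And>i. i \<in> I \<Longrightarrow> integrable lborel (f i)"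
  shows "fourier (\<lambda>x. \<Sum>i\<in>I. f i x) \<xi> = (\<Sum>i\<in>I. fourier (f i) \<xi>)"
  unfolding fourier_def by (subst Bochner_Integration.integral_sum[symmetric]) (auto simp: assms sum_distrib_left)

lemma nice_zero: "nice (\<lambda>x. 0)"
  by (rule niceI[where B=0 and R=0]) (auto simp: fourier_def)

lemma nice_add:
  assumes "nice f" "nice g"
  shows "nice (\<lambda>x. f x + g x)"
proof -
  obtain B R where B: "\<And>x. cmod (f x) \<le> B" "\<And>\<xi>. fourier f \<xi> \<noteq> 0 \<Longrightarrow> norm \<xi> \<le> R" using assms(1) by (rule niceE) blast
  obtain B' R' where B': "\<And>x. cmod (g x) \<le> B'" "\<And>\<xi>. fourier g \<xi> \<noteq> 0 \<Longrightarrow> norm \<xi> \<le> R'" using assms(2) by (rule niceE) blast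
  show ?thesis
  proof (rule niceI[where B="B + B'" and R="max R R'"])
    show "continuous_on UNIV (\<lambda>x. f x + g x)" by (intro continuous_intros nice_cont assms)
    show "cmod (f x + g x) \<le> B + B'" for x using B(1)[of x] B'(1)[of x] norm_triangle_ineq[of "f x" "g x"] by linarith
    show "integrable lborel (\<lambda>x. f x + g x)" by (intro Bochner_Integration.integrable_add nice_integrable assms)
    show "fourier (\<lambda>x. f x + g x) \<xi> = 0" if "max R R' < norm \<xi>" for \<xi>
    proof -
      have "fourier f \<xi> = 0" "fourier g \<xi> = 0" using B(2)[of \<xi>] B'(2)[of \<xi>] that by auto
      then show ?thesis by (simp add: fourier_add nice_integrable assms)
    qed
  qed
qed

lemma nice_sum:
  assumes "\<And>i. i \<in> I \<Longrightarrow> nice (f i)"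
  shows "nice (\<lambda>x. \<Sum>i\<in>I. f i x)"
  using assms by (induction I rule: infinite_finite_induct) (auto intro!: nice_zero nice_add)

lemma fourier_modulate: "fourier (\<lambda>x. cis (2 * pi * (x \<bullet> p)) * f x) \<xi> = fourier f (\<xi> - p)"
  unfolding fourier_def
proof (rule Bochner_Integration.integral_cong)
  fix x
  have "cis (- 2 * pi * (x \<bullet> \<xi>)) * cis (2 * pi * (x \<bullet> p)) = cis (- 2 * pi * (x \<bullet> (\<xi> - p)))"
    by (simp add: cis_mult inner_diff_right algebra_simps)
  then show "cis (- 2 * pi * (x \<bullet> \<xi>)) * (cis (2 * pi * (x \<bullet> p)) * f x) = cis (- 2 * pi * (x \<bullet> (\<xi> - p))) * f x"
    by (simp only: mult.assoc[symmetric])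
qed simp

lemma nice_modulate:
  assumes "nice f"
  shows "nice (\<lambda>x. cis (2 * pi * (x \<bullet> p)) * f x)"
proof -
  obtain B R where B: "\<And>x. cmod (f x) \<le> B" "\<And>\<xi>. fourier f \<xi> \<noteq> 0 \<Longrightarrow> norm \<xi> \<le> R" using assms by (rule niceE) blast
  show ?thesis
  proof (rule niceI[where B=B and R="R + norm p"])
    show "continuous_on UNIV (\<lambda>x. cis (2 * pi * (x \<bullet> p)) * f x)" by (intro continuous_intros nice_cont assms)
    show "fourier (\<lambda>x. cis (2 * pi * (x \<bullet> p)) * f x) \<xi> = 0" if "R + norm p < norm \<xi>" for \<xi>
      using B(2)[of "\<xi> - p"] that norm_triangle_ineq2[of \<xi> p] unfolding fourier_modulate by force
    show "integrable lborel (\<lambda>x. cis (2 * pi * (x \<bullet> p)) * f x)"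
      using nice_integrable[OF assms] by (intro integrable_cis_mult) auto
  qed (use B in \<open>auto simp: norm_mult\<close>)
qed

section \<open>Averages against probability measures\<close>

definition chf :: "'a::euclidean_space measure \<Rightarrow> 'a \<Rightarrow> complex" where
  "chf \<nu> \<xi> = (\<integral>y. cis (- 2 * pi * (y \<bullet> \<xi>)) \<partial>\<nu>)"

definition cv :: "'a::euclidean_space measure \<Rightarrow> ('a \<Rightarrow> complex) \<Rightarrow> 'a \<Rightarrow> complex" where
  "cv \<nu> f x = (\<integral>y. f (x - y) \<partial>\<nu>)"

text \<open>Measures rather than densities are used because the kernel that slices the cone is
  carried by a line. Positivity and total mass 1 give Jensen's inequality, and also
  \<open>cmod (chf \<nu> \<xi>) \<le> 1\<close>, hence a contraction of L2.\<close>

locale borel_prob =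
  fixes \<nu> :: "'a::euclidean_space measure"
  assumes prob: "prob_space \<nu>" and sets_eq [measurable_cong, simp]: "sets \<nu> = sets borel"
begin

sublocale prob_space \<nu> by (rule prob)

lemma integrable_bdd:
  assumes [measurable]: "f \<in> borel_measurable borel" and "\<And>x. norm (f x) \<le> B"
  shows "integrable \<nu> (f :: _ \<Rightarrow> _::{banach, second_countable_topology})"
  by (rule integrable_const_bound[where B=B]) (use assms in auto)

lemma cmod_chf_le: "cmod (chf \<nu> \<xi>) \<le> 1"
proof -
  have "cmod (chf \<nu> \<xi>) \<le> (\<integral>y. cmod (cis (- 2 * pi * (y \<bullet> \<xi>))) \<partial>\<nu>)"
    unfolding chf_def by (rule integral_norm_bound)
  then show ?thesis using prob_space by simp
qed

lemma integrable_cv: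
  assumes "nice f"
  shows "integrable \<nu> (\<lambda>y. f (x - y))"
proof -
  obtain B R where "\<And>x. cmod (f x) \<le> B" using assms by (rule niceE) blast
  moreover have [measurable]: "f \<in> borel_measurable borel" by (rule nice_measurable) fact
  ultimately show ?thesis by (intro integrable_bdd[where B=B]) auto
qed

lemma
  assumes "nice f"
  shows nice_cv: "nice (cv \<nu> f)" and fourier_cv: "fourier (cv \<nu> f) \<xi> = fourier f \<xi> * chf \<nu> \<xi>"
proof -
  have [measurable]: "f \<in> borel_measurable borel" by (rule nice_measurable) fact
  have fi: "integrable lborel f" by (rule nice_integrable) fact
  obtain B R where B: "\<And>x. cmod (f x) \<le> B" "\<And>\<xi>. fourier f \<xi> \<noteq> 0 \<Longrightarrow> norm \<xi> \<le> R" using assms by (rule niceE) blast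
  interpret P: pair_sigma_finite \<nu> lborel
    by (intro pair_sigma_finite.intro sigma_finite_measure_axioms sigma_finite_lborel)
  have shift: "(\<integral>x. g (x - y) \<partial>lborel) = (\<integral>x. g x \<partial>lborel)" if "g \<in> borel_measurable borel" for g :: "'a \<Rightarrow> 'c::{banach, second_countable_topology}" and y
    using integral_affine[OF that, of 1 "- y"] by simp
  have shifti: "integrable lborel (\<lambda>x. f (x - y))" for y
    using integrable_affine[OF fi, of 1 "- y"] by simp
  have I: "integrable (\<nu> \<Otimes>\<^sub>M lborel) (\<lambda>(y, x). f (x - y))"
  proof (rule P.Fubini_integrable)
    show "(\<lambda>(y, x). f (x - y)) \<in> borel_measurable (\<nu> \<Otimes>\<^sub>M lborel)" by measurable
    have "(\<integral>x. norm (f (x - y)) \<partial>lborel) = (\<integral>x. norm (f x) \<partial>lborel)" for y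
      by (rule shift[of "\<lambda>x. norm (f x)"]) simp
    then show "integrable \<nu> (\<lambda>y. \<integral>x. norm (case (y, x) of (y, x) \<Rightarrow> f (x - y)) \<partial>lborel)" by simp
    show "AE y in \<nu>. integrable lborel (\<lambda>x. case (y, x) of (y, x) \<Rightarrow> f (x - y))" by (simp add: shifti)
  qed
  have I2: "integrable (\<nu> \<Otimes>\<^sub>M lborel) (\<lambda>(y, x). cis (- 2 * pi * (x \<bullet> \<xi>)) * f (x - y))" for \<xi>
    by (rule Bochner_Integration.integrable_bound[OF I]) (measurable, auto simp: norm_mult)
  have F: "fourier (cv \<nu> f) \<xi> = fourier f \<xi> * chf \<nu> \<xi>" for \<xi>
  proof -
    have "fourier (cv \<nu> f) \<xi> = (\<integral>x. (\<integral>y. cis (- 2 * pi * (x \<bullet> \<xi>)) * f (x - y) \<partial>\<nu>) \<partial>lborel)"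
      unfolding fourier_def[of "cv \<nu> f"] unfolding cv_def by simp
    also have "\<dots> = (\<integral>y. (\<integral>x. cis (- 2 * pi * (x \<bullet> \<xi>)) * f (x - y) \<partial>lborel) \<partial>\<nu>)"
      by (rule P.Fubini_integral[OF I2])
    also have "\<dots> = (\<integral>y. fourier f \<xi> * cis (- 2 * pi * (y \<bullet> \<xi>)) \<partial>\<nu>)"
    proof (rule Bochner_Integration.integral_cong)
      fix y
      have "(\<integral>x. cis (- 2 * pi * (x \<bullet> \<xi>)) * f (x - y) \<partial>lborel)
        = (\<integral>x. cis (- 2 * pi * ((x + y) \<bullet> \<xi>)) * f x \<partial>lborel)"
        using shift[of "\<lambda>x. cis (- 2 * pi * ((x + y) \<bullet> \<xi>)) * f x" y] by simp
      also have "\<dots> = (\<integral>x. (cis (- 2 * pi * (x \<bullet> \<xi>)) * f x) * cis (- 2 * pi * (y \<bullet> \<xi>)) \<partial>lborel)"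
      proof (rule Bochner_Integration.integral_cong)
        fix x
        have "cis (- 2 * pi * ((x + y) \<bullet> \<xi>)) = cis (- 2 * pi * (x \<bullet> \<xi>)) * cis (- 2 * pi * (y \<bullet> \<xi>))"
          by (simp add: cis_mult inner_add_left algebra_simps)
        then show "cis (- 2 * pi * ((x + y) \<bullet> \<xi>)) * f x = (cis (- 2 * pi * (x \<bullet> \<xi>)) * f x) * cis (- 2 * pi * (y \<bullet> \<xi>))"
          by (simp only: mult.assoc mult.commute mult.left_commute)
      qed simp
      also have "\<dots> = fourier f \<xi> * cis (- 2 * pi * (y \<bullet> \<xi>))"
        unfolding fourier_def by (rule integral_mult_left_zero)
      finally show "(\<integral>x. cis (- 2 * pi * (x \<bullet> \<xi>)) * f (x - y) \<partial>lborel) = fourier f \<xi> * cis (- 2 * pi * (y \<bullet> \<xi>))" .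
    qed simp
    also have "\<dots> = fourier f \<xi> * chf \<nu> \<xi>" unfolding chf_def by (rule integral_mult_right_zero)
    finally show ?thesis .
  qed
  then show "fourier (cv \<nu> f) \<xi> = fourier f \<xi> * chf \<nu> \<xi>" .
  show "nice (cv \<nu> f)"
  proof (rule niceI[where B=B and R=R])
    show "continuous_on UNIV (cv \<nu> f)"
      unfolding continuous_on_sequentially
    proof safe
      fix X :: "nat \<Rightarrow> 'a" and x assume X: "X \<longlonglongrightarrow> x"
      have "(\<lambda>n. cv \<nu> f (X n)) \<longlonglongrightarrow> cv \<nu> f x" unfolding cv_def
      proof (rule integral_dominated_convergence[where w="\<lambda>y. B"])
        show "AE y in \<nu>. (\<lambda>n. f (X n - y)) \<longlonglongrightarrow> f (x - y)"
          by (intro AE_I2 isCont_tendsto_compose[OF nice_isCont[OF assms]] tendsto_intros X)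
      qed (use B in auto)
      then show "(cv \<nu> f \<circ> X) \<longlonglongrightarrow> cv \<nu> f x" by (simp add: o_def)
    qed
    show "cmod (cv \<nu> f x) \<le> B" for x
    proof -
      have "cmod (cv \<nu> f x) \<le> (\<integral>y. cmod (f (x - y)) \<partial>\<nu>)" unfolding cv_def by (rule integral_norm_bound)
      also have "\<dots> \<le> (\<integral>y. B \<partial>\<nu>)" using integrable_norm[OF integrable_cv[OF assms]] B by (intro integral_mono) auto
      finally show ?thesis using prob_space by simp
    qed
    show "integrable lborel (cv \<nu> f)"
      unfolding cv_def using P.integrable_snd[OF I] by simp
    show "fourier (cv \<nu> f) \<xi> = 0" if "R < norm \<xi>" for \<xi>
      using B(2)[of \<xi>] that unfolding F by auto
  qed
qed

lemma cv_sum: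
  assumes "\<And>i. i \<in> I \<Longrightarrow> nice (f i)"
  shows "cv \<nu> (\<lambda>x. \<Sum>i\<in>I. f i x) x = (\<Sum>i\<in>I. cv \<nu> (f i) x)"
  unfolding cv_def by (rule Bochner_Integration.integral_sum) (auto intro!: integrable_cv assms)

text \<open>Jensen's inequality, in the form that the variance of \<open>cmod (f (x - y))\<close>
  under \<nu> is nonnegative. It keeps a square function under control when all its pieces are
  averaged with the same measure.\<close>

lemma cmod_cv_square_le:
  assumes "nice f"
  shows "(cmod (cv \<nu> f x))\<^sup>2 \<le> Re (cv \<nu> (\<lambda>x. f x * cnj (f x)) x)"
proof -
  have i: "integrable \<nu> (\<lambda>y. f (x - y))" by (rule integrable_cv) fact
  have "integrable \<nu> (\<lambda>y. f (x - y) * cnj (f (x - y)))"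
    using integrable_cv[OF nice_mult[OF assms nice_cnj(1)[OF assms]]] by simp
  then have i2: "integrable \<nu> (\<lambda>y. (cmod (f (x - y)))\<^sup>2)"
    unfolding complex_norm_square[symmetric] by (subst (asm) complex_of_real_integrable_eq)
  have "cmod (cv \<nu> f x) \<le> (\<integral>y. cmod (f (x - y)) \<partial>\<nu>)"
    unfolding cv_def by (rule integral_norm_bound)
  then have "(cmod (cv \<nu> f x))\<^sup>2 \<le> (\<integral>y. cmod (f (x - y)) \<partial>\<nu>)\<^sup>2" by (intro power_mono) auto
  also have "\<dots> \<le> (\<integral>y. (cmod (f (x - y)))\<^sup>2 \<partial>\<nu>)"
    using variance_positive[of "\<lambda>y. cmod (f (x - y))"] integrable_norm[OF i] i2 by (subst (asm) variance_eq) auto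
  also have "\<dots> = Re (cv \<nu> (\<lambda>x. f x * cnj (f x)) x)"
    unfolding cv_def complex_norm_square[symmetric] integral_complex_of_real by simp
  finally show ?thesis .
qed

lemma cmod_cv_mult_le:
  assumes "nice f" "nice g"
  shows "cmod (cv \<nu> (\<lambda>x. f x * cnj (g x)) x)
    \<le> (Re (cv \<nu> (\<lambda>x. f x * cnj (f x)) x) + Re (cv \<nu> (\<lambda>x. g x * cnj (g x)) x)) / 2"
proof -
  have fg: "nice (\<lambda>x. f x * cnj (g x))" by (intro nice_mult nice_cnj assms)
  have ff: "integrable \<nu> (\<lambda>y. (cmod (h (x - y)))\<^sup>2)" "Re (cv \<nu> (\<lambda>x. h x * cnj (h x)) x) = (\<integral>y. (cmod (h (x - y)))\<^sup>2 \<partial>\<nu>)" if "nice h" for h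
  proof -
    have "integrable \<nu> (\<lambda>y. h (x - y) * cnj (h (x - y)))"
      using integrable_cv[OF nice_mult[OF that nice_cnj(1)[OF that]]] by simp
    then show "integrable \<nu> (\<lambda>y. (cmod (h (x - y)))\<^sup>2)"
      unfolding complex_norm_square[symmetric] by (subst (asm) complex_of_real_integrable_eq)
    show "Re (cv \<nu> (\<lambda>x. h x * cnj (h x)) x) = (\<integral>y. (cmod (h (x - y)))\<^sup>2 \<partial>\<nu>)"
      unfolding cv_def complex_norm_square[symmetric] integral_complex_of_real by simp
  qed
  have "cmod (cv \<nu> (\<lambda>x. f x * cnj (g x)) x) \<le> (\<integral>y. cmod (f (x - y) * cnj (g (x - y))) \<partial>\<nu>)"
    unfolding cv_def by (rule integral_norm_bound)
  also have "\<dots> \<le> (\<integral>y. ((cmod (f (x - y)))\<^sup>2 + (cmod (g (x - y)))\<^sup>2) / 2 \<partial>\<nu>)"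
  proof (rule integral_mono)
    show "integrable \<nu> (\<lambda>y. cmod (f (x - y) * cnj (g (x - y))))"
      using integrable_norm[OF integrable_cv[OF fg]] by simp
    show "integrable \<nu> (\<lambda>y. ((cmod (f (x - y)))\<^sup>2 + (cmod (g (x - y)))\<^sup>2) / 2)"
      using ff(1) assms by auto
    show "cmod (f (x - y) * cnj (g (x - y))) \<le> ((cmod (f (x - y)))\<^sup>2 + (cmod (g (x - y)))\<^sup>2) / 2" for y
      using sum_squares_bound[of "cmod (f (x - y))" "cmod (g (x - y))"] by (simp add: norm_mult)
  qed
  also have "\<dots> = (Re (cv \<nu> (\<lambda>x. f x * cnj (f x)) x) + Re (cv \<nu> (\<lambda>x. g x * cnj (g x)) x)) / 2"
    using ff assms by simp
  finally show ?thesis .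
qed

lemma cv_L2_le:
  assumes "nice f"
  shows "(\<integral>x. (cmod (cv \<nu> f x))\<^sup>2 \<partial>lborel) \<le> (\<integral>x. (cmod (f x))\<^sup>2 \<partial>lborel)"
  unfolding plancherel[OF assms] plancherel[OF nice_cv[OF assms]]
proof (rule integral_mono)
  show "(cmod (fourier (cv \<nu> f) \<xi>))\<^sup>2 \<le> (cmod (fourier f \<xi>))\<^sup>2" for \<xi>
    unfolding fourier_cv[OF assms] norm_mult
    by (intro power_mono mult_right_le_one_le cmod_chf_le) auto
  show "integrable lborel (\<lambda>\<xi>. (cmod (fourier (cv \<nu> f) \<xi>))\<^sup>2)"
    by (rule nice_integrable_square(2)[OF nice_cv[OF assms]])
  show "integrable lborel (\<lambda>\<xi>. (cmod (fourier f \<xi>))\<^sup>2)"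
    by (rule nice_integrable_square(2)[OF assms])
qed

end

lemma borel_prob_density:
  assumes w: "integrable lborel w" "\<And>x. 0 \<le> w x" "(\<integral>x. w x \<partial>lborel) = (1::real)"
  shows "borel_prob (density lborel w)" "chf (density lborel w) \<xi> = fourier (\<lambda>x. complex_of_real (w x)) \<xi>"
proof -
  have [measurable]: "w \<in> borel_measurable borel" using w by auto
  show "borel_prob (density lborel w)"
  proof (intro borel_prob.intro prob_spaceI)
    have "emeasure (density lborel w) (space (density lborel w)) = (\<integral>\<^sup>+x. ennreal (w x) \<partial>lborel)"
      by (simp add: emeasure_density)
    also have "\<dots> = 1" using w by (subst nn_integral_eq_integral) auto
    finally show "emeasure (density lborel w) (space (density lborel w)) = 1" .
  qed simp
  show "chf (density lborel w) \<xi> = fourier (\<lambda>x. complex_of_real (w x)) \<xi>"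
    unfolding chf_def fourier_def using w
    by (subst integral_density) (auto simp: scaleR_conv_of_real mult.commute)
qed

lemma averaging_measure_exists:
  fixes Q :: "'a::euclidean_space set"
  assumes "open Q" "convex Q" "bounded Q" "\<And>x. x \<in> Q \<Longrightarrow> - x \<in> Q" "0 \<in> Q"
  obtains \<nu> where "borel_prob \<nu>" "\<And>\<xi>. (1/2) *\<^sub>R \<xi> \<notin> Q \<Longrightarrow> chf \<nu> \<xi> = 0"
    "\<And>\<xi>. \<xi> \<in> Q \<Longrightarrow> 1 / 2 ^ DIM('a) \<le> cmod (chf \<nu> \<xi>)"
    "\<And>\<xi>. chf \<nu> \<xi> = of_real (measure lborel {y\<in>Q. y + \<xi> \<in> Q} / measure lborel Q)"
proof -
  obtain w where w: "integrable lborel w" "\<forall>x. 0 \<le> w x" "(\<integral>x. w x \<partial>lborel) = (1::real)"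
    "\<And>\<xi>. (1/2) *\<^sub>R \<xi> \<notin> Q \<Longrightarrow> fourier (\<lambda>x. complex_of_real (w x)) \<xi> = 0"
    "\<And>\<xi>. \<xi> \<in> Q \<Longrightarrow> 1 / 2 ^ DIM('a) \<le> cmod (fourier (\<lambda>x. complex_of_real (w x)) \<xi>)"
    "\<And>\<xi>. fourier (\<lambda>x. complex_of_real (w x)) \<xi> = of_real (measure lborel {y\<in>Q. y + \<xi> \<in> Q} / measure lborel Q)"
    using averaging_kernel_exists[OF assms] by blast
  show thesis
    by (rule that[of "density lborel w"]) (use w in \<open>auto simp: borel_prob_density\<close>)
qed

text \<open>The measure is the Fejer kernel, carried by the line through \<open>e\<close>.\<close>

lemma tent_measure_exists:
  fixes e :: "'a::euclidean_space"
  assumes mu: "\<mu> > 0"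
  obtains \<nu> where "borel_prob \<nu>" "\<And>\<xi>. chf \<nu> \<xi> = of_real (max 0 (1 - \<bar>e \<bullet> \<xi>\<bar> / \<mu>))"
proof -
  \<comment> \<open>An interval of length \<mu> overlaps its translate by \<xi> in length
    \<open>max 0 (\<mu> - \<bar>\<xi>\<bar>)\<close>, so the general averaging measure has a tent as
    its transform. The image of this measure on the line through \<open>e\<close> sees only
    \<open>e \<bullet> \<xi>\<close>.\<close>
  let ?Q = "{- (\<mu>/2) <..< \<mu>/2}"
  obtain \<nu> where nu: "borel_prob \<nu>" "\<And>\<xi>. chf \<nu> \<xi> = of_real (measure lborel {y\<in>?Q. y + \<xi> \<in> ?Q} / measure lborel ?Q)"
  proof (rule averaging_measure_exists[of ?Q])
    show "- x \<in> ?Q" if "x \<in> ?Q" for x using that by simp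
    show "0 \<in> ?Q" using mu by simp
  qed (auto intro: that)
  interpret borel_prob \<nu> by fact
  have Q: "{y\<in>?Q. y + \<xi> \<in> ?Q} = {max (- (\<mu>/2)) (- (\<mu>/2) - \<xi>) <..< min (\<mu>/2) (\<mu>/2 - \<xi>)}" for \<xi>
    by (auto simp: max_def min_def)
  have c: "chf \<nu> \<xi> = of_real (max 0 (1 - \<bar>\<xi>\<bar> / \<mu>))" for \<xi>
    unfolding nu(2) Q using mu by (auto simp: measure_def max_def min_def field_simps abs_if)
  have [measurable]: "(\<lambda>u. u *\<^sub>R e) \<in> borel_measurable borel" by measurable
  interpret D: prob_space "distr \<nu> borel (\<lambda>u. u *\<^sub>R e)" by (rule prob_space_distr) simp
  show thesis
  proof (rule that[of "distr \<nu> borel (\<lambda>u. u *\<^sub>R e)"])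
    show "borel_prob (distr \<nu> borel (\<lambda>u. u *\<^sub>R e))" by (intro borel_prob.intro D.prob_space_axioms) simp
    show "chf (distr \<nu> borel (\<lambda>u. u *\<^sub>R e)) \<xi> = of_real (max 0 (1 - \<bar>e \<bullet> \<xi>\<bar> / \<mu>))" for \<xi>
      unfolding c[symmetric] chf_def by (subst integral_distr) auto
  qed
qed

section \<open>Planks of the cone\<close>

text \<open>In the coordinates \<open>a = p \<bullet> va\<close>, \<open>b = p \<bullet> vb\<close>, \<open>c = p \<bullet> vc\<close> the cone is \<open>a c = b\<^sup>2\<close>; its generator with parameter \<open>t\<close> is
  \<open>lin t = qd t = 0\<close>, and \<open>qd t = 0\<close> is the tangent plane along it.\<close>

locale cone_coords =
  fixes va vb vc :: "'a::euclidean_space" and N0 :: real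
  assumes coords_bound: "norm p \<le> N0 * (\<bar>p \<bullet> va\<bar> + \<bar>p \<bullet> vb\<bar> + \<bar>p \<bullet> vc\<bar>)"
begin

definition lin :: "real \<Rightarrow> 'a \<Rightarrow> real" where "lin t p = p \<bullet> vb - t * (p \<bullet> va)"
definition qd :: "real \<Rightarrow> 'a \<Rightarrow> real" where "qd t p = p \<bullet> vc - 2 * t * (p \<bullet> vb) + t\<^sup>2 * (p \<bullet> va)"

text \<open>As a function of \<open>t\<close>, \<open>qd t p\<close> is a quadratic polynomial with
  derivative \<open>- 2 * lin t p\<close> and leading coefficient \<open>p \<bullet> va\<close>. The
  shift rules for \<open>lin\<close> and \<open>qd\<close> are its exact Taylor expansions, and
  every passage between a node and its ancestors rests on them.\<close>

lemma lin_shift: "lin s p = lin t p - (s - t) * (p \<bullet> va)"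
  by (simp add: lin_def algebra_simps)

lemma qd_shift: "qd s p = qd t p - 2 * (s - t) * lin t p + (s - t)\<^sup>2 * (p \<bullet> va)"
  by (simp add: qd_def lin_def algebra_simps power2_eq_square)

lemma lin_linear: "lin t (p + q) = lin t p + lin t q" "lin t (p - q) = lin t p - lin t q"
    "lin t (- p) = - lin t p" "lin t (r *\<^sub>R p) = r * lin t p" "lin t 0 = 0"
  and qd_linear: "qd t (p + q) = qd t p + qd t q" "qd t (p - q) = qd t p - qd t q"
    "qd t (- p) = - qd t p" "qd t (r *\<^sub>R p) = r * qd t p" "qd t 0 = 0"
  by (simp_all add: lin_def qd_def inner_simps algebra_simps)

lemma continuous_lin_qd [continuous_intros]:
  "continuous_on S (lin t)" "continuous_on S (qd t)"
  unfolding lin_def[abs_def] qd_def[abs_def]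
  by (intro continuous_on_add continuous_on_diff continuous_on_mult continuous_on_const continuous_on_inner continuous_on_id)+

definition fbox :: "real \<Rightarrow> real \<Rightarrow> real \<Rightarrow> real \<Rightarrow> 'a set" where
  "fbox t A B D = {p. \<bar>p \<bullet> va\<bar> < A \<and> \<bar>lin t p\<bar> < B \<and> \<bar>qd t p\<bar> < D}"

lemma fbox:
  shows "open (fbox t A B D)" "convex (fbox t A B D)" "bounded (fbox t A B D)"
    "\<And>x. x \<in> fbox t A B D \<Longrightarrow> - x \<in> fbox t A B D"
    "A > 0 \<Longrightarrow> B > 0 \<Longrightarrow> D > 0 \<Longrightarrow> 0 \<in> fbox t A B D"
proof -
  have eq: "fbox t A B D = {p. \<bar>p \<bullet> va\<bar> < A} \<inter> ({p. \<bar>lin t p\<bar> < B} \<inter> {p. \<bar>qd t p\<bar> < D})"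
    by (auto simp: fbox_def)
  show "open (fbox t A B D)" unfolding eq
    by (intro open_Int open_Collect_less continuous_intros)
  have cv: "convex {p. \<bar>l p\<bar> < (r::real)}"
    if "\<And>p q. l (p + q) = l p + l q" "\<And>s p. l (s *\<^sub>R p) = s * l p" for l :: "'a \<Rightarrow> real" and r
  proof (rule convexI)
    fix x y u v assume xy: "x \<in> {p. \<bar>l p\<bar> < r}" "y \<in> {p. \<bar>l p\<bar> < r}" "0 \<le> u" "0 \<le> v" "u + v = (1::real)"
    have "l x \<in> {-r<..<r}" "l y \<in> {-r<..<r}" using xy by auto
    then have "u *\<^sub>R l x + v *\<^sub>R l y \<in> {-r<..<r}" using xy by (intro convexD) auto
    then show "u *\<^sub>R x + v *\<^sub>R y \<in> {p. \<bar>l p\<bar> < r}" by (auto simp: that)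
  qed
  show "convex (fbox t A B D)" unfolding eq
    by (intro convex_Int cv) (auto simp: inner_simps lin_linear qd_linear)
  show "bounded (fbox t A B D)" unfolding bounded_iff
  proof (intro exI ballI)
    fix p assume p: "p \<in> fbox t A B D"
    have b: "p \<bullet> vb = lin t p + t * (p \<bullet> va)" by (simp add: lin_def)
    have c: "p \<bullet> vc = qd t p + 2 * t * lin t p + t\<^sup>2 * (p \<bullet> va)"
      by (simp add: lin_def qd_def algebra_simps power2_eq_square)
    have ab: "\<bar>p \<bullet> va\<bar> \<le> A" "\<bar>lin t p\<bar> \<le> B" "\<bar>qd t p\<bar> \<le> D" using p by (auto simp: fbox_def)
    have 1: "\<bar>p \<bullet> vb\<bar> \<le> B + \<bar>t\<bar> * A"
      unfolding b using ab by (intro order.trans[OF abs_triangle_ineq] add_mono) (auto simp: abs_mult intro!: mult_left_mono)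
    have 2: "\<bar>p \<bullet> vc\<bar> \<le> D + 2 * \<bar>t\<bar> * B + t\<^sup>2 * A"
      unfolding c using ab
      by (intro order.trans[OF abs_triangle_ineq] add_mono) (auto simp: abs_mult intro!: mult_left_mono)
    have "norm p \<le> \<bar>N0\<bar> * (\<bar>p \<bullet> va\<bar> + \<bar>p \<bullet> vb\<bar> + \<bar>p \<bullet> vc\<bar>)"
      by (rule order.trans[OF coords_bound]) (intro mult_right_mono, auto)
    also have "\<dots> \<le> \<bar>N0\<bar> * (A + (B + \<bar>t\<bar> * A) + (D + 2 * \<bar>t\<bar> * B + t\<^sup>2 * A))"
      using 1 2 ab by (intro mult_left_mono add_mono) auto
    finally show "norm p \<le> \<bar>N0\<bar> * (A + (B + \<bar>t\<bar> * A) + (D + 2 * \<bar>t\<bar> * B + t\<^sup>2 * A))" .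
  qed
  show "- x \<in> fbox t A B D" if "x \<in> fbox t A B D" for x
    using that by (auto simp: fbox_def lin_linear qd_linear)
  show "0 \<in> fbox t A B D" if "A > 0" "B > 0" "D > 0"
    using that by (auto simp: fbox_def lin_linear qd_linear)
qed

definition box_measure :: "real \<Rightarrow> real \<Rightarrow> real \<Rightarrow> real \<Rightarrow> 'a measure" where
  "box_measure t A B D = (SOME \<nu>. borel_prob \<nu> \<and> (\<forall>\<xi>. (1/2) *\<^sub>R \<xi> \<notin> fbox t A B D \<longrightarrow> chf \<nu> \<xi> = 0) \<and>
     (\<forall>\<xi>\<in>fbox t A B D. 1 / 2 ^ DIM('a) \<le> cmod (chf \<nu> \<xi>)))"

lemma box_measure:
  assumes "A > 0" "B > 0" "D > 0"
  shows "borel_prob (box_measure t A B D)"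
    "\<And>\<xi>. chf (box_measure t A B D) \<xi> \<noteq> 0 \<Longrightarrow> \<bar>\<xi> \<bullet> va\<bar> < 2 * A \<and> \<bar>lin t \<xi>\<bar> < 2 * B \<and> \<bar>qd t \<xi>\<bar> < 2 * D"
    "\<And>\<xi>. \<xi> \<in> fbox t A B D \<Longrightarrow> 1 / 2 ^ DIM('a) \<le> cmod (chf (box_measure t A B D) \<xi>)"
proof -
  have "\<exists>\<nu>. borel_prob \<nu> \<and> (\<forall>\<xi>. (1/2) *\<^sub>R \<xi> \<notin> fbox t A B D \<longrightarrow> chf \<nu> \<xi> = 0) \<and>
     (\<forall>\<xi>\<in>fbox t A B D. 1 / 2 ^ DIM('a) \<le> cmod (chf \<nu> \<xi>))"
    by (rule averaging_measure_exists[of "fbox t A B D", OF fbox(1,2,3,4,5)]) (use assms in blast)+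
  from someI_ex[OF this, folded box_measure_def]
  have *: "borel_prob (box_measure t A B D)" "\<And>\<xi>. (1/2) *\<^sub>R \<xi> \<notin> fbox t A B D \<Longrightarrow> chf (box_measure t A B D) \<xi> = 0"
    "\<And>\<xi>. \<xi> \<in> fbox t A B D \<Longrightarrow> 1 / 2 ^ DIM('a) \<le> cmod (chf (box_measure t A B D) \<xi>)" by blast+
  show "borel_prob (box_measure t A B D)" by (rule *)
  show "1 / 2 ^ DIM('a) \<le> cmod (chf (box_measure t A B D) \<xi>)" if "\<xi> \<in> fbox t A B D" for \<xi> by (rule *(3)[OF that])
  show "\<bar>\<xi> \<bullet> va\<bar> < 2 * A \<and> \<bar>lin t \<xi>\<bar> < 2 * B \<and> \<bar>qd t \<xi>\<bar> < 2 * D" if "chf (box_measure t A B D) \<xi> \<noteq> 0" for \<xi>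
  proof -
    have "(1/2) *\<^sub>R \<xi> \<in> fbox t A B D" using *(2) that by blast
    then show ?thesis by (simp add: fbox_def lin_linear qd_linear abs_mult)
  qed
qed

text \<open>A quadratic polynomial that is small at three points, consecutive ones at distance at
  least \<open>h\<close>, has small coefficients; divided differences give the constants. The base
  point \<open>t\<close> may lie up to \<open>2 * h\<close> to the left of the first point: this is
  the position of the left end of the parent of a node of length \<open>h\<close>.\<close>

lemma qd_three_points:
  assumes small: "\<bar>qd t1 p\<bar> \<le> \<eta>" "\<bar>qd t2 p\<bar> \<le> \<eta>" "\<bar>qd t3 p\<bar> \<le> \<eta>"
    and sep: "t1 + h \<le> t2" "t2 + h \<le> t3" and h: "h > 0" and t: "t \<le> t1" "t1 \<le> t + 2 * h"
  shows "\<bar>p \<bullet> va\<bar> \<le> 2 * \<eta> / h\<^sup>2" "\<bar>lin t p\<bar> \<le> 7 * \<eta> / h" "\<bar>qd t p\<bar> \<le> 21 * \<eta>"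
proof -
  define a where "a = p \<bullet> va"
  define l where "l = lin t1 p"
  define x where "x = t2 - t1"
  define y where "y = t3 - t2"
  have eta: "\<eta> \<ge> 0" using small(1) by linarith
  have x: "x \<ge> h" and y: "y \<ge> h" using sep by (auto simp: x_def y_def)
  have q2: "qd t2 p = qd t1 p - 2 * x * l + x\<^sup>2 * a"
    using qd_shift[of t2 p t1] by (simp add: x_def l_def a_def)
  have q3: "qd t3 p = qd t1 p - 2 * (x + y) * l + (x + y)\<^sup>2 * a"
    using qd_shift[of t3 p t1] by (simp add: x_def y_def l_def a_def)
  define d1 where "d1 = (qd t2 p - qd t1 p) / x"
  define d2 where "d2 = (qd t3 p - qd t2 p) / y"
  have d1: "d1 = - 2 * l + x * a" using x h unfolding d1_def q2 by (simp add: field_simps power2_eq_square)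
  have d2: "d2 = - 2 * l + (2 * x + y) * a" using y h unfolding d2_def q2 q3 by (simp add: field_simps power2_eq_square)
  have b1: "\<bar>d1\<bar> \<le> 2 * \<eta> / h"
    unfolding d1_def abs_divide using small x h eta by (intro frac_le) auto
  have b2: "\<bar>d2\<bar> \<le> 2 * \<eta> / h"
    unfolding d2_def abs_divide using small y h eta by (intro frac_le) auto
  \<comment> \<open>The second divided difference isolates the leading coefficient. As
    \<open>x + y \<ge> 2 * h\<close>, it bounds \<open>a\<close>; together with \<open>d1\<close> it
    then bounds \<open>l\<close>.\<close>
  have s: "(x + y) * a = d2 - d1" by (simp add: d1 d2 algebra_simps)
  have s2: "\<bar>(x + y) * a\<bar> \<le> 4 * \<eta> / h" unfolding s using b1 b2 by linarith
  have xa: "\<bar>x * a\<bar> \<le> 4 * \<eta> / h"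
  proof -
    have "\<bar>x * a\<bar> \<le> \<bar>(x + y) * a\<bar>" using x y h by (auto simp: abs_mult intro!: mult_right_mono)
    with s2 show ?thesis by linarith
  qed
  have ha: "2 * h * \<bar>a\<bar> \<le> 4 * \<eta> / h"
  proof -
    have "2 * h * \<bar>a\<bar> \<le> \<bar>(x + y) * a\<bar>" using x y h by (auto simp: abs_mult intro!: mult_right_mono)
    with s2 show ?thesis by linarith
  qed
  have l: "\<bar>l\<bar> \<le> 3 * \<eta> / h"
  proof -
    have "2 * l = x * a - d1" by (simp add: d1)
    then have "2 * \<bar>l\<bar> \<le> 4 * \<eta> / h + 2 * \<eta> / h" using xa b1 by linarith
    then show ?thesis using h by (simp add: field_simps)
  qed
  have a: "\<bar>a\<bar> \<le> 2 * \<eta> / h\<^sup>2"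
    using ha h by (simp add: field_simps power2_eq_square)
  then show "\<bar>p \<bullet> va\<bar> \<le> 2 * \<eta> / h\<^sup>2" by (simp add: a_def)
  define s where "s = t1 - t"
  have sr: "0 \<le> s" "s \<le> 2 * h" using t by (auto simp: s_def)
  have sa: "\<bar>s * a\<bar> \<le> 4 * \<eta> / h"
  proof -
    have "\<bar>s * a\<bar> \<le> 2 * h * \<bar>a\<bar>" using sr by (auto simp: abs_mult intro!: mult_right_mono)
    with ha show ?thesis by linarith
  qed
  have "lin t p = l + s * a" using lin_shift[of t p t1] by (simp add: l_def s_def a_def algebra_simps)
  then have "\<bar>lin t p\<bar> \<le> 3 * \<eta> / h + 4 * \<eta> / h" using l sa by linarith
  then show "\<bar>lin t p\<bar> \<le> 7 * \<eta> / h" by (simp add: field_simps)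
  have sl: "\<bar>s * l\<bar> \<le> 6 * \<eta>"
  proof -
    have "\<bar>s * l\<bar> \<le> 2 * h * (3 * \<eta> / h)" unfolding abs_mult using sr l h by (intro mult_mono) auto
    also have "\<dots> = 6 * \<eta>" using h by simp
    finally show ?thesis .
  qed
  have ssa: "\<bar>s * (s * a)\<bar> \<le> 8 * \<eta>"
  proof -
    have "\<bar>s * (s * a)\<bar> \<le> 2 * h * (4 * \<eta> / h)" unfolding abs_mult[of s "s * a"] using sr sa h by (intro mult_mono) auto
    also have "\<dots> = 8 * \<eta>" using h by simp
    finally show ?thesis .
  qed
  have "qd t p = qd t1 p + 2 * (s * l) + s * (s * a)"
    using qd_shift[of t p t1] by (simp add: l_def s_def a_def algebra_simps power2_eq_square)
  then show "\<bar>qd t p\<bar> \<le> 21 * \<eta>" using small(1) sl ssa by linarith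
qed

end

text \<open>Greedy choice of minima: each choice discards at most the minimum and its successor, so
  5 = 2 + 2 + 1 elements suffice. A gap of 2 between the indices of two nodes leaves a full node
  between them.\<close>

lemma three_separated_elements:
  fixes A :: "nat set"
  assumes A: "finite A" "card A \<ge> 5"
  obtains k1 k2 k3 where "k1 \<in> A" "k2 \<in> A" "k3 \<in> A" "k1 + 2 \<le> k2" "k2 + 2 \<le> k3"
proof -
  have step: "\<exists>k\<in>B. card {m\<in>B. k + 2 \<le> m} + 2 \<ge> card B \<and> {m\<in>B. k + 2 \<le> m} \<subseteq> B" if "finite B" "B \<noteq> {}" for B :: "nat set"
  proof (intro bexI conjI)
    let ?k = "Min B"
    show "?k \<in> B" using that by simp
    have "B \<subseteq> {m\<in>B. ?k + 2 \<le> m} \<union> {?k, Suc ?k}"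
    proof
      fix m assume "m \<in> B"
      then have "?k \<le> m" using that by simp
      then show "m \<in> {m\<in>B. ?k + 2 \<le> m} \<union> {?k, Suc ?k}" using \<open>m \<in> B\<close> by auto
    qed
    then have "card B \<le> card ({m\<in>B. ?k + 2 \<le> m} \<union> {?k, Suc ?k})" using that by (intro card_mono) auto
    also have "\<dots> \<le> card {m\<in>B. ?k + 2 \<le> m} + card {?k, Suc ?k}" by (rule card_Un_le)
    finally show "card {m\<in>B. ?k + 2 \<le> m} + 2 \<ge> card B" by simp
  qed auto
  obtain k1 where k1: "k1 \<in> A" "card {m\<in>A. k1 + 2 \<le> m} + 2 \<ge> card A"
    using step[OF A(1)] A(2) by (metis card.empty not_numeral_le_zero)
  let ?B = "{m\<in>A. k1 + 2 \<le> m}"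
  have "?B \<noteq> {}"
  proof
    assume "?B = {}"
    then have "card ?B = 0" by (simp only: card.empty)
    with k1(2) A(2) show False by linarith
  qed
  then obtain k2 where k2: "k2 \<in> ?B" "card {m\<in>?B. k2 + 2 \<le> m} + 2 \<ge> card ?B" using step[of ?B] A(1) by auto
  have "card {m\<in>?B. k2 + 2 \<le> m} > 0" using k1 k2 A by linarith
  then obtain k3 where "k3 \<in> {m\<in>?B. k2 + 2 \<le> m}" by (metis card_gt_0_iff ex_in_conv)
  then show thesis using that[of k1 k2 k3] k1(1) k2(1) by simp
qed

text \<open>Node \<open>i\<close> of level \<open>v\<close> is the dyadic interval \<open>[i / 2\<^sup>v, (i + 1) / 2\<^sup>v)\<close>; its descendants of level \<open>v'\<close> are \<open>kids v v' i\<close>.\<close>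

definition kids :: "nat \<Rightarrow> nat \<Rightarrow> nat \<Rightarrow> nat set" where
  "kids v v' i = {k. k < 2 ^ v' \<and> k div 2 ^ (v' - v) = i}"

lemma finite_kids [simp]: "finite (kids v v' i)"
  by (rule finite_subset[of _ "{..<2 ^ v'}"]) (auto simp: kids_def)

lemma div_pow_less: "v \<le> v' \<Longrightarrow> k < 2 ^ v' \<Longrightarrow> k div 2 ^ (v' - v) < (2::nat) ^ v"
  by (simp add: less_mult_imp_div_less flip: power_add)

lemma div_pow_div: "u \<le> v \<Longrightarrow> v \<le> w \<Longrightarrow> (j::nat) div 2 ^ (w - v) div 2 ^ (v - u) = j div 2 ^ (w - u)"
  by (simp add: div_mult2_eq[symmetric] flip: power_add)

lemma kids_trans: "u \<le> v \<Longrightarrow> v \<le> w \<Longrightarrow> i \<in> kids u v k \<Longrightarrow> a \<in> kids v w i \<Longrightarrow> a \<in> kids u w k"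
  using div_pow_div[of u v w a] by (simp add: kids_def)

lemma sum_kids:
  fixes h :: "nat \<Rightarrow> 'b::comm_monoid_add"
  assumes "u \<le> v" "v \<le> w"
  shows "(\<Sum>k\<in>kids u v i. \<Sum>j\<in>kids v w k. h j) = (\<Sum>j\<in>kids u w i. h j)"
proof -
  have "kids v w k = {j \<in> kids u w i. j div 2 ^ (w - v) = k}" if "k \<in> kids u v i" for k
    using that assms by (auto simp: kids_def div_pow_div)
  then have "(\<Sum>k\<in>kids u v i. \<Sum>j\<in>kids v w k. h j) = (\<Sum>k\<in>kids u v i. \<Sum>j\<in>{j \<in> kids u w i. j div 2 ^ (w - v) = k}. h j)"
    by simp
  also have "\<dots> = (\<Sum>j\<in>kids u w i. h j)"
    by (rule sum.group) (use assms in \<open>auto simp: kids_def div_pow_div div_pow_less\<close>)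
  finally show ?thesis .
qed

lemma sum_kids_all:
  fixes h :: "nat \<Rightarrow> 'b::comm_monoid_add"
  assumes "u \<le> v"
  shows "(\<Sum>k<2 ^ u. \<Sum>j\<in>kids u v k. h j) = (\<Sum>j<2 ^ v. h j)"
proof -
  have "kids 0 u 0 = {..<2 ^ u}" "kids 0 v 0 = {..<2 ^ v}" by (auto simp: kids_def)
  then show ?thesis using sum_kids[of 0 u v h 0] assms by simp
qed

definition dya :: "nat \<Rightarrow> nat \<Rightarrow> real" where "dya v i = real i / 2 ^ v"

lemma dya_kid:
  assumes "k \<in> kids u v i" "u \<le> v"
  shows "dya u i \<le> dya v k" "dya v k < dya u i + 1 / 2 ^ u"
proof -
  have "i * 2 ^ (v - u) \<le> k" "k < (i + 1) * 2 ^ (v - u)"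
    using assms by (auto simp: kids_def mult.commute dividend_less_times_div div_times_less_eq_dividend algebra_simps)
  then have "real (i * 2 ^ (v - u)) \<le> real k" "real k < real ((i + 1) * 2 ^ (v - u))"
    unfolding of_nat_le_iff of_nat_less_iff by blast+
  then have *: "real i * 2 ^ (v - u) \<le> real k" "real k < (real i + 1) * 2 ^ (v - u)"
    by (simp_all add: algebra_simps)
  have p: "(2::real) ^ v = 2 ^ u * 2 ^ (v - u)" using assms(2) by (simp flip: power_add)
  show "dya u i \<le> dya v k" "dya v k < dya u i + 1 / 2 ^ u"
    using * unfolding dya_def p by (simp_all add: field_simps)
qed

text \<open>The number \<open>1 / 4 ^ n\<close> plays the part of \<delta>: the frequencies of
  \<open>g j\<close> lie in a plank of size about \<open>1\<close>, \<open>1 / 2 ^ n\<close>,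
  \<open>1 / 4 ^ n\<close> around the generator of parameter \<open>dya n j\<close>, and
  \<open>C\<close> absorbs all comparabilities. The lower bound \<open>1 / C\<close> keeps
  frequencies away from the vertex, so that a bound on a parameter times
  \<open>p \<bullet> va\<close> becomes a bound on the parameter.\<close>

locale cone_family = cone_coords va vb vc N0 for va vb vc :: "'a::euclidean_space" and N0 +
  fixes n :: nat and g :: "nat \<Rightarrow> 'a \<Rightarrow> complex" and C :: real
  assumes C1: "C \<ge> 1" and nice_g: "\<And>j. nice (g j)"
    and supp_g: "\<And>j p. j < 2 ^ n \<Longrightarrow> fourier (g j) p \<noteq> 0 \<Longrightarrow>
      1 / C \<le> p \<bullet> va \<and> p \<bullet> va \<le> C \<and> \<bar>lin (dya n j) p\<bar> \<le> C / 2 ^ n \<and> \<bar>qd (dya n j) p\<bar> \<le> C / 4 ^ n"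
begin

definition F :: "nat \<Rightarrow> nat \<Rightarrow> 'a \<Rightarrow> complex" where
  "F v i x = (\<Sum>j\<in>kids v n i. g j x)"

definition G :: "nat \<Rightarrow> nat \<Rightarrow> 'a \<Rightarrow> complex" where
  "G v i x = F v i x * cnj (F v i x)"

definition X :: "nat \<Rightarrow> real" where
  "X v = (\<integral>x. (\<Sum>i<2 ^ v. (cmod (F v i x))\<^sup>2)\<^sup>2 \<partial>lborel)"

lemma nice_F: "nice (F v i)"
  unfolding F_def[abs_def] by (intro nice_sum nice_g)

lemma nice_G: "nice (G v i)"
  unfolding G_def[abs_def] by (intro nice_mult nice_cnj nice_F)

lemma G_eq: "G v i x = of_real ((cmod (F v i x))\<^sup>2)"
  unfolding G_def by (rule complex_norm_square[symmetric])

lemma F_refine: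
  assumes "v \<le> w" "w \<le> n"
  shows "F v i x = (\<Sum>k\<in>kids v w i. F w k x)"
  unfolding F_def using assms by (simp add: sum_kids)

text \<open>A leaf lies at most \<open>1 / 2 ^ v\<close> to the right of the left end of its
  ancestor of level \<open>v\<close>. The shift rules therefore add only terms of the sizes
  \<open>C / 2 ^ v\<close> and \<open>C / 4 ^ v\<close>.\<close>

lemma supp_F:
  assumes v: "v \<le> n" and p: "fourier (F v i) p \<noteq> 0"
  shows "\<exists>j\<in>kids v n i. fourier (g j) p \<noteq> 0"
    "1 / C \<le> p \<bullet> va" "p \<bullet> va \<le> C" "\<bar>lin (dya v i) p\<bar> \<le> 2 * C / 2 ^ v" "\<bar>qd (dya v i) p\<bar> \<le> 4 * C / 4 ^ v"
proof -
  have "fourier (F v i) p = (\<Sum>j\<in>kids v n i. fourier (g j) p)"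
    unfolding F_def[abs_def] by (rule fourier_sum) (intro nice_integrable nice_g)
  with p obtain j where j: "j \<in> kids v n i" "fourier (g j) p \<noteq> 0"
    by (metis sum.neutral)
  then show "\<exists>j\<in>kids v n i. fourier (g j) p \<noteq> 0" by blast
  have jn: "j < 2 ^ n" using j by (auto simp: kids_def)
  note s = supp_g[OF jn j(2)]
  then show a: "1 / C \<le> p \<bullet> va" "p \<bullet> va \<le> C" by auto
  define s where "s = dya n j - dya v i"
  have s0: "0 \<le> s" "s \<le> 1 / 2 ^ v" using dya_kid[OF j(1) v] by (auto simp: s_def)
  have a0: "0 \<le> p \<bullet> va" using a C1 by (meson order.trans divide_nonneg_pos zero_le_one less_le_trans zero_less_one)
  have nv: "C / 2 ^ n \<le> C / 2 ^ v" "C / 4 ^ n \<le> C / 4 ^ v"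
    using v C1 by (auto intro!: divide_left_mono power_increasing)
  have sa: "s * (p \<bullet> va) \<le> C / 2 ^ v" "0 \<le> s * (p \<bullet> va)"
    using mult_mono[OF s0(2) a(2)] s0 a0 by auto
  have l: "lin (dya v i) p = lin (dya n j) p + s * (p \<bullet> va)"
    using lin_shift[of "dya v i" p "dya n j"] by (simp add: s_def algebra_simps)
  show "\<bar>lin (dya v i) p\<bar> \<le> 2 * C / 2 ^ v"
    unfolding l using s sa nv by (auto simp: abs_le_iff)
  have q: "qd (dya v i) p = qd (dya n j) p + 2 * (s * lin (dya n j) p) + s * (s * (p \<bullet> va))"
    using qd_shift[of "dya v i" p "dya n j"] by (simp add: s_def algebra_simps power2_eq_square)
  have e4: "1 / 2 ^ v * (C / 2 ^ v) = C / (4::real) ^ v" by (simp flip: power_mult_distrib)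
  have "\<bar>s * lin (dya n j) p\<bar> \<le> 1 / 2 ^ v * (C / 2 ^ v)"
    unfolding abs_mult using s s0 nv by (intro mult_mono) auto
  moreover have "\<bar>s * (s * (p \<bullet> va))\<bar> \<le> 1 / 2 ^ v * (C / 2 ^ v)"
    unfolding abs_mult[of s "s * _"] using sa s0 by (intro mult_mono) auto
  moreover have "4 * C / 4 ^ v = C / 4 ^ v + 2 * (C / 4 ^ v) + C / 4 ^ v" by simp
  ultimately show "\<bar>qd (dya v i) p\<bar> \<le> 4 * C / 4 ^ v"
    unfolding q e4 using s nv by linarith
qed

lemma fourier_mult_cnj_nonzeroD:
  assumes "nice f" "nice h" "fourier (\<lambda>x. f x * cnj (h x)) \<xi> \<noteq> 0"
  obtains p q where "\<xi> = p - q" "fourier f p \<noteq> 0" "fourier h q \<noteq> 0"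
proof -
  obtain p q where "\<xi> = p + q" "fourier f p \<noteq> 0" "fourier (\<lambda>x. cnj (h x)) q \<noteq> 0"
    using fourier_mult_nonzeroD[OF assms(1) nice_cnj(1)[OF assms(2)] assms(3)] by blast
  then show thesis using that[of p "- q"] by (simp add: nice_cnj(2)[OF assms(2)])
qed

lemma supp_G:
  assumes v: "v \<le> n" and p: "fourier (G v i) \<xi> \<noteq> 0"
  shows "\<bar>\<xi> \<bullet> va\<bar> \<le> 8 * C" "\<bar>lin (dya v i) \<xi>\<bar> \<le> 8 * C / 2 ^ v" "\<bar>qd (dya v i) \<xi>\<bar> \<le> 8 * C / 4 ^ v"
proof -
  obtain p q where pq: "\<xi> = p - q" "fourier (F v i) p \<noteq> 0" "fourier (F v i) q \<noteq> 0"
    using fourier_mult_cnj_nonzeroD[OF nice_F nice_F p[unfolded G_def[abs_def]]] by blast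
  have C0: "0 \<le> 1 / C" using C1 by simp
  note P = supp_F(2,3,4,5)[OF v pq(2)]
  note Q = supp_F(2,3,4,5)[OF v pq(3)]
  show "\<bar>\<xi> \<bullet> va\<bar> \<le> 8 * C"
    unfolding pq(1) inner_diff_left using P(1,2) Q(1,2) C1 C0 by linarith
  have "2 * C / 2 ^ v \<ge> 0" using C1 by simp
  moreover have "8 * C / 2 ^ v = 4 * (2 * C / 2 ^ v)" "8 * C / 4 ^ v = 2 * (4 * C / 4 ^ v)" by simp_all
  ultimately show "\<bar>lin (dya v i) \<xi>\<bar> \<le> 8 * C / 2 ^ v" "\<bar>qd (dya v i) \<xi>\<bar> \<le> 8 * C / 4 ^ v"
    unfolding pq(1) lin_linear qd_linear using P Q by linarith+
qed

section \<open>Charging frequencies to planks\<close>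

definition Kc :: real where "Kc = 264 * C"

lemma Kc: "Kc > 0" using C1 by (simp add: Kc_def)

text \<open>The frequency box is the plank of level \<open>u\<close>, of size about
  \<open>1\<close>, \<open>1 / 2 ^ u\<close>, \<open>1 / 4 ^ u\<close>, dilated by
  \<open>4 ^ u / 4 ^ v\<close>. For \<open>u = v\<close> it contains the spectrum of
  \<open>G v k\<close>; for smaller \<open>u\<close> it is about the common part of the planks of
  all blocks of level \<open>v\<close> inside the node \<open>k\<close>.\<close>

definition plank_measure :: "nat \<Rightarrow> nat \<Rightarrow> nat \<Rightarrow> 'a measure" where
  "plank_measure v u k = box_measure (dya u k) (Kc * 4 ^ u / 4 ^ v) (Kc * 2 ^ u / 4 ^ v) (Kc / 4 ^ v)"

text \<open>A frequency \<open>p\<close> is charged to the coarsest node \<open>k\<close> (of level \<open>u\<close>) whose plank contains it. If more than four nodes of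
  one level were chosen, \<open>qd\<close> would be small at three separated points, hence \<open>p\<close> would lie in the plank of a parent.\<close>

definition good :: "nat \<Rightarrow> 'a \<Rightarrow> nat \<Rightarrow> nat \<Rightarrow> bool" where
  "good v p u k \<longleftrightarrow> p \<in> fbox (dya u k) (Kc * 4 ^ u / 4 ^ v) (Kc * 2 ^ u / 4 ^ v) (Kc / 4 ^ v)"

definition chosen :: "nat \<Rightarrow> 'a \<Rightarrow> nat \<Rightarrow> nat \<Rightarrow> bool" where
  "chosen v p u k \<longleftrightarrow> good v p u k \<and> (\<forall>u'<u. \<not> good v p u' (k div 2 ^ (u - u')))"

lemma plank_measure:
  "borel_prob (plank_measure v u k)"
  "chf (plank_measure v u k) \<xi> \<noteq> 0 \<Longrightarrow> \<bar>\<xi> \<bullet> va\<bar> < 2 * (Kc * 4 ^ u / 4 ^ v) \<and> \<bar>lin (dya u k) \<xi>\<bar> < 2 * (Kc * 2 ^ u / 4 ^ v)"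
  "good v \<xi> u k \<Longrightarrow> 1 / 2 ^ DIM('a) \<le> cmod (chf (plank_measure v u k) \<xi>)"
  unfolding plank_measure_def good_def
  using box_measure[where A="Kc * 4 ^ u / 4 ^ v" and B="Kc * 2 ^ u / 4 ^ v" and D="Kc / 4 ^ v" and t="dya u k"] Kc
  by auto

definition active :: "nat \<Rightarrow> 'a \<Rightarrow> nat set" where
  "active v p = {i. i < 2 ^ v \<and> fourier (G v i) p \<noteq> 0}"

text \<open>\<open>Kc\<close> exceeds the constant \<open>8 * C\<close> of \<open>supp_G\<close>, so
  level \<open>v\<close> itself qualifies and a coarsest ancestor of \<open>i\<close> with
  \<open>p\<close> in its plank exists. Uniqueness holds along the ancestors of one
  \<open>i\<close>; different \<open>i\<close> may be charged to different nodes.\<close>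

lemma chosen_ex1:
  assumes v: "v \<le> n" and i: "i \<in> active v p"
  shows "\<exists>!u. u \<le> v \<and> chosen v p u (i div 2 ^ (v - u))"
proof -
  have "8 * C < Kc" using C1 by (simp add: Kc_def)
  moreover have "(4::real) ^ v = 2 ^ v * 2 ^ v" by (simp flip: power_mult_distrib)
  ultimately have "8 * C < Kc * 4 ^ v / 4 ^ v" "8 * C / 2 ^ v < Kc * 2 ^ v / 4 ^ v" "8 * C / 4 ^ v < Kc / 4 ^ v"
    by (simp_all add: divide_strict_right_mono)
  then have g: "good v p v (i div 2 ^ (v - v))"
    using supp_G[OF v, of i p] i unfolding good_def fbox_def active_def by auto
  define u where "u = (LEAST u. good v p u (i div 2 ^ (v - u)))"
  have gu: "good v p u (i div 2 ^ (v - u))" unfolding u_def by (rule LeastI) (rule g)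
  have uv: "u \<le> v" unfolding u_def by (rule Least_le) (rule g)
  have least: "\<not> good v p u' (i div 2 ^ (v - u'))" if "u' < u" for u'
    using not_less_Least[of u' "\<lambda>u. good v p u (i div 2 ^ (v - u))"] that by (simp add: u_def)
  show ?thesis
  proof (rule ex1I[of _ u])
    show "u \<le> v \<and> chosen v p u (i div 2 ^ (v - u))"
      unfolding chosen_def using uv gu least by (auto simp: div_pow_div)
    fix w assume w: "w \<le> v \<and> chosen v p w (i div 2 ^ (v - w))"
    then have gw: "good v p w (i div 2 ^ (v - w))" and lw: "\<And>u'. u' < w \<Longrightarrow> \<not> good v p u' (i div 2 ^ (v - u'))"
      by (auto simp: chosen_def div_pow_div)
    show "w = u" using lw[of u] least[of w] gu gw by (metis linorder_neqE_nat)
  qed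
qed

definition chosen_nodes :: "nat \<Rightarrow> 'a \<Rightarrow> nat \<Rightarrow> nat set" where
  "chosen_nodes v p u = {k. k < 2 ^ u \<and> chosen v p u k \<and> (\<exists>i\<in>active v p. i div 2 ^ (v - u) = k)}"

lemma card_chosen_nodes:
  assumes v: "v \<le> n" and u: "u \<le> v"
  shows "card (chosen_nodes v p u) \<le> 4"
proof (rule ccontr)
  assume "\<not> card (chosen_nodes v p u) \<le> 4"
  then have c5: "card (chosen_nodes v p u) \<ge> 5" by simp
  have fin: "finite (chosen_nodes v p u)" by (rule finite_subset[of _ "{..<2 ^ u}"]) (auto simp: chosen_nodes_def)
  have "u \<noteq> 0"
  proof
    assume "u = 0"
    then have "chosen_nodes v p u \<subseteq> {0}" by (auto simp: chosen_nodes_def)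
    then have "card (chosen_nodes v p u) \<le> card {0::nat}" by (intro card_mono) auto
    with c5 show False by simp
  qed
  obtain k1 k2 k3 where k: "k1 \<in> chosen_nodes v p u" "k2 \<in> chosen_nodes v p u" "k3 \<in> chosen_nodes v p u" "k1 + 2 \<le> k2" "k2 + 2 \<le> k3"
    using three_separated_elements[OF fin c5] by blast
  \<comment> \<open>Every chosen node contains a block active at \<open>p\<close>, and at the
    parameter of that block \<open>qd\<close> is small. The index gaps of 2 separate the three
    parameters by at least the node length \<open>h\<close>, wherever they lie in their
    nodes.\<close>
  have ex: "\<exists>i. i \<in> active v p \<and> i \<in> kids u v k'" if "k' \<in> chosen_nodes v p u" for k'
    using that by (auto simp: chosen_nodes_def kids_def active_def)
  obtain i1 i2 i3 where i: "i1 \<in> active v p" "i1 \<in> kids u v k1" "i2 \<in> active v p" "i2 \<in> kids u v k2" "i3 \<in> active v p" "i3 \<in> kids u v k3"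
    using ex k by metis
  define h where "h = (1::real) / 2 ^ u"
  have h: "h > 0" by (simp add: h_def)
  define \<eta> where "\<eta> = 8 * C / 4 ^ v"
  have e0: "\<eta> > 0" using C1 by (simp add: \<eta>_def)
  have sm: "\<bar>qd (dya v i) p\<bar> \<le> \<eta>" if "i \<in> active v p" for i
    using supp_G(3)[OF v, of i p] that by (simp add: \<eta>_def active_def)
  have dk: "dya u k' = real k' * h" for k' by (simp add: dya_def h_def)
  have sep: "dya v a + h \<le> dya v b" if "a \<in> kids u v k" "b \<in> kids u v l" "k + 2 \<le> l" for a b k l
  proof -
    have "real k + 2 \<le> real l" using that(3) by linarith
    then have "real k * h + 2 * h \<le> real l * h" using h by (metis distrib_right mult_right_mono less_imp_le)
    then show ?thesis using dya_kid[OF that(1) u] dya_kid[OF that(2) u] by (simp add: dk h_def[symmetric])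
  qed
  define t where "t = dya (u - 1) (k1 div 2)"
  have kk: "k1 \<in> kids (u - 1) u (k1 div 2)" using k(1) \<open>u \<noteq> 0\<close> by (auto simp: kids_def chosen_nodes_def)
  have h2: "1 / 2 ^ (u - 1) = 2 * h" using \<open>u \<noteq> 0\<close> by (cases u) (auto simp: h_def)
  have "i1 \<in> kids (u - 1) v (k1 div 2)"
  proof -
    have "k1 div 2 ^ (u - (u - 1)) = k1 div 2" using \<open>u \<noteq> 0\<close> by simp
    moreover have "i1 div 2 ^ (v - u) = k1" using i(2) by (simp add: kids_def)
    ultimately have "i1 div 2 ^ (v - (u - 1)) = k1 div 2"
      using div_pow_div[of "u - 1" u v i1] u by simp
    then show ?thesis using i(2) by (simp add: kids_def)
  qed
  moreover have "u - 1 \<le> v" using u by simp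
  ultimately have "t \<le> dya v i1" "dya v i1 < t + 1 / 2 ^ (u - 1)" unfolding t_def by (rule dya_kid)+
  then have t: "t \<le> dya v i1" "dya v i1 \<le> t + 2 * h" unfolding h2 by auto
  note small = qd_three_points[OF sm[OF i(1)] sm[OF i(3)] sm[OF i(5)] sep[OF i(2,4) k(4)] sep[OF i(4,6) k(5)] h t]
  \<comment> \<open>The origin of the constant in \<open>Kc\<close>: as 264 = 8 * 33, the plank of
    the parent has the sizes 33/4, 33/2 and 33 in units of \<open>\<eta> / h\<^sup>2\<close>,
    \<open>\<eta> / h\<close> and \<open>\<eta>\<close>. These exceed the bounds 2, 7 and 21
    obtained from the three points.\<close>
  have hp: "Kc * 4 ^ (u - 1) / 4 ^ v = 33 / 4 * \<eta> / h\<^sup>2" "Kc * 2 ^ (u - 1) / 4 ^ v = 33 / 2 * \<eta> / h" "Kc / 4 ^ v = 33 * \<eta>"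
    using \<open>u \<noteq> 0\<close> by (cases u; simp add: Kc_def \<eta>_def h_def power_divide power2_eq_square flip: power_mult_distrib)+
  have "good v p (u - 1) (k1 div 2)"
    unfolding good_def fbox_def t_def[symmetric] hp
  proof (intro CollectI conjI)
    show "\<bar>p \<bullet> va\<bar> < 33 / 4 * \<eta> / h\<^sup>2"
    proof (rule le_less_trans[OF small(1)])
      show "2 * \<eta> / h\<^sup>2 < 33 / 4 * \<eta> / h\<^sup>2" using e0 h by (intro divide_strict_right_mono) auto
    qed
    show "\<bar>lin t p\<bar> < 33 / 2 * \<eta> / h"
    proof (rule le_less_trans[OF small(2)])
      show "7 * \<eta> / h < 33 / 2 * \<eta> / h" using e0 h by (intro divide_strict_right_mono) auto
    qed
    show "\<bar>qd t p\<bar> < 33 * \<eta>" using small(3) e0 by linarith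
  qed
  moreover have "chosen v p u k1" using k(1) by (simp add: chosen_nodes_def)
  ultimately show False using \<open>u \<noteq> 0\<close>
    unfolding chosen_def by (metis One_nat_def diff_Suc_1 diff_diff_cancel diff_less gr0I less_one less_Suc0 power_one_right Suc_leI zero_less_one)
qed

definition GS :: "nat \<Rightarrow> nat \<Rightarrow> nat \<Rightarrow> 'a \<Rightarrow> complex" where
  "GS v u k x = (\<Sum>i\<in>kids u v k. G v i x)"

lemma nice_GS: "nice (GS v u k)"
  unfolding GS_def[abs_def] by (intro nice_sum nice_G)

lemma fourier_GS: "fourier (GS v u k) p = (\<Sum>i\<in>kids u v k. fourier (G v i) p)"
  unfolding GS_def[abs_def] by (rule fourier_sum) (intro nice_integrable nice_G)

lemma GS_root: "GS v 0 0 x = of_real (\<Sum>i<2 ^ v. (cmod (F v i x))\<^sup>2)"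
proof -
  have "kids 0 v 0 = {..<2 ^ v}" by (auto simp: kids_def)
  then show ?thesis by (simp add: GS_def G_eq)
qed

lemma X_eq: "X v = (\<integral>x. (cmod (GS v 0 0 x))\<^sup>2 \<partial>lborel)"
  unfolding X_def GS_root norm_of_real by simp

text \<open>Whether a node is chosen depends on the frequency and the node, not on the block that
  led to it. All blocks below a chosen node are therefore charged to it, and their sum is the
  complete \<open>GS v u k\<close> rather than a fragment. At most \<open>4 * (v + 1)\<close> nodes
  are chosen, which is the loss in Cauchy-Schwarz; on the plank of a chosen node the transform of
  the averaging measure is bounded below, which is the factor \<open>4 ^ DIM('a)\<close>.\<close>

lemma fourier_GS_bound:
  assumes v: "v \<le> n"
  shows "(cmod (fourier (GS v 0 0) p))\<^sup>2 \<le> 4 * real (v + 1) * 4 ^ DIM('a) *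
    (\<Sum>u\<le>v. \<Sum>k<2 ^ u. (cmod (fourier (cv (plank_measure v u k) (GS v u k)) p))\<^sup>2)"
proof -
  define T where "T u k = fourier (GS v u k) p" for u k
  have z: "fourier (G v i) p = (\<Sum>u\<le>v. if chosen v p u (i div 2 ^ (v - u)) then fourier (G v i) p else 0)" if "i < 2 ^ v" for i
  proof (cases "i \<in> active v p")
    case True
    from chosen_ex1[OF v this] obtain u where u: "u \<le> v" "chosen v p u (i div 2 ^ (v - u))"
      and un: "\<And>w. w \<le> v \<Longrightarrow> chosen v p w (i div 2 ^ (v - w)) \<Longrightarrow> w = u" by blast
    have "(\<Sum>u\<le>v. if chosen v p u (i div 2 ^ (v - u)) then fourier (G v i) p else 0)
      = (\<Sum>w\<le>v. if w = u then fourier (G v i) p else 0)"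
    proof (rule sum.cong)
      fix w assume "w \<in> {..v}"
      then have "chosen v p w (i div 2 ^ (v - w)) \<longleftrightarrow> w = u"
        using u un by blast
      then show "(if chosen v p w (i div 2 ^ (v - w)) then fourier (G v i) p else 0) = (if w = u then fourier (G v i) p else 0)"
        by (simp only:)
    qed simp
    then show ?thesis using u(1) by simp
  next
    case False
    then have "fourier (G v i) p = 0" using that by (simp add: active_def)
    then show ?thesis by (simp only: if_cancel sum.neutral_const)
  qed
  have "fourier (GS v 0 0) p = (\<Sum>i<2 ^ v. fourier (G v i) p)"
    unfolding fourier_GS by (rule sum.cong) (auto simp: kids_def)
  also have "\<dots> = (\<Sum>i<2 ^ v. \<Sum>u\<le>v. if chosen v p u (i div 2 ^ (v - u)) then fourier (G v i) p else 0)"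
    by (rule sum.cong) (use z in auto)
  also have "\<dots> = (\<Sum>u\<le>v. \<Sum>i<2 ^ v. if chosen v p u (i div 2 ^ (v - u)) then fourier (G v i) p else 0)"
    by (rule sum.swap)
  also have "\<dots> = (\<Sum>u\<le>v. \<Sum>k\<in>chosen_nodes v p u. T u k)"
  proof (rule sum.cong)
    fix u assume "u \<in> {..v}"
    then have u: "u \<le> v" by simp
    have "(\<Sum>i<2 ^ v. if chosen v p u (i div 2 ^ (v - u)) then fourier (G v i) p else 0)
      = (\<Sum>k<2 ^ u. \<Sum>i\<in>kids u v k. if chosen v p u (i div 2 ^ (v - u)) then fourier (G v i) p else 0)"
      by (rule sum_kids_all[OF u, symmetric])
    also have "\<dots> = (\<Sum>k<2 ^ u. if chosen v p u k then T u k else 0)"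
      unfolding T_def fourier_GS by (rule sum.cong) (auto simp: kids_def intro!: sum.cong)
    also have "\<dots> = (\<Sum>k\<in>chosen_nodes v p u. T u k)"
    proof (rule sum.mono_neutral_cong_right)
      show "\<forall>k\<in>{..<2 ^ u} - chosen_nodes v p u. (if chosen v p u k then T u k else 0) = 0"
      proof
        fix k assume k: "k \<in> {..<2 ^ u} - chosen_nodes v p u"
        have "T u k = 0" if "chosen v p u k"
          unfolding T_def fourier_GS
          by (rule sum.neutral) (use k that in \<open>auto simp: chosen_nodes_def active_def kids_def\<close>)
        then show "(if chosen v p u k then T u k else 0) = 0" by simp
      qed
    qed (auto simp: chosen_nodes_def)
    finally show "(\<Sum>i<2 ^ v. if chosen v p u (i div 2 ^ (v - u)) then fourier (G v i) p else 0) = (\<Sum>k\<in>chosen_nodes v p u. T u k)" .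
  qed simp
  also have "\<dots> = (\<Sum>(u,k)\<in>Sigma {..v} (chosen_nodes v p). T u k)"
    by (rule sum.Sigma) (auto intro: finite_subset[of _ "{..<2 ^ _}"] simp: chosen_nodes_def)
  finally have eq: "fourier (GS v 0 0) p = (\<Sum>(u,k)\<in>Sigma {..v} (chosen_nodes v p). T u k)" .
  have finK: "finite (chosen_nodes v p u)" for u
    by (rule finite_subset[of _ "{..<2 ^ u}"]) (auto simp: chosen_nodes_def)
  have card: "real (card (Sigma {..v} (chosen_nodes v p))) \<le> 4 * real (v + 1)"
  proof -
    have "card (Sigma {..v} (chosen_nodes v p)) = (\<Sum>u\<le>v. card (chosen_nodes v p u))" using finK by (intro card_SigmaI) auto
    also have "\<dots> \<le> (\<Sum>u\<le>v. 4)" by (rule sum_mono) (use card_chosen_nodes[OF v] in auto)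
    also have "\<dots> = 4 * (v + 1)" by simp
    finally show ?thesis by (metis of_nat_le_iff of_nat_mult of_nat_numeral)
  qed
  have Tb: "(cmod (T u k))\<^sup>2 \<le> 4 ^ DIM('a) * (cmod (fourier (cv (plank_measure v u k) (GS v u k)) p))\<^sup>2" if "k \<in> chosen_nodes v p u" for u k
  proof -
    interpret borel_prob "plank_measure v u k" by (rule plank_measure)
    have "good v p u k" using that by (simp add: chosen_nodes_def chosen_def)
    from plank_measure(3)[OF this] have "1 \<le> 2 ^ DIM('a) * cmod (chf (plank_measure v u k) p)" by (simp add: field_simps)
    then have "cmod (T u k) * 1 \<le> cmod (T u k) * (2 ^ DIM('a) * cmod (chf (plank_measure v u k) p))"
      by (intro mult_left_mono) auto
    also have "\<dots> = 2 ^ DIM('a) * cmod (fourier (cv (plank_measure v u k) (GS v u k)) p)"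
      by (simp add: T_def fourier_cv nice_GS norm_mult)
    finally have "(cmod (T u k))\<^sup>2 \<le> (2 ^ DIM('a) * cmod (fourier (cv (plank_measure v u k) (GS v u k)) p))\<^sup>2"
      by (intro power_mono) auto
    moreover have "((2::real) ^ DIM('a))\<^sup>2 = 4 ^ DIM('a)" by (simp add: power2_eq_square flip: power_mult_distrib)
    ultimately show ?thesis by (simp only: power_mult_distrib)
  qed
  have "(cmod (fourier (GS v 0 0) p))\<^sup>2 \<le> (\<Sum>(u,k)\<in>Sigma {..v} (chosen_nodes v p). cmod (T u k))\<^sup>2"
    unfolding eq by (intro power_mono order.trans[OF norm_sum]) (auto simp: case_prod_unfold)
  also have "\<dots> \<le> (\<Sum>(u,k)\<in>Sigma {..v} (chosen_nodes v p). (cmod (T u k))\<^sup>2) * card (Sigma {..v} (chosen_nodes v p))"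
    using sum_squared_le_sum_of_squares[of "\<lambda>(u,k). cmod (T u k)" "Sigma {..v} (chosen_nodes v p)"]
    by (simp add: case_prod_unfold)
  also have "\<dots> \<le> (\<Sum>(u,k)\<in>Sigma {..v} (chosen_nodes v p). (cmod (T u k))\<^sup>2) * (4 * real (v + 1))"
    by (intro mult_left_mono card sum_nonneg) auto
  also have "(\<Sum>(u,k)\<in>Sigma {..v} (chosen_nodes v p). (cmod (T u k))\<^sup>2) = (\<Sum>u\<le>v. \<Sum>k\<in>chosen_nodes v p u. (cmod (T u k))\<^sup>2)"
    by (rule sum.Sigma[symmetric]) (use finK in auto)
  also have "\<dots> \<le> (\<Sum>u\<le>v. \<Sum>k\<in>chosen_nodes v p u. 4 ^ DIM('a) * (cmod (fourier (cv (plank_measure v u k) (GS v u k)) p))\<^sup>2)"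
    by (intro sum_mono Tb)
  also have "\<dots> \<le> (\<Sum>u\<le>v. \<Sum>k<2 ^ u. 4 ^ DIM('a) * (cmod (fourier (cv (plank_measure v u k) (GS v u k)) p))\<^sup>2)"
    by (intro sum_mono sum_mono2) (auto simp: chosen_nodes_def)
  finally show ?thesis by (simp add: sum_distrib_left mult_ac)
qed

text \<open>Plancherel on both sides of the pointwise bound. The result is an inequality of Kakeya
  type: the left side is the L2 norm of a sum over all directions, while each term on the right is
  an average over the box dual to a single plank.\<close>

theorem kakeya:
  assumes v: "v \<le> n"
  shows "X v \<le> 4 * real (v + 1) * 4 ^ DIM('a) *
    (\<Sum>u\<le>v. \<Sum>k<2 ^ u. \<integral>x. (cmod (cv (plank_measure v u k) (GS v u k) x))\<^sup>2 \<partial>lborel)"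
proof -
  have n: "nice (cv (plank_measure v u k) (GS v u k))" for u k
    by (rule borel_prob.nice_cv[OF plank_measure(1) nice_GS])
  have "X v = (\<integral>p. (cmod (fourier (GS v 0 0) p))\<^sup>2 \<partial>lborel)"
    unfolding X_eq by (rule plancherel[OF nice_GS])
  also have "\<dots> \<le> (\<integral>p. 4 * real (v + 1) * 4 ^ DIM('a) *
    (\<Sum>u\<le>v. \<Sum>k<2 ^ u. (cmod (fourier (cv (plank_measure v u k) (GS v u k)) p))\<^sup>2) \<partial>lborel)"
    using nice_integrable_square(2)[OF nice_GS] nice_integrable_square(2)[OF n] fourier_GS_bound[OF v]
    by (intro integral_mono integrable_mult_right Bochner_Integration.integrable_sum) auto
  also have "\<dots> = 4 * real (v + 1) * 4 ^ DIM('a) *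
    (\<Sum>u\<le>v. \<Sum>k<2 ^ u. \<integral>p. (cmod (fourier (cv (plank_measure v u k) (GS v u k)) p))\<^sup>2 \<partial>lborel)"
    using nice_integrable_square(2)[OF n] by (simp add: Bochner_Integration.integral_sum)
  finally show ?thesis by (simp add: plancherel[OF n])
qed

end

section \<open>Refining the sectors\<close>

lemma sum_squares_le_square_sum:
  fixes a :: "'i \<Rightarrow> real"
  assumes "finite I" "\<And>i. i \<in> I \<Longrightarrow> 0 \<le> a i"
  shows "(\<Sum>i\<in>I. (a i)\<^sup>2) \<le> (\<Sum>i\<in>I. a i)\<^sup>2"
  using assms
proof (induction I rule: finite_induct)
  case (insert i I)
  then have "0 \<le> a i * sum a I" by (intro mult_nonneg_nonneg sum_nonneg) auto
  with insert show ?case by (simp add: power2_sum)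
qed simp

lemma almost_orthogonal:
  fixes f :: "'i \<Rightarrow> 'a::euclidean_space \<Rightarrow> complex"
  assumes I: "finite I" and f: "\<And>i. i \<in> I \<Longrightarrow> nice (f i)"
    and N: "\<And>\<xi>. real (card {i\<in>I. fourier (f i) \<xi> \<noteq> 0}) \<le> N"
  shows "(\<integral>x. (cmod (\<Sum>i\<in>I. f i x))\<^sup>2 \<partial>lborel) \<le> N * (\<Sum>i\<in>I. \<integral>x. (cmod (f i x))\<^sup>2 \<partial>lborel)"
proof -
  have n: "nice (\<lambda>x. \<Sum>i\<in>I. f i x)" by (intro nice_sum f)
  have pt: "(cmod (fourier (\<lambda>x. \<Sum>i\<in>I. f i x) \<xi>))\<^sup>2 \<le> N * (\<Sum>i\<in>I. (cmod (fourier (f i) \<xi>))\<^sup>2)" for \<xi>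
  proof -
    let ?A = "{i\<in>I. fourier (f i) \<xi> \<noteq> 0}"
    have "fourier (\<lambda>x. \<Sum>i\<in>I. f i x) \<xi> = (\<Sum>i\<in>I. fourier (f i) \<xi>)"
      by (rule fourier_sum) (intro nice_integrable f)
    also have "\<dots> = (\<Sum>i\<in>?A. fourier (f i) \<xi>)"
      by (rule sum.mono_neutral_right) (use I in auto)
    finally have "(cmod (fourier (\<lambda>x. \<Sum>i\<in>I. f i x) \<xi>))\<^sup>2 \<le> (\<Sum>i\<in>?A. cmod (fourier (f i) \<xi>))\<^sup>2"
      by (simp add: norm_sum power_mono)
    also have "\<dots> \<le> (\<Sum>i\<in>?A. (cmod (fourier (f i) \<xi>))\<^sup>2) * real (card ?A)"
      by (rule sum_squared_le_sum_of_squares)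
    also have "\<dots> \<le> (\<Sum>i\<in>I. (cmod (fourier (f i) \<xi>))\<^sup>2) * N"
      by (intro mult_mono sum_mono2 N sum_nonneg I) auto
    finally show ?thesis by (simp add: mult.commute)
  qed
  have "(\<integral>x. (cmod (\<Sum>i\<in>I. f i x))\<^sup>2 \<partial>lborel) = (\<integral>\<xi>. (cmod (fourier (\<lambda>x. \<Sum>i\<in>I. f i x) \<xi>))\<^sup>2 \<partial>lborel)"
    by (rule plancherel[OF n])
  also have "\<dots> \<le> (\<integral>\<xi>. N * (\<Sum>i\<in>I. (cmod (fourier (f i) \<xi>))\<^sup>2) \<partial>lborel)"
  proof (rule integral_mono)
    show "integrable lborel (\<lambda>\<xi>. (cmod (fourier (\<lambda>x. \<Sum>i\<in>I. f i x) \<xi>))\<^sup>2)"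
      by (rule nice_integrable_square(2)[OF n])
    show "integrable lborel (\<lambda>\<xi>. N * (\<Sum>i\<in>I. (cmod (fourier (f i) \<xi>))\<^sup>2))"
      by (intro integrable_mult_right Bochner_Integration.integrable_sum nice_integrable_square(2) f)
  qed (rule pt)
  also have "\<dots> = N * (\<Sum>i\<in>I. \<integral>\<xi>. (cmod (fourier (f i) \<xi>))\<^sup>2 \<partial>lborel)"
    using f by (simp add: Bochner_Integration.integral_sum nice_integrable_square(2))
  also have "\<dots> = N * (\<Sum>i\<in>I. \<integral>x. (cmod (f i x))\<^sup>2 \<partial>lborel)"
    using f by (simp add: plancherel)
  finally show ?thesis .
qed

lemma near_subset:
  assumes "L \<ge> 0"
  shows "{k'. \<bar>real k' - real k\<bar> \<le> L} \<subseteq> {k - nat \<lfloor>L\<rfloor>..k + nat \<lfloor>L\<rfloor>}"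
proof
  fix k' assume "k' \<in> {k'. \<bar>real k' - real k\<bar> \<le> L}"
  then have "of_int \<bar>int k' - int k\<bar> \<le> L" by simp
  then have "\<bar>int k' - int k\<bar> \<le> \<lfloor>L\<rfloor>" by (simp only: le_floor_iff)
  then show "k' \<in> {k - nat \<lfloor>L\<rfloor>..k + nat \<lfloor>L\<rfloor>}" by auto
qed

lemma card_near:
  assumes "L \<ge> 0"
  shows "finite {k'. \<bar>real k' - real k\<bar> \<le> L}" "real (card {k'. \<bar>real k' - real k\<bar> \<le> L}) \<le> 2 * L + 1"
proof -
  show "finite {k'. \<bar>real k' - real k\<bar> \<le> L}" by (rule finite_subset[OF near_subset[OF assms]]) simp
  have "card {k'. \<bar>real k' - real k\<bar> \<le> L} \<le> card {k - nat \<lfloor>L\<rfloor>..k + nat \<lfloor>L\<rfloor>}"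
    by (intro card_mono near_subset assms) simp
  also have "\<dots> \<le> 2 * nat \<lfloor>L\<rfloor> + 1" by simp
  finally have "real (card {k'. \<bar>real k' - real k\<bar> \<le> L}) \<le> 2 * real (nat \<lfloor>L\<rfloor>) + 1"
    by linarith
  also have "real (nat \<lfloor>L\<rfloor>) \<le> L" using assms by simp
  finally show "real (card {k'. \<bar>real k' - real k\<bar> \<le> L}) \<le> 2 * L + 1" by simp
qed

section \<open>Coarse nodes: orthogonality after averaging\<close>

context cone_family
begin

lemma GS_real: "GS v u k x = of_real (\<Sum>i\<in>kids u v k. (cmod (F v i x))\<^sup>2)"
  by (simp add: GS_def G_eq)

lemma integrable_GS2: "integrable lborel (\<lambda>x. (cmod (GS v u k x))\<^sup>2)"
  by (rule nice_integrable_square(1)[OF nice_GS])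

text \<open>The functions \<open>GS\<close> are nonnegative, so the squares over one level sum to at
  most the square of the total. In this way the sum over nodes on the right of \<open>kakeya\<close>
  is brought back to a single \<open>X\<close>.\<close>

lemma sum_GS_le_X:
  assumes "u \<le> w"
  shows "(\<Sum>k<2 ^ u. \<integral>x. (cmod (GS w u k x))\<^sup>2 \<partial>lborel) \<le> X w"
proof -
  have "(\<Sum>k<2 ^ u. \<integral>x. (cmod (GS w u k x))\<^sup>2 \<partial>lborel) = (\<integral>x. (\<Sum>k<2 ^ u. (cmod (GS w u k x))\<^sup>2) \<partial>lborel)"
    by (rule Bochner_Integration.integral_sum[symmetric]) (rule integrable_GS2)
  also have "\<dots> \<le> (\<integral>x. (cmod (GS w 0 0 x))\<^sup>2 \<partial>lborel)"
  proof (rule integral_mono)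
    show "integrable lborel (\<lambda>x. \<Sum>k<2 ^ u. (cmod (GS w u k x))\<^sup>2)"
      by (intro Bochner_Integration.integrable_sum integrable_GS2)
    show "integrable lborel (\<lambda>x. (cmod (GS w 0 0 x))\<^sup>2)" by (rule integrable_GS2)
    fix x
    have "(\<Sum>k<2 ^ u. (cmod (GS w u k x))\<^sup>2) = (\<Sum>k<2 ^ u. (\<Sum>i\<in>kids u w k. (cmod (F w i x))\<^sup>2)\<^sup>2)"
      unfolding GS_real norm_of_real by simp
    also have "\<dots> \<le> (\<Sum>k<2 ^ u. \<Sum>i\<in>kids u w k. (cmod (F w i x))\<^sup>2)\<^sup>2"
      by (rule sum_squares_le_square_sum) (auto intro: sum_nonneg)
    also have "\<dots> = (cmod (GS w 0 0 x))\<^sup>2"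
      unfolding sum_kids_all[OF assms] GS_root norm_of_real by simp
    finally show "(\<Sum>k<2 ^ u. (cmod (GS w u k x))\<^sup>2) \<le> (cmod (GS w 0 0 x))\<^sup>2" .
  qed
  also have "\<dots> = X w" by (rule X_eq[symmetric])
  finally show ?thesis .
qed

text \<open>The four terms on the right of the identity \<open>key\<close> below are at most
  \<open>2 * Kc\<close>, \<open>2 * C\<close>, \<open>2 * C\<close> and \<open>2 * Kc\<close> times
  the block length; division by the coordinate \<open>va\<close> costs the factor \<open>C\<close>
  in front.\<close>

definition L1 :: real where "L1 = C * (4 * Kc + 4 * C)"

lemma L1: "L1 \<ge> 0" using C1 Kc by (simp add: L1_def)

text \<open>The condition \<open>w + u \<le> 2 * v\<close> says that the frequencies kept by the
  average are transversally no larger, up to a constant, than the length \<open>1 / 2 ^ w\<close> of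
  a block. A difference of frequencies from two blocks has transversal size about the distance of
  the blocks, so distant blocks leave nothing after averaging.\<close>

lemma cross_term_vanishes:
  assumes w: "v \<le> w" "w \<le> n" "w + u \<le> 2 * v" and u: "u \<le> v"
    and a: "a \<in> kids u w k" and far: "\<bar>real a - real b\<bar> > L1"
  shows "cv (plank_measure v u k) (\<lambda>x. F w a x * cnj (F w b x)) x = 0"
proof -
  interpret borel_prob "plank_measure v u k" by (rule plank_measure)
  have nf: "nice (\<lambda>x. F w a x * cnj (F w b x))" by (intro nice_mult nice_cnj nice_F)
  show ?thesis
  proof (rule nice_eq_0I[OF nice_cv[OF nf]], rule ccontr)
    fix \<xi> assume "fourier (cv (plank_measure v u k) (\<lambda>x. F w a x * cnj (F w b x))) \<xi> \<noteq> 0"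
    then have 1: "fourier (\<lambda>x. F w a x * cnj (F w b x)) \<xi> \<noteq> 0" and 2: "chf (plank_measure v u k) \<xi> \<noteq> 0"
      by (auto simp: fourier_cv[OF nf])
    obtain p q where pq: "\<xi> = p - q" "fourier (F w a) p \<noteq> 0" "fourier (F w b) q \<noteq> 0"
      using fourier_mult_cnj_nonzeroD[OF nice_F nice_F 1] by blast
    note P = supp_F(2,3,4,5)[OF w(2) pq(2)]
    note Q = supp_F(2,3,4,5)[OF w(2) pq(3)]
    note X = plank_measure(2)[OF 2]
    define h where "h = (1::real) / 2 ^ w"
    have h: "h > 0" by (simp add: h_def)
    have uw: "u \<le> w" using u w by simp
    have s: "0 \<le> dya w a - dya u k" "dya w a - dya u k \<le> 1 / 2 ^ u" using dya_kid[OF a uw] by auto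
    have pw: "(2::real) ^ w * 2 ^ u \<le> 4 ^ v"
    proof -
      have "(2::real) ^ (w + u) \<le> 2 ^ (2 * v)" by (intro power_increasing w) simp
      then show ?thesis by (simp add: power_add power_mult)
    qed
    have hv: "2 ^ u / 4 ^ v \<le> h" using pw unfolding h_def by (simp add: field_simps)
    have "1 / 2 ^ u * (2 * (Kc * 4 ^ u / 4 ^ v)) = 2 * Kc * (2 ^ u / 4 ^ v)"
    proof -
      have "(4::real) ^ u = 2 ^ u * 2 ^ u" by (simp flip: power_mult_distrib)
      then show ?thesis by simp
    qed
    also have "\<dots> \<le> 2 * Kc * h" using hv Kc by (intro mult_left_mono) auto
    finally have e1: "1 / 2 ^ u * (2 * (Kc * 4 ^ u / 4 ^ v)) \<le> 2 * Kc * h" .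
    have e2: "2 * (Kc * 2 ^ u / 4 ^ v) \<le> 2 * Kc * h" using hv Kc by (simp add: field_simps)
    have A: "\<bar>(dya w a - dya u k) * (\<xi> \<bullet> va)\<bar> \<le> 2 * Kc * h"
    proof -
      have "\<bar>(dya w a - dya u k) * (\<xi> \<bullet> va)\<bar> \<le> 1 / 2 ^ u * (2 * (Kc * 4 ^ u / 4 ^ v))"
        unfolding abs_mult using s X by (intro mult_mono) auto
      with e1 show ?thesis by linarith
    qed
    \<comment> \<open>All terms are expressed relative to the generator of block \<open>a\<close>,
      which isolates the distance of the two blocks. The last term multiplies the node length
      \<open>1 / 2 ^ u\<close> by the long side \<open>4 ^ u / 4 ^ v\<close> of the plank, and the
      product is again of size \<open>h\<close>.\<close>
    have key: "(dya w a - dya w b) * (q \<bullet> va) = lin (dya u k) \<xi> - lin (dya w a) p + lin (dya w b) q - (dya w a - dya u k) * (\<xi> \<bullet> va)"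
      unfolding pq(1) lin_def by (simp add: inner_simps algebra_simps)
    have hC: "2 * C / 2 ^ w = 2 * C * h" by (simp add: h_def)
    have "\<bar>(dya w a - dya w b) * (q \<bullet> va)\<bar> \<le> (4 * Kc + 4 * C) * h"
    proof -
      have "\<bar>lin (dya u k) \<xi>\<bar> \<le> 2 * Kc * h" using X e2 by linarith
      moreover have "(4 * Kc + 4 * C) * h = 2 * Kc * h + 2 * Kc * h + 2 * C * h + 2 * C * h" by (simp add: algebra_simps)
      ultimately show ?thesis unfolding key using A P(3)[unfolded hC] Q(3)[unfolded hC] by linarith
    qed
    moreover have "\<bar>dya w a - dya w b\<bar> * (1 / C) \<le> \<bar>(dya w a - dya w b) * (q \<bullet> va)\<bar>"
      unfolding abs_mult using Q(1) by (intro mult_left_mono) auto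
    ultimately have "\<bar>dya w a - dya w b\<bar> * (1 / C) \<le> (4 * Kc + 4 * C) * h" by linarith
    then have "\<bar>dya w a - dya w b\<bar> \<le> L1 * h" using C1 by (simp add: L1_def field_simps)
    moreover have "dya w a - dya w b = (real a - real b) * h" by (simp add: dya_def h_def diff_divide_distrib)
    ultimately have "\<bar>real a - real b\<bar> * h \<le> L1 * h" using h by (simp add: abs_mult)
    with h far show False by simp
  qed
qed

lemma Re_cv_G_nonneg: "0 \<le> Re (cv (plank_measure v u k) (G w a) x)"
  using borel_prob.cmod_cv_square_le[OF plank_measure(1) nice_F, of v u k w a x] unfolding G_def[abs_def]
  by (meson order.trans zero_le_power2)

text \<open>The distant cross terms vanish as functions, not merely in the mean, so orthogonality
  holds at every point. The remaining ones are split by the inequality between arithmetic and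
  geometric mean, which survives averaging because the measure is positive; each block then occurs
  at most \<open>2 * L1 + 1\<close> times.\<close>

lemma local_orth_pointwise:
  assumes w: "v \<le> w" "w \<le> n" "w + u \<le> 2 * v" and u: "u \<le> v"
  shows "cmod (cv (plank_measure v u k) (GS v u k) x) \<le> (2 * L1 + 1) * cmod (cv (plank_measure v u k) (GS w u k) x)"
proof -
  interpret borel_prob "plank_measure v u k" by (rule plank_measure)
  define c where "c f = cv (plank_measure v u k) f x" for f
  define H where "H a = Re (c (G w a))" for a
  have H0: "H a \<ge> 0" for a unfolding H_def c_def by (rule Re_cv_G_nonneg)
  have one: "cmod (c (G v i)) \<le> (2 * L1 + 1) * (\<Sum>a\<in>kids v w i. H a)" if i: "i \<in> kids u v k" for i
  proof -
    let ?D = "kids v w i"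
    have Gexp: "G v i = (\<lambda>x. \<Sum>a\<in>?D. \<Sum>b\<in>?D. F w a x * cnj (F w b x))"
    proof
      fix x show "G v i x = (\<Sum>a\<in>?D. \<Sum>b\<in>?D. F w a x * cnj (F w b x))"
        unfolding G_def F_refine[OF w(1,2)] by (simp add: sum_product)
    qed
    have nab: "nice (\<lambda>x. F w a x * cnj (F w b x))" for a b by (intro nice_mult nice_cnj nice_F)
    have "c (G v i) = (\<Sum>a\<in>?D. \<Sum>b\<in>?D. c (\<lambda>x. F w a x * cnj (F w b x)))"
      unfolding Gexp c_def by (subst cv_sum, intro nice_sum nab, rule sum.cong, rule refl, rule cv_sum, rule nab)
    then have "cmod (c (G v i)) \<le> (\<Sum>a\<in>?D. \<Sum>b\<in>?D. cmod (c (\<lambda>x. F w a x * cnj (F w b x))))"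
      by (simp add: norm_sum order.trans[OF norm_sum] sum_mono)
    also have "\<dots> \<le> (\<Sum>a\<in>?D. \<Sum>b\<in>?D. if \<bar>real a - real b\<bar> \<le> L1 then (H a + H b) / 2 else 0)"
    proof (intro sum_mono)
      fix a b assume ab: "a \<in> ?D" "b \<in> ?D"
      have ak: "a \<in> kids u w k"
        using kids_trans[OF u w(1) i ab(1)] .
      show "cmod (c (\<lambda>x. F w a x * cnj (F w b x))) \<le> (if \<bar>real a - real b\<bar> \<le> L1 then (H a + H b) / 2 else 0)"
      proof (cases "\<bar>real a - real b\<bar> \<le> L1")
        case True
        then show ?thesis unfolding c_def H_def
          using cmod_cv_mult_le[OF nice_F nice_F, of w a w b x] by (simp add: G_def[abs_def])
      next
        case False
        then have "c (\<lambda>x. F w a x * cnj (F w b x)) = 0"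
          unfolding c_def by (intro cross_term_vanishes[OF w u ak]) simp
        then show ?thesis using False by simp
      qed
    qed
    also have "\<dots> = (\<Sum>a\<in>?D. \<Sum>b\<in>?D. if \<bar>real a - real b\<bar> \<le> L1 then H a / 2 else 0)
        + (\<Sum>a\<in>?D. \<Sum>b\<in>?D. if \<bar>real a - real b\<bar> \<le> L1 then H b / 2 else 0)"
      by (simp add: sum.distrib[symmetric] add_divide_distrib if_distrib cong: if_cong sum.cong)
    also have "(\<Sum>a\<in>?D. \<Sum>b\<in>?D. if \<bar>real a - real b\<bar> \<le> L1 then H b / 2 else 0)
       = (\<Sum>a\<in>?D. \<Sum>b\<in>?D. if \<bar>real a - real b\<bar> \<le> L1 then H a / 2 else 0)"
      by (subst sum.swap) (simp add: abs_minus_commute)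
    also have "(\<Sum>a\<in>?D. \<Sum>b\<in>?D. if \<bar>real a - real b\<bar> \<le> L1 then H a / 2 else 0) + (\<Sum>a\<in>?D. \<Sum>b\<in>?D. if \<bar>real a - real b\<bar> \<le> L1 then H a / 2 else 0)
       = (\<Sum>a\<in>?D. real (card {b\<in>?D. \<bar>real a - real b\<bar> \<le> L1}) * H a)"
      by (simp add: sum.distrib[symmetric] mult.commute flip: sum.inter_filter)
    also have "\<dots> \<le> (\<Sum>a\<in>?D. (2 * L1 + 1) * H a)"
    proof (intro sum_mono mult_right_mono H0)
      fix a
      have "card {b\<in>?D. \<bar>real a - real b\<bar> \<le> L1} \<le> card {b. \<bar>real b - real a\<bar> \<le> L1}"
        by (intro card_mono card_near L1) (auto simp: abs_minus_commute)
      with card_near(2)[OF L1, of a] show "real (card {b\<in>?D. \<bar>real a - real b\<bar> \<le> L1}) \<le> 2 * L1 + 1" by linarith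
    qed
    finally show ?thesis by (simp add: sum_distrib_left)
  qed
  have "c (GS v u k) = (\<Sum>i\<in>kids u v k. c (G v i))"
    unfolding c_def GS_def[abs_def] by (rule cv_sum) (rule nice_G)
  then have "cmod (c (GS v u k)) \<le> (\<Sum>i\<in>kids u v k. cmod (c (G v i)))" by (simp add: norm_sum)
  also have "\<dots> \<le> (\<Sum>i\<in>kids u v k. (2 * L1 + 1) * (\<Sum>a\<in>kids v w i. H a))" by (intro sum_mono one)
  also have "\<dots> = (2 * L1 + 1) * (\<Sum>a\<in>kids u w k. H a)"
    by (simp add: sum_kids[OF u w(1)] flip: sum_distrib_left)
  also have "(\<Sum>a\<in>kids u w k. H a) = Re (c (GS w u k))"
    unfolding c_def H_def GS_def[abs_def] by (subst cv_sum) (auto intro: nice_G)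
  also have "\<dots> \<le> cmod (c (GS w u k))" by (rule complex_Re_le_cmod)
  finally show ?thesis using L1 unfolding c_def by (simp add: mult_left_mono)
qed

lemma high_case:
  assumes w: "v \<le> w" "w \<le> n" "w + u \<le> 2 * v" and u: "u \<le> v"
  shows "(\<Sum>k<2 ^ u. \<integral>x. (cmod (cv (plank_measure v u k) (GS v u k) x))\<^sup>2 \<partial>lborel) \<le> (2 * L1 + 1)\<^sup>2 * X w"
proof -
  have *: "(\<integral>x. (cmod (cv (plank_measure v u k) (GS v u k) x))\<^sup>2 \<partial>lborel) \<le> (2 * L1 + 1)\<^sup>2 * (\<integral>x. (cmod (GS w u k x))\<^sup>2 \<partial>lborel)" for k
  proof -
    interpret borel_prob "plank_measure v u k" by (rule plank_measure)
    have "(\<integral>x. (cmod (cv (plank_measure v u k) (GS v u k) x))\<^sup>2 \<partial>lborel) \<le> (\<integral>x. (2 * L1 + 1)\<^sup>2 * (cmod (cv (plank_measure v u k) (GS w u k) x))\<^sup>2 \<partial>lborel)"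
    proof (rule integral_mono)
      show "integrable lborel (\<lambda>x. (cmod (cv (plank_measure v u k) (GS v u k) x))\<^sup>2)"
        by (rule nice_integrable_square(1)[OF nice_cv[OF nice_GS]])
      show "integrable lborel (\<lambda>x. (2 * L1 + 1)\<^sup>2 * (cmod (cv (plank_measure v u k) (GS w u k) x))\<^sup>2)"
        by (rule integrable_mult_right[OF nice_integrable_square(1)[OF nice_cv[OF nice_GS]]])
      show "(cmod (cv (plank_measure v u k) (GS v u k) x))\<^sup>2 \<le> (2 * L1 + 1)\<^sup>2 * (cmod (cv (plank_measure v u k) (GS w u k) x))\<^sup>2" for x
        using power_mono[OF local_orth_pointwise[OF w u], of k x 2] by (simp add: power_mult_distrib)
    qed
    also have "\<dots> = (2 * L1 + 1)\<^sup>2 * (\<integral>x. (cmod (cv (plank_measure v u k) (GS w u k) x))\<^sup>2 \<partial>lborel)"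
      by (rule integral_mult_right_zero)
    also have "\<dots> \<le> (2 * L1 + 1)\<^sup>2 * (\<integral>x. (cmod (GS w u k x))\<^sup>2 \<partial>lborel)"
      by (intro mult_left_mono cv_L2_le nice_GS) simp
    finally show ?thesis .
  qed
  have "(\<Sum>k<2 ^ u. \<integral>x. (cmod (cv (plank_measure v u k) (GS v u k) x))\<^sup>2 \<partial>lborel) \<le> (\<Sum>k<2 ^ u. (2 * L1 + 1)\<^sup>2 * (\<integral>x. (cmod (GS w u k x))\<^sup>2 \<partial>lborel))"
    by (rule sum_mono) (rule *)
  also have "\<dots> \<le> (2 * L1 + 1)\<^sup>2 * X w"
    unfolding sum_distrib_left[symmetric] using u w by (intro mult_left_mono sum_GS_le_X) auto
  finally show ?thesis .
qed

end

text \<open>Up to the error \<open>B h\<close>, two numbers are determined, up to their order, by their sum and the sum of their squares;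
  this is stated with the first number shifted to the origin.\<close>

lemma sum_and_square_sum_determine:
  fixes x y z B h :: real
  assumes h: "h > 0" and B: "B \<ge> 2" and e: "\<bar>x - y - z\<bar> \<le> B * h"
    and q: "\<bar>x\<^sup>2 - y\<^sup>2 - z\<^sup>2\<bar> \<le> 2 * B * h\<^sup>2 + B * h * (\<bar>x\<bar> + \<bar>y\<bar> + \<bar>z\<bar>)"
  shows "\<bar>y\<bar> \<le> 7 * B * h \<and> \<bar>x - z\<bar> \<le> 8 * B * h \<or> \<bar>z\<bar> \<le> 7 * B * h \<and> \<bar>x - y\<bar> \<le> 8 * B * h"
proof -
  define r where "r = B * h"
  have r: "r > 0" using h B by (simp add: r_def)
  define \<epsilon> where "\<epsilon> = x - y - z"
  have ee: "\<bar>\<epsilon>\<bar> \<le> r" using e by (simp add: \<epsilon>_def r_def)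
  have xb: "\<bar>x\<bar> \<le> \<bar>y\<bar> + \<bar>z\<bar> + r" using ee by (simp add: \<epsilon>_def)
  have rr: "2 * B * h\<^sup>2 \<le> r\<^sup>2"
  proof -
    have "B * (2 * h\<^sup>2) \<le> B * (B * h\<^sup>2)" using B by (intro mult_left_mono mult_right_mono) auto
    then show ?thesis by (simp add: r_def power2_eq_square mult_ac)
  qed
  \<comment> \<open>The sum and the sum of squares determine the product, up to terms with
    \<epsilon>. A small product forces the smaller factor to be small, and the relation for the sum
    then locates the other one.\<close>
  have yz: "2 * (y * z) = (x\<^sup>2 - y\<^sup>2 - z\<^sup>2) - 2 * (x * \<epsilon>) + \<epsilon>\<^sup>2"
    by (simp add: \<epsilon>_def power2_eq_square algebra_simps)
  have xe: "\<bar>x * \<epsilon>\<bar> \<le> (\<bar>y\<bar> + \<bar>z\<bar> + r) * r"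
    unfolding abs_mult using xb ee r by (intro mult_mono) auto
  have e2: "\<epsilon>\<^sup>2 \<le> r\<^sup>2" using ee r by (metis abs_le_square_iff abs_of_pos)
  have q': "\<bar>x\<^sup>2 - y\<^sup>2 - z\<^sup>2\<bar> \<le> r\<^sup>2 + r * (2 * \<bar>y\<bar> + 2 * \<bar>z\<bar> + r)"
  proof -
    have "r * (\<bar>x\<bar> + \<bar>y\<bar> + \<bar>z\<bar>) \<le> r * (2 * \<bar>y\<bar> + 2 * \<bar>z\<bar> + r)" using xb r by (intro mult_left_mono) auto
    then show ?thesis using q rr by (simp add: r_def)
  qed
  have "2 * \<bar>y * z\<bar> \<le> r\<^sup>2 + r * (2 * \<bar>y\<bar> + 2 * \<bar>z\<bar> + r) + 2 * ((\<bar>y\<bar> + \<bar>z\<bar> + r) * r) + r\<^sup>2"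
    using yz xe e2 q' zero_le_power2[of \<epsilon>] by linarith
  then have main: "2 * (\<bar>y\<bar> * \<bar>z\<bar>) \<le> 5 * r\<^sup>2 + 4 * r * (\<bar>y\<bar> + \<bar>z\<bar>)"
    by (simp add: abs_mult power2_eq_square algebra_simps)
  have small: "\<bar>a\<bar> \<le> 7 * r" if m: "2 * (\<bar>a\<bar> * \<bar>b\<bar>) \<le> 5 * r\<^sup>2 + 4 * r * (\<bar>a\<bar> + \<bar>b\<bar>)" and ab: "\<bar>a\<bar> \<le> \<bar>b\<bar>" for a b
  proof (cases "\<bar>b\<bar> \<le> r")
    case True then show ?thesis using ab r by linarith
  next
    case False
    then have b: "\<bar>b\<bar> > 0" using r by linarith
    have "5 * r\<^sup>2 \<le> 5 * r * \<bar>b\<bar>" using False r by (simp add: power2_eq_square)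
    moreover have "4 * r * (\<bar>a\<bar> + \<bar>b\<bar>) \<le> 4 * r * (2 * \<bar>b\<bar>)" using ab r by (intro mult_left_mono) auto
    ultimately have "(2 * \<bar>a\<bar>) * \<bar>b\<bar> \<le> (13 * r) * \<bar>b\<bar>" using m by (simp add: algebra_simps)
    then have "2 * \<bar>a\<bar> \<le> 13 * r" using b by (simp only: mult_le_cancel_right_pos)
    then show ?thesis using r by linarith
  qed
  show ?thesis
  proof (cases "\<bar>y\<bar> \<le> \<bar>z\<bar>")
    case True
    have "\<bar>y\<bar> \<le> 7 * r" by (rule small[OF main True])
    then show ?thesis using ee unfolding \<epsilon>_def r_def by linarith
  next
    case False
    have "\<bar>z\<bar> \<le> 7 * r" by (rule small[of z y]) (use main False in \<open>simp_all add: mult.commute add.commute\<close>)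
    then show ?thesis using ee unfolding \<epsilon>_def r_def by linarith
  qed
qed

section \<open>Fine nodes: the parabola inside a slice\<close>

locale narrow_cone_family = cone_family va vb vc N0 n g C
  for va vb vc :: "'a::euclidean_space" and N0 n g C +
  fixes a0 :: real and \<kappa> :: nat
  assumes narrow: "\<And>j p. j < 2 ^ n \<Longrightarrow> fourier (g j) p \<noteq> 0 \<Longrightarrow> \<bar>p \<bullet> va - a0\<bar> \<le> 1 / 16 ^ \<kappa>"
begin

lemma narrow_F:
  assumes "v \<le> n" "fourier (F v i) p \<noteq> 0"
  shows "\<bar>p \<bullet> va - a0\<bar> \<le> 1 / 16 ^ \<kappa>"
  using supp_F(1)[OF assms] narrow by (auto simp: kids_def)

text \<open>Where \<lambda> is nearly constant, the values of \<open>lin\<close> and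
  \<open>qd\<close> at \<open>p1 + p2\<close> determine the sum of the two parameters and the sum of
  their squares, hence the pair of blocks up to order: the classical L4 biorthogonality of the
  parabola. Replacing the coordinates \<open>va\<close> by one value \<open>a\<close> costs
  \<open>\<mu> * s\<close> in the linear and \<open>\<mu> * s\<^sup>2\<close> in the quadratic
  relation. Both errors are admissible because \<open>w \<le> u + 2 * \<kappa>\<close> gives
  \<open>s \<le> 4 ^ \<kappa> * h\<close>.\<close>

lemma sumset_overlap:
  assumes w: "w \<le> n" "w \<le> u + 2 * \<kappa>" and u: "u \<le> w"
    and k: "k1 \<in> kids u w k" "k2 \<in> kids u w k" "l1 \<in> kids u w k" "l2 \<in> kids u w k"
    and ne: "fourier (F w k1) p1 \<noteq> 0" "fourier (F w k2) p2 \<noteq> 0" "fourier (F w l1) q1 \<noteq> 0" "fourier (F w l2) q2 \<noteq> 0"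
    and eq: "p1 + p2 = q1 + q2"
  shows "\<bar>real l1 - real k1\<bar> \<le> 96 * C\<^sup>2 \<and> \<bar>real l2 - real k2\<bar> \<le> 96 * C\<^sup>2 \<or>
    \<bar>real l2 - real k1\<bar> \<le> 96 * C\<^sup>2 \<and> \<bar>real l1 - real k2\<bar> \<le> 96 * C\<^sup>2"
proof -
  define h where "h = (1::real) / 2 ^ w"
  define s where "s = (1::real) / 2 ^ u"
  define \<mu> where "\<mu> = (1::real) / 16 ^ \<kappa>"
  have h: "h > 0" and s: "s > 0" and hs: "h \<le> s" using u by (auto simp: h_def s_def intro!: divide_left_mono power_increasing)
  have mu: "\<mu> * s\<^sup>2 \<le> h\<^sup>2"
  proof -
    have "(2::real) ^ (2 * w) \<le> 2 ^ (2 * (u + 2 * \<kappa>))" using w by (intro power_increasing) auto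
    moreover have "2 * w = w * 2" "2 * (u + 2 * \<kappa>) = u * 2 + 4 * \<kappa>" by simp_all
    ultimately have "((2::real) ^ w)\<^sup>2 \<le> (2 ^ u)\<^sup>2 * (2 ^ 4) ^ \<kappa>"
      by (simp only: power_add power_mult)
    then have "((2::real) ^ w)\<^sup>2 \<le> (2 ^ u)\<^sup>2 * 16 ^ \<kappa>" by simp
    then show ?thesis by (simp add: h_def s_def \<mu>_def power_divide field_simps)
  qed
  have mu0: "\<mu> \<ge> 0" by (simp add: \<mu>_def)
  have mus: "\<mu> * s \<le> h"
  proof -
    have "(\<mu> * s) * s \<le> h * h" using mu by (simp add: power2_eq_square mult.assoc)
    also have "\<dots> \<le> h * s" using hs h by (intro mult_left_mono) auto
    finally show ?thesis using s by simp
  qed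
  \<comment> \<open>Parameters are measured from the block of \<open>p1\<close>. Then
    \<open>p1\<close> produces no shift terms, and three unknowns remain.\<close>
  define T where "T = dya w k1"
  have d: "\<bar>dya w a - dya w b\<bar> \<le> s" if "a \<in> kids u w k" "b \<in> kids u w k" for a b
    using dya_kid[OF that(1) u] dya_kid[OF that(2) u] by (auto simp: s_def abs_le_iff)
  define x where "x = dya w k2 - T"
  define y where "y = dya w l1 - T"
  define z where "z = dya w l2 - T"
  have xyz: "\<bar>x\<bar> \<le> s" "\<bar>y\<bar> \<le> s" "\<bar>z\<bar> \<le> s" using d k by (auto simp: x_def y_def z_def T_def)
  have C2: "C \<le> C\<^sup>2" using C1 by (simp add: power2_eq_square)
  have hC: "2 * C / 2 ^ w = 2 * C * h" "4 * C / 4 ^ w = 4 * C * h\<^sup>2"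
    by (simp_all add: h_def power_divide power2_eq_square flip: power_mult_distrib)
  note P1 = supp_F(2,3,4,5)[OF w(1) ne(1), unfolded hC]
  note P2 = supp_F(2,3,4,5)[OF w(1) ne(2), unfolded hC]
  note Q1 = supp_F(2,3,4,5)[OF w(1) ne(3), unfolded hC]
  note Q2 = supp_F(2,3,4,5)[OF w(1) ne(4), unfolded hC]
  define a where "a = p2 \<bullet> va"
  have adiff: "\<bar>a - q1 \<bullet> va\<bar> \<le> 2 * \<mu>" "\<bar>a - q2 \<bullet> va\<bar> \<le> 2 * \<mu>"
    using narrow_F[OF w(1) ne(2)] narrow_F[OF w(1) ne(3)] narrow_F[OF w(1) ne(4)]
    unfolding a_def \<mu>_def by (auto simp: abs_le_iff)
  have lT: "lin T p = lin (dya w i) p + (dya w i - T) * (p \<bullet> va)" for i p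
    using lin_shift[of T p "dya w i"] by (simp add: algebra_simps)
  have qT: "qd T p = qd (dya w i) p + 2 * ((dya w i - T) * lin (dya w i) p) + (dya w i - T)\<^sup>2 * (p \<bullet> va)" for i p
    using qd_shift[of T p "dya w i"] by (simp add: algebra_simps power2_eq_square)
  have Leq: "lin T p1 + lin T p2 = lin T q1 + lin T q2" "qd T p1 + qd T p2 = qd T q1 + qd T q2"
    using arg_cong[OF eq, of "lin T"] arg_cong[OF eq, of "qd T"] by (simp_all add: lin_linear qd_linear)
  have "(x - y - z) * a = lin (dya w l1) q1 + lin (dya w l2) q2 - lin (dya w k1) p1 - lin (dya w k2) p2 - y * (a - q1 \<bullet> va) - z * (a - q2 \<bullet> va)"
    using Leq(1) unfolding lT[of p2 k2] lT[of q1 l1] lT[of q2 l2] x_def[symmetric] y_def[symmetric] z_def[symmetric] a_def[symmetric]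
    unfolding T_def by (simp add: algebra_simps)
  moreover have "\<bar>y * (a - q1 \<bullet> va)\<bar> \<le> s * (2 * \<mu>)" "\<bar>z * (a - q2 \<bullet> va)\<bar> \<le> s * (2 * \<mu>)"
    unfolding abs_mult using xyz adiff s by (auto intro!: mult_mono)
  moreover have "s * (2 * \<mu>) \<le> 2 * h" using mus by (simp add: mult.commute)
  ultimately have "\<bar>(x - y - z) * a\<bar> \<le> 4 * (2 * C * h) + 4 * h"
    using P1(3) P2(3) Q1(3) Q2(3) by linarith
  moreover have "h \<le> C * h" using C1 h by simp
  ultimately have l1: "\<bar>(x - y - z) * a\<bar> \<le> 12 * (C * h)" by linarith
  have inva: "\<bar>r\<bar> \<le> C * D" if "\<bar>r * a\<bar> \<le> D" for r D
  proof -
    have "\<bar>r\<bar> * (1 / C) \<le> \<bar>r * a\<bar>" unfolding abs_mult using P2(1) by (intro mult_left_mono) (auto simp: a_def)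
    then have "\<bar>r\<bar> * (1 / C) \<le> D" using that by linarith
    then show ?thesis using C1 by (simp add: field_simps)
  qed
  \<comment> \<open>12 = 8 + 4: the four linear terms give \<open>4 * (2 * C * h)\<close> and the
    two slice errors \<open>2 * h\<close> each; dividing by \<open>a\<close> costs another
    \<open>C\<close>. The 96 of the claim is 8 * 12.\<close>
  define B where "B = 12 * C\<^sup>2"
  have "C\<^sup>2 \<ge> 1" using C1 by simp
  then have B2: "B \<ge> 2" by (simp add: B_def)
  have 1: "\<bar>x - y - z\<bar> \<le> B * h" using inva[OF l1] by (simp add: B_def power2_eq_square)
  have e0: "(x\<^sup>2 - y\<^sup>2 - z\<^sup>2) * a = qd (dya w l1) q1 + qd (dya w l2) q2 - qd (dya w k1) p1 - qd (dya w k2) p2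
     + 2 * (y * lin (dya w l1) q1) + 2 * (z * lin (dya w l2) q2) - 2 * (x * lin (dya w k2) p2) - y\<^sup>2 * (a - q1 \<bullet> va) - z\<^sup>2 * (a - q2 \<bullet> va)"
    using Leq(2) unfolding qT[of p2 k2] qT[of q1 l1] qT[of q2 l2] x_def[symmetric] y_def[symmetric] z_def[symmetric] a_def[symmetric]
    unfolding T_def by (simp add: algebra_simps)
  have sm: "s\<^sup>2 * (2 * \<mu>) \<le> 2 * h\<^sup>2" using mu by (simp add: mult.commute)
  have e1: "\<bar>y\<^sup>2 * (a - q1 \<bullet> va)\<bar> \<le> 2 * h\<^sup>2"
    by (rule order.trans[OF _ sm]) (use xyz adiff s in \<open>auto simp: abs_mult abs_le_square_iff[symmetric] intro!: mult_mono\<close>)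
  have e2: "\<bar>z\<^sup>2 * (a - q2 \<bullet> va)\<bar> \<le> 2 * h\<^sup>2"
    by (rule order.trans[OF _ sm]) (use xyz adiff s in \<open>auto simp: abs_mult abs_le_square_iff[symmetric] intro!: mult_mono\<close>)
  have e3: "\<bar>y * lin (dya w l1) q1\<bar> \<le> \<bar>y\<bar> * (2 * C * h)" "\<bar>z * lin (dya w l2) q2\<bar> \<le> \<bar>z\<bar> * (2 * C * h)"
    "\<bar>x * lin (dya w k2) p2\<bar> \<le> \<bar>x\<bar> * (2 * C * h)"
    unfolding abs_mult using P2(3) Q1(3) Q2(3) by (auto intro!: mult_left_mono)
  have tri: "\<bar>r1 + r2 - r3 - r4 + 2 * r5 + 2 * r6 - 2 * r7 - r8 - r9\<bar> \<le> 4 * E + 2 * D + 2 * U + 2 * V + 2 * W"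
    if "\<bar>r1\<bar> \<le> E" "\<bar>r2\<bar> \<le> E" "\<bar>r3\<bar> \<le> E" "\<bar>r4\<bar> \<le> E" "\<bar>r5\<bar> \<le> U" "\<bar>r6\<bar> \<le> V" "\<bar>r7\<bar> \<le> W" "\<bar>r8\<bar> \<le> D" "\<bar>r9\<bar> \<le> D"
    for r1 r2 r3 r4 r5 r6 r7 r8 r9 E D U V W :: real
  proof (rule abs_leI)
    note b = that[unfolded abs_le_iff]
    show "r1 + r2 - r3 - r4 + 2 * r5 + 2 * r6 - 2 * r7 - r8 - r9 \<le> 4 * E + 2 * D + 2 * U + 2 * V + 2 * W"
      using b by linarith
    show "- (r1 + r2 - r3 - r4 + 2 * r5 + 2 * r6 - 2 * r7 - r8 - r9) \<le> 4 * E + 2 * D + 2 * U + 2 * V + 2 * W"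
      using b by linarith
  qed
  have "\<bar>(x\<^sup>2 - y\<^sup>2 - z\<^sup>2) * a\<bar> \<le> 4 * (4 * C * h\<^sup>2) + 2 * (2 * h\<^sup>2) + 2 * (\<bar>y\<bar> * (2 * C * h)) + 2 * (\<bar>z\<bar> * (2 * C * h)) + 2 * (\<bar>x\<bar> * (2 * C * h))"
    unfolding e0 by (rule tri[OF Q1(4) Q2(4) P1(4) P2(4) e3 e1 e2])
  moreover have "h\<^sup>2 \<le> C * h\<^sup>2" using C1 h by simp
  ultimately have "\<bar>(x\<^sup>2 - y\<^sup>2 - z\<^sup>2) * a\<bar> \<le> 20 * C * h\<^sup>2 + 4 * C * h * (\<bar>x\<bar> + \<bar>y\<bar> + \<bar>z\<bar>)"
    by (simp add: algebra_simps)
  from inva[OF this] have "\<bar>x\<^sup>2 - y\<^sup>2 - z\<^sup>2\<bar> \<le> 20 * C\<^sup>2 * h\<^sup>2 + 4 * C\<^sup>2 * h * (\<bar>x\<bar> + \<bar>y\<bar> + \<bar>z\<bar>)"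
    by (simp add: algebra_simps power2_eq_square)
  also have "\<dots> \<le> 2 * B * h\<^sup>2 + B * h * (\<bar>x\<bar> + \<bar>y\<bar> + \<bar>z\<bar>)"
    unfolding B_def using h by (intro add_mono mult_right_mono) auto
  finally have 2: "\<bar>x\<^sup>2 - y\<^sup>2 - z\<^sup>2\<bar> \<le> 2 * B * h\<^sup>2 + B * h * (\<bar>x\<bar> + \<bar>y\<bar> + \<bar>z\<bar>)" .
  have idx: "\<bar>dya w i - dya w j\<bar> \<le> 8 * B * h \<longleftrightarrow> \<bar>real i - real j\<bar> \<le> 96 * C\<^sup>2" for i j
  proof -
    have "dya w i - dya w j = (real i - real j) * h" by (simp add: dya_def h_def diff_divide_distrib)
    then show ?thesis using h by (simp add: abs_mult B_def)
  qed
  have Bh: "7 * B * h \<le> 8 * B * h" using B2 h by simp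
  from sum_and_square_sum_determine[OF h B2 1 2] show ?thesis
  proof
    assume A: "\<bar>y\<bar> \<le> 7 * B * h \<and> \<bar>x - z\<bar> \<le> 8 * B * h"
    then have "\<bar>dya w l1 - dya w k1\<bar> \<le> 8 * B * h" "\<bar>dya w l2 - dya w k2\<bar> \<le> 8 * B * h"
      using Bh by (auto simp: y_def x_def z_def T_def abs_minus_commute)
    then show ?thesis unfolding idx by blast
  next
    assume A: "\<bar>z\<bar> \<le> 7 * B * h \<and> \<bar>x - y\<bar> \<le> 8 * B * h"
    then have "\<bar>dya w l2 - dya w k1\<bar> \<le> 8 * B * h" "\<bar>dya w l1 - dya w k2\<bar> \<le> 8 * B * h"
      using Bh by (auto simp: y_def x_def z_def T_def abs_minus_commute)
    then show ?thesis unfolding idx by blast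
  qed
qed

text \<open>The factor 2 counts the two orders of a pair; for each of its members at most
  \<open>2 * (96 * C\<^sup>2) + 1\<close> indices lie within the distance allowed by
  \<open>sumset_overlap\<close>.\<close>

definition N2 :: real where "N2 = 2 * (192 * C\<^sup>2 + 1)\<^sup>2"

lemma pair_orth:
  assumes w: "v \<le> w" "w \<le> n" "w \<le> u + 2 * \<kappa>" and u: "u \<le> v"
    and i: "i1 \<in> kids u v k" "i2 \<in> kids u v k"
  shows "(\<integral>x. (cmod (F v i1 x * F v i2 x))\<^sup>2 \<partial>lborel)
    \<le> N2 * (\<Sum>k1\<in>kids v w i1. \<Sum>k2\<in>kids v w i2. \<integral>x. (cmod (F w k1 x * F w k2 x))\<^sup>2 \<partial>lborel)"
proof -
  let ?I = "kids v w i1 \<times> kids v w i2"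
  have kk: "l \<in> kids u w k" if "l \<in> kids v w i1 \<or> l \<in> kids v w i2" for l
    using that kids_trans[OF u w(1) i(1)] kids_trans[OF u w(1) i(2)] by blast
  have uw: "u \<le> w" using u w by simp
  have C0: "0 \<le> 96 * C\<^sup>2" by simp
  have deg: "real (card {i\<in>?I. fourier (\<lambda>x. F w (fst i) x * F w (snd i) x) \<xi> \<noteq> 0}) \<le> N2" for \<xi>
  proof (cases "{i\<in>?I. fourier (\<lambda>x. F w (fst i) x * F w (snd i) x) \<xi> \<noteq> 0} = {}")
    case False
    then obtain k1 k2 where k12: "k1 \<in> kids v w i1" "k2 \<in> kids v w i2" "fourier (\<lambda>x. F w k1 x * F w k2 x) \<xi> \<noteq> 0"
      by auto
    obtain p1 p2 where p: "\<xi> = p1 + p2" "fourier (F w k1) p1 \<noteq> 0" "fourier (F w k2) p2 \<noteq> 0"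
      using fourier_mult_nonzeroD[OF nice_F nice_F k12(3)] by blast
    let ?S = "\<lambda>k. {k'. \<bar>real k' - real k\<bar> \<le> 96 * C\<^sup>2}"
    have sub: "{i\<in>?I. fourier (\<lambda>x. F w (fst i) x * F w (snd i) x) \<xi> \<noteq> 0} \<subseteq> ?S k1 \<times> ?S k2 \<union> ?S k2 \<times> ?S k1"
    proof
      fix ll assume ll: "ll \<in> {i\<in>?I. fourier (\<lambda>x. F w (fst i) x * F w (snd i) x) \<xi> \<noteq> 0}"
      obtain l1 l2 where lp: "ll = (l1, l2)" by (cases ll) auto
      have l: "l1 \<in> kids v w i1" "l2 \<in> kids v w i2" "fourier (\<lambda>x. F w l1 x * F w l2 x) \<xi> \<noteq> 0"
        using ll unfolding lp by auto
      obtain q1 q2 where q: "\<xi> = q1 + q2" "fourier (F w l1) q1 \<noteq> 0" "fourier (F w l2) q2 \<noteq> 0"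
        using fourier_mult_nonzeroD[OF nice_F nice_F l(3)] by blast
      have "k1 \<in> kids u w k" "k2 \<in> kids u w k" "l1 \<in> kids u w k" "l2 \<in> kids u w k"
        using kk k12 l by blast+
      from sumset_overlap[OF w(2,3) uw this p(2,3) q(2,3)] p(1) q(1)
      show "ll \<in> ?S k1 \<times> ?S k2 \<union> ?S k2 \<times> ?S k1" unfolding lp by auto
    qed
    have "card {i\<in>?I. fourier (\<lambda>x. F w (fst i) x * F w (snd i) x) \<xi> \<noteq> 0} \<le> card (?S k1 \<times> ?S k2 \<union> ?S k2 \<times> ?S k1)"
      by (intro card_mono sub finite_UnI finite_cartesian_product card_near(1) C0)
    also have "\<dots> \<le> card (?S k1 \<times> ?S k2) + card (?S k2 \<times> ?S k1)" by (rule card_Un_le)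
    also have "\<dots> = 2 * (card (?S k1) * card (?S k2))" by (simp add: card_cartesian_product)
    finally have "real (card {i\<in>?I. fourier (\<lambda>x. F w (fst i) x * F w (snd i) x) \<xi> \<noteq> 0}) \<le> real (2 * (card (?S k1) * card (?S k2)))"
      by (rule of_nat_mono)
    also have "\<dots> = 2 * (real (card (?S k1)) * real (card (?S k2)))"
      by (simp only: of_nat_mult of_nat_numeral)
    also have "\<dots> \<le> 2 * ((192 * C\<^sup>2 + 1) * (192 * C\<^sup>2 + 1))"
      using card_near(2)[OF C0, of k1] card_near(2)[OF C0, of k2] by (intro mult_left_mono mult_mono) auto
    finally show ?thesis by (simp add: N2_def power2_eq_square)
  next
    case True
    show ?thesis unfolding True by (simp add: N2_def)
  qed
  have "F v i1 x * F v i2 x = (\<Sum>i\<in>?I. F w (fst i) x * F w (snd i) x)" for x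
    unfolding F_refine[OF w(1,2)] by (simp add: sum_product sum.cartesian_product case_prod_unfold)
  then have "(\<integral>x. (cmod (F v i1 x * F v i2 x))\<^sup>2 \<partial>lborel) = (\<integral>x. (cmod (\<Sum>i\<in>?I. F w (fst i) x * F w (snd i) x))\<^sup>2 \<partial>lborel)"
    by simp
  also have "\<dots> \<le> N2 * (\<Sum>i\<in>?I. \<integral>x. (cmod (F w (fst i) x * F w (snd i) x))\<^sup>2 \<partial>lborel)"
    by (rule almost_orthogonal) (auto intro: nice_mult nice_F deg)
  finally show ?thesis by (simp add: sum.cartesian_product case_prod_unfold)
qed

lemma GS2_expand:
  "(\<integral>x. (cmod (GS v u k x))\<^sup>2 \<partial>lborel) = (\<Sum>i1\<in>kids u v k. \<Sum>i2\<in>kids u v k. \<integral>x. (cmod (F v i1 x * F v i2 x))\<^sup>2 \<partial>lborel)"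
proof -
  have "(cmod (GS v u k x))\<^sup>2 = (\<Sum>i1\<in>kids u v k. \<Sum>i2\<in>kids u v k. (cmod (F v i1 x * F v i2 x))\<^sup>2)" for x
    unfolding GS_real norm_of_real power2_abs
    by (simp add: power2_eq_square[of "sum _ _"] sum_product norm_mult power_mult_distrib)
  moreover have "integrable lborel (\<lambda>x. (cmod (F v i1 x * F v i2 x))\<^sup>2)" for i1 i2
    by (rule nice_integrable_square(1)) (intro nice_mult nice_F)
  ultimately show ?thesis by (simp add: Bochner_Integration.integral_sum Bochner_Integration.integrable_sum)
qed

text \<open>The average is discarded here, being a contraction of L2. Expanding the square of a sum
  of \<open>|F|\<^sup>2\<close> gives L2 norms of products of two blocks, which are the quantities
  that biorthogonality refines from level \<open>v\<close> to level \<open>w\<close>.\<close>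

lemma low_case:
  assumes w: "v \<le> w" "w \<le> n" "w \<le> u + 2 * \<kappa>" and u: "u \<le> v"
  shows "(\<Sum>k<2 ^ u. \<integral>x. (cmod (cv (plank_measure v u k) (GS v u k) x))\<^sup>2 \<partial>lborel) \<le> N2 * X w"
proof -
  let ?I = "\<lambda>k1 k2. \<integral>x. (cmod (F w k1 x * F w k2 x))\<^sup>2 \<partial>lborel"
  have *: "(\<integral>x. (cmod (cv (plank_measure v u k) (GS v u k) x))\<^sup>2 \<partial>lborel) \<le> N2 * (\<integral>x. (cmod (GS w u k x))\<^sup>2 \<partial>lborel)" for k
  proof -
    have "(\<integral>x. (cmod (cv (plank_measure v u k) (GS v u k) x))\<^sup>2 \<partial>lborel) \<le> (\<integral>x. (cmod (GS v u k x))\<^sup>2 \<partial>lborel)"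
      by (rule borel_prob.cv_L2_le[OF plank_measure(1) nice_GS])
    also have "\<dots> \<le> (\<Sum>i1\<in>kids u v k. \<Sum>i2\<in>kids u v k. N2 * (\<Sum>k1\<in>kids v w i1. \<Sum>k2\<in>kids v w i2. ?I k1 k2))"
      unfolding GS2_expand by (intro sum_mono pair_orth[OF w u])
    also have "\<dots> = N2 * (\<Sum>i1\<in>kids u v k. \<Sum>k1\<in>kids v w i1. \<Sum>i2\<in>kids u v k. \<Sum>k2\<in>kids v w i2. ?I k1 k2)"
      by (simp add: sum_distrib_left[symmetric]) (intro disjI2 sum.cong refl sum.swap)
    also have "\<dots> = N2 * (\<integral>x. (cmod (GS w u k x))\<^sup>2 \<partial>lborel)"
      unfolding GS2_expand sum_kids[OF u w(1)] ..
    finally show ?thesis .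
  qed
  have "(\<Sum>k<2 ^ u. \<integral>x. (cmod (cv (plank_measure v u k) (GS v u k) x))\<^sup>2 \<partial>lborel) \<le> (\<Sum>k<2 ^ u. N2 * (\<integral>x. (cmod (GS w u k x))\<^sup>2 \<partial>lborel))"
    by (rule sum_mono) (rule *)
  also have "\<dots> \<le> N2 * X w"
    unfolding sum_distrib_left[symmetric] using u w by (intro mult_left_mono sum_GS_le_X) (auto simp: N2_def)
  finally show ?thesis .
qed

definition Kstep :: real where "Kstep = 4 * 4 ^ DIM('a) * ((2 * L1 + 1)\<^sup>2 + N2)"

lemma X_nonneg: "X v \<ge> 0"
  unfolding X_def by simp

lemma Kstep: "Kstep \<ge> 0" by (simp add: Kstep_def N2_def)

text \<open>If the first condition \<open>v + \<kappa> + u \<le> 2 * v\<close> fails, then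
  \<open>u + \<kappa> > v\<close>, which gives \<open>v + \<kappa> \<le> u + 2 * \<kappa>\<close>;
  so each level \<open>u\<close> falls under one of the two cases. One factor \<open>n + 1\<close>
  is the overlap of the planks, the other comes from summing over \<open>u\<close>.\<close>

theorem square_function_step:
  assumes v: "v + \<kappa> \<le> n"
  shows "X v \<le> Kstep * (real n + 1)\<^sup>2 * X (v + \<kappa>)"
proof -
  let ?w = "v + \<kappa>"
  have vn: "v \<le> n" using v by simp
  have "(\<Sum>k<2 ^ u. \<integral>x. (cmod (cv (plank_measure v u k) (GS v u k) x))\<^sup>2 \<partial>lborel) \<le> ((2 * L1 + 1)\<^sup>2 + N2) * X ?w" if u: "u \<le> v" for u
  proof (cases "?w + u \<le> 2 * v")
    case True
    have "(\<Sum>k<2 ^ u. \<integral>x. (cmod (cv (plank_measure v u k) (GS v u k) x))\<^sup>2 \<partial>lborel) \<le> (2 * L1 + 1)\<^sup>2 * X ?w"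
      by (rule high_case) (use True u v in auto)
    also have "\<dots> \<le> ((2 * L1 + 1)\<^sup>2 + N2) * X ?w" by (intro mult_right_mono X_nonneg) (simp add: N2_def)
    finally show ?thesis .
  next
    case False
    have "(\<Sum>k<2 ^ u. \<integral>x. (cmod (cv (plank_measure v u k) (GS v u k) x))\<^sup>2 \<partial>lborel) \<le> N2 * X ?w"
      by (rule low_case) (use False u v in auto)
    also have "\<dots> \<le> ((2 * L1 + 1)\<^sup>2 + N2) * X ?w" by (intro mult_right_mono X_nonneg) simp
    finally show ?thesis .
  qed
  then have "(\<Sum>u\<le>v. \<Sum>k<2 ^ u. \<integral>x. (cmod (cv (plank_measure v u k) (GS v u k) x))\<^sup>2 \<partial>lborel) \<le> (\<Sum>u\<le>v. ((2 * L1 + 1)\<^sup>2 + N2) * X ?w)"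
    by (intro sum_mono) auto
  also have "\<dots> = (real v + 1) * (((2 * L1 + 1)\<^sup>2 + N2) * X ?w)" by simp
  finally have s: "(\<Sum>u\<le>v. \<Sum>k<2 ^ u. \<integral>x. (cmod (cv (plank_measure v u k) (GS v u k) x))\<^sup>2 \<partial>lborel) \<le> (real v + 1) * (((2 * L1 + 1)\<^sup>2 + N2) * X ?w)" .
  have "X v \<le> 4 * real (v + 1) * 4 ^ DIM('a) * ((real v + 1) * (((2 * L1 + 1)\<^sup>2 + N2) * X ?w))"
    by (rule order.trans[OF kakeya[OF vn]]) (intro mult_left_mono s, simp)
  also have "\<dots> = (real v + 1)\<^sup>2 * (Kstep * X ?w)" by (simp add: Kstep_def power2_eq_square)
  also have "\<dots> \<le> (real n + 1)\<^sup>2 * (Kstep * X ?w)"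
    using vn by (intro mult_right_mono power_mono mult_nonneg_nonneg Kstep X_nonneg) auto
  finally show ?thesis by (simp add: mult_ac)
qed

corollary X_iterate:
  assumes "m * \<kappa> \<le> n"
  shows "X 0 \<le> (Kstep * (real n + 1)\<^sup>2) ^ m * X (m * \<kappa>)"
  using assms
proof (induction m)
  case (Suc m)
  then have "X 0 \<le> (Kstep * (real n + 1)\<^sup>2) ^ m * X (m * \<kappa>)" by simp
  also have "\<dots> \<le> (Kstep * (real n + 1)\<^sup>2) ^ m * (Kstep * (real n + 1)\<^sup>2 * X (m * \<kappa> + \<kappa>))"
    using Suc.prems Kstep by (intro mult_left_mono square_function_step zero_le_power mult_nonneg_nonneg) auto
  finally show ?case by (simp add: mult_ac add.commute)
qed simp

end

section \<open>Cutting the cone into slices\<close>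

lemma nice_eqI:
  assumes "nice f" "nice g" "\<And>\<xi>. fourier f \<xi> = fourier g \<xi>"
  shows "f x = g x"
  unfolding nice_inversion[OF assms(1), of x] nice_inversion[OF assms(2), of x] assms(3) ..

lemma sum_power4_le:
  fixes z :: "'i \<Rightarrow> complex"
  assumes "finite I"
  shows "(cmod (\<Sum>i\<in>I. z i)) ^ 4 \<le> real (card I) ^ 3 * (\<Sum>i\<in>I. (cmod (z i)) ^ 4)"
proof -
  have "(cmod (\<Sum>i\<in>I. z i))\<^sup>2 \<le> (\<Sum>i\<in>I. cmod (z i))\<^sup>2" by (intro power_mono norm_sum) simp
  also have "\<dots> \<le> (\<Sum>i\<in>I. (cmod (z i))\<^sup>2) * real (card I)" by (rule sum_squared_le_sum_of_squares)
  finally have "((cmod (\<Sum>i\<in>I. z i))\<^sup>2)\<^sup>2 \<le> ((\<Sum>i\<in>I. (cmod (z i))\<^sup>2) * real (card I))\<^sup>2"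
    by (intro power_mono) auto
  also have "\<dots> = (\<Sum>i\<in>I. (cmod (z i))\<^sup>2)\<^sup>2 * (real (card I))\<^sup>2" by (rule power_mult_distrib)
  also have "\<dots> \<le> ((\<Sum>i\<in>I. ((cmod (z i))\<^sup>2)\<^sup>2) * real (card I)) * (real (card I))\<^sup>2"
    by (intro mult_right_mono sum_squared_le_sum_of_squares) simp
  finally show ?thesis by (simp add: power4_eq_xxxx power3_eq_cube power2_eq_square mult_ac)
qed

text \<open>In the variable \<open>r = a / \<mu>\<close> these are the hat functions at the
  integers: only the two integers around \<open>r\<close> contribute, with weights adding up to 1.
  The extra 1 in the bound for \<open>N\<close> keeps the upper of the two in the range.\<close>

lemma tent_partition:
  fixes a \<mu> :: real
  assumes mu: "\<mu> > 0" and a: "0 \<le> a" "a \<le> C" and N: "C / \<mu> + 1 \<le> real N"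
  shows "(\<Sum>i\<le>N. max 0 (1 - \<bar>a - real i * \<mu>\<bar> / \<mu>)) = 1"
proof -
  define r where "r = a / \<mu>"
  define k where "k = nat \<lfloor>r\<rfloor>"
  have r0: "r \<ge> 0" using mu a by (simp add: r_def)
  have k: "real k \<le> r" "r < real k + 1" using r0 by (auto simp: k_def)
  have "r \<le> C / \<mu>" using mu a by (simp add: r_def divide_right_mono)
  then have kN: "Suc k \<le> N" using k N by linarith
  have t: "max 0 (1 - \<bar>a - real i * \<mu>\<bar> / \<mu>) = max 0 (1 - \<bar>r - real i\<bar>)" for i
  proof -
    have "\<bar>a - real i * \<mu>\<bar> / \<mu> = \<bar>(a - real i * \<mu>) / \<mu>\<bar>" using mu by simp
    also have "(a - real i * \<mu>) / \<mu> = r - real i" using mu by (simp add: r_def diff_divide_distrib)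
    finally show ?thesis by simp
  qed
  have "(\<Sum>i\<le>N. max 0 (1 - \<bar>a - real i * \<mu>\<bar> / \<mu>)) = (\<Sum>i\<in>{k, Suc k}. max 0 (1 - \<bar>r - real i\<bar>))"
    unfolding t
  proof (rule sum.mono_neutral_right)
    show "\<forall>i\<in>{..N} - {k, Suc k}. max 0 (1 - \<bar>r - real i\<bar>) = 0"
    proof
      fix i assume "i \<in> {..N} - {k, Suc k}"
      then have "real i + 1 \<le> real k \<or> real k + 2 \<le> real i" by auto
      then show "max 0 (1 - \<bar>r - real i\<bar>) = 0" using k by auto
    qed
  qed (use kN in auto)
  also have "\<dots> = 1" using k by auto
  finally show ?thesis .
qed

text \<open>\<open>Kstep\<close> written out outside the locale: it depends on the dimension and
  \<open>C\<close> only, hence is the same for all slices and all scales.\<close>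

definition kstep :: "nat \<Rightarrow> real \<Rightarrow> real" where
  "kstep d C = 4 * 4 ^ d * ((2 * (C * (4 * (264 * C) + 4 * C)) + 1)\<^sup>2 + 2 * (192 * C\<^sup>2 + 1)\<^sup>2)"

lemma (in narrow_cone_family) Kstep_eq: "Kstep = kstep DIM('a) C"
  by (simp add: Kstep_def kstep_def L1_def Kc_def N2_def)

context cone_family
begin

lemma F_n: "j < 2 ^ n \<Longrightarrow> F n j x = g j x"
proof -
  assume "j < 2 ^ n"
  then have "kids n n j = {j}" by (auto simp: kids_def)
  then show ?thesis by (simp add: F_def)
qed

lemma X_n: "X n = (\<integral>x. (\<Sum>j<2 ^ n. (cmod (g j x))\<^sup>2)\<^sup>2 \<partial>lborel)"
  unfolding X_def by (simp add: F_n)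

lemma F_0: "F 0 0 x = (\<Sum>j<2 ^ n. g j x)"
proof -
  have "kids 0 n 0 = {..<2 ^ n}" by (auto simp: kids_def)
  then show ?thesis by (simp add: F_def)
qed

lemma X_0: "X 0 = (\<integral>x. (cmod (\<Sum>j<2 ^ n. g j x)) ^ 4 \<partial>lborel)"
  unfolding X_def by (simp add: F_0 flip: power_mult)

text \<open>The slices are tents in the coordinate \<open>va\<close> and not sharp cutoffs, so that
  each is, up to modulation, an average against a probability measure. Then the slices add up to the
  original functions, and Jensen's inequality bounds the square function of one slice by that of the
  whole. The fourth power of the number of slices is the cube from Hoelder's inequality times one
  factor from adding equal bounds.\<close>

theorem square_function_estimate:
  assumes va: "va \<noteq> 0" and n: "n = m * \<kappa>"
  shows "(\<integral>x. (cmod (\<Sum>j<2 ^ n. g j x)) ^ 4 \<partial>lborel)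
    \<le> (C * 16 ^ \<kappa> + 3) ^ 4 * (kstep DIM('a) C * (real n + 1)\<^sup>2) ^ m * (\<integral>x. (\<Sum>j<2 ^ n. (cmod (g j x))\<^sup>2)\<^sup>2 \<partial>lborel)"
proof -
  define \<mu> where "\<mu> = (1::real) / 16 ^ \<kappa>"
  have mu: "\<mu> > 0" by (simp add: \<mu>_def)
  define N where "N = nat \<lceil>C / \<mu>\<rceil> + 1"
  have Cm: "C / \<mu> \<ge> 0" using C1 mu by simp
  have N: "C / \<mu> + 1 \<le> real N" "real (N + 1) \<le> C * 16 ^ \<kappa> + 3"
  proof -
    show "C / \<mu> + 1 \<le> real N" using Cm unfolding N_def by simp
    have "real (N + 1) = real_of_int \<lceil>C / \<mu>\<rceil> + 2" using Cm unfolding N_def by simp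
    also have "\<dots> \<le> C / \<mu> + 3" by linarith
    finally show "real (N + 1) \<le> C * 16 ^ \<kappa> + 3" by (simp add: \<mu>_def)
  qed
  obtain \<nu> where nu: "borel_prob \<nu>" "\<And>\<xi>. chf \<nu> \<xi> = of_real (max 0 (1 - \<bar>va \<bullet> \<xi>\<bar> / \<mu>))"
    using tent_measure_exists[OF mu, of va] by blast
  interpret borel_prob \<nu> by fact
  \<comment> \<open>A frequency whose coordinate \<open>va\<close> is the \<open>i\<close>-th
    center. Modulation by \<open>- P i\<close>, averaging and modulation back move the tent from 0
    to that center.\<close>
  define P where "P i = (real i * \<mu> / (va \<bullet> va)) *\<^sub>R va" for i :: nat
  have P: "va \<bullet> P i = real i * \<mu>" for i using va by (simp add: P_def)
  define e where "e i j x = cis (2 * pi * (x \<bullet> (- P i))) * g j x" for i j x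
  define H where "H i j x = cis (2 * pi * (x \<bullet> P i)) * cv \<nu> (e i j) x" for i j x
  have ne: "nice (e i j)" for i j unfolding e_def[abs_def] by (rule nice_modulate[OF nice_g])
  have nH: "nice (H i j)" for i j unfolding H_def[abs_def] by (intro nice_modulate nice_cv ne)
  have FH: "fourier (H i j) \<xi> = fourier (g j) \<xi> * of_real (max 0 (1 - \<bar>va \<bullet> \<xi> - real i * \<mu>\<bar> / \<mu>))" for i j \<xi>
    unfolding H_def[abs_def] fourier_modulate fourier_cv[OF ne] nu(2) inner_diff_right P
    unfolding e_def[abs_def] fourier_modulate by simp
  have Hsum: "g j x = (\<Sum>i\<le>N. H i j x)" if j: "j < 2 ^ n" for j x
  proof (rule nice_eqI[OF nice_g])
    show "nice (\<lambda>x. \<Sum>i\<le>N. H i j x)" by (intro nice_sum nH)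
    fix \<xi>
    have "fourier (\<lambda>x. \<Sum>i\<le>N. H i j x) \<xi> = (\<Sum>i\<le>N. fourier (H i j) \<xi>)"
      by (rule fourier_sum) (intro nice_integrable nH)
    also have "\<dots> = fourier (g j) \<xi> * of_real (\<Sum>i\<le>N. max 0 (1 - \<bar>va \<bullet> \<xi> - real i * \<mu>\<bar> / \<mu>))"
      unfolding FH by (simp add: sum_distrib_left)
    also have "\<dots> = fourier (g j) \<xi>"
    proof (cases "fourier (g j) \<xi> = 0")
      case False
      from supp_g[OF j this] have "1 / C \<le> va \<bullet> \<xi>" "va \<bullet> \<xi> \<le> C" by (auto simp: inner_commute)
      moreover have "0 \<le> 1 / C" using C1 by simp
      ultimately have "0 \<le> va \<bullet> \<xi>" "va \<bullet> \<xi> \<le> C" by linarith+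
      then have "(\<Sum>i\<le>N. max 0 (1 - \<bar>va \<bullet> \<xi> - real i * \<mu>\<bar> / \<mu>)) = 1"
        by (intro tent_partition[OF mu _ _ N(1)]) auto
      then show ?thesis by simp
    qed simp
    finally show "fourier (g j) \<xi> = fourier (\<lambda>x. \<Sum>i\<le>N. H i j x) \<xi>" ..
  qed
  have fam: "narrow_cone_family va vb vc N0 n (H i) C (real i * \<mu>) \<kappa>" for i
  proof unfold_locales
    fix j p assume j: "j < 2 ^ n" and p: "fourier (H i j) p \<noteq> 0"
    then have "fourier (g j) p \<noteq> 0" by (auto simp: FH)
    from supp_g[OF j this] show "1 / C \<le> p \<bullet> va \<and> p \<bullet> va \<le> C \<and> \<bar>lin (dya n j) p\<bar> \<le> C / 2 ^ n \<and> \<bar>qd (dya n j) p\<bar> \<le> C / 4 ^ n" .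
    have "max 0 (1 - \<bar>va \<bullet> p - real i * \<mu>\<bar> / \<mu>) \<noteq> 0" using p by (auto simp: FH)
    then have "0 < 1 - \<bar>va \<bullet> p - real i * \<mu>\<bar> / \<mu>" by (metis max.absorb1 not_le)
    then show "\<bar>p \<bullet> va - real i * \<mu>\<bar> \<le> 1 / 16 ^ \<kappa>" using mu by (simp add: \<mu>_def inner_commute field_simps)
  qed (use C1 nH in auto)
  \<comment> \<open>The same measure serves all \<open>j\<close>, so Jensen's inequality can be
    summed: the square function of the slice is at most the average of \<open>GS n 0 0\<close>, and
    averaging contracts L2.\<close>
  have Xi: "(\<integral>x. (\<Sum>j<2 ^ n. (cmod (H i j x))\<^sup>2)\<^sup>2 \<partial>lborel) \<le> X n" for i
  proof -
    interpret H: narrow_cone_family va vb vc N0 n "H i" C "real i * \<mu>" \<kappa> by (rule fam)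
    have gr: "e i j x * cnj (e i j x) = G n j x" if "j < 2 ^ n" for j x
      using that unfolding G_eq F_n[OF that] complex_norm_square[symmetric] by (simp add: e_def norm_mult)
    have sg: "(\<lambda>x. \<Sum>j<2 ^ n. e i j x * cnj (e i j x)) = GS n 0 0"
    proof
      fix x show "(\<Sum>j<2 ^ n. e i j x * cnj (e i j x)) = GS n 0 0 x"
        unfolding GS_def by (rule sum.cong) (auto simp: kids_def gr)
    qed
    have pt: "(\<Sum>j<2 ^ n. (cmod (H i j x))\<^sup>2) \<le> cmod (cv \<nu> (GS n 0 0) x)" for x
    proof -
      have "(\<Sum>j<2 ^ n. (cmod (H i j x))\<^sup>2) \<le> (\<Sum>j<2 ^ n. Re (cv \<nu> (\<lambda>x. e i j x * cnj (e i j x)) x))"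
        by (intro sum_mono) (simp add: H_def norm_mult cmod_cv_square_le[OF ne])
      also have "\<dots> = Re (cv \<nu> (GS n 0 0) x)"
        unfolding sg[symmetric] by (subst cv_sum, intro nice_mult nice_cnj(1) ne, simp)
      also have "\<dots> \<le> cmod (cv \<nu> (GS n 0 0) x)" by (rule complex_Re_le_cmod)
      finally show ?thesis .
    qed
    have "(\<integral>x. (\<Sum>j<2 ^ n. (cmod (H i j x))\<^sup>2)\<^sup>2 \<partial>lborel) = H.X n" by (rule H.X_n[symmetric])
    also have "\<dots> = (\<integral>x. (cmod (H.GS n 0 0 x))\<^sup>2 \<partial>lborel)" by (rule H.X_eq)
    also have "\<dots> \<le> (\<integral>x. (cmod (cv \<nu> (GS n 0 0) x))\<^sup>2 \<partial>lborel)"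
    proof (rule integral_mono)
      show "integrable lborel (\<lambda>x. (cmod (H.GS n 0 0 x))\<^sup>2)" by (rule H.integrable_GS2)
      show "integrable lborel (\<lambda>x. (cmod (cv \<nu> (GS n 0 0) x))\<^sup>2)"
        by (rule nice_integrable_square(1)[OF nice_cv[OF nice_GS]])
      fix x
      have "cmod (H.GS n 0 0 x) = (\<Sum>j<2 ^ n. (cmod (H i j x))\<^sup>2)"
        unfolding H.GS_root norm_of_real by (simp add: H.F_n sum_nonneg)
      with pt[of x] have "cmod (H.GS n 0 0 x) \<le> cmod (cv \<nu> (GS n 0 0) x)" by linarith
      then show "(cmod (H.GS n 0 0 x))\<^sup>2 \<le> (cmod (cv \<nu> (GS n 0 0) x))\<^sup>2" by (intro power_mono norm_ge_zero)
    qed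
    also have "\<dots> \<le> (\<integral>x. (cmod (GS n 0 0 x))\<^sup>2 \<partial>lborel)" by (rule cv_L2_le[OF nice_GS])
    also have "\<dots> = X n" by (rule X_eq[symmetric])
    finally show ?thesis .
  qed
  define A where "A = (kstep DIM('a) C * (real n + 1)\<^sup>2) ^ m"
  have A0: "A \<ge> 0" by (simp add: A_def kstep_def)
  have step: "(\<integral>x. (cmod (\<Sum>j<2 ^ n. H i j x)) ^ 4 \<partial>lborel) \<le> A * X n" for i
  proof -
    interpret H: narrow_cone_family va vb vc N0 n "H i" C "real i * \<mu>" \<kappa> by (rule fam)
    have "(\<integral>x. (cmod (\<Sum>j<2 ^ n. H i j x)) ^ 4 \<partial>lborel) = H.X 0" by (rule H.X_0[symmetric])
    also have "\<dots> \<le> A * H.X n" using H.X_iterate[of m] n unfolding A_def H.Kstep_eq by simp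
    also have "\<dots> \<le> A * X n" using Xi[of i] A0 unfolding H.X_n by (intro mult_left_mono) auto
    finally show ?thesis .
  qed
  have i4: "integrable lborel (\<lambda>x. (cmod (\<Sum>j<2 ^ n. H i j x)) ^ 4)" for i
  proof -
    interpret H: narrow_cone_family va vb vc N0 n "H i" C "real i * \<mu>" \<kappa> by (rule fam)
    have "integrable lborel (\<lambda>x. (cmod (H.GS 0 0 0 x))\<^sup>2)" by (rule H.integrable_GS2)
    then show ?thesis unfolding H.GS_root norm_of_real by (simp add: H.F_0 flip: power_mult)
  qed
  have g4: "integrable lborel (\<lambda>x. (cmod (\<Sum>j<2 ^ n. g j x)) ^ 4)"
    using integrable_GS2[of 0 0 0] unfolding GS_root norm_of_real by (simp add: F_0 flip: power_mult)
  have "(\<integral>x. (cmod (\<Sum>j<2 ^ n. g j x)) ^ 4 \<partial>lborel) \<le> (\<integral>x. real (N + 1) ^ 3 * (\<Sum>i\<le>N. (cmod (\<Sum>j<2 ^ n. H i j x)) ^ 4) \<partial>lborel)"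
  proof (rule integral_mono[OF g4])
    show "integrable lborel (\<lambda>x. real (N + 1) ^ 3 * (\<Sum>i\<le>N. (cmod (\<Sum>j<2 ^ n. H i j x)) ^ 4))"
      by (intro integrable_mult_right Bochner_Integration.integrable_sum i4)
    fix x
    have "(\<Sum>j<2 ^ n. g j x) = (\<Sum>i\<le>N. \<Sum>j<2 ^ n. H i j x)"
      by (subst sum.swap) (simp add: Hsum)
    then show "(cmod (\<Sum>j<2 ^ n. g j x)) ^ 4 \<le> real (N + 1) ^ 3 * (\<Sum>i\<le>N. (cmod (\<Sum>j<2 ^ n. H i j x)) ^ 4)"
      using sum_power4_le[of "{..N}" "\<lambda>i. \<Sum>j<2 ^ n. H i j x"] by simp
  qed
  also have "\<dots> = real (N + 1) ^ 3 * (\<Sum>i\<le>N. \<integral>x. (cmod (\<Sum>j<2 ^ n. H i j x)) ^ 4 \<partial>lborel)"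
    using i4 by (simp add: Bochner_Integration.integral_sum)
  also have "\<dots> \<le> real (N + 1) ^ 3 * (\<Sum>i\<le>N. A * X n)"
    by (intro mult_left_mono sum_mono step) simp
  also have "\<dots> = real (N + 1) ^ 4 * (A * X n)" by (simp add: power4_eq_xxxx power3_eq_cube mult_ac)
  also have "\<dots> \<le> (C * 16 ^ \<kappa> + 3) ^ 4 * (A * X n)"
    using N A0 X_def by (intro mult_right_mono power_mono mult_nonneg_nonneg) auto
  finally show ?thesis unfolding X_n A_def by (simp add: mult_ac)
qed

end

section \<open>Cutoff functions\<close>

text \<open>A function \<open>D 0\<close> is carried together with all its derivatives, so that
  differentiation is a shift of the index.\<close>

definition smooth_seq :: "(nat \<Rightarrow> real \<Rightarrow> real) \<Rightarrow> bool" where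
  "smooth_seq D \<longleftrightarrow> (\<forall>k t. (D k has_real_derivative D (Suc k) t) (at t))"

text \<open>The derivatives of \<open>exp (- 1 / (1 - t\<^sup>2))\<close> are \<open>p(t) y\<^sup>k exp (- y)\<close> with \<open>y = 1 / (1 - t\<^sup>2)\<close> and a polynomial \<open>p\<close>.\<close>

definition bumpf :: "real poly \<Rightarrow> nat \<Rightarrow> real \<Rightarrow> real" where
  "bumpf p k t = (if \<bar>t\<bar> < 1 then poly p t * (1 / (1 - t\<^sup>2)) ^ k * exp (- (1 / (1 - t\<^sup>2))) else 0)"

text \<open>With \<open>y = 1 / (1 - t\<^sup>2)\<close> the derivative of \<open>y\<close> is
  \<open>2 * t * y\<^sup>2\<close>. Differentiating \<open>p * y ^ k * exp (- y)\<close> and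
  extracting \<open>y ^ (k + 2) * exp (- y)\<close> leaves this polynomial;
  \<open>[:1, 0, -1:]\<close> stands for \<open>1 - t\<^sup>2\<close>.\<close>

definition bump_poly :: "real poly \<Rightarrow> nat \<Rightarrow> real poly" where
  "bump_poly p k = pderiv p * [:1, 0, -1:]\<^sup>2 + smult (2 * real k) ([:0, 1:] * p * [:1, 0, -1:]) - smult 2 ([:0, 1:] * p)"

lemma exp_dominates_power:
  shows "\<exists>M>0. \<forall>y>(0::real). y ^ n * exp (- y) \<le> M"
proof (cases "n = 0")
  case False
  have "\<forall>y>(0::real). y ^ n * exp (- y) \<le> real n ^ n"
  proof (intro allI impI)
    fix y :: real assume y: "y > 0"
    have "y / real n \<le> exp (y / real n)" using exp_ge_add_one_self[of "y / real n"] by linarith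
    then have "(y / real n) ^ n \<le> exp (y / real n) ^ n" using y by (intro power_mono) auto
    also have "\<dots> = exp y" using False by (simp flip: exp_of_nat_mult)
    finally have "y ^ n \<le> real n ^ n * exp y" using False by (simp add: power_divide field_simps)
    then show "y ^ n * exp (- y) \<le> real n ^ n" by (simp add: exp_minus field_simps)
  qed
  moreover have "real n ^ n > 0" using False by simp
  ultimately show ?thesis by blast
next
  case True
  then have "\<forall>y>0. y ^ n * exp (- y) \<le> (1::real)" by simp
  then show ?thesis using zero_less_one by blast
qed

text \<open>The exponential absorbs two more powers of \<open>y = 1 / (1 - s\<^sup>2)\<close> than
  are present, and \<open>1 / y\<close> is at most twice the distance to an endpoint. Vanishing to
  second order gives derivative 0 at 1 and -1, where the two branches of \<open>bumpf\<close>
  meet.\<close>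

lemma bumpf_quadratic_bound: "\<exists>M. \<forall>t s. \<bar>t\<bar> = 1 \<longrightarrow> \<bar>bumpf p k s\<bar> \<le> M * \<bar>s - t\<bar>\<^sup>2"
proof -
  have "bounded (poly p ` {-1..1})"
    by (intro compact_imp_bounded compact_continuous_image continuous_intros) auto
  then obtain P where "\<forall>x\<in>poly p ` {-1..1}. norm x \<le> P" by (auto simp: bounded_iff)
  then have P: "\<bar>poly p s\<bar> \<le> P" if "\<bar>s\<bar> < 1" for s using that by (auto simp: abs_less_iff)
  have P0: "P \<ge> 0" using P[of 0] by simp
  obtain M where M: "M > 0" "\<And>y. y > 0 \<Longrightarrow> y ^ (k + 2) * exp (- y) \<le> (M::real)"
    using exp_dominates_power[of "k + 2"] by auto
  have "\<bar>bumpf p k s\<bar> \<le> (P * M * 4) * \<bar>s - t\<bar>\<^sup>2" if t: "\<bar>t\<bar> = 1" for s t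
  proof (cases "\<bar>s\<bar> < 1")
    case True
    define y where "y = 1 / (1 - s\<^sup>2)"
    have s2: "s\<^sup>2 < 1" using True by (simp add: abs_square_less_1)
    then have y: "y > 0" by (simp add: y_def)
    have "1 / y = (1 - \<bar>s\<bar>) * (1 + \<bar>s\<bar>)" by (simp add: y_def power2_eq_square algebra_simps)
    also have "\<dots> \<le> \<bar>s - t\<bar> * 2" using t True by (intro mult_mono) auto
    finally have iy: "1 / y \<le> 2 * \<bar>s - t\<bar>" by simp
    have "y ^ k * exp (- y) = y ^ (k + 2) * exp (- y) * (1 / y)\<^sup>2" using y by (simp add: power_add power_divide power2_eq_square)
    also have "\<dots> \<le> M * (2 * \<bar>s - t\<bar>)\<^sup>2" using M y iy by (intro mult_mono power_mono) auto
    finally have 1: "y ^ k * exp (- y) \<le> M * (2 * \<bar>s - t\<bar>)\<^sup>2" .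
    have "\<bar>bumpf p k s\<bar> = \<bar>poly p s\<bar> * (y ^ k * exp (- y))" using True y by (simp add: bumpf_def y_def abs_mult)
    also have "\<dots> \<le> P * (M * (2 * \<bar>s - t\<bar>)\<^sup>2)" by (rule mult_mono[OF P[OF True] 1 P0]) (use y in auto)
    finally show ?thesis by (simp add: power_mult_distrib)
  next
    case False
    then show ?thesis using P0 M by (simp add: bumpf_def)
  qed
  then show ?thesis by blast
qed

lemma bumpf_deriv: "(bumpf p k has_real_derivative bumpf (bump_poly p k) (k + 2) t) (at t)"
proof -
  consider "\<bar>t\<bar> < 1" | "\<bar>t\<bar> > 1" | "\<bar>t\<bar> = 1" by linarith
  then show ?thesis
  proof cases
    case 1
    define W where "W = 1 - t\<^sup>2"
    have W: "W > 0" using 1 by (simp add: W_def abs_square_less_1)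
    have "((\<lambda>t. poly p t * (1 / (1 - t\<^sup>2)) ^ k * exp (- (1 / (1 - t\<^sup>2)))) has_real_derivative
       (poly (pderiv p) t * (1 / W) ^ k + poly p t * (real k * (1 / W) ^ (k - 1) * (2 * t / W\<^sup>2))) * exp (- (1 / W))
         + poly p t * (1 / W) ^ k * (exp (- (1 / W)) * (- (2 * t / W\<^sup>2)))) (at t)"
    proof -
      have dW: "((\<lambda>t. 1 / (1 - t\<^sup>2)) has_real_derivative 2 * t / W\<^sup>2) (at t)"
        using W unfolding W_def by (auto intro!: derivative_eq_intros simp: power2_eq_square)
      have dk: "((\<lambda>t. (1 / (1 - t\<^sup>2)) ^ k) has_real_derivative real k * (1 / W) ^ (k - 1) * (2 * t / W\<^sup>2)) (at t)"
        using DERIV_power[OF dW, of k] by (simp add: W_def mult_ac)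
      have de: "((\<lambda>t. exp (- (1 / (1 - t\<^sup>2)))) has_real_derivative exp (- (1 / W)) * (- (2 * t / W\<^sup>2))) (at t)"
        using DERIV_fun_exp[OF DERIV_minus[OF dW]] by (simp add: W_def)
      show ?thesis
        using DERIV_mult[OF DERIV_mult[OF poly_DERIV[of p t] dk] de] by (simp add: W_def algebra_simps)
    qed
    also have "(poly (pderiv p) t * (1 / W) ^ k + poly p t * (real k * (1 / W) ^ (k - 1) * (2 * t / W\<^sup>2))) * exp (- (1 / W))
         + poly p t * (1 / W) ^ k * (exp (- (1 / W)) * (- (2 * t / W\<^sup>2))) = bumpf (bump_poly p k) (k + 2) t"
    proof -
      have pb: "poly (bump_poly p k) t = poly (pderiv p) t * W\<^sup>2 + 2 * real k * t * poly p t * W - 2 * t * poly p t"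
        by (simp add: bump_poly_def W_def algebra_simps power2_eq_square)
      have kk: "real k * (1 / W) ^ (k - 1) = real k * (1 / W) ^ k * W" using W by (cases k) auto
      have z: "(1 / W) ^ (k + 2) = (1 / W) ^ k / W\<^sup>2" by (simp add: power_add power2_eq_square)
      have Wd: "W\<^sup>2 / W\<^sup>2 = 1" "W / W\<^sup>2 = 1 / W" using W unfolding power2_eq_square by auto
      have "bumpf (bump_poly p k) (k + 2) t = poly (bump_poly p k) t * ((1 / W) ^ k / W\<^sup>2) * exp (- (1 / W))"
        using 1 unfolding bumpf_def W_def[symmetric] z by simp
      also have "\<dots> = (poly (pderiv p) t * (1 / W) ^ k + poly p t * ((real k * (1 / W) ^ k * W) * (2 * t / W\<^sup>2))) * exp (- (1 / W))
         + poly p t * (1 / W) ^ k * (exp (- (1 / W)) * (- (2 * t / W\<^sup>2)))"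
      proof -
        have *: "poly (bump_poly p k) t * ((1 / W) ^ k / W\<^sup>2) = (poly (pderiv p) t * (1 / W) ^ k) * (W\<^sup>2 / W\<^sup>2)
          + poly p t * (real k * (1 / W) ^ k * W * (2 * t / W\<^sup>2)) - poly p t * (1 / W) ^ k * (2 * t / W\<^sup>2)"
          unfolding pb by (simp add: algebra_simps add_divide_distrib diff_divide_distrib)
        show ?thesis unfolding *[unfolded Wd(1)] by (simp add: algebra_simps)
      qed
      finally show ?thesis unfolding kk ..
    qed
    finally show ?thesis
    proof (rule has_field_derivative_transform_within_open)
      show "open {-1<..<1::real}" "t \<in> {-1<..<1}" using 1 by auto
    qed (auto simp: bumpf_def)
  next
    case 2
    have "((\<lambda>t. 0) has_real_derivative bumpf (bump_poly p k) (k + 2) t) (at t)"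
      using 2 by (simp add: bumpf_def)
    then show ?thesis
    proof (rule has_field_derivative_transform_within_open)
      show "open (- {-1..1::real})" "t \<in> - {-1..1}" using 2 by auto
    qed (auto simp: bumpf_def)
  next
    case 3
    obtain M where M: "\<And>s. \<bar>bumpf p k s\<bar> \<le> M * \<bar>s - t\<bar>\<^sup>2" using bumpf_quadratic_bound[of p k] 3 by blast
    have b0: "bumpf p k t = 0" "bumpf (bump_poly p k) (k + 2) t = 0" using 3 by (auto simp: bumpf_def)
    have "((\<lambda>s. (bumpf p k s - bumpf p k t) / (s - t)) \<longlongrightarrow> 0) (at t)"
    proof (rule Lim_null_comparison)
      show "\<forall>\<^sub>F s in at t. norm ((bumpf p k s - bumpf p k t) / (s - t)) \<le> M * \<bar>s - t\<bar>"
      proof (rule eventually_at_filter[THEN iffD2], intro always_eventually allI impI)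
        fix s assume "s \<noteq> t"
        then show "norm ((bumpf p k s - bumpf p k t) / (s - t)) \<le> M * \<bar>s - t\<bar>"
          using M[of s] by (simp add: b0 abs_divide divide_le_eq power2_eq_square mult.assoc)
      qed
      have "((\<lambda>s. M * \<bar>s - t\<bar>) \<longlongrightarrow> M * \<bar>t - t\<bar>) (at t)" by (intro tendsto_intros)
      then show "((\<lambda>s. M * \<bar>s - t\<bar>) \<longlongrightarrow> 0) (at t)" by simp
    qed
    then show ?thesis unfolding b0(2) has_field_derivative_iff .
  qed
qed

primrec bump_polys :: "nat \<Rightarrow> real poly" where
  "bump_polys 0 = 1"
| "bump_polys (Suc m) = bump_poly (bump_polys m) (2 * m)"

definition bmp :: "nat \<Rightarrow> real \<Rightarrow> real" where "bmp m = bumpf (bump_polys m) (2 * m)"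

lemma smooth_seq_bmp: "smooth_seq bmp"
  unfolding smooth_seq_def bmp_def using bumpf_deriv[of "bump_polys _" "2 * _"] by simp

lemma bmp_outside: "\<bar>t\<bar> \<ge> 1 \<Longrightarrow> bmp m t = 0"
  by (simp add: bmp_def bumpf_def)

lemma bmp_0: "bmp 0 t = (if \<bar>t\<bar> < 1 then exp (- (1 / (1 - t\<^sup>2))) else 0)" "bmp 0 t \<ge> 0"
  by (simp_all add: bmp_def bumpf_def)

lemma smooth_seq_cont: "smooth_seq D \<Longrightarrow> continuous_on S (D k)"
  unfolding smooth_seq_def by (meson DERIV_continuous_on has_field_derivative_at_within)

lemma smooth_seq_meas [measurable]: "smooth_seq D \<Longrightarrow> D k \<in> borel_measurable borel"
  by (intro borel_measurable_continuous_onI smooth_seq_cont)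

lemma compact_support_bounded:
  fixes f :: "real \<Rightarrow> real"
  assumes "continuous_on {-r..r} f" "\<And>t. \<bar>t\<bar> \<ge> r \<Longrightarrow> f t = 0"
  shows "\<exists>B\<ge>0. \<forall>t. \<bar>f t\<bar> \<le> B"
proof -
  have "bounded (f ` {-r..r})" by (intro compact_imp_bounded compact_continuous_image assms) simp
  then obtain B where "\<forall>x\<in>f ` {-r..r}. norm x \<le> B" by (auto simp: bounded_iff)
  then have B: "\<bar>f t\<bar> \<le> B" if "\<bar>t\<bar> \<le> r" for t using that by (simp add: abs_le_iff)
  have "\<bar>f t\<bar> \<le> max B 0" for t using B[of t] assms(2)[of t] by (cases "\<bar>t\<bar> \<le> r") auto
  then show ?thesis by (intro exI[of _ "max B 0"]) auto
qed

lemma compact_support_integrable: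
  fixes f :: "real \<Rightarrow> real"
  assumes c: "continuous_on UNIV f" and s: "\<And>t. \<bar>t\<bar> \<ge> r \<Longrightarrow> f t = 0"
  shows "integrable lborel f"
proof -
  obtain B where B: "\<And>t. \<bar>f t\<bar> \<le> B" using compact_support_bounded[OF continuous_on_subset[OF c] s, of r] by auto
  have [measurable]: "f \<in> borel_measurable borel" by (rule borel_measurable_continuous_onI[OF c])
  have i: "integrable lborel (\<lambda>t. B * indicator {-r..r} t)"
    by (intro integrable_mult_right integrable_real_indicator) (auto simp: emeasure_lborel_Icc_eq)
  show ?thesis
  proof (rule Bochner_Integration.integrable_bound[OF i])
    show "AE t in lborel. norm (f t) \<le> norm (B * indicator {-r..r} t)"
    proof (rule AE_I2)
      fix t show "norm (f t) \<le> norm (B * indicator {-r..r} t)"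
        using B[of t] s[of t] by (cases "\<bar>t\<bar> < r") (auto simp: indicator_def)
    qed
  qed simp
qed

section \<open>A rapidly decreasing function with compactly supported transform\<close>

definition bump_mass :: real where "bump_mass = (\<integral>t. bmp 0 t \<partial>lborel)"

definition bm :: "nat \<Rightarrow> real \<Rightarrow> real" where "bm k t = bmp k t / bump_mass"

lemma bmp_integrable: "integrable lborel (bmp k)"
  by (rule compact_support_integrable[OF smooth_seq_cont[OF smooth_seq_bmp], of 1]) (rule bmp_outside)

lemma bump_mass_pos: "bump_mass > 0"
proof -
  have "exp (- (4/3 :: real)) * 1 = (\<integral>t. exp (- (4/3)) * indicator {-1/2..1/2::real} t \<partial>lborel)"
    by (simp add: measure_def)
  also have "\<dots> \<le> bump_mass"
    unfolding bump_mass_def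
  proof (rule integral_mono)
    show "integrable lborel (\<lambda>t. exp (- (4/3)) * indicator {-1/2..1/2::real} t :: real)"
      by (intro integrable_mult_right integrable_real_indicator) (auto simp: emeasure_lborel_Icc_eq)
    fix t :: real
    show "exp (- (4/3)) * indicator {-1/2..1/2} t \<le> bmp 0 t"
    proof (cases "t \<in> {-1/2..1/2}")
      case True
      then have "\<bar>t\<bar> \<le> 1/2" by (auto simp: abs_le_iff)
      then have "t\<^sup>2 \<le> (1/2)\<^sup>2" using abs_le_square_iff[of t "1/2"] by simp
      then have "1 / (1 - t\<^sup>2) \<le> 4/3" by (simp add: divide_simps power2_eq_square)
      then show ?thesis using True \<open>\<bar>t\<bar> \<le> 1/2\<close> by (simp add: bmp_0(1))
    qed (simp add: bmp_0(2))
  qed (rule bmp_integrable)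
  finally show ?thesis by (smt (verit) exp_gt_zero)
qed

lemma smooth_seq_bm: "smooth_seq bm"
  using smooth_seq_bmp unfolding smooth_seq_def bm_def[abs_def] by (auto intro!: DERIV_cdivide)

lemma bm_props:
  "\<bar>t\<bar> \<ge> 1 \<Longrightarrow> bm k t = 0" "bm 0 t \<ge> 0" "(\<integral>t. bm 0 t \<partial>lborel) = 1" "integrable lborel (bm k)"
  "continuous_on S (bm k)"
  using bump_mass_pos bmp_integrable smooth_seq_cont[OF smooth_seq_bm]
  by (auto simp: bm_def[abs_def] bmp_outside bmp_0(2) bump_mass_def[symmetric])

lemma bm_meas [measurable]: "bm k \<in> borel_measurable borel"
  by (rule borel_measurable_continuous_onI[OF bm_props(5)])

definition psi1 :: "real \<Rightarrow> complex" where
  "psi1 t = (\<integral>r. cis (2 * pi * (r * t)) * of_real (bm 0 r) \<partial>lborel)"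

text \<open>Integration by parts over the interval from -1 to 1, with vanishing boundary terms.
  Iterated, it turns \<open>k\<close> derivatives of the bump into decay of order \<open>k\<close>
  of \<open>psi1\<close>.\<close>

lemma bm_transform_deriv:
  "(\<integral>r. cis (2 * pi * (r * t)) * of_real (bm (Suc k) r) \<partial>lborel)
    = - (2 * pi * \<i> * t) * (\<integral>r. cis (2 * pi * (r * t)) * of_real (bm k r) \<partial>lborel)"
proof -
  let ?c = "\<lambda>r. cis (2 * pi * (r * t))"
  have i: "integrable lborel (\<lambda>r. ?c r * of_real (bm j r))" for j
    using bm_props(4)[of j] by (intro integrable_cis_mult integrable_of_real) auto
  have d: "((\<lambda>r. ?c r * of_real (bm k r)) has_vector_derivative
     (?c r * of_real (bm (Suc k) r) + (2 * pi * \<i> * t) * (?c r * of_real (bm k r)))) (at r)" for r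
  proof -
    have 1: "((\<lambda>r. complex_of_real (bm k r)) has_vector_derivative of_real (bm (Suc k) r)) (at r)"
      using smooth_seq_bm unfolding smooth_seq_def
      by (intro has_vector_derivative_of_real) (simp add: has_real_derivative_iff_has_vector_derivative)
    have 2: "(?c has_vector_derivative (2 * pi * t) *\<^sub>R (\<i> * ?c r)) (at r)"
    proof -
      have a: "((\<lambda>r. 2 * pi * (r * t)) has_vector_derivative (2 * pi * t)) (at r)"
        unfolding has_real_derivative_iff_has_vector_derivative[symmetric] by (auto intro!: derivative_eq_intros)
      have b: "(cis has_vector_derivative \<i> * cis s) (at s)" for s
      proof -
        have "((\<lambda>s. exp (\<i> * complex_of_real s)) has_vector_derivative (exp (\<i> * complex_of_real s) * \<i>)) (at s)"
          by (intro has_vector_derivative_real_field derivative_eq_intros | simp)+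
        then show ?thesis by (simp add: cis_conv_exp[abs_def] mult.commute)
      qed
      show ?thesis using vector_diff_chain_at[OF a b] by (simp add: o_def)
    qed
    show ?thesis using has_vector_derivative_mult[OF 2 1] by (simp add: scaleR_conv_of_real algebra_simps)
  qed
  let ?f = "\<lambda>r. ?c r * of_real (bm (Suc k) r) + (2 * pi * \<i> * t) * (?c r * of_real (bm k r))"
  have "has_bochner_integral lborel (\<lambda>r. indicator {-1..1} r *\<^sub>R ?f r) (?c 1 * of_real (bm k 1) - ?c (-1) * of_real (bm k (-1)))"
  proof (rule has_bochner_integral_FTC_Icc)
    show "((\<lambda>r. ?c r * of_real (bm k r)) has_vector_derivative ?f r) (at r within {-1..1})" for r
      by (rule has_vector_derivative_at_within[OF d])
    show "continuous_on {-1..1} ?f"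
      by (intro continuous_intros continuous_on_compose2[OF _ bm_props(5)] bm_props(5) continuous_on_of_real) auto
  qed simp
  moreover have "(\<lambda>r. indicator {-1..1} r *\<^sub>R ?f r) = ?f"
  proof
    fix r show "indicator {-1..1} r *\<^sub>R ?f r = ?f r"
      using bm_props(1)[of r k] bm_props(1)[of r "Suc k"] by (cases "\<bar>r\<bar> \<le> 1") (auto simp: indicator_def abs_le_iff)
  qed
  ultimately have "(\<integral>r. ?f r \<partial>lborel) = 0" by (simp add: has_bochner_integral_integral_eq bm_props(1))
  then have "(\<integral>r. ?c r * of_real (bm (Suc k) r) \<partial>lborel) + (\<integral>r. (2 * pi * \<i> * t) * (?c r * of_real (bm k r)) \<partial>lborel) = 0"
    by (subst Bochner_Integration.integral_add[symmetric]) (auto intro!: i integrable_mult_right)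
  then show ?thesis unfolding integral_mult_right_zero by (simp add: add_eq_0_iff)
qed

lemma psi1_le: "cmod (psi1 t) \<le> 1"
proof -
  have "cmod (psi1 t) \<le> (\<integral>r. cmod (cis (2 * pi * (r * t)) * of_real (bm 0 r)) \<partial>lborel)"
    unfolding psi1_def by (rule integral_norm_bound)
  also have "\<dots> = 1" using bm_props(2,3) by (simp add: norm_mult)
  finally show ?thesis .
qed

lemma psi1_0: "psi1 0 = 1"
  using bm_props(3) by (simp add: psi1_def)

lemma psi1_power_bound: "\<exists>C. \<forall>t. \<bar>t\<bar> ^ k * cmod (psi1 t) \<le> C"
proof -
  have eq: "(\<integral>r. cis (2 * pi * (r * t)) * of_real (bm k r) \<partial>lborel) = (- (2 * pi * \<i> * t)) ^ k * psi1 t" for t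
  proof (induction k)
    case (Suc k)
    show ?case unfolding bm_transform_deriv Suc by (simp add: mult.assoc)
  qed (simp add: psi1_def)
  define C where "C = (\<integral>r. \<bar>bm k r\<bar> \<partial>lborel)"
  have "\<bar>t\<bar> ^ k * cmod (psi1 t) \<le> C" for t
  proof -
    have "\<bar>t\<bar> ^ k * cmod (psi1 t) \<le> (2 * pi * \<bar>t\<bar>) ^ k * cmod (psi1 t)"
    proof (intro mult_right_mono power_mono)
      have "1 * \<bar>t\<bar> \<le> (2 * pi) * \<bar>t\<bar>" using pi_gt3 by (intro mult_right_mono) auto
      then show "\<bar>t\<bar> \<le> 2 * pi * \<bar>t\<bar>" by simp
    qed auto
    also have "\<dots> = cmod (\<integral>r. cis (2 * pi * (r * t)) * of_real (bm k r) \<partial>lborel)"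
      unfolding eq by (simp add: norm_mult norm_power)
    also have "\<dots> \<le> (\<integral>r. cmod (cis (2 * pi * (r * t)) * of_real (bm k r)) \<partial>lborel)" by (rule integral_norm_bound)
    also have "\<dots> = C" by (simp add: C_def norm_mult)
    finally show ?thesis .
  qed
  then show ?thesis by blast
qed

lemma one_plus_power_le: "(1 + x) ^ N \<le> 2 ^ N * (1 + x ^ N)" if "x \<ge> (0::real)"
proof (cases "x \<le> 1")
  case True
  then have "(1 + x) ^ N \<le> 2 ^ N" using that by (intro power_mono) auto
  also have "\<dots> \<le> 2 ^ N * (1 + x ^ N)" using that by simp
  finally show ?thesis .
next
  case False
  then have "(1 + x) ^ N \<le> (2 * x) ^ N" by (intro power_mono) auto
  also have "\<dots> \<le> 2 ^ N * (1 + x ^ N)" using that by (simp add: power_mult_distrib)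
  finally show ?thesis .
qed

lemma psi1_decay: "\<exists>C\<ge>0. \<forall>t. (1 + \<bar>t\<bar>) ^ N * cmod (psi1 t) \<le> C"
proof -
  obtain C where C: "\<And>t. \<bar>t\<bar> ^ N * cmod (psi1 t) \<le> C" using psi1_power_bound by blast
  have C0: "C \<ge> 0" by (rule order.trans[OF _ C[of 1]]) simp
  have "(1 + \<bar>t\<bar>) ^ N * cmod (psi1 t) \<le> 2 ^ N * (1 + C)" for t
  proof -
    have "(1 + \<bar>t\<bar>) ^ N * cmod (psi1 t) \<le> 2 ^ N * (1 + \<bar>t\<bar> ^ N) * cmod (psi1 t)"
      by (intro mult_right_mono one_plus_power_le) auto
    also have "\<dots> = 2 ^ N * (cmod (psi1 t) + \<bar>t\<bar> ^ N * cmod (psi1 t))" by (simp add: algebra_simps)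
    also have "\<dots> \<le> 2 ^ N * (1 + C)" using psi1_le C by (intro mult_left_mono add_mono) auto
    finally show ?thesis .
  qed
  then show ?thesis using C0 by (intro exI[of _ "2 ^ N * (1 + C)"]) auto
qed

definition psi :: "'a::euclidean_space \<Rightarrow> complex" where
  "psi x = (\<Prod>b\<in>Basis. psi1 (x \<bullet> b))"

text \<open>A bump of mass 1 and width \<epsilon> around \<xi>. Its transform is a character times
  \<open>psi (\<epsilon> *\<^sub>R x)\<close>, so testing the transform of a tempered
  \<open>f\<close> against it yields the transform at \<xi> of \<open>f\<close> multiplied by the
  cutoff.\<close>

definition freq_bump :: "real \<Rightarrow> 'a::euclidean_space \<Rightarrow> 'a \<Rightarrow> complex" where
  "freq_bump \<epsilon> \<xi> p = (\<Prod>b\<in>Basis. of_real (bm 0 ((\<xi> \<bullet> b - p \<bullet> b) / \<epsilon>) / \<epsilon>))"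

lemma psi_le: "cmod (psi x) \<le> 1"
  unfolding psi_def prod_norm[symmetric] by (intro prod_le_1) (auto intro: psi1_le)

lemma psi_0: "psi 0 = 1"
  by (simp add: psi_def psi1_0)

lemma psi_decay: "\<exists>C\<ge>0. \<forall>x::'a::euclidean_space. (1 + norm x) ^ N * cmod (psi x) \<le> C"
proof -
  obtain C where C: "C \<ge> 0" "\<And>t. (1 + \<bar>t\<bar>) ^ N * cmod (psi1 t) \<le> C" using psi1_decay by blast
  let ?d = "real DIM('a)"
  have "(1 + norm x) ^ N * cmod (psi x) \<le> ?d ^ N * C" for x :: 'a
  proof -
    define m where "m = Max ((\<lambda>b. \<bar>x \<bullet> b\<bar>) ` Basis)"
    have fin: "finite ((\<lambda>b. \<bar>x \<bullet> b\<bar>) ` Basis)" "(\<lambda>b. \<bar>x \<bullet> b\<bar>) ` (Basis::'a set) \<noteq> {}" by auto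
    obtain b where b: "b \<in> Basis" "m = \<bar>x \<bullet> b\<bar>" using Max_in[OF fin] unfolding m_def[symmetric] by blast
    have "norm x \<le> (\<Sum>b\<in>Basis. \<bar>x \<bullet> b\<bar>)" by (rule norm_le_l1)
    also have "\<dots> \<le> (\<Sum>b\<in>(Basis::'a set). m)" using fin by (intro sum_mono) (simp add: m_def)
    also have "\<dots> = ?d * m" by simp
    finally have n: "norm x \<le> ?d * m" .
    have d1: "1 \<le> ?d" using DIM_positive[where 'a='a] by linarith
    have "cmod (psi x) = cmod (psi1 (x \<bullet> b)) * (\<Prod>c\<in>Basis - {b}. cmod (psi1 (x \<bullet> c)))"
      unfolding psi_def prod_norm[symmetric] using b(1) by (simp add: prod.remove)
    also have "\<dots> \<le> cmod (psi1 (x \<bullet> b)) * 1"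
      by (intro mult_left_mono prod_le_1) (auto intro: psi1_le)
    finally have 1: "cmod (psi x) \<le> cmod (psi1 (x \<bullet> b))" by simp
    have "1 + norm x \<le> ?d * (1 + \<bar>x \<bullet> b\<bar>)" using n d1 unfolding b(2) distrib_left by linarith
    then have "(1 + norm x) ^ N \<le> (?d * (1 + \<bar>x \<bullet> b\<bar>)) ^ N" by (intro power_mono) auto
    then have "(1 + norm x) ^ N * cmod (psi x) \<le> (?d * (1 + \<bar>x \<bullet> b\<bar>)) ^ N * cmod (psi1 (x \<bullet> b))"
      using 1 by (intro mult_mono) auto
    also have "\<dots> = ?d ^ N * ((1 + \<bar>x \<bullet> b\<bar>) ^ N * cmod (psi1 (x \<bullet> b)))" by (simp add: power_mult_distrib)
    also have "\<dots> \<le> ?d ^ N * C" using C by (intro mult_left_mono) auto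
    finally show ?thesis .
  qed
  then show ?thesis using C by (intro exI[of _ "?d ^ N * C"]) auto
qed

text \<open>The majorant is the product of \<open>1 / (1 + t\<^sup>2)\<close> over the coordinates.
  Each factor costs two powers of \<open>1 + norm x\<close>, whence the exponent
  \<open>2 * DIM('a)\<close>.\<close>

lemma integrable_of_decay:
  fixes h :: "'a::euclidean_space \<Rightarrow> 'b::{banach, second_countable_topology}"
  assumes [measurable]: "h \<in> borel_measurable borel" and C: "\<And>x. (1 + norm x) ^ (2 * DIM('a)) * norm (h x) \<le> C"
  shows "integrable lborel h"
proof -
  have "integrable lborel (\<lambda>t::real. inverse (1 + t\<^sup>2))"
    using integrable_inverse_1_plus_square by (simp add: set_integrable_def einterval_def)
  then have "integrable lborel (\<lambda>t::real. complex_of_real (inverse (1 + t\<^sup>2)))" by (rule integrable_of_real)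
  then have "integrable lborel (\<lambda>x::'a. \<Prod>b\<in>Basis. complex_of_real (inverse (1 + (x \<bullet> b)\<^sup>2)))"
    by (intro integrable_prod_Basis)
  then have w: "integrable lborel (\<lambda>x::'a. C * (\<Prod>b\<in>Basis. inverse (1 + (x \<bullet> b)\<^sup>2)))"
    unfolding of_real_prod[symmetric] complex_of_real_integrable_eq by (rule integrable_mult_right)
  show ?thesis
  proof (rule Bochner_Integration.integrable_bound[OF w])
    show "AE x in lborel. norm (h x) \<le> norm (C * (\<Prod>b\<in>Basis. inverse (1 + (x \<bullet> b)\<^sup>2)))"
    proof (rule AE_I2)
      fix x :: 'a
      have C0: "C \<ge> 0" by (rule order.trans[OF _ C[of 0]]) simp
      have "(\<Prod>b\<in>(Basis::'a set). 1 + (x \<bullet> b)\<^sup>2) \<le> (\<Prod>b\<in>(Basis::'a set). (1 + norm x)\<^sup>2)"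
      proof (intro prod_mono conjI)
        fix b :: 'a assume b: "b \<in> Basis"
        have "(x \<bullet> b)\<^sup>2 \<le> (norm x)\<^sup>2" using Basis_le_norm[OF b, of x] abs_le_square_iff[of "x \<bullet> b" "norm x"] by simp
        moreover have "(1 + norm x)\<^sup>2 = 1 + 2 * norm x + (norm x)\<^sup>2" by (simp add: power2_sum)
        ultimately show "1 + (x \<bullet> b)\<^sup>2 \<le> (1 + norm x)\<^sup>2" using norm_ge_zero[of x] by linarith
      qed simp
      also have "\<dots> = (1 + norm x) ^ (2 * DIM('a))" by (simp add: power_mult)
      finally have le: "(\<Prod>b\<in>(Basis::'a set). 1 + (x \<bullet> b)\<^sup>2) \<le> (1 + norm x) ^ (2 * DIM('a))" .
      have pos: "(\<Prod>b\<in>(Basis::'a set). 1 + (x \<bullet> b)\<^sup>2) > 0"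
        by (intro prod_pos) (simp add: add_pos_nonneg)
      have "(\<Prod>b\<in>(Basis::'a set). 1 + (x \<bullet> b)\<^sup>2) * norm (h x) \<le> C"
        using le C[of x] by (meson mult_right_mono norm_ge_zero order.trans)
      then have "norm (h x) \<le> C / (\<Prod>b\<in>(Basis::'a set). 1 + (x \<bullet> b)\<^sup>2)" using pos by (simp add: field_simps)
      also have "\<dots> = C * (\<Prod>b\<in>Basis. inverse (1 + (x \<bullet> b)\<^sup>2))" by (simp add: divide_inverse prod_inversef[unfolded o_def])
      finally show "norm (h x) \<le> norm (C * (\<Prod>b\<in>Basis. inverse (1 + (x \<bullet> b)\<^sup>2)))" by simp
    qed
  qed simp
qed

lemma fourier_freq_bump:
  assumes e: "\<epsilon> > 0"
  shows "fourier (freq_bump \<epsilon> \<xi>) x = cis (- 2 * pi * (\<xi> \<bullet> x)) * psi (\<epsilon> *\<^sub>R x)"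
proof -
  have i: "integrable lborel (\<lambda>s. complex_of_real (bm 0 ((c - s) / \<epsilon>) / \<epsilon>))" for c
  proof -
    have "integrable lborel (\<lambda>s. bm 0 (c / \<epsilon> + (- 1 / \<epsilon>) * s) / \<epsilon>)"
      using e by (intro integrable_divide lborel_integrable_real_affine bm_props(4)) auto
    then show ?thesis by (intro integrable_of_real) (simp add: diff_divide_distrib)
  qed
  have 1: "fourier (\<lambda>s. complex_of_real (bm 0 ((c - s) / \<epsilon>) / \<epsilon>)) y = cis (- 2 * pi * (c * y)) * psi1 (\<epsilon> * y)" for c y :: real
  proof -
    have "fourier (\<lambda>s. complex_of_real (bm 0 ((c - s) / \<epsilon>) / \<epsilon>)) y
      = \<epsilon> *\<^sub>R (\<integral>r. cis (- 2 * pi * ((c + - \<epsilon> * r) * y)) * complex_of_real (bm 0 r / \<epsilon>) \<partial>lborel)"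
      unfolding fourier_def using e by (subst lborel_integral_real_affine[of "- \<epsilon>" _ c]) auto
    also have "(\<lambda>r. cis (- 2 * pi * ((c + - \<epsilon> * r) * y)) * complex_of_real (bm 0 r / \<epsilon>))
       = (\<lambda>r. (cis (- 2 * pi * (c * y)) / \<epsilon>) * (cis (2 * pi * (r * (\<epsilon> * y))) * complex_of_real (bm 0 r)))"
    proof
      fix r
      have "cis (- 2 * pi * ((c + - \<epsilon> * r) * y)) = cis (- 2 * pi * (c * y)) * cis (2 * pi * (r * (\<epsilon> * y)))"
        by (simp add: cis_mult algebra_simps)
      then show "cis (- 2 * pi * ((c + - \<epsilon> * r) * y)) * complex_of_real (bm 0 r / \<epsilon>)
        = (cis (- 2 * pi * (c * y)) / \<epsilon>) * (cis (2 * pi * (r * (\<epsilon> * y))) * complex_of_real (bm 0 r))" by simp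
    qed
    also have "\<epsilon> *\<^sub>R (\<integral>r. (cis (- 2 * pi * (c * y)) / \<epsilon>) * (cis (2 * pi * (r * (\<epsilon> * y))) * complex_of_real (bm 0 r)) \<partial>lborel)
       = cis (- 2 * pi * (c * y)) * psi1 (\<epsilon> * y)"
      unfolding integral_mult_right_zero psi1_def using e by (simp add: scaleR_conv_of_real)
    finally show ?thesis .
  qed
  have "fourier (freq_bump \<epsilon> \<xi>) x = (\<Prod>b\<in>Basis. cis (- 2 * pi * (\<xi> \<bullet> b * (x \<bullet> b))) * psi1 (\<epsilon> * (x \<bullet> b)))"
    unfolding freq_bump_def[abs_def] by (subst fourier_prod_Basis[OF i]) (simp only: 1)
  also have "\<dots> = cis (- 2 * pi * (\<xi> \<bullet> x)) * psi (\<epsilon> *\<^sub>R x)"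
    unfolding cis_inner_prod psi_def by (simp add: prod.distrib)
  finally show ?thesis .
qed

lemma freq_bump_nonzeroD:
  assumes "freq_bump \<epsilon> \<xi> p \<noteq> 0" and e: "\<epsilon> > 0" and b: "b \<in> Basis"
  shows "\<bar>\<xi> \<bullet> b - p \<bullet> b\<bar> < \<epsilon>"
proof -
  have "bm 0 ((\<xi> \<bullet> b - p \<bullet> b) / \<epsilon>) \<noteq> 0" using assms by (auto simp: freq_bump_def prod_zero_iff)
  then have "\<bar>(\<xi> \<bullet> b - p \<bullet> b) / \<epsilon>\<bar> < 1" using bm_props(1) not_less by blast
  then show ?thesis using e by (simp add: abs_divide)
qed

text \<open>Tensor products, with \<open>k\<close> a multi-index of orders of differentiation. A
  partial derivative raises one entry of \<open>k\<close>, so the family is stable and smoothness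
  follows by induction on the list of directions.\<close>

definition prod_fun :: "('a \<Rightarrow> nat \<Rightarrow> real \<Rightarrow> real) \<Rightarrow> ('a \<Rightarrow> nat) \<Rightarrow> 'a::euclidean_space \<Rightarrow> complex" where
  "prod_fun D k p = (\<Prod>b\<in>Basis. of_real (D b (k b) (p \<bullet> b)))"

lemma prod_fun_has_derivative:
  assumes D: "\<And>b. smooth_seq (D b)"
  shows "(prod_fun D k has_derivative
     (\<lambda>y. \<Sum>b\<in>Basis. of_real (D b (Suc (k b)) (x \<bullet> b) * (y \<bullet> b)) * (\<Prod>c\<in>Basis - {b}. of_real (D c (k c) (x \<bullet> c))))) (at x)"
  unfolding prod_fun_def[abs_def]
proof (rule has_derivative_prod)
  fix b :: 'a
  have "((\<lambda>p. D b (k b) (p \<bullet> b)) has_derivative (\<lambda>y. D b (Suc (k b)) (x \<bullet> b) * (y \<bullet> b))) (at x)"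
  proof -
    have 1: "((\<lambda>p. p \<bullet> b) has_derivative (\<lambda>y. y \<bullet> b)) (at x)" by (auto intro!: derivative_eq_intros)
    have 2: "(D b (k b) has_derivative (\<lambda>y. D b (Suc (k b)) (x \<bullet> b) * y)) (at (x \<bullet> b))"
      using D[of b] unfolding smooth_seq_def has_field_derivative_def by simp
    show ?thesis using has_derivative_compose[OF 1 2] by simp
  qed
  then show "((\<lambda>p. complex_of_real (D b (k b) (p \<bullet> b))) has_derivative (\<lambda>y. complex_of_real (D b (Suc (k b)) (x \<bullet> b) * (y \<bullet> b)))) (at x)"
    by (rule has_derivative_of_real)
qed

lemma prod_fun_partial:
  assumes D: "\<And>b. smooth_seq (D b)" and v: "v \<in> Basis"
  shows "frechet_derivative (prod_fun D k) (at x) v = prod_fun D (k(v := Suc (k v))) x"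
proof -
  have "frechet_derivative (prod_fun D k) (at x) v =
     (\<Sum>b\<in>Basis. of_real (D b (Suc (k b)) (x \<bullet> b) * (v \<bullet> b)) * (\<Prod>c\<in>Basis - {b}. of_real (D c (k c) (x \<bullet> c))))"
    by (simp add: frechet_derivative_at[OF prod_fun_has_derivative[OF D], symmetric])
  also have "\<dots> = (\<Sum>b\<in>Basis. if b = v then of_real (D v (Suc (k v)) (x \<bullet> v)) * (\<Prod>c\<in>Basis - {v}. of_real (D c (k c) (x \<bullet> c))) else 0)"
    by (rule sum.cong) (use v in \<open>auto simp: inner_Basis\<close>)
  also have "\<dots> = of_real (D v (Suc (k v)) (x \<bullet> v)) * (\<Prod>c\<in>Basis - {v}. of_real (D c (k c) (x \<bullet> c)))"
    using v by simp
  also have "\<dots> = prod_fun D (k(v := Suc (k v))) x"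
    unfolding prod_fun_def prod.remove[OF finite_Basis v] by (auto intro!: prod.cong)
  finally show ?thesis .
qed

lemma smooth_prod_fun:
  assumes D: "\<And>b. smooth_seq (D b)"
  shows "smooth (prod_fun D k)"
proof -
  have "\<exists>l. partial_derivs vs (prod_fun D k) = prod_fun D l" if "set vs \<subseteq> Basis" for vs
    using that
  proof (induction vs)
    case (Cons v vs)
    then obtain l where l: "partial_derivs vs (prod_fun D k) = prod_fun D l" by auto
    have "partial_derivs (v # vs) (prod_fun D k) = prod_fun D (l(v := Suc (l v)))"
      using Cons.prems by (auto simp: l prod_fun_partial[OF D])
    then show ?case by blast
  qed auto
  moreover have "prod_fun D l differentiable_on UNIV" for l
    unfolding differentiable_on_def differentiable_def using prod_fun_has_derivative[of D, OF D] by blast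
  ultimately show ?thesis unfolding smooth_def by metis
qed

lemma freq_bump_smooth:
  assumes e: "\<epsilon> > 0"
  shows "smooth (freq_bump \<epsilon> \<xi>)"
proof -
  define D where "D b k s = (- 1 / \<epsilon>) ^ k * (bm k ((\<xi> \<bullet> b - s) / \<epsilon>) / \<epsilon>)" for b k s
  have "smooth_seq (D b)" for b
    unfolding smooth_seq_def
  proof (intro allI)
    fix k t
    have 1: "((\<lambda>s. (\<xi> \<bullet> b - s) / \<epsilon>) has_real_derivative - 1 / \<epsilon>) (at t)"
      using e by (auto intro!: derivative_eq_intros)
    have 2: "(bm k has_real_derivative bm (Suc k) ((\<xi> \<bullet> b - t) / \<epsilon>)) (at ((\<xi> \<bullet> b - t) / \<epsilon>))"
      using smooth_seq_bm by (simp add: smooth_seq_def)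
    have "((\<lambda>s. (- 1 / \<epsilon>) ^ k * (bm k ((\<xi> \<bullet> b - s) / \<epsilon>) / \<epsilon>)) has_real_derivative (- 1 / \<epsilon>) ^ k * (bm (Suc k) ((\<xi> \<bullet> b - t) / \<epsilon>) * (- 1 / \<epsilon>) / \<epsilon>)) (at t)"
      by (intro DERIV_cmult DERIV_cdivide DERIV_chain2[OF 2 1])
    then show "(D b k has_real_derivative D b (Suc k) t) (at t)"
      unfolding D_def[abs_def] by (simp add: mult_ac)
  qed
  from smooth_prod_fun[of D "\<lambda>_. 0", OF this] show ?thesis
    by (simp add: prod_fun_def[abs_def] freq_bump_def[abs_def] D_def)
qed

lemma freq_bump_support: "\<epsilon> > 0 \<Longrightarrow> closure {p. freq_bump \<epsilon> \<xi> p \<noteq> 0} \<subseteq> {p. \<forall>b\<in>Basis. \<bar>\<xi> \<bullet> b - p \<bullet> b\<bar> \<le> \<epsilon>}"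
proof (rule closure_minimal)
  assume e: "\<epsilon> > 0"
  show "{p. freq_bump \<epsilon> \<xi> p \<noteq> 0} \<subseteq> {p. \<forall>b\<in>Basis. \<bar>\<xi> \<bullet> b - p \<bullet> b\<bar> \<le> \<epsilon>}"
    using freq_bump_nonzeroD[OF _ e] by (auto intro: less_imp_le)
  have "{p. \<forall>b\<in>Basis. \<bar>\<xi> \<bullet> b - p \<bullet> b\<bar> \<le> \<epsilon>} = (\<Inter>b\<in>Basis. {p. \<bar>\<xi> \<bullet> b - p \<bullet> b\<bar> \<le> \<epsilon>})" by auto
  also have "closed \<dots>" by (intro closed_INT ballI closed_Collect_le continuous_intros)
  finally show "closed {p. \<forall>b\<in>Basis. \<bar>\<xi> \<bullet> b - p \<bullet> b\<bar> \<le> \<epsilon>}" .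
qed

lemma cube_norm_le:
  fixes \<xi> p :: "'a::euclidean_space"
  assumes "\<And>b. b \<in> Basis \<Longrightarrow> \<bar>\<xi> \<bullet> b - p \<bullet> b\<bar> \<le> \<epsilon>"
  shows "norm (\<xi> - p) \<le> real DIM('a) * \<epsilon>"
proof -
  have "norm (\<xi> - p) \<le> (\<Sum>b\<in>Basis. \<bar>(\<xi> - p) \<bullet> b\<bar>)" by (rule norm_le_l1)
  also have "\<dots> \<le> (\<Sum>b\<in>(Basis::'a set). \<epsilon>)" by (intro sum_mono) (simp add: assms inner_diff_left)
  finally show ?thesis by simp
qed

lemma freq_bump_test_function:
  assumes e: "\<epsilon> > 0"
  shows "test_function (freq_bump \<epsilon> \<xi>)"
  unfolding test_function_def compact_closure
proof (intro conjI freq_bump_smooth e)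
  have "{p. freq_bump \<epsilon> \<xi> p \<noteq> 0} \<subseteq> cball \<xi> (real DIM('a) * \<epsilon>)"
  proof
    fix p assume "p \<in> {p. freq_bump \<epsilon> \<xi> p \<noteq> 0}"
    then have "p \<in> {p. \<forall>b\<in>Basis. \<bar>\<xi> \<bullet> b - p \<bullet> b\<bar> \<le> \<epsilon>}"
      by (rule subsetD[OF order.trans[OF closure_subset freq_bump_support[OF e]]])
    then show "p \<in> cball \<xi> (real DIM('a) * \<epsilon>)" using cube_norm_le[of \<xi> p \<epsilon>] by (simp add: dist_norm)
  qed
  then show "bounded {p. freq_bump \<epsilon> \<xi> p \<noteq> 0}" by (rule bounded_subset[OF bounded_cball])
qed

lemma continuous_freq_bump: "\<epsilon> > 0 \<Longrightarrow> continuous_on S (freq_bump \<epsilon> \<xi>)"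
  unfolding freq_bump_def[abs_def]
  by (intro continuous_intros continuous_on_compose2[OF bm_props(5)[of UNIV]]) auto

lemma freq_bump_bounded: "\<epsilon> > 0 \<Longrightarrow> \<exists>B. \<forall>p. cmod (freq_bump \<epsilon> \<xi> p) \<le> B"
proof -
  assume e: "\<epsilon> > 0"
  obtain B where B: "B \<ge> 0" "\<And>t. \<bar>bm 0 t\<bar> \<le> B" using compact_support_bounded[of 1 "bm 0"] bm_props(1,5) by blast
  have "cmod (freq_bump \<epsilon> \<xi> p) \<le> (\<Prod>b\<in>(Basis::'a set). B / \<epsilon>)" for p
    unfolding freq_bump_def prod_norm[symmetric] using B e by (intro prod_mono) (auto simp: norm_divide divide_right_mono)
  then show ?thesis by blast
qed

lemma integrable_freq_bump: "\<epsilon> > 0 \<Longrightarrow> integrable lborel (freq_bump \<epsilon> \<xi>)"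
proof -
  assume e: "\<epsilon> > 0"
  obtain B where B: "\<And>p. cmod (freq_bump \<epsilon> \<xi> p) \<le> B" using freq_bump_bounded[OF e] by blast
  have b: "bounded {p. freq_bump \<epsilon> \<xi> p \<noteq> 0}" using freq_bump_test_function[OF e, of \<xi>] by (simp add: test_function_def)
  have [measurable]: "freq_bump \<epsilon> \<xi> \<in> borel_measurable borel"
    by (rule borel_measurable_continuous_onI[OF continuous_freq_bump[OF e]])
  have c: "integrable lborel (indicator (closure {p. freq_bump \<epsilon> \<xi> p \<noteq> 0}) :: 'a \<Rightarrow> complex)"
    using b by (intro integrable_indicator_bounded) (auto simp: bounded_closure)
  show ?thesis
  proof (rule Bochner_Integration.integrable_bound[OF integrable_mult_right[OF c, of "of_real B"]])
    show "AE p in lborel. norm (freq_bump \<epsilon> \<xi> p) \<le> norm (of_real B * indicator (closure {p. freq_bump \<epsilon> \<xi> p \<noteq> 0}) p :: complex)"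
    proof (rule AE_I2)
      fix p
      show "norm (freq_bump \<epsilon> \<xi> p) \<le> norm (of_real B * indicator (closure {p. freq_bump \<epsilon> \<xi> p \<noteq> 0}) p :: complex)"
      proof (cases "freq_bump \<epsilon> \<xi> p = 0")
        case False
        then have "p \<in> closure {p. freq_bump \<epsilon> \<xi> p \<noteq> 0}" by (intro subsetD[OF closure_subset]) simp
        then show ?thesis using B[of p] by simp
      qed simp
    qed
  qed simp
qed

lemma fourier_freq_bump_0: "fourier (freq_bump 1 0) = psi"
proof
  fix x :: 'a show "fourier (freq_bump 1 0) x = psi x" using fourier_freq_bump[of 1 0 x] by simp
qed

lemma continuous_psi: "continuous_on UNIV psi"
  unfolding fourier_freq_bump_0[symmetric] by (intro continuous_fourier integrable_freq_bump) simp

lemma measurable_psi [measurable]: "psi \<in> borel_measurable borel"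
  by (rule borel_measurable_continuous_onI[OF continuous_psi])

text \<open>The dependence on \<epsilon> is explicit because the integrals of the cutoff functions
  must be known to grow polynomially in \<open>1 / \<epsilon>\<close>, with a definite
  degree.\<close>

lemma psi_scaled_aux:
  fixes x :: "'a::euclidean_space"
  assumes e: "0 < \<epsilon>" and C: "\<And>x::'a. (1 + norm x) ^ N * cmod (psi x) \<le> C"
  shows "(1 + norm x) ^ N * cmod (psi (\<epsilon> *\<^sub>R x)) \<le> max 1 (1 / \<epsilon>) ^ N * C"
proof -
  have le: "1 + norm x \<le> max 1 (1 / \<epsilon>) * (1 + norm (\<epsilon> *\<^sub>R x))"
  proof (cases "\<epsilon> \<le> 1")
    case True
    then have m: "max 1 (1 / \<epsilon>) = 1 / \<epsilon>" using e by (simp add: field_simps)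
    show ?thesis unfolding m using e True by (simp add: field_simps)
  next
    case False
    then have m: "max 1 (1 / \<epsilon>) = 1" using e by (simp add: field_simps)
    have "1 * norm x \<le> \<epsilon> * norm x" using False by (intro mult_right_mono) auto
    then show ?thesis unfolding m using e by simp
  qed
  have "(1 + norm x) ^ N * cmod (psi (\<epsilon> *\<^sub>R x)) \<le> (max 1 (1 / \<epsilon>) * (1 + norm (\<epsilon> *\<^sub>R x))) ^ N * cmod (psi (\<epsilon> *\<^sub>R x))"
    by (intro mult_right_mono power_mono le) auto
  also have "\<dots> = max 1 (1 / \<epsilon>) ^ N * ((1 + norm (\<epsilon> *\<^sub>R x)) ^ N * cmod (psi (\<epsilon> *\<^sub>R x)))" by (simp add: power_mult_distrib)
  also have "\<dots> \<le> max 1 (1 / \<epsilon>) ^ N * C" by (intro mult_left_mono C) auto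
  finally show ?thesis .
qed

lemma psi_scaled_decay:
  assumes e: "0 < \<epsilon>"
  shows "\<exists>C\<ge>0. \<forall>x::'a::euclidean_space. (1 + norm x) ^ N * cmod (psi (\<epsilon> *\<^sub>R x)) \<le> C"
proof -
  obtain C where C: "C \<ge> 0" "\<And>x::'a. (1 + norm x) ^ N * cmod (psi x) \<le> C" using psi_decay by blast
  show ?thesis
    using psi_scaled_aux[OF e C(2)] C(1) by (intro exI[of _ "max 1 (1 / \<epsilon>) ^ N * C"]) auto
qed

lemma integrable_psi: "integrable lborel (psi :: 'a::euclidean_space \<Rightarrow> complex)"
proof -
  obtain C where "\<And>x::'a. (1 + norm x) ^ (2 * DIM('a)) * cmod (psi x) \<le> C" using psi_decay by blast
  then show ?thesis by (intro integrable_of_decay) auto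
qed

text \<open>\<open>psi\<close> is the transform of \<open>freq_bump 1 0\<close>, so by inversion its
  own transform is that bump, reflected. The scaling shrinks the spectrum to a cube of half-side
  \<epsilon>.\<close>

lemma nice_psi_scaled:
  assumes e: "\<epsilon> > 0"
  shows "nice (\<lambda>x::'a::euclidean_space. psi (\<epsilon> *\<^sub>R x))"
    "fourier (\<lambda>x::'a. psi (\<epsilon> *\<^sub>R x)) \<xi> \<noteq> 0 \<Longrightarrow> norm \<xi> \<le> real DIM('a) * \<epsilon>"
proof -
  have F1: "fourier psi \<xi> = freq_bump 1 0 (- \<xi>)" for \<xi> :: 'a
  proof -
    obtain B where B: "\<And>p. cmod (freq_bump 1 0 (p::'a)) \<le> B" using freq_bump_bounded[of 1] by auto
    have "freq_bump 1 0 (- \<xi>) = (\<integral>x. fourier (freq_bump 1 0) x * cis (2 * pi * ((- \<xi>) \<bullet> x)) \<partial>lborel)"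
      using integrable_psi continuous_freq_bump[of 1 UNIV 0] B
      by (intro fourier_inversion integrable_freq_bump) (auto simp: fourier_freq_bump_0 continuous_on_eq_continuous_at)
    then show ?thesis by (simp add: fourier_freq_bump_0 fourier_def[of psi] inner_commute mult.commute)
  qed
  have F: "fourier (\<lambda>x::'a. psi (\<epsilon> *\<^sub>R x)) \<xi> = freq_bump 1 0 (- (\<xi> /\<^sub>R \<epsilon>)) / \<epsilon> ^ DIM('a)" for \<xi>
  proof -
    have "fourier psi (\<xi> /\<^sub>R \<epsilon>) = \<epsilon> ^ DIM('a) *\<^sub>R fourier (\<lambda>x::'a. psi (\<epsilon> *\<^sub>R x)) \<xi>"
      unfolding fourier_def using e by (subst integral_affine[of _ \<epsilon> 0]) (auto simp: inverse_eq_divide)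
    then show ?thesis using e by (simp add: F1 scaleR_conv_of_real)
  qed
  have s: "norm \<xi> \<le> real DIM('a) * \<epsilon>" if "fourier (\<lambda>x::'a. psi (\<epsilon> *\<^sub>R x)) \<xi> \<noteq> 0" for \<xi>
  proof -
    have "freq_bump 1 0 (- (\<xi> /\<^sub>R \<epsilon>)) \<noteq> 0" using that by (simp add: F)
    then have "\<bar>0 \<bullet> b - (- (\<xi> /\<^sub>R \<epsilon>)) \<bullet> b\<bar> \<le> 1" if "b \<in> Basis" for b
      using freq_bump_nonzeroD[of 1 0 "- (\<xi> /\<^sub>R \<epsilon>)" b] that by simp
    from cube_norm_le[OF this] have "norm (\<xi> /\<^sub>R \<epsilon>) \<le> real DIM('a)" by simp
    then show ?thesis using e by (simp add: field_simps)
  qed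
  then show "fourier (\<lambda>x::'a. psi (\<epsilon> *\<^sub>R x)) \<xi> \<noteq> 0 \<Longrightarrow> norm \<xi> \<le> real DIM('a) * \<epsilon>" .
  show "nice (\<lambda>x::'a. psi (\<epsilon> *\<^sub>R x))"
  proof (rule niceI[where B=1 and R="real DIM('a) * \<epsilon>"])
    show "continuous_on UNIV (\<lambda>x::'a. psi (\<epsilon> *\<^sub>R x))"
      by (intro continuous_on_compose2[OF continuous_psi] continuous_intros) auto
    show "integrable lborel (\<lambda>x::'a. psi (\<epsilon> *\<^sub>R x))"
      using integrable_affine[OF integrable_psi, of \<epsilon> 0] e by simp
    show "fourier (\<lambda>x::'a. psi (\<epsilon> *\<^sub>R x)) \<xi> = 0" if "real DIM('a) * \<epsilon> < norm \<xi>" for \<xi>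
      using s[of \<xi>] that by auto
  qed (rule psi_le)
qed

section \<open>Tempered functions\<close>

text \<open>HOL-Probability has a \<open>convolution\<close> of measures.\<close>

abbreviation conv :: "('a::euclidean_space \<Rightarrow> complex) \<Rightarrow> ('a \<Rightarrow> complex) \<Rightarrow> 'a \<Rightarrow> complex" where
  "conv \<equiv> Defs.convolution"

text \<open>Decay alone, without derivatives: enough to convolve with a function of polynomial
  growth, and to have the moments that control differences of the transform.\<close>

definition rapid :: "('a::euclidean_space \<Rightarrow> complex) \<Rightarrow> bool" where
  "rapid k \<longleftrightarrow> k \<in> borel_measurable borel \<and> (\<forall>N. \<exists>C\<ge>0. \<forall>x. (1 + norm x) ^ N * cmod (k x) \<le> C)"

lemma rapidE:
  assumes "rapid k"
  obtains C where "C \<ge> 0" "\<And>x. (1 + norm x) ^ N * cmod (k x) \<le> C"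
  using assms unfolding rapid_def by blast

lemma rapid_measurable: "rapid k \<Longrightarrow> k \<in> borel_measurable borel"
  by (simp add: rapid_def)

lemma rapid_integrable: "rapid k \<Longrightarrow> integrable lborel k"
  by (rule rapidE[of k "2 * DIM('a)"]) (auto intro!: integrable_of_decay rapid_measurable)

lemma rapid_moment:
  fixes k :: "'a::euclidean_space \<Rightarrow> complex"
  assumes k: "rapid k"
  shows "integrable lborel (\<lambda>x. norm x ^ n * cmod (k x))"
proof -
  obtain C where C: "C \<ge> 0" "\<And>x. (1 + norm x) ^ (2 * DIM('a) + n) * cmod (k x) \<le> C" using k by (rule rapidE) blast
  have [measurable]: "k \<in> borel_measurable borel" by (rule rapid_measurable[OF k])
  show ?thesis
  proof (rule integrable_of_decay)
    fix x :: 'a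
    have "norm x ^ n \<le> (1 + norm x) ^ n" by (intro power_mono) auto
    then have "(1 + norm x) ^ (2 * DIM('a)) * (norm x ^ n * cmod (k x)) \<le> (1 + norm x) ^ (2 * DIM('a)) * ((1 + norm x) ^ n * cmod (k x))"
      by (intro mult_left_mono mult_right_mono) auto
    also have "\<dots> \<le> C" using C(2)[of x] by (simp add: power_add mult.assoc)
    finally show "(1 + norm x) ^ (2 * DIM('a)) * norm (norm x ^ n * cmod (k x)) \<le> C" by (simp add: abs_mult)
  qed measurable
qed

lemma schwartz_rapid: "schwartz k \<Longrightarrow> rapid k"
proof -
  assume s: "schwartz k"
  have "partial_derivs [] k differentiable_on UNIV"
    using s unfolding schwartz_def smooth_def by (metis empty_set empty_subsetI)
  then have c: "continuous_on UNIV k" by (intro differentiable_imp_continuous_on) simp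
  have b: "bounded (range (\<lambda>x. norm x ^ n *\<^sub>R k x))" for n
  proof -
    have "bounded (range (\<lambda>x. norm x ^ n *\<^sub>R partial_derivs [] k x))"
      using s unfolding schwartz_def by (metis empty_set empty_subsetI)
    then show ?thesis by simp
  qed
  have "\<exists>C\<ge>0. \<forall>x. (1 + norm x) ^ N * cmod (k x) \<le> C" for N
  proof -
    obtain C1 where C1: "\<And>x. cmod (k x) \<le> C1" using b[of 0] by (auto simp: bounded_iff)
    obtain C2 where C2: "\<And>x. norm x ^ N * cmod (k x) \<le> C2" using b[of N] by (auto simp: bounded_iff)
    have "(1 + norm x) ^ N * cmod (k x) \<le> 2 ^ N * (C1 + C2)" for x
    proof -
      have "(1 + norm x) ^ N * cmod (k x) \<le> 2 ^ N * (1 + norm x ^ N) * cmod (k x)"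
        by (intro mult_right_mono one_plus_power_le) auto
      also have "\<dots> = 2 ^ N * (cmod (k x) + norm x ^ N * cmod (k x))" by (simp add: algebra_simps)
      also have "\<dots> \<le> 2 ^ N * (C1 + C2)" using C1 C2 by (intro mult_left_mono add_mono) auto
      finally show ?thesis .
    qed
    moreover have "0 \<le> 2 ^ N * (C1 + C2)" by (rule order.trans[OF _ calculation[of 0]]) simp
    ultimately show ?thesis by blast
  qed
  then show ?thesis unfolding rapid_def using borel_measurable_continuous_onI[OF c] by blast
qed

lemma rapid_add: "rapid k \<Longrightarrow> rapid l \<Longrightarrow> rapid (\<lambda>x. k x + l x)"
  unfolding rapid_def
proof (elim conjE, intro conjI allI)
  fix N
  assume a: "\<forall>N. \<exists>C\<ge>0. \<forall>x. (1 + norm x) ^ N * cmod (k x) \<le> C" "\<forall>N. \<exists>C\<ge>0. \<forall>x. (1 + norm x) ^ N * cmod (l x) \<le> C"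
  obtain C1 where C1: "C1 \<ge> 0" "\<And>x. (1 + norm x) ^ N * cmod (k x) \<le> C1" using a(1) by blast
  obtain C2 where C2: "C2 \<ge> 0" "\<And>x. (1 + norm x) ^ N * cmod (l x) \<le> C2" using a(2) by blast
  have "(1 + norm x) ^ N * cmod (k x + l x) \<le> C1 + C2" for x
  proof -
    have "(1 + norm x) ^ N * cmod (k x + l x) \<le> (1 + norm x) ^ N * (cmod (k x) + cmod (l x))"
      by (intro mult_left_mono norm_triangle_ineq) auto
    also have "\<dots> \<le> C1 + C2" unfolding distrib_left using C1 C2 by (intro add_mono) auto
    finally show ?thesis .
  qed
  then show "\<exists>C\<ge>0. \<forall>x. (1 + norm x) ^ N * cmod (k x + l x) \<le> C" using C1 C2 by (intro exI[of _ "C1 + C2"]) auto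
qed measurable

lemma rapid_sum: "(\<And>i. i \<in> I \<Longrightarrow> rapid (k i)) \<Longrightarrow> rapid (\<lambda>x. \<Sum>i\<in>I. k i x)"
proof (induction I rule: infinite_finite_induct)
  case (insert i I)
  then show ?case by (simp add: rapid_add)
qed (auto simp: rapid_def)

lemma
  assumes f: "nice f" and k: "integrable lborel k"
  shows nice_convolution: "nice (conv f k)"
    and fourier_convolution: "fourier (conv f k) \<xi> = fourier f \<xi> * fourier k \<xi>"
proof -
  have [measurable]: "f \<in> borel_measurable borel" by (rule nice_measurable) fact
  have [measurable]: "k \<in> borel_measurable borel" using k by auto
  have fi: "integrable lborel f" by (rule nice_integrable) fact
  obtain B R where B: "\<And>x. cmod (f x) \<le> B" "\<And>\<xi>. fourier f \<xi> \<noteq> 0 \<Longrightarrow> norm \<xi> \<le> R" using f by (rule niceE) blast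
  have conv_eq: "conv f k x = (\<integral>y. k y * f (x - y) \<partial>lborel)" for x
    unfolding Defs.convolution_def
    by (subst integral_affine[of _ "-1" x]) (auto simp: mult.commute)
  have shift: "(\<integral>x. h (x - y) \<partial>lborel) = (\<integral>x. h x \<partial>lborel)" if "h \<in> borel_measurable borel" for h :: "'a \<Rightarrow> 'c::{banach, second_countable_topology}" and y
    using integral_affine[OF that, of 1 "- y"] by simp
  have shifti: "integrable lborel (\<lambda>x. f (x - y))" for y
    using integrable_affine[OF fi, of 1 "- y"] by simp
  have ki: "integrable lborel (\<lambda>y. k y * f (x - y))" for x
    by (rule Bochner_Integration.integrable_bound[OF integrable_mult_left[OF k, of "of_real B"]])
       (auto simp: norm_mult intro!: AE_I2 mult_left_mono order.trans[OF B(1)])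
  have I: "integrable (lborel \<Otimes>\<^sub>M lborel) (\<lambda>(y, x). k y * f (x - y))"
  proof (rule lborel_pair.Fubini_integrable)
    show "(\<lambda>(y, x). k y * f (x - y)) \<in> borel_measurable (lborel \<Otimes>\<^sub>M lborel)" by measurable
    have "(\<integral>x. norm (f (x - y)) \<partial>lborel) = (\<integral>x. norm (f x) \<partial>lborel)" for y
      by (rule shift[of "\<lambda>x. norm (f x)"]) simp
    then show "integrable lborel (\<lambda>y. \<integral>x. norm (case (y, x) of (y, x) \<Rightarrow> k y * f (x - y)) \<partial>lborel)"
      using k by (simp add: norm_mult)
    show "AE y in lborel. integrable lborel (\<lambda>x. case (y, x) of (y, x) \<Rightarrow> k y * f (x - y))" by (simp add: shifti)
  qed
  have I2: "integrable (lborel \<Otimes>\<^sub>M lborel) (\<lambda>(y, x). cis (- 2 * pi * (x \<bullet> \<xi>)) * (k y * f (x - y)))" for \<xi>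
    by (rule Bochner_Integration.integrable_bound[OF I]) (measurable, auto simp: norm_mult)
  have F: "fourier (conv f k) \<xi> = fourier f \<xi> * fourier k \<xi>" for \<xi>
  proof -
    have "fourier (conv f k) \<xi> = (\<integral>x. (\<integral>y. cis (- 2 * pi * (x \<bullet> \<xi>)) * (k y * f (x - y)) \<partial>lborel) \<partial>lborel)"
      unfolding fourier_def[of "conv f k"] conv_eq by simp
    also have "\<dots> = (\<integral>y. (\<integral>x. cis (- 2 * pi * (x \<bullet> \<xi>)) * (k y * f (x - y)) \<partial>lborel) \<partial>lborel)"
      by (rule lborel_pair.Fubini_integral[OF I2])
    also have "\<dots> = (\<integral>y. fourier f \<xi> * (cis (- 2 * pi * (y \<bullet> \<xi>)) * k y) \<partial>lborel)"
    proof (rule Bochner_Integration.integral_cong)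
      fix y
      have "(\<integral>x. cis (- 2 * pi * (x \<bullet> \<xi>)) * (k y * f (x - y)) \<partial>lborel)
        = (\<integral>x. cis (- 2 * pi * ((x + y) \<bullet> \<xi>)) * (k y * f x) \<partial>lborel)"
        using shift[of "\<lambda>x. cis (- 2 * pi * ((x + y) \<bullet> \<xi>)) * (k y * f x)" y] by simp
      also have "\<dots> = (\<integral>x. (cis (- 2 * pi * (x \<bullet> \<xi>)) * f x) * (cis (- 2 * pi * (y \<bullet> \<xi>)) * k y) \<partial>lborel)"
      proof (rule Bochner_Integration.integral_cong)
        fix x
        have "cis (- 2 * pi * ((x + y) \<bullet> \<xi>)) = cis (- 2 * pi * (x \<bullet> \<xi>)) * cis (- 2 * pi * (y \<bullet> \<xi>))"
          by (simp add: cis_mult inner_add_left algebra_simps)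
        then show "cis (- 2 * pi * ((x + y) \<bullet> \<xi>)) * (k y * f x) = (cis (- 2 * pi * (x \<bullet> \<xi>)) * f x) * (cis (- 2 * pi * (y \<bullet> \<xi>)) * k y)"
          by (simp only: mult.assoc mult.commute mult.left_commute)
      qed simp
      also have "\<dots> = fourier f \<xi> * (cis (- 2 * pi * (y \<bullet> \<xi>)) * k y)"
        unfolding fourier_def by (rule integral_mult_left_zero)
      finally show "(\<integral>x. cis (- 2 * pi * (x \<bullet> \<xi>)) * (k y * f (x - y)) \<partial>lborel) = fourier f \<xi> * (cis (- 2 * pi * (y \<bullet> \<xi>)) * k y)" .
    qed simp
    also have "\<dots> = fourier f \<xi> * fourier k \<xi>" unfolding fourier_def[of k] by (rule integral_mult_right_zero)
    finally show ?thesis .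
  qed
  then show "fourier (conv f k) \<xi> = fourier f \<xi> * fourier k \<xi>" .
  define K where "K = (\<integral>y. cmod (k y) \<partial>lborel)"
  show "nice (conv f k)"
  proof (rule niceI[where B="K * B" and R=R])
    show "continuous_on UNIV (conv f k)"
      unfolding continuous_on_sequentially
    proof safe
      fix X :: "nat \<Rightarrow> 'a" and x assume X: "X \<longlonglongrightarrow> x"
      have "(\<lambda>n. conv f k (X n)) \<longlonglongrightarrow> conv f k x" unfolding conv_eq
      proof (rule integral_dominated_convergence[where w="\<lambda>y. cmod (k y) * B"])
        show "AE y in lborel. (\<lambda>n. k y * f (X n - y)) \<longlonglongrightarrow> k y * f (x - y)"
          by (intro AE_I2 tendsto_mult tendsto_const isCont_tendsto_compose[OF nice_isCont[OF f]] tendsto_intros X)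
        show "AE y in lborel. norm (k y * f (X n - y)) \<le> cmod (k y) * B" for n
          by (intro AE_I2) (auto simp: norm_mult intro!: mult_left_mono B)
      qed (use k in auto)
      then show "(conv f k \<circ> X) \<longlonglongrightarrow> conv f k x" by (simp add: o_def)
    qed
    show "cmod (conv f k x) \<le> K * B" for x
    proof -
      have "cmod (conv f k x) \<le> (\<integral>y. cmod (k y * f (x - y)) \<partial>lborel)" unfolding conv_eq by (rule integral_norm_bound)
      also have "\<dots> \<le> (\<integral>y. cmod (k y) * B \<partial>lborel)"
        using integrable_norm[OF ki] integrable_norm[OF k] B by (intro integral_mono) (auto simp: norm_mult mult_left_mono)
      finally show ?thesis by (simp add: K_def)
    qed
    show "integrable lborel (conv f k)"
      unfolding conv_eq[abs_def] using lborel_pair.integrable_snd[OF I] by simp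
    show "fourier (conv f k) \<xi> = 0" if "R < norm \<xi>" for \<xi>
      using B(2)[of \<xi>] that unfolding F by auto
  qed
qed

text \<open>The \<open>k\<close>-th difference of the Fourier transform along a direction: this replaces Taylor expansion
  in the proof that \<open>1 - fourier k\<close> vanishes to infinite order at the boundary of the set where it is zero.\<close>

lemma fourier_flat:
  fixes k :: "'a::euclidean_space \<Rightarrow> complex"
  assumes k: "rapid k" and n: "n > 0" and \<rho>: "\<rho> \<ge> 0" "real n * \<rho> \<le> \<delta>"
    and one: "\<And>p. dist q p \<le> \<delta> \<Longrightarrow> fourier k p = 1" and p: "dist q p \<le> \<delta> + \<rho>"
  shows "cmod (1 - fourier k p) \<le> (2 * pi * \<rho>) ^ n * (\<integral>x. norm x ^ n * cmod (k x) \<partial>lborel)"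
proof (cases "dist q p \<le> \<delta>")
  case True
  then show ?thesis using one[OF True] \<rho> by simp
next
  case False
  have k1: "integrable lborel k" by (rule rapid_integrable[OF k])
  have [measurable]: "k \<in> borel_measurable borel" by (rule rapid_measurable[OF k])
  define d where "d = dist q p"
  define v where "v = (q - p) /\<^sub>R d"
  have \<delta>0: "\<delta> \<ge> 0" using \<rho> by (meson mult_nonneg_nonneg of_nat_0_le_iff order.trans)
  have d: "d > 0" "d \<le> \<delta> + \<rho>" "d > \<delta>" using False p \<delta>0 by (auto simp: d_def)
  have nv: "norm v = 1" using d by (simp add: v_def d_def dist_norm)
  have qp: "q - p = d *\<^sub>R v" using d by (simp add: v_def)
  \<comment> \<open>The points march from \<open>p\<close> towards \<open>q\<close>. The first step
    already enters the ball because \<open>p\<close> is within \<open>\<delta> + \<rho>\<close> of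
    \<open>q\<close>, and none passes the center because
    \<open>real n * \<rho> \<le> \<delta>\<close>. Only the term \<open>j = 0\<close> remains
    unknown.\<close>
  have on: "fourier k (p + (real j * \<rho>) *\<^sub>R v) = 1" if "1 \<le> j" "j \<le> n" for j
  proof (rule one)
    have "q - (p + (real j * \<rho>) *\<^sub>R v) = (d - real j * \<rho>) *\<^sub>R v" using qp by (simp add: algebra_simps)
    then have "dist q (p + (real j * \<rho>) *\<^sub>R v) = \<bar>d - real j * \<rho>\<bar>" by (simp add: dist_norm nv)
    moreover have "real j * \<rho> \<le> real n * \<rho>" using that \<rho> by (intro mult_right_mono) auto
    moreover have "1 * \<rho> \<le> real j * \<rho>" using that \<rho> by (intro mult_right_mono) auto
    ultimately show "dist q (p + (real j * \<rho>) *\<^sub>R v) \<le> \<delta>" using d \<rho> by linarith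
  qed
  define w where "w x = cis (- 2 * pi * (x \<bullet> (\<rho> *\<^sub>R v)))" for x
  have wj: "cis (- 2 * pi * (x \<bullet> p)) * w x ^ j = cis (- 2 * pi * (x \<bullet> (p + (real j * \<rho>) *\<^sub>R v)))" for x j
    unfolding w_def Complex.DeMoivre cis_mult by (simp add: inner_add_right algebra_simps)
  have bin: "(1 - w x) ^ n = (\<Sum>j\<le>n. of_nat (n choose j) * (- 1) ^ j * w x ^ j)" for x
  proof -
    have "(1 - w x) ^ n = (- w x + 1) ^ n" by simp
    also have "\<dots> = (\<Sum>j\<le>n. of_nat (n choose j) * (- w x) ^ j * 1 ^ (n - j))" by (rule binomial_ring)
    also have "\<dots> = (\<Sum>j\<le>n. of_nat (n choose j) * (- 1) ^ j * w x ^ j)"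
      by (rule sum.cong) (auto simp: power_minus[of "w x"] mult.assoc)
    finally show ?thesis .
  qed
  have "(\<integral>x. cis (- 2 * pi * (x \<bullet> p)) * k x * (1 - w x) ^ n \<partial>lborel)
     = (\<integral>x. (\<Sum>j\<le>n. of_nat (n choose j) * (- 1) ^ j * (cis (- 2 * pi * (x \<bullet> (p + (real j * \<rho>) *\<^sub>R v))) * k x)) \<partial>lborel)"
  proof (rule Bochner_Integration.integral_cong)
    fix x
    have "cis (- 2 * pi * (x \<bullet> p)) * k x * (1 - w x) ^ n
      = (\<Sum>j\<le>n. of_nat (n choose j) * (- 1) ^ j * ((cis (- 2 * pi * (x \<bullet> p)) * w x ^ j) * k x))"
      unfolding bin sum_distrib_left by (rule sum.cong) (auto simp only: mult.assoc mult.commute mult.left_commute)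
    then show "cis (- 2 * pi * (x \<bullet> p)) * k x * (1 - w x) ^ n = (\<Sum>j\<le>n. of_nat (n choose j) * (- 1) ^ j * (cis (- 2 * pi * (x \<bullet> (p + (real j * \<rho>) *\<^sub>R v))) * k x))"
      unfolding wj .
  qed simp
  also have "\<dots> = (\<Sum>j\<le>n. of_nat (n choose j) * (- 1) ^ j * fourier k (p + (real j * \<rho>) *\<^sub>R v))"
  proof -
    have "integrable lborel (\<lambda>x. cis (- 2 * pi * (x \<bullet> z)) * k x)" for z by (rule integrable_cis_mult[OF k1]) measurable
    then show ?thesis unfolding fourier_def by (subst Bochner_Integration.integral_sum) (auto intro!: integrable_mult_right simp del: integrable_mult_right_iff)
  qed
  also have "\<dots> = (\<Sum>j\<le>n. of_nat (n choose j) * (- 1) ^ j * (if j = 0 then fourier k p else 1))"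
    by (rule sum.cong) (auto simp: on)
  also have "\<dots> = (\<Sum>j\<le>n. (- 1) ^ j * of_nat (n choose j)) + (fourier k p - 1)"
  proof -
    have "(\<Sum>j\<le>n. of_nat (n choose j) * (- 1) ^ j * (if j = 0 then fourier k p else 1))
      = (\<Sum>j\<le>n. (- 1) ^ j * of_nat (n choose j) + (if j = 0 then fourier k p - 1 else 0))"
      by (rule sum.cong) auto
    then show ?thesis by (simp add: sum.distrib)
  qed
  \<comment> \<open>For positive \<open>n\<close> the signed binomial coefficients cancel, so the
    \<open>n\<close>-th difference equals \<open>fourier k p - 1\<close> exactly.\<close>
  also have "(\<Sum>j\<le>n. (- 1) ^ j * of_nat (n choose j)) = (0::complex)" by (rule choose_alternating_sum) fact
  finally have eq: "fourier k p - 1 = (\<integral>x. cis (- 2 * pi * (x \<bullet> p)) * k x * (1 - w x) ^ n \<partial>lborel)" by simp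
  have wb: "cmod (1 - w x) \<le> 2 * pi * \<rho> * norm x" for x
  proof -
    have "cmod (1 - w x) = cmod (iexp (- 2 * pi * (x \<bullet> (\<rho> *\<^sub>R v))) - 1)"
      by (simp add: w_def cis_conv_exp norm_minus_commute)
    also have "\<dots> \<le> \<bar>- 2 * pi * (x \<bullet> (\<rho> *\<^sub>R v))\<bar>"
      using iexp_approx1[of "- 2 * pi * (x \<bullet> (\<rho> *\<^sub>R v))" 0] by simp
    also have "\<dots> = 2 * pi * \<rho> * \<bar>x \<bullet> v\<bar>" using \<rho> by (simp add: abs_mult)
    also have "\<dots> \<le> 2 * pi * \<rho> * norm x"
      using \<rho> Cauchy_Schwarz_ineq2[of x v] nv by (intro mult_left_mono) auto
    finally show ?thesis .
  qed
  have "cmod (1 - fourier k p) = cmod (\<integral>x. cis (- 2 * pi * (x \<bullet> p)) * k x * (1 - w x) ^ n \<partial>lborel)"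
    unfolding eq[symmetric] by (rule norm_minus_commute)
  also have "\<dots> \<le> (\<integral>x. cmod (cis (- 2 * pi * (x \<bullet> p)) * k x * (1 - w x) ^ n) \<partial>lborel)" by (rule integral_norm_bound)
  also have "\<dots> \<le> (\<integral>x. (2 * pi * \<rho>) ^ n * (norm x ^ n * cmod (k x)) \<partial>lborel)"
  proof (rule integral_mono')
    show "integrable lborel (\<lambda>x. (2 * pi * \<rho>) ^ n * (norm x ^ n * cmod (k x)))"
      by (intro integrable_mult_right rapid_moment k)
    fix x
    have "cmod (1 - w x) ^ n \<le> (2 * pi * \<rho> * norm x) ^ n" by (intro power_mono wb) simp
    then have "cmod (k x) * cmod (1 - w x) ^ n \<le> cmod (k x) * (2 * pi * \<rho> * norm x) ^ n" by (intro mult_left_mono) auto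
    then show "cmod (cis (- 2 * pi * (x \<bullet> p)) * k x * (1 - w x) ^ n) \<le> (2 * pi * \<rho>) ^ n * (norm x ^ n * cmod (k x))"
      by (simp add: norm_mult norm_power power_mult_distrib mult_ac)
  qed (use \<rho> in auto)
  finally show ?thesis by simp
qed

section \<open>Cutting off a tempered function\<close>

locale tempered =
  fixes f :: "'a::euclidean_space \<Rightarrow> complex" and N0 :: nat
  assumes f_meas [measurable]: "f \<in> borel_measurable borel"
    and f_int: "integrable lborel (\<lambda>x. f x / of_real ((1 + norm x) ^ N0))"
begin

definition weight_norm :: real where "weight_norm = (\<integral>x. cmod (f x / of_real ((1 + norm x) ^ N0)) \<partial>lborel)"

lemma weight_norm: "weight_norm \<ge> 0" by (simp add: weight_norm_def)

lemma
  assumes [measurable]: "k \<in> borel_measurable borel" and C: "\<And>x. (1 + norm x) ^ N0 * cmod (k x) \<le> C"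
  shows integrable_weight: "integrable lborel (\<lambda>x. f x * k x)"
    and norm_weight_le: "(\<integral>x. cmod (f x * k x) \<partial>lborel) \<le> C * weight_norm"
proof -
  have pt: "cmod (f x * k x) \<le> C * cmod (f x / of_real ((1 + norm x) ^ N0))" for x
  proof -
    have p: "1 + norm x \<noteq> 0" using norm_ge_zero[of x] by linarith
    then have "cmod (f x * k x) = cmod (f x / of_real ((1 + norm x) ^ N0)) * ((1 + norm x) ^ N0 * cmod (k x))"
      by (simp add: norm_mult norm_divide norm_power del: of_real_power)
    also have "\<dots> \<le> cmod (f x / of_real ((1 + norm x) ^ N0)) * C" by (intro mult_left_mono C) simp
    finally show ?thesis by (simp add: mult.commute)
  qed
  have i: "integrable lborel (\<lambda>x. C * cmod (f x / of_real ((1 + norm x) ^ N0)))"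
    by (intro integrable_mult_right integrable_norm f_int)
  show 1: "integrable lborel (\<lambda>x. f x * k x)"
    by (rule Bochner_Integration.integrable_bound[OF i]) (use pt order.trans[OF pt abs_ge_self] in auto)
  have "(\<integral>x. cmod (f x * k x) \<partial>lborel) \<le> (\<integral>x. C * cmod (f x / of_real ((1 + norm x) ^ N0)) \<partial>lborel)"
    by (intro integral_mono integrable_norm 1 i pt)
  then show "(\<integral>x. cmod (f x * k x) \<partial>lborel) \<le> C * weight_norm" by (simp add: weight_norm_def)
qed

text \<open>Peetre's inequality \<open>1 + |y| \<le> (1 + |x|) (1 + |x - y|)\<close>: a translated
  kernel still pairs with \<open>f\<close>, at the price of growth of order \<open>N0\<close> in
  \<open>x\<close>.\<close>

lemma translate_weight:
  fixes k :: "'a \<Rightarrow> complex"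
  assumes C: "\<And>x. (1 + norm x) ^ N0 * cmod (k x) \<le> C"
  shows "(1 + norm y) ^ N0 * cmod (k (x - y)) \<le> (1 + norm x) ^ N0 * C"
proof -
  have "norm y \<le> norm x + norm (x - y)" using norm_triangle_ineq4[of x "x - y"] by simp
  then have "1 + norm y \<le> (1 + norm x) * (1 + norm (x - y))"
  proof -
    have "(1 + norm x) * (1 + norm (x - y)) = 1 + norm x + norm (x - y) + norm x * norm (x - y)" by (simp add: algebra_simps)
    moreover have "0 \<le> norm x * norm (x - y)" by simp
    ultimately show ?thesis using \<open>norm y \<le> norm x + norm (x - y)\<close> by linarith
  qed
  then have "(1 + norm y) ^ N0 \<le> ((1 + norm x) * (1 + norm (x - y))) ^ N0" by (intro power_mono) auto
  then have "(1 + norm y) ^ N0 * cmod (k (x - y)) \<le> ((1 + norm x) * (1 + norm (x - y))) ^ N0 * cmod (k (x - y))"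
    by (intro mult_right_mono) auto
  also have "\<dots> = (1 + norm x) ^ N0 * ((1 + norm (x - y)) ^ N0 * cmod (k (x - y)))" by (simp add: power_mult_distrib)
  also have "\<dots> \<le> (1 + norm x) ^ N0 * C" by (intro mult_left_mono C) auto
  finally show ?thesis .
qed

lemma conv_weight:
  assumes k: "rapid k"
  obtains C where "C \<ge> 0" "\<And>x. integrable lborel (\<lambda>y. f y * k (x - y))"
    "\<And>x. (\<integral>y. cmod (f y * k (x - y)) \<partial>lborel) \<le> C * (1 + norm x) ^ N0"
proof -
  obtain C where C: "C \<ge> 0" "\<And>x. (1 + norm x) ^ N0 * cmod (k x) \<le> C" using k by (rule rapidE) blast
  have [measurable]: "k \<in> borel_measurable borel" by (rule rapid_measurable[OF k])
  show thesis
  proof (rule that[of "C * weight_norm"])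
    fix x :: 'a
    have m: "(\<lambda>y. k (x - y)) \<in> borel_measurable borel" by measurable
    show "integrable lborel (\<lambda>y. f y * k (x - y))" by (rule integrable_weight[OF m translate_weight[OF C(2)]])
    show "(\<integral>y. cmod (f y * k (x - y)) \<partial>lborel) \<le> C * weight_norm * (1 + norm x) ^ N0"
    proof -
      have "(\<integral>y. cmod (f y * k (x - y)) \<partial>lborel) \<le> ((1 + norm x) ^ N0 * C) * weight_norm"
        by (rule norm_weight_le[OF m translate_weight[OF C(2)]])
      then show ?thesis by (simp add: mult_ac)
    qed
  qed (use C weight_norm in auto)
qed

text \<open>\<open>Suc m\<close> is the scale \<open>1 / \<eta>\<close> of the cutoff.\<close>

definition cutoff :: "nat \<Rightarrow> 'a \<Rightarrow> complex" where
  "cutoff m x = f x * psi ((1 / real (Suc m)) *\<^sub>R x)"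

lemma cutoff_meas [measurable]: "cutoff m \<in> borel_measurable borel"
  unfolding cutoff_def by measurable

lemma integrable_cutoff: "integrable lborel (cutoff m)"
proof -
  obtain C where "\<And>x::'a. (1 + norm x) ^ N0 * cmod (psi ((1 / real (Suc m)) *\<^sub>R x)) \<le> C"
    using psi_scaled_decay[of "1 / real (Suc m)"] by (metis of_nat_0_less_iff zero_less_Suc zero_less_divide_1_iff)
  then show ?thesis unfolding cutoff_def by (intro integrable_weight) auto
qed

text \<open>The exponent \<open>N0\<close> is the point: this L1 norm bounds the transform of the
  cutoff function and will be outweighed by a factor of order \<open>Suc N0\<close> in
  \<open>1 / Suc m\<close>.\<close>

lemma norm_cutoff_le: "\<exists>C\<ge>0. \<forall>m. (\<integral>x. cmod (cutoff m x) \<partial>lborel) \<le> C * real (Suc m) ^ N0"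
proof -
  obtain C where C: "C \<ge> 0" "\<And>x::'a. (1 + norm x) ^ N0 * cmod (psi x) \<le> C" using psi_decay by blast
  have "(\<integral>x. cmod (cutoff m x) \<partial>lborel) \<le> (C * weight_norm) * real (Suc m) ^ N0" for m
  proof -
    have "max 1 (1 / (1 / real (Suc m))) = real (Suc m)" by simp
    then have b: "(1 + norm x) ^ N0 * cmod (psi ((1 / real (Suc m)) *\<^sub>R x)) \<le> real (Suc m) ^ N0 * C" for x :: 'a
      using psi_scaled_aux[OF _ C(2), of "1 / real (Suc m)" x] by (simp del: of_nat_Suc)
    have "(\<lambda>x::'a. psi ((1 / real (Suc m)) *\<^sub>R x)) \<in> borel_measurable borel" by measurable
    from norm_weight_le[OF this b] show ?thesis unfolding cutoff_def by (simp add: mult_ac)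
  qed
  then show ?thesis using C weight_norm by (intro exI[of _ "C * weight_norm"]) auto
qed

lemma cutoff_tendsto: "(\<lambda>m. cutoff m x) \<longlonglongrightarrow> f x"
proof -
  have "(\<lambda>m. (1 / real (Suc m)) *\<^sub>R x) \<longlonglongrightarrow> 0 *\<^sub>R x"
    by (intro tendsto_intros LIMSEQ_Suc[OF lim_1_over_n, unfolded o_def])
  moreover have "isCont psi (0::'a)" using continuous_psi[where 'a='a] by (simp add: continuous_on_eq_continuous_at)
  ultimately have "(\<lambda>m. psi ((1 / real (Suc m)) *\<^sub>R x)) \<longlonglongrightarrow> psi (0::'a)"
    using isCont_tendsto_compose by fastforce
  then have "(\<lambda>m. f x * psi ((1 / real (Suc m)) *\<^sub>R x)) \<longlonglongrightarrow> f x * psi (0::'a)" by (intro tendsto_intros)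
  then show ?thesis by (simp add: cutoff_def psi_0)
qed

lemma cmod_cutoff_le: "cmod (cutoff m x) \<le> cmod (f x)"
  unfolding cutoff_def norm_mult by (intro mult_right_le_one_le psi_le) auto

lemma conv_cutoff_tendsto:
  assumes k: "rapid k"
  shows "(\<lambda>m. conv (cutoff m) k x) \<longlonglongrightarrow> conv f k x"
proof -
  have [measurable]: "k \<in> borel_measurable borel" by (rule rapid_measurable[OF k])
  obtain C where i: "\<And>x. integrable lborel (\<lambda>y. f y * k (x - y))" using k by (rule conv_weight) blast
  show ?thesis unfolding Defs.convolution_def
  proof (rule integral_dominated_convergence[where w="\<lambda>y. cmod (f y * k (x - y))"])
    show "AE y in lborel. (\<lambda>m. cutoff m y * k (x - y)) \<longlonglongrightarrow> f y * k (x - y)"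
      by (intro AE_I2 tendsto_mult tendsto_const cutoff_tendsto)
    show "AE y in lborel. cmod (cutoff m y * k (x - y)) \<le> cmod (f y * k (x - y))" for m
      by (intro AE_I2) (simp add: norm_mult mult_right_mono cmod_cutoff_le)
    show "integrable lborel (\<lambda>y. cmod (f y * k (x - y)))" by (intro integrable_norm i)
  qed measurable
qed

lemma conv_cutoff_bound:
  assumes k: "rapid k"
  shows "\<exists>C\<ge>0. \<forall>x. (\<forall>m. cmod (conv (cutoff m) k x) \<le> C * (1 + norm x) ^ N0)"
proof -
  have [measurable]: "k \<in> borel_measurable borel" by (rule rapid_measurable[OF k])
  obtain C where C: "C \<ge> 0" and i: "\<And>x. integrable lborel (\<lambda>y. f y * k (x - y))"
    and b: "\<And>x. (\<integral>y. cmod (f y * k (x - y)) \<partial>lborel) \<le> C * (1 + norm x) ^ N0" using k by (rule conv_weight) blast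
  have "cmod (conv (cutoff m) k x) \<le> C * (1 + norm x) ^ N0" for m x
  proof -
    have "cmod (conv (cutoff m) k x) \<le> (\<integral>y. cmod (cutoff m y * k (x - y)) \<partial>lborel)"
      unfolding Defs.convolution_def by (rule integral_norm_bound)
    also have "\<dots> \<le> (\<integral>y. cmod (f y * k (x - y)) \<partial>lborel)"
      by (rule integral_mono'[OF integrable_norm[OF i]]) (simp_all add: norm_mult mult_right_mono cmod_cutoff_le)
    also note b
    finally show ?thesis .
  qed
  then show ?thesis using C by blast
qed

text \<open>The transform of \<open>cutoff m\<close> at \<xi> is \<open>f\<close> tested against the
  transform of a bump in the cube of half-side \<open>1 / Suc m\<close> around \<xi>. If the cube
  misses \<open>A\<close>, the hypothesis on the distributional support makes it zero.\<close>

lemma fourier_cutoff_support: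
  assumes sp: "fourier_supported_in f A" and far: "\<And>p. p \<in> A \<Longrightarrow> dist p \<xi> > real DIM('a) / real (Suc m)"
  shows "fourier (cutoff m) \<xi> = 0"
proof -
  let ?e = "1 / real (Suc m)"
  have e: "?e > 0" by simp
  have "closure {p. freq_bump ?e \<xi> p \<noteq> 0} \<inter> A = {}"
  proof -
    have "p \<notin> A" if "p \<in> closure {p. freq_bump ?e \<xi> p \<noteq> 0}" for p
    proof
      assume "p \<in> A"
      from that have "norm (\<xi> - p) \<le> real DIM('a) * ?e"
        using freq_bump_support[OF e, of \<xi>] by (intro cube_norm_le) auto
      with far[OF \<open>p \<in> A\<close>] show False by (simp add: dist_norm norm_minus_commute)
    qed
    then show ?thesis by blast
  qed
  then have "(\<integral>x. f x * fourier (freq_bump ?e \<xi>) x \<partial>lborel) = 0"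
    using sp freq_bump_test_function[OF e] unfolding fourier_supported_in_def by blast
  moreover have "fourier (cutoff m) \<xi> = (\<integral>x. f x * fourier (freq_bump ?e \<xi>) x \<partial>lborel)"
    unfolding fourier_freq_bump[OF e] fourier_def[of "cutoff m"] cutoff_def
    by (rule Bochner_Integration.integral_cong) (simp_all only: inner_commute mult.assoc mult.commute mult.left_commute)
  ultimately show ?thesis by simp
qed

text \<open>The cutoff function is only measurable, whereas \<open>nice\<close> demands continuity.
  Its transform has bounded support, so the inversion integral provides a continuous representative
  with the same transform.\<close>

lemma cutoff_nice:
  assumes sp: "fourier_supported_in f A" and A: "bounded A"
  shows "\<exists>u. nice u \<and> (AE x in lborel. cutoff m x = u x) \<and> fourier u = fourier (cutoff m)"
proof -
  define h where "h = fourier (cutoff m)"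
  define u where "u x = (\<integral>\<xi>. h \<xi> * cis (2 * pi * (x \<bullet> \<xi>)) \<partial>lborel)" for x
  obtain R where R: "\<And>p. p \<in> A \<Longrightarrow> norm p \<le> R" using A by (auto simp: bounded_iff)
  let ?R = "R + real DIM('a) / real (Suc m)"
  have hz: "h \<xi> = 0" if "norm \<xi> > ?R" for \<xi>
    unfolding h_def
  proof (rule fourier_cutoff_support[OF sp])
    fix p assume "p \<in> A"
    have "norm \<xi> \<le> norm p + dist p \<xi>" using norm_triangle_sub[of \<xi> p] by (simp add: dist_norm norm_minus_commute)
    then show "dist p \<xi> > real DIM('a) / real (Suc m)" using that R[OF \<open>p \<in> A\<close>] by linarith
  qed
  have hc: "continuous_on UNIV h" unfolding h_def by (rule continuous_fourier[OF integrable_cutoff])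
  have [measurable]: "h \<in> borel_measurable borel" by (rule borel_measurable_continuous_onI[OF hc])
  define B where "B = (\<integral>x. cmod (cutoff m x) \<partial>lborel)"
  have hB: "cmod (h \<xi>) \<le> B" for \<xi> unfolding h_def B_def by (rule cmod_fourier_le)
  have hi: "integrable lborel h"
  proof (rule Bochner_Integration.integrable_bound[OF integrable_mult_right[OF integrable_indicator_bounded[of "cball 0 ?R"], of "of_real B"]])
    show "AE \<xi> in lborel. norm (h \<xi>) \<le> norm (of_real B * indicator (cball 0 ?R) \<xi> :: complex)"
    proof (rule AE_I2)
      fix \<xi> show "norm (h \<xi>) \<le> norm (of_real B * indicator (cball 0 ?R) \<xi> :: complex)"
        using hB[of \<xi>] hz[of \<xi>] by (cases "norm \<xi> > ?R") (auto simp: indicator_def)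
    qed
  qed auto
  have ae: "AE x in lborel. cutoff m x = u x"
    using fourier_inversion_AE[OF integrable_cutoff, of m] hi unfolding u_def h_def by simp
  have uF: "u x = fourier h (- x)" for x unfolding u_def fourier_def by (simp add: inner_commute mult.commute)
  have uc: "continuous_on UNIV u"
    unfolding uF[abs_def] by (intro continuous_on_compose2[OF continuous_fourier[OF hi]] continuous_intros) auto
  have [measurable]: "u \<in> borel_measurable borel" by (rule borel_measurable_continuous_onI[OF uc])
  have "integrable lborel (cutoff m) \<longleftrightarrow> integrable lborel u"
    by (rule integrable_cong_AE[OF _ _ ae]) measurable
  then have ui: "integrable lborel u" using integrable_cutoff[of m] by (rule iffD1)
  have fu: "fourier u = fourier (cutoff m)"
  proof
    fix \<xi> show "fourier u \<xi> = fourier (cutoff m) \<xi>" unfolding fourier_def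
    proof (rule integral_cong_AE)
      show "AE x in lborel. cis (- 2 * pi * (x \<bullet> \<xi>)) * u x = cis (- 2 * pi * (x \<bullet> \<xi>)) * cutoff m x"
        using ae by eventually_elim simp
      show "(\<lambda>x. cis (- 2 * pi * (x \<bullet> \<xi>)) * u x) \<in> borel_measurable lborel" by measurable
      show "(\<lambda>x. cis (- 2 * pi * (x \<bullet> \<xi>)) * cutoff m x) \<in> borel_measurable lborel" by measurable
    qed
  qed
  have "nice u"
  proof (rule niceI[where B="\<integral>\<xi>. cmod (h \<xi>) \<partial>lborel" and R="?R"])
    show "cmod (u x) \<le> (\<integral>\<xi>. cmod (h \<xi>) \<partial>lborel)" for x unfolding uF by (rule cmod_fourier_le)
    show "fourier u \<xi> = 0" if "?R < norm \<xi>" for \<xi> using hz[OF that] by (simp add: fu h_def)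
    show "continuous_on UNIV u" by (rule uc)
    show "integrable lborel u" by (rule ui)
  qed
  then show ?thesis using ae fu by blast
qed

end

section \<open>Reproducing formula and passage to the limit\<close>

lemma nice_cmod_le:
  assumes "nice v"
  shows "cmod (v x) \<le> (\<integral>\<xi>. cmod (fourier v \<xi>) \<partial>lborel)"
proof -
  have "cmod (v x) \<le> (\<integral>\<xi>. cmod (fourier v \<xi> * cis (2 * pi * (x \<bullet> \<xi>))) \<partial>lborel)"
    by (subst nice_inversion[OF assms]) (rule integral_norm_bound)
  then show ?thesis by (simp add: norm_mult)
qed

lemma integral_indicator_bound:
  fixes h :: "'a::euclidean_space \<Rightarrow> real"
  assumes b: "\<And>x. h x \<le> B * indicator (cball 0 R) x" and i: "integrable lborel h"
  shows "(\<integral>x. h x \<partial>lborel) \<le> B * (\<integral>x. indicator (cball (0::'a) R) x \<partial>lborel)"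
proof -
  have j: "integrable lborel (indicator (cball (0::'a) R) :: 'a \<Rightarrow> real)"
    by (rule integrable_real_indicator) (use emeasure_bounded_finite[of "cball (0::'a) R"] in auto)
  have "(\<integral>x. h x \<partial>lborel) \<le> (\<integral>x. B * indicator (cball (0::'a) R) x \<partial>lborel)"
    by (intro integral_mono i b integrable_mult_right j)
  then show ?thesis by simp
qed

context tempered
begin

lemma fourier_nice_cutoff_near:
  assumes sp: "fourier_supported_in f A" and u: "fourier u = fourier (cutoff m)" and \<xi>: "fourier u \<xi> \<noteq> 0"
  shows "\<exists>p\<in>A. dist p \<xi> \<le> real DIM('a) / real (Suc m)"
proof (rule ccontr)
  assume "\<not> ?thesis"
  then have "fourier (cutoff m) \<xi> = 0" by (intro fourier_cutoff_support[OF sp]) (auto simp: not_le)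
  then show False using u \<xi> by simp
qed

lemma conv_cong_AE:
  assumes "AE x in lborel. cutoff m x = u x" "nice u" "rapid k"
  shows "conv (cutoff m) k x = conv u k x"
  unfolding Defs.convolution_def
proof (rule integral_cong_AE)
  have [measurable]: "k \<in> borel_measurable borel" by (rule rapid_measurable[OF assms(3)])
  have [measurable]: "u \<in> borel_measurable borel" by (rule nice_measurable[OF assms(2)])
  show "(\<lambda>y. cutoff m y * k (x - y)) \<in> borel_measurable lborel" by measurable
  show "(\<lambda>y. u y * k (x - y)) \<in> borel_measurable lborel" by measurable
  show "AE y in lborel. cutoff m y * k (x - y) = u y * k (x - y)" using assms(1) by eventually_elim simp
qed

text \<open>The transform of the defect is \<open>fourier (cutoff m)\<close> times
  \<open>1 - fourier k\<close>. The first factor is at most of order \<open>Suc m ^ N0\<close>. The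
  second is flat of order \<open>Suc N0\<close> on the support of the first, which exceeds the
  prescribed set by at most \<open>DIM('a) / Suc m\<close>. The support is bounded uniformly in
  \<open>m\<close>, so one power of \<open>1 / Suc m\<close> is left over in the supremum
  norm.\<close>

lemma reproducing_aux:
  assumes sp: "fourier_supported_in f (\<Union>q\<in>S. cball q \<delta>)" and S: "bounded S" and \<delta>: "\<delta> > 0"
    and k: "rapid k" and one: "\<And>q p. q \<in> S \<Longrightarrow> dist q p \<le> \<delta> \<Longrightarrow> fourier k p = 1"
  shows "\<exists>D. \<forall>m u x. real (Suc N0) * (real DIM('a) / real (Suc m)) \<le> \<delta> \<longrightarrow> nice u \<longrightarrow> fourier u = fourier (cutoff m)
    \<longrightarrow> cmod (u x - conv u k x) \<le> D / real (Suc m)"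
proof -
  let ?n = "Suc N0" and ?d = "real DIM('a)"
  obtain C where C: "C \<ge> 0" "\<And>m. (\<integral>x. cmod (cutoff m x) \<partial>lborel) \<le> C * real (Suc m) ^ N0" using norm_cutoff_le by blast
  obtain R0 where R0: "\<And>q. q \<in> S \<Longrightarrow> norm q \<le> R0" using S by (auto simp: bounded_iff)
  let ?R = "R0 + 2 * \<delta>"
  define V where "V = (\<integral>x. indicator (cball (0::'a) ?R) x \<partial>lborel :: real)"
  define M where "M = (\<integral>x. norm x ^ ?n * cmod (k x) \<partial>lborel)"
  have M: "M \<ge> 0" by (simp add: M_def)
  have "cmod (u x - conv u k x) \<le> (C * (2 * pi * ?d) ^ ?n * M * V) / real (Suc m)"
    if m: "real ?n * (?d / real (Suc m)) \<le> \<delta>" and u: "nice u" "fourier u = fourier (cutoff m)" for m u x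
  proof -
    let ?\<rho> = "?d / real (Suc m)"
    have ki: "integrable lborel k" by (rule rapid_integrable[OF k])
    have nc: "nice (conv u k)" by (rule nice_convolution[OF u(1) ki])
    define v where "v y = u y + (- 1) * conv u k y" for y
    have n1: "nice (\<lambda>y. (- 1) * conv u k y)"
    proof -
      obtain B' R' where B: "\<And>x. cmod (conv u k x) \<le> B'" "\<And>\<xi>. fourier (conv u k) \<xi> \<noteq> 0 \<Longrightarrow> norm \<xi> \<le> R'" using nc by (rule niceE) blast
      show ?thesis
      proof (rule niceI[where B=B' and R=R'])
        show "continuous_on UNIV (\<lambda>y. (- 1) * conv u k y)" by (intro continuous_intros nice_cont nc)
        show "cmod ((- 1) * conv u k x) \<le> B'" for x using B by simp
        show "integrable lborel (\<lambda>y. (- 1) * conv u k y)" by (intro integrable_mult_right nice_integrable nc)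
        show "fourier (\<lambda>y. (- 1) * conv u k y) \<xi> = 0" if "R' < norm \<xi>" for \<xi>
          using B(2)[of \<xi>] that by (auto simp: fourier_def)
      qed
    qed
    have nv: "nice v" unfolding v_def[abs_def] by (intro nice_add u n1)
    have Fv: "fourier v \<xi> = fourier (cutoff m) \<xi> * (1 - fourier k \<xi>)" for \<xi>
    proof -
      have "fourier v \<xi> = fourier u \<xi> + fourier (\<lambda>y. (- 1) * conv u k y) \<xi>"
        unfolding v_def[abs_def] by (rule fourier_add[OF nice_integrable[OF u(1)] nice_integrable[OF n1]])
      also have "fourier (\<lambda>y. (- 1) * conv u k y) \<xi> = - fourier (conv u k) \<xi>" by (simp add: fourier_def)
      finally show ?thesis by (simp add: fourier_convolution[OF u(1) ki] u(2) algebra_simps)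
    qed
    have b: "cmod (fourier v \<xi>) \<le> (C * real (Suc m) ^ N0 * ((2 * pi * ?\<rho>) ^ ?n * M)) * indicator (cball 0 ?R) \<xi>" for \<xi>
    proof (cases "fourier (cutoff m) \<xi> = 0")
      case True
      then show ?thesis unfolding Fv using C(1) M by simp
    next
      case False
      then obtain q p where q: "q \<in> S" "dist q p \<le> \<delta>" "dist p \<xi> \<le> ?\<rho>"
        using fourier_nice_cutoff_near[OF sp u(2), of \<xi>] u(2) by auto
      have d: "dist q \<xi> \<le> \<delta> + ?\<rho>" using q dist_triangle[of q \<xi> p] by linarith
      have r0: "?\<rho> \<ge> 0" by simp
      have "1 * ?\<rho> \<le> real ?n * ?\<rho>" by (rule mult_right_mono[OF _ r0]) simp
      then have "?\<rho> \<le> \<delta>" using m by linarith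
      then have "norm \<xi> \<le> ?R" using d R0[OF q(1)] norm_triangle_sub[of \<xi> q] by (simp add: dist_norm norm_minus_commute)
      then have ind: "indicator (cball 0 ?R) \<xi> = (1::real)" by (simp add: indicator_def)
      have f1: "cmod (1 - fourier k \<xi>) \<le> (2 * pi * ?\<rho>) ^ ?n * M"
        unfolding M_def by (rule fourier_flat[OF k _ r0 m one[OF q(1)] d]) auto
      have "cmod (fourier (cutoff m) \<xi>) \<le> C * real (Suc m) ^ N0" by (rule order.trans[OF cmod_fourier_le C(2)])
      with f1 have "cmod (fourier v \<xi>) \<le> (C * real (Suc m) ^ N0) * ((2 * pi * ?\<rho>) ^ ?n * M)"
        unfolding Fv norm_mult using C(1) by (intro mult_mono) auto
      then show ?thesis unfolding ind by simp
    qed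
    have "cmod (v x) \<le> (\<integral>\<xi>. cmod (fourier v \<xi>) \<partial>lborel)" by (rule nice_cmod_le[OF nv])
    also have "\<dots> \<le> (C * real (Suc m) ^ N0 * ((2 * pi * ?\<rho>) ^ ?n * M)) * V"
      unfolding V_def by (rule integral_indicator_bound[OF b integrable_norm[OF nice_integrable_fourier[OF nv]]])
    also have "\<dots> = (C * (2 * pi * ?d) ^ ?n * M * V) / real (Suc m)"
      by (simp add: field_simps power_divide power_mult_distrib del: of_nat_Suc)
    finally show ?thesis by (simp add: v_def)
  qed
  then show ?thesis by blast
qed

theorem reproducing:
  assumes sp: "fourier_supported_in f (\<Union>q\<in>S. cball q \<delta>)" and S: "bounded S" and \<delta>: "\<delta> > 0"
    and k: "rapid k" and one: "\<And>q p. q \<in> S \<Longrightarrow> dist q p \<le> \<delta> \<Longrightarrow> fourier k p = 1"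
  shows "AE x in lborel. f x = conv f k x"
proof -
  have bA: "bounded (\<Union>q\<in>S. cball q \<delta>)"
  proof -
    obtain R0 where R0: "\<And>q. q \<in> S \<Longrightarrow> norm q \<le> R0" using S by (auto simp: bounded_iff)
    have "norm p \<le> R0 + \<delta>" if "q \<in> S" "dist q p \<le> \<delta>" for p q
      using R0[OF that(1)] that(2) norm_triangle_sub[of p q] by (simp add: dist_norm norm_minus_commute)
    then show ?thesis unfolding bounded_iff by (intro exI[of _ "R0 + \<delta>"]) auto
  qed
  obtain u where u: "\<And>m. nice (u m)" "\<And>m. AE x in lborel. cutoff m x = u m x" "\<And>m. fourier (u m) = fourier (cutoff m)"
    using cutoff_nice[OF sp bA] by metis
  obtain D where D: "\<And>m u x. real (Suc N0) * (real DIM('a) / real (Suc m)) \<le> \<delta> \<Longrightarrow> nice u \<Longrightarrow> fourier u = fourier (cutoff m)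
    \<Longrightarrow> cmod (u x - conv u k x) \<le> D / real (Suc m)"
  proof -
    have "\<exists>D. \<forall>m u x. real (Suc N0) * (real DIM('a) / real (Suc m)) \<le> \<delta> \<longrightarrow> nice u \<longrightarrow> fourier u = fourier (cutoff m)
      \<longrightarrow> cmod (u x - conv u k x) \<le> D / real (Suc m)"
      by (rule reproducing_aux[OF sp S \<delta> k one])
    then show thesis using that by blast
  qed
  have ev: "eventually (\<lambda>m. real (Suc N0) * (real DIM('a) / real (Suc m)) \<le> \<delta>) sequentially"
  proof -
    have "(\<lambda>m. real (Suc N0) * (real DIM('a) / real (Suc m))) \<longlonglongrightarrow> real (Suc N0) * 0"
      by (intro tendsto_intros LIMSEQ_Suc[OF lim_const_over_n])
    then have "eventually (\<lambda>m. real (Suc N0) * (real DIM('a) / real (Suc m)) < \<delta>) sequentially"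
      using \<delta> by (intro order_tendstoD(2)) auto
    then show ?thesis by eventually_elim simp
  qed
  have D0: "(\<lambda>m. D / real (Suc m)) \<longlonglongrightarrow> 0" by (intro LIMSEQ_Suc[OF lim_const_over_n])
  have "AE x in lborel. \<forall>m. cutoff m x = u m x" using u(2) by (simp add: AE_all_countable)
  then show ?thesis
  proof eventually_elim
    fix x assume x: "\<forall>m. cutoff m x = u m x"
    have "(\<lambda>m. cutoff m x - conv (cutoff m) k x) \<longlonglongrightarrow> 0"
    proof (rule Lim_null_comparison[OF _ D0])
      show "eventually (\<lambda>m. cmod (cutoff m x - conv (cutoff m) k x) \<le> D / real (Suc m)) sequentially"
        using ev
      proof eventually_elim
        fix m assume "real (Suc N0) * (real DIM('a) / real (Suc m)) \<le> \<delta>"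
        from D[OF this u(1,3), of x] show "cmod (cutoff m x - conv (cutoff m) k x) \<le> D / real (Suc m)"
          using x conv_cong_AE[OF u(2,1) k, of m x] by simp
      qed
    qed
    moreover have "(\<lambda>m. cutoff m x - conv (cutoff m) k x) \<longlonglongrightarrow> f x - conv f k x"
      by (intro tendsto_diff cutoff_tendsto conv_cutoff_tendsto k)
    ultimately have "f x - conv f k x = 0" by (rule LIMSEQ_unique[symmetric])
    then show "f x = conv f k x" by simp
  qed
qed

lemma transfer_step:
  assumes sp: "fourier_supported_in f A" and A: "bounded A"
    and I: "finite I" and k: "\<And>i. i \<in> I \<Longrightarrow> rapid (k i)" and \<rho>: "\<rho> > 0" and K: "K \<ge> 0"
    and main: "\<And>u. nice u \<Longrightarrow> (\<And>\<xi>. fourier u \<xi> \<noteq> 0 \<Longrightarrow> \<exists>p\<in>A. dist p \<xi> \<le> \<rho>) \<Longrightarrow>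
       (\<integral>x. (cmod (\<Sum>i\<in>I. conv u (k i) x * psi (\<epsilon> *\<^sub>R x))) ^ 4 \<partial>lborel)
         \<le> K * (\<integral>x. (\<Sum>i\<in>I. (cmod (conv u (k i) x * psi (\<epsilon> *\<^sub>R x)))\<^sup>2)\<^sup>2 \<partial>lborel)"
    and e: "\<epsilon> > 0"
  shows "(\<integral>\<^sup>+x. ennreal ((cmod (\<Sum>i\<in>I. conv f (k i) x * psi (\<epsilon> *\<^sub>R x))) ^ 4) \<partial>lborel)
         \<le> ennreal K * (\<integral>\<^sup>+x. ennreal ((\<Sum>i\<in>I. (cmod (conv f (k i) x))\<^sup>2)\<^sup>2) \<partial>lborel)"
proof -
  define \<phi> where "\<phi> x = psi (\<epsilon> *\<^sub>R x)" for x :: 'a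
  have [measurable]: "\<phi> \<in> borel_measurable borel" unfolding \<phi>_def[abs_def] by measurable
  have km [measurable]: "i \<in> I \<Longrightarrow> k i \<in> borel_measurable borel" for i by (rule rapid_measurable[OF k])
  have cm [measurable]: "conv h (k i) \<in> borel_measurable borel" if "i \<in> I" "h \<in> borel_measurable borel" for h i
    using km[OF that(1)] that(2) unfolding Defs.convolution_def[abs_def]
    by measurable
  obtain c where c: "\<And>i. i \<in> I \<Longrightarrow> c i \<ge> 0" "\<And>i x m. i \<in> I \<Longrightarrow> cmod (conv (cutoff m) (k i) x) \<le> c i * (1 + norm x) ^ N0"
    using conv_cutoff_bound[OF k] by metis
  define W where "W x = (sum c I * ((1 + norm x) ^ N0 * cmod (\<phi> x))) ^ 4" for x
  have bsum: "(\<Sum>i\<in>I. cmod (conv (cutoff m) (k i) x * \<phi> x)) \<le> sum c I * ((1 + norm x) ^ N0 * cmod (\<phi> x))" for m x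
  proof -
    have "(\<Sum>i\<in>I. cmod (conv (cutoff m) (k i) x * \<phi> x)) \<le> (\<Sum>i\<in>I. c i * (1 + norm x) ^ N0 * cmod (\<phi> x))"
      unfolding norm_mult by (intro sum_mono mult_right_mono c) auto
    then show ?thesis by (simp add: sum_distrib_right mult.assoc)
  qed
  have Wi: "integrable lborel W"
  proof -
    obtain C where C: "C \<ge> 0" "\<And>x::'a. (1 + norm x) ^ (N0 + 2 * DIM('a)) * cmod (\<phi> x) \<le> C"
      using psi_scaled_decay[OF e] unfolding \<phi>_def by blast
    show ?thesis
    proof (rule integrable_of_decay)
      show "W \<in> borel_measurable borel" unfolding W_def[abs_def] by measurable
      fix x :: 'a
      have s0: "sum c I \<ge> 0" by (intro sum_nonneg c)
      have o: "1 \<le> (1 + norm x) ^ (2 * DIM('a))" by (rule one_le_power) simp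
      have y: "(1 + norm x) ^ (2 * DIM('a)) * ((1 + norm x) ^ N0 * cmod (\<phi> x)) \<le> C" using C(2)[of x] by (simp add: power_add mult_ac)
      have "(1 + norm x) ^ (2 * DIM('a)) * norm (W x) \<le> ((1 + norm x) ^ (2 * DIM('a))) ^ 4 * W x"
        using power_increasing[OF _ o, of 1 4] by (auto simp: W_def intro!: mult_right_mono)
      also have "\<dots> = (sum c I * ((1 + norm x) ^ (2 * DIM('a)) * ((1 + norm x) ^ N0 * cmod (\<phi> x)))) ^ 4"
        unfolding W_def power_mult_distrib by (simp add: mult_ac)
      also have "\<dots> \<le> (sum c I * C) ^ 4" by (intro power_mono mult_left_mono y s0 mult_nonneg_nonneg) auto
      finally show "(1 + norm x) ^ (2 * DIM('a)) * norm (W x) \<le> (sum c I * C) ^ 4" .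
    qed
  qed
  have b1: "(cmod (\<Sum>i\<in>I. conv (cutoff m) (k i) x * \<phi> x)) ^ 4 \<le> W x" for m x
    unfolding W_def by (intro power_mono order.trans[OF norm_sum bsum]) simp
  have b2: "(\<Sum>i\<in>I. (cmod (conv (cutoff m) (k i) x * \<phi> x))\<^sup>2)\<^sup>2 \<le> W x" for m x
  proof -
    have "(\<Sum>i\<in>I. (cmod (conv (cutoff m) (k i) x * \<phi> x))\<^sup>2) \<le> (\<Sum>i\<in>I. cmod (conv (cutoff m) (k i) x * \<phi> x))\<^sup>2"
      by (rule sum_squares_le_square_sum[OF I]) simp
    also have "\<dots> \<le> (sum c I * ((1 + norm x) ^ N0 * cmod (\<phi> x)))\<^sup>2" by (intro power_mono bsum sum_nonneg) auto
    finally have "(\<Sum>i\<in>I. (cmod (conv (cutoff m) (k i) x * \<phi> x))\<^sup>2)\<^sup>2 \<le> ((sum c I * ((1 + norm x) ^ N0 * cmod (\<phi> x)))\<^sup>2)\<^sup>2"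
      by (intro power_mono sum_nonneg) auto
    then show ?thesis by (simp add: W_def flip: power_mult)
  qed
  have lim: "(\<lambda>m. conv (cutoff m) (k i) x * \<phi> x) \<longlonglongrightarrow> conv f (k i) x * \<phi> x" if "i \<in> I" for i x
    by (intro tendsto_intros conv_cutoff_tendsto k that)
  have L1: "(\<lambda>m. \<integral>x. (cmod (\<Sum>i\<in>I. conv (cutoff m) (k i) x * \<phi> x)) ^ 4 \<partial>lborel) \<longlonglongrightarrow> (\<integral>x. (cmod (\<Sum>i\<in>I. conv f (k i) x * \<phi> x)) ^ 4 \<partial>lborel)"
  proof (rule integral_dominated_convergence[where w=W])
    show "AE x in lborel. (\<lambda>m. (cmod (\<Sum>i\<in>I. conv (cutoff m) (k i) x * \<phi> x)) ^ 4) \<longlonglongrightarrow> (cmod (\<Sum>i\<in>I. conv f (k i) x * \<phi> x)) ^ 4"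
      by (intro AE_I2 tendsto_power tendsto_norm tendsto_sum lim)
    show "AE x in lborel. norm ((cmod (\<Sum>i\<in>I. conv (cutoff m) (k i) x * \<phi> x)) ^ 4) \<le> W x" for m
      using b1[of m] by (intro AE_I2) simp
    show "(\<lambda>x. (cmod (\<Sum>i\<in>I. conv (cutoff m) (k i) x * \<phi> x)) ^ 4) \<in> borel_measurable lborel" for m
      using cm[OF _ cutoff_meas] by measurable
    show "(\<lambda>x. (cmod (\<Sum>i\<in>I. conv f (k i) x * \<phi> x)) ^ 4) \<in> borel_measurable lborel"
      using cm[OF _ f_meas] by measurable
  qed (rule Wi)
  have L2: "(\<lambda>m. \<integral>x. (\<Sum>i\<in>I. (cmod (conv (cutoff m) (k i) x * \<phi> x))\<^sup>2)\<^sup>2 \<partial>lborel) \<longlonglongrightarrow> (\<integral>x. (\<Sum>i\<in>I. (cmod (conv f (k i) x * \<phi> x))\<^sup>2)\<^sup>2 \<partial>lborel)"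
  proof (rule integral_dominated_convergence[where w=W])
    show "AE x in lborel. (\<lambda>m. (\<Sum>i\<in>I. (cmod (conv (cutoff m) (k i) x * \<phi> x))\<^sup>2)\<^sup>2) \<longlonglongrightarrow> (\<Sum>i\<in>I. (cmod (conv f (k i) x * \<phi> x))\<^sup>2)\<^sup>2"
      by (intro AE_I2 tendsto_power tendsto_norm tendsto_sum lim)
    show "AE x in lborel. norm ((\<Sum>i\<in>I. (cmod (conv (cutoff m) (k i) x * \<phi> x))\<^sup>2)\<^sup>2) \<le> W x" for m
      using b2[of m] by (intro AE_I2) simp
    show "(\<lambda>x. (\<Sum>i\<in>I. (cmod (conv (cutoff m) (k i) x * \<phi> x))\<^sup>2)\<^sup>2) \<in> borel_measurable lborel" for m
      using cm[OF _ cutoff_meas] by measurable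
    show "(\<lambda>x. (\<Sum>i\<in>I. (cmod (conv f (k i) x * \<phi> x))\<^sup>2)\<^sup>2) \<in> borel_measurable lborel"
      using cm[OF _ f_meas] by measurable
  qed (rule Wi)
  have ev: "eventually (\<lambda>m. real DIM('a) / real (Suc m) \<le> \<rho>) sequentially"
  proof -
    have "(\<lambda>m. real DIM('a) / real (Suc m)) \<longlonglongrightarrow> 0" by (intro LIMSEQ_Suc[OF lim_const_over_n])
    then have "eventually (\<lambda>m. real DIM('a) / real (Suc m) < \<rho>) sequentially"
      using \<rho> by (intro order_tendstoD(2)) auto
    then show ?thesis by eventually_elim simp
  qed
  have lim_le: "(\<integral>x. (cmod (\<Sum>i\<in>I. conv f (k i) x * \<phi> x)) ^ 4 \<partial>lborel) \<le> K * (\<integral>x. (\<Sum>i\<in>I. (cmod (conv f (k i) x * \<phi> x))\<^sup>2)\<^sup>2 \<partial>lborel)"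
  proof (rule tendsto_le[OF _ tendsto_mult[OF tendsto_const L2] L1])
    show "eventually (\<lambda>m. (\<integral>x. (cmod (\<Sum>i\<in>I. conv (cutoff m) (k i) x * \<phi> x)) ^ 4 \<partial>lborel)
       \<le> K * (\<integral>x. (\<Sum>i\<in>I. (cmod (conv (cutoff m) (k i) x * \<phi> x))\<^sup>2)\<^sup>2 \<partial>lborel)) sequentially"
      using ev
    proof eventually_elim
      fix m assume m: "real DIM('a) / real (Suc m) \<le> \<rho>"
      obtain u where u: "nice u" "AE x in lborel. cutoff m x = u x" "fourier u = fourier (cutoff m)"
        using cutoff_nice[OF sp A] by blast
      have near: "\<exists>p\<in>A. dist p \<xi> \<le> \<rho>" if "fourier u \<xi> \<noteq> 0" for \<xi>
        using fourier_nice_cutoff_near[OF sp u(3) that] m by (meson order.trans)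
      have eq: "i \<in> I \<Longrightarrow> conv u (k i) x = conv (cutoff m) (k i) x" for i x
        using conv_cong_AE[OF u(2,1) k] by simp
      have "(\<integral>x. (cmod (\<Sum>i\<in>I. conv u (k i) x * \<phi> x)) ^ 4 \<partial>lborel)
         \<le> K * (\<integral>x. (\<Sum>i\<in>I. (cmod (conv u (k i) x * \<phi> x))\<^sup>2)\<^sup>2 \<partial>lborel)"
        using main[OF u(1) near] unfolding \<phi>_def .
      then show "(\<integral>x. (cmod (\<Sum>i\<in>I. conv (cutoff m) (k i) x * \<phi> x)) ^ 4 \<partial>lborel)
       \<le> K * (\<integral>x. (\<Sum>i\<in>I. (cmod (conv (cutoff m) (k i) x * \<phi> x))\<^sup>2)\<^sup>2 \<partial>lborel)"
        by (simp add: eq cong: sum.cong)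
    qed
  qed simp
  have i1: "integrable lborel (\<lambda>x. (cmod (\<Sum>i\<in>I. conv f (k i) x * \<phi> x)) ^ 4)"
  proof (rule Bochner_Integration.integrable_bound[OF Wi])
    show "(\<lambda>x. (cmod (\<Sum>i\<in>I. conv f (k i) x * \<phi> x)) ^ 4) \<in> borel_measurable lborel"
      using cm[OF _ f_meas] by measurable
    have "(cmod (\<Sum>i\<in>I. conv f (k i) x * \<phi> x)) ^ 4 \<le> W x" for x
      by (rule LIMSEQ_le_const2[OF tendsto_power[OF tendsto_norm[OF tendsto_sum[OF lim]]]]) (auto intro: b1)
    then show "AE x in lborel. norm ((cmod (\<Sum>i\<in>I. conv f (k i) x * \<phi> x)) ^ 4) \<le> norm (W x)"
      by (intro AE_I2) (simp add: W_def)
  qed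
  have i2: "integrable lborel (\<lambda>x. (\<Sum>i\<in>I. (cmod (conv f (k i) x * \<phi> x))\<^sup>2)\<^sup>2)"
  proof (rule Bochner_Integration.integrable_bound[OF Wi])
    show "(\<lambda>x. (\<Sum>i\<in>I. (cmod (conv f (k i) x * \<phi> x))\<^sup>2)\<^sup>2) \<in> borel_measurable lborel"
      using cm[OF _ f_meas] by measurable
    have "(\<Sum>i\<in>I. (cmod (conv f (k i) x * \<phi> x))\<^sup>2)\<^sup>2 \<le> W x" for x
      by (rule LIMSEQ_le_const2[OF tendsto_power[OF tendsto_sum[OF tendsto_power[OF tendsto_norm[OF lim]]]]]) (auto intro: b2)
    then show "AE x in lborel. norm ((\<Sum>i\<in>I. (cmod (conv f (k i) x * \<phi> x))\<^sup>2)\<^sup>2) \<le> norm (W x)"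
      by (intro AE_I2) (simp add: W_def)
  qed
  have "(\<integral>\<^sup>+x. ennreal ((cmod (\<Sum>i\<in>I. conv f (k i) x * \<phi> x)) ^ 4) \<partial>lborel) = ennreal (\<integral>x. (cmod (\<Sum>i\<in>I. conv f (k i) x * \<phi> x)) ^ 4 \<partial>lborel)"
    by (rule nn_integral_eq_integral[OF i1]) simp
  also have "\<dots> \<le> ennreal (K * (\<integral>x. (\<Sum>i\<in>I. (cmod (conv f (k i) x * \<phi> x))\<^sup>2)\<^sup>2 \<partial>lborel))" by (rule ennreal_leI[OF lim_le])
  also have "\<dots> = ennreal K * ennreal (\<integral>x. (\<Sum>i\<in>I. (cmod (conv f (k i) x * \<phi> x))\<^sup>2)\<^sup>2 \<partial>lborel)" by (rule ennreal_mult'[OF K])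
  also have "ennreal (\<integral>x. (\<Sum>i\<in>I. (cmod (conv f (k i) x * \<phi> x))\<^sup>2)\<^sup>2 \<partial>lborel) = (\<integral>\<^sup>+x. ennreal ((\<Sum>i\<in>I. (cmod (conv f (k i) x * \<phi> x))\<^sup>2)\<^sup>2) \<partial>lborel)"
    by (rule nn_integral_eq_integral[OF i2, symmetric]) simp
  also have "\<dots> \<le> (\<integral>\<^sup>+x. ennreal ((\<Sum>i\<in>I. (cmod (conv f (k i) x))\<^sup>2)\<^sup>2) \<partial>lborel)"
  proof (intro nn_integral_mono ennreal_leI power_mono sum_mono)
    fix x i show "cmod (conv f (k i) x * \<phi> x) \<le> cmod (conv f (k i) x)"
      unfolding norm_mult \<phi>_def by (intro mult_right_le_one_le psi_le) auto
  qed (auto intro: sum_nonneg)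
  finally show ?thesis unfolding \<phi>_def by (simp add: mult_left_mono)
qed

text \<open>The outer cutoff tends to 1 pointwise and the bound of \<open>transfer_step\<close> is
  uniform in \<epsilon>, so Fatou's lemma removes it. The right side may be infinite;
  \<open>f\<close> need not belong to L4.\<close>

theorem transfer:
  assumes sp: "fourier_supported_in f A" and A: "bounded A"
    and I: "finite I" and k: "\<And>i. i \<in> I \<Longrightarrow> rapid (k i)" and \<rho>: "\<rho> > 0" and K: "K \<ge> 0"
    and rep: "AE x in lborel. f x = (\<Sum>i\<in>I. conv f (k i) x)"
    and main: "\<And>u \<epsilon>. nice u \<Longrightarrow> (\<And>\<xi>. fourier u \<xi> \<noteq> 0 \<Longrightarrow> \<exists>p\<in>A. dist p \<xi> \<le> \<rho>) \<Longrightarrow> 0 < \<epsilon> \<Longrightarrow> \<epsilon> \<le> \<rho> \<Longrightarrow>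
       (\<integral>x. (cmod (\<Sum>i\<in>I. conv u (k i) x * psi (\<epsilon> *\<^sub>R x))) ^ 4 \<partial>lborel)
         \<le> K * (\<integral>x. (\<Sum>i\<in>I. (cmod (conv u (k i) x * psi (\<epsilon> *\<^sub>R x)))\<^sup>2)\<^sup>2 \<partial>lborel)"
  shows "(\<integral>\<^sup>+x. ennreal ((cmod (f x)) ^ 4) \<partial>lborel)
         \<le> ennreal K * (\<integral>\<^sup>+x. ennreal ((\<Sum>i\<in>I. (cmod (conv f (k i) x))\<^sup>2)\<^sup>2) \<partial>lborel)"
proof -
  define \<epsilon> where "\<epsilon> m = \<rho> / real (Suc m)" for m
  have e: "0 < \<epsilon> m" "\<epsilon> m \<le> \<rho>" for m using \<rho> by (auto simp: \<epsilon>_def field_simps)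
  define H where "H m x = (cmod (\<Sum>i\<in>I. conv f (k i) x * psi (\<epsilon> m *\<^sub>R x))) ^ 4" for m x
  have km: "i \<in> I \<Longrightarrow> k i \<in> borel_measurable borel" for i by (rule rapid_measurable[OF k])
  have cm: "conv f (k i) \<in> borel_measurable borel" if "i \<in> I" for i
    using km[OF that] unfolding Defs.convolution_def[abs_def] by measurable
  have Hm: "H m \<in> borel_measurable lborel" for m unfolding H_def[abs_def] using cm by measurable
  have Hl: "(\<lambda>m. H m x) \<longlonglongrightarrow> (cmod (\<Sum>i\<in>I. conv f (k i) x)) ^ 4" for x
  proof -
    have "(\<lambda>m. \<epsilon> m *\<^sub>R x) \<longlonglongrightarrow> 0 *\<^sub>R x"
      unfolding \<epsilon>_def by (intro tendsto_intros LIMSEQ_Suc[OF lim_const_over_n])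
    moreover have "isCont psi (0::'a)" using continuous_psi[where 'a='a] by (simp add: continuous_on_eq_continuous_at)
    ultimately have "(\<lambda>m. psi (\<epsilon> m *\<^sub>R x)) \<longlonglongrightarrow> psi (0::'a)"
      using isCont_tendsto_compose by fastforce
    then have "(\<lambda>m. H m x) \<longlonglongrightarrow> (cmod (\<Sum>i\<in>I. conv f (k i) x * psi (0::'a))) ^ 4"
      unfolding H_def by (intro tendsto_intros)
    then show ?thesis by (simp add: psi_0)
  qed
  have "(\<integral>\<^sup>+x. ennreal ((cmod (f x)) ^ 4) \<partial>lborel) = (\<integral>\<^sup>+x. liminf (\<lambda>m. ennreal (H m x)) \<partial>lborel)"
  proof (rule nn_integral_cong_AE)
    show "AE x in lborel. ennreal ((cmod (f x)) ^ 4) = liminf (\<lambda>m. ennreal (H m x))"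
      using rep
    proof eventually_elim
      fix x assume x: "f x = (\<Sum>i\<in>I. conv f (k i) x)"
      have "(\<lambda>m. ennreal (H m x)) \<longlonglongrightarrow> ennreal ((cmod (f x)) ^ 4)" using Hl[of x] x by (intro tendsto_ennrealI) simp
      then show "ennreal ((cmod (f x)) ^ 4) = liminf (\<lambda>m. ennreal (H m x))"
        by (intro lim_imp_Liminf[symmetric]) auto
    qed
  qed
  also have "\<dots> \<le> liminf (\<lambda>m. \<integral>\<^sup>+x. ennreal (H m x) \<partial>lborel)"
    by (rule nn_integral_liminf) (use Hm in measurable)
  also have "\<dots> \<le> ennreal K * (\<integral>\<^sup>+x. ennreal ((\<Sum>i\<in>I. (cmod (conv f (k i) x))\<^sup>2)\<^sup>2) \<partial>lborel)"
  proof (rule Liminf_le)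
    show "eventually (\<lambda>m. (\<integral>\<^sup>+x. ennreal (H m x) \<partial>lborel) \<le> ennreal K * (\<integral>\<^sup>+x. ennreal ((\<Sum>i\<in>I. (cmod (conv f (k i) x))\<^sup>2)\<^sup>2) \<partial>lborel)) sequentially"
      unfolding H_def by (intro always_eventually allI transfer_step[OF sp A I k \<rho> K main] e) auto
  qed simp
  finally show ?thesis .
qed

end

section \<open>Geometry of the sectors\<close>

definition dir :: "real \<Rightarrow> real^2" where "dir \<alpha> = vector [cos \<alpha>, sin \<alpha>]"

text \<open>\<open>yf \<alpha>\<close> is the component of \<xi> tangential to the circle at angle
  \<alpha>, and \<open>zf \<alpha>\<close> is \<tau> minus the radial component. The plane
  \<open>zf \<alpha> p = 0\<close> is tangent to the cone along the generator of angle \<alpha>, on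
  which \<open>yf \<alpha>\<close> vanishes as well.\<close>

definition yf :: "real \<Rightarrow> spacetime \<Rightarrow> real" where
  "yf \<alpha> p = fst p $ 2 * cos \<alpha> - fst p $ 1 * sin \<alpha>"

definition zf :: "real \<Rightarrow> spacetime \<Rightarrow> real" where
  "zf \<alpha> p = snd p - fst p $ 1 * cos \<alpha> - fst p $ 2 * sin \<alpha>"

lemma dir_nth [simp]: "dir \<alpha> $ 1 = cos \<alpha>" "dir \<alpha> $ 2 = sin \<alpha>"
  by (simp_all add: dir_def)

lemma norm_dir_diff: "(norm (dir \<alpha> - dir \<beta>))\<^sup>2 = (cos \<alpha> - cos \<beta>)\<^sup>2 + (sin \<alpha> - sin \<beta>)\<^sup>2"
  unfolding power2_norm_eq_inner inner_vec_def sum_2 by (simp add: power2_eq_square)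

lemma linear_yf: "linear (yf \<alpha>)" and linear_zf: "linear (zf \<alpha>)"
  by (rule linearI; simp add: yf_def zf_def algebra_simps)+

lemma abs_component_le: "\<bar>fst p $ i\<bar> \<le> norm p" "\<bar>snd p\<bar> \<le> norm p" for p :: spacetime
proof -
  show "\<bar>fst p $ i\<bar> \<le> norm p"
    using component_le_norm_cart[of "fst p" i] norm_fst_le[of "fst p" "snd p"] by simp
  show "\<bar>snd p\<bar> \<le> norm p" using norm_snd_le[of "snd p" "fst p"] by simp
qed

lemma yf_zf_le_norm: "\<bar>yf \<alpha> p\<bar> \<le> 2 * norm p" "\<bar>zf \<alpha> p\<bar> \<le> 3 * norm p"
proof -
  have c: "\<bar>x * cos \<alpha>\<bar> \<le> \<bar>x\<bar>" "\<bar>x * sin \<alpha>\<bar> \<le> \<bar>x\<bar>" for x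
    by (simp_all add: abs_mult mult_left_le)
  show "\<bar>yf \<alpha> p\<bar> \<le> 2 * norm p"
    using c(1)[of "fst p $ 2"] c(2)[of "fst p $ 1"] abs_component_le(1)[of p 1] abs_component_le(1)[of p 2] unfolding yf_def by linarith
  show "\<bar>zf \<alpha> p\<bar> \<le> 3 * norm p"
    using c(2)[of "fst p $ 2"] c(1)[of "fst p $ 1"] abs_component_le(1)[of p 1] abs_component_le(1)[of p 2] abs_component_le(2)[of p]
    unfolding zf_def by linarith
qed

lemma one_minus_cos_le: "1 - cos x \<le> x\<^sup>2 / 2" for x :: real
proof -
  have "1 - cos x = 2 * (sin (x / 2))\<^sup>2" using cos_double_sin[of "x / 2"] by simp
  also have "\<dots> \<le> 2 * \<bar>x / 2\<bar>\<^sup>2"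
    using power_mono[OF abs_sin_x_le_abs_x[of "x / 2"], of 2] by simp
  finally show ?thesis by (simp add: power2_eq_square)
qed

lemma arc_midpoint:
  assumes "arc_of_length l \<theta>"
  obtains \<alpha> where "\<And>w. w \<in> \<theta> \<Longrightarrow> \<exists>\<phi>. \<bar>\<phi>\<bar> \<le> l / 2 \<and> w = dir (\<alpha> + \<phi>)"
    "\<And>\<phi>. \<bar>\<phi>\<bar> < l / 2 \<Longrightarrow> dir (\<alpha> + \<phi>) \<in> \<theta>"
proof -
  obtain a I where aI: "{a<..<a + l} \<subseteq> I" "I \<subseteq> {a..a + l}" "\<theta> = (\<lambda>t. vector [cos t, sin t]) ` I"
    using assms by (auto simp: arc_of_length_def)
  have th: "\<theta> = dir ` I" unfolding aI(3) by (auto simp: dir_def)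
  show thesis
  proof (rule that[of "a + l / 2"])
    show "\<exists>\<phi>. \<bar>\<phi>\<bar> \<le> l / 2 \<and> w = dir (a + l / 2 + \<phi>)" if w: "w \<in> \<theta>" for w
    proof -
      obtain t where t: "t \<in> I" "w = dir t" using w unfolding th by blast
      have "t \<in> {a..a + l}" using t aI(2) by blast
      then have "\<bar>t - (a + l / 2)\<bar> \<le> l / 2" by (auto simp: abs_le_iff field_simps)
      then show ?thesis using t by (intro exI[of _ "t - (a + l / 2)"]) simp
    qed
    show "dir (a + l / 2 + \<phi>) \<in> \<theta>" if "\<bar>\<phi>\<bar> < l / 2" for \<phi>
    proof -
      have "a + l / 2 + \<phi> \<in> {a<..<a + l}" using that by (auto simp: abs_less_iff field_simps)
      then show ?thesis using aI(1) th by blast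
    qed
  qed
qed

lemma cone_nbhd_near:
  assumes "p \<in> cone_nbhd \<delta>"
  shows "\<bar>norm (fst p) - snd p\<bar> \<le> 2 * \<delta>" "1 - \<delta> \<le> snd p" "snd p \<le> 2 + \<delta>" "1 - \<delta> \<le> norm (fst p)" "norm (fst p) \<le> 2 + \<delta>"
proof -
  obtain q where q: "q \<in> cone" "dist q p \<le> \<delta>" using assms by (auto simp: cone_nbhd_def)
  have 1: "snd q = norm (fst q)" "1 \<le> snd q" "snd q \<le> 2" using q(1) by (auto simp: cone_def)
  have 2: "dist (fst q) (fst p) \<le> \<delta>" "dist (snd q) (snd p) \<le> \<delta>"
    using q(2) dist_fst_le[of q p] dist_snd_le[of q p] by linarith+
  have 3: "\<bar>norm (fst q) - norm (fst p)\<bar> \<le> \<delta>"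
    using 2(1) norm_triangle_ineq3[of "fst q" "fst p"] unfolding dist_norm by linarith
  show "\<bar>norm (fst p) - snd p\<bar> \<le> 2 * \<delta>" "1 - \<delta> \<le> snd p" "snd p \<le> 2 + \<delta>" "1 - \<delta> \<le> norm (fst p)" "norm (fst p) \<le> 2 + \<delta>"
    using 1 2(2) 3 unfolding dist_real_def by linarith+
qed

text \<open>In polar coordinates with radius \<open>r\<close> and angle
  \<open>\<alpha> + \<phi>\<close>, \<open>yf\<close> is \<open>r * sin \<phi>\<close> and
  \<open>zf\<close> is \<open>(\<tau> - r) + r * (1 - cos \<phi>)\<close>. The second term is
  quadratic in the arc length, which is why arcs of length about \<open>sqrt \<delta>\<close> match
  the thickness \<delta>.\<close>

lemma sector_bounds:
  assumes p: "p \<in> sector \<delta> \<theta>" and d: "0 < \<delta>" "\<delta> < 1"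
    and \<alpha>: "\<And>w. w \<in> \<theta> \<Longrightarrow> \<exists>\<phi>. \<bar>\<phi>\<bar> \<le> l / 2 \<and> w = dir (\<alpha> + \<phi>)"
  shows "\<bar>yf \<alpha> p\<bar> \<le> 2 * l" "\<bar>zf \<alpha> p\<bar> \<le> 2 * \<delta> + l\<^sup>2"
proof -
  have n: "p \<in> cone_nbhd \<delta>" and "fst p /\<^sub>R norm (fst p) \<in> \<theta>" using p by (auto simp: sector_def)
  then obtain \<phi> where \<phi>: "\<bar>\<phi>\<bar> \<le> l / 2" "fst p /\<^sub>R norm (fst p) = dir (\<alpha> + \<phi>)" using \<alpha> by blast
  define r where "r = norm (fst p)"
  note b = cone_nbhd_near[OF n, folded r_def]
  have r: "0 < r" "r \<le> 3" using b d by linarith+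
  have "fst p = r *\<^sub>R dir (\<alpha> + \<phi>)" using \<phi>(2) r by (simp add: r_def flip: \<phi>(2))
  then have c: "fst p $ 1 = r * cos (\<alpha> + \<phi>)" "fst p $ 2 = r * sin (\<alpha> + \<phi>)" by simp_all
  have "yf \<alpha> p = r * (sin (\<alpha> + \<phi>) * cos \<alpha> - cos (\<alpha> + \<phi>) * sin \<alpha>)"
    unfolding yf_def c by (simp add: algebra_simps)
  also have "\<dots> = r * sin \<phi>" unfolding sin_diff[symmetric] by simp
  finally have y: "yf \<alpha> p = r * sin \<phi>" .
  have "zf \<alpha> p = snd p - r * (cos (\<alpha> + \<phi>) * cos \<alpha> + sin (\<alpha> + \<phi>) * sin \<alpha>)"
    unfolding zf_def c by (simp add: algebra_simps)
  also have "cos (\<alpha> + \<phi>) * cos \<alpha> + sin (\<alpha> + \<phi>) * sin \<alpha> = cos \<phi>" unfolding cos_diff[symmetric] by simp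
  finally have z: "zf \<alpha> p = (snd p - r) + r * (1 - cos \<phi>)" by (simp add: algebra_simps)
  have "\<bar>yf \<alpha> p\<bar> = r * \<bar>sin \<phi>\<bar>" using r by (simp add: y abs_mult)
  also have "\<dots> \<le> 3 * (l / 2)" using r \<phi>(1) abs_sin_x_le_abs_x[of \<phi>] by (intro mult_mono) auto
  finally show "\<bar>yf \<alpha> p\<bar> \<le> 2 * l" using \<phi>(1) by linarith
  have "\<phi>\<^sup>2 \<le> (l / 2)\<^sup>2" using power_mono[OF \<phi>(1), of 2] by simp
  then have "1 - cos \<phi> \<le> l\<^sup>2 / 8" using one_minus_cos_le[of \<phi>] by (simp add: power2_eq_square)
  then have "r * (1 - cos \<phi>) \<le> 3 * (l\<^sup>2 / 8)" using r by (intro mult_mono) auto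
  moreover have "0 \<le> r * (1 - cos \<phi>)" using r by simp
  moreover have "0 \<le> l\<^sup>2" by simp
  ultimately show "\<bar>zf \<alpha> p\<bar> \<le> 2 * \<delta> + l\<^sup>2" unfolding z using b(1) by (simp add: abs_le_iff)
qed

text \<open>The small dilate contains the center and its translates by plus and minus
  \<open>1 / (2 * K)\<close> times an edge; comparing the two bounds the functional on each edge by
  \<open>2 * K * b\<close>. In \<open>dilate 2 B\<close> the edges have coefficients at most 1, so
  the center and three edges add up to \<open>1 + 6 * K\<close>.\<close>

lemma dilate_linear_bound:
  fixes L :: "spacetime \<Rightarrow> real"
  assumes L: "linear L" and b: "\<And>p. p \<in> \<Theta> \<Longrightarrow> \<bar>L p\<bar> \<le> b" and sub: "dilate (1 / K) B \<subseteq> \<Theta>" and K: "K > 0"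
    and p: "p \<in> dilate 2 B"
  shows "\<bar>L p\<bar> \<le> (1 + 6 * K) * b"
proof -
  have Lb: "L (box_map B t) = L (center B) + (t $ 1) * L (edge1 B) + (t $ 2) * L (edge2 B) + (t $ 3) * L (edge3 B)" for t
    unfolding box_map_def by (simp add: linear_add[OF L] linear_scale[OF L])
  have bx: "\<bar>L (box_map B t)\<bar> \<le> b" if "\<And>i. \<bar>t $ i\<bar> \<le> 1 / K / 2" for t
  proof -
    have "box_map B t \<in> dilate (1 / K) B" unfolding dilate_def using that by blast
    then show ?thesis using sub b by blast
  qed
  let ?h = "1 / K / 2"
  have h: "0 \<le> ?h" using K by simp
  have c: "\<bar>L (center B)\<bar> \<le> b" using bx[of 0] h unfolding Lb by simp
  have e: "\<bar>L (edge1 B)\<bar> \<le> 2 * K * b" "\<bar>L (edge2 B)\<bar> \<le> 2 * K * b" "\<bar>L (edge3 B)\<bar> \<le> 2 * K * b"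
  proof -
    have *: "\<bar>E\<bar> \<le> 2 * K * b" if "\<bar>C + ?h * E\<bar> \<le> b" "\<bar>C - ?h * E\<bar> \<le> b" for C E
    proof -
      have "\<bar>?h * E\<bar> \<le> b" using that by (auto simp: abs_le_iff)
      then have "?h * \<bar>E\<bar> \<le> b" using h by (simp add: abs_mult)
      then show ?thesis using K by (simp add: field_simps)
    qed
    have v: "\<bar>(vector [x, y, z] :: real^3) $ i\<bar> \<le> ?h" if "\<bar>x\<bar> \<le> ?h" "\<bar>y\<bar> \<le> ?h" "\<bar>z\<bar> \<le> ?h" for x y z i
      using that exhaust_3[of i] by auto
    show "\<bar>L (edge1 B)\<bar> \<le> 2 * K * b"
      by (rule *[of "L (center B)"]) (use bx[OF v, of ?h 0 0] bx[OF v, of "- ?h" 0 0] h in \<open>auto simp: Lb\<close>)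
    show "\<bar>L (edge2 B)\<bar> \<le> 2 * K * b"
      by (rule *[of "L (center B)"]) (use bx[OF v, of 0 ?h 0] bx[OF v, of 0 "- ?h" 0] h in \<open>auto simp: Lb\<close>)
    show "\<bar>L (edge3 B)\<bar> \<le> 2 * K * b"
      by (rule *[of "L (center B)"]) (use bx[OF v, of 0 0 ?h] bx[OF v, of 0 0 "- ?h"] h in \<open>auto simp: Lb\<close>)
  qed
  obtain t where t: "\<And>i. \<bar>t $ i\<bar> \<le> 1" "p = box_map B t" using p by (auto simp: dilate_def)
  have m: "\<bar>(t $ i) * E\<bar> \<le> 2 * K * b" if "\<bar>E\<bar> \<le> 2 * K * b" for E i
  proof -
    have "\<bar>t $ i\<bar> * \<bar>E\<bar> \<le> 1 * \<bar>E\<bar>" by (intro mult_right_mono t) simp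
    then show ?thesis using that by (simp add: abs_mult)
  qed
  have "(1 + 6 * K) * b = b + 2 * K * b + 2 * K * b + 2 * K * b" by (simp add: algebra_simps)
  then show ?thesis unfolding t(2) Lb using c m[OF e(1), of 1] m[OF e(2), of 2] m[OF e(3), of 3] by linarith
qed

text \<open>The coordinates \<open>(\<tau> + s \<xi>\<^sub>1, \<xi>\<^sub>2 / 4, (\<tau> - s \<xi>\<^sub>1) / 16)\<close> parametrize the half \<open>s \<xi>\<^sub>1 \<ge> 0\<close> of the cone by
  \<open>t = st s \<alpha> / 4\<close> with \<open>|t| \<le> 1 / 4\<close>; the vectors below arise from the shear that replaces \<open>t\<close> by \<open>t + 1 / 2\<close>.\<close>

definition va :: "real \<Rightarrow> spacetime" where "va s = (vector [s, 0], 1)"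
definition vb :: "real \<Rightarrow> spacetime" where "vb s = (vector [s / 2, 1 / 4], 1 / 2)"
definition vc :: "real \<Rightarrow> spacetime" where "vc s = (vector [3 * s / 16, 1 / 4], 5 / 16)"

lemma inner_v:
  "p \<bullet> va s = snd p + s * fst p $ 1"
  "p \<bullet> vb s = (snd p + s * fst p $ 1) / 2 + fst p $ 2 / 4"
  "p \<bullet> vc s = (snd p - s * fst p $ 1) / 16 + fst p $ 2 / 4 + (snd p + s * fst p $ 1) / 4"
  by (cases p; simp add: va_def vb_def vc_def inner_vec_def sum_2 field_simps)+

lemma va_nonzero: "va s \<noteq> 0"
  by (simp add: va_def zero_prod_def)

lemma cone_coords_v:
  assumes s: "s = 1 \<or> s = - 1"
  shows "cone_coords (va s) (vb s) (vc s) 40"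
proof
  fix p :: spacetime
  have "norm p \<le> norm (fst p) + norm (snd p)" using norm_Pair_le[of "fst p" "snd p"] by simp
  also have "norm (fst p) \<le> \<bar>fst p $ 1\<bar> + \<bar>fst p $ 2\<bar>" using norm_le_l1_cart[of "fst p"] by (simp add: sum_2)
  finally have n: "norm p \<le> \<bar>fst p $ 1\<bar> + \<bar>fst p $ 2\<bar> + \<bar>snd p\<bar>" by simp
  define A where "A = p \<bullet> va s"
  define B where "B = p \<bullet> vb s"
  define C where "C = p \<bullet> vc s"
  have e: "fst p $ 2 = 4 * (B - A / 2)" "snd p = (A + 16 * (C - B + A / 4)) / 2" "s * fst p $ 1 = (A - 16 * (C - B + A / 4)) / 2"
    unfolding A_def B_def C_def inner_v by (simp_all add: field_simps)
  have "\<bar>fst p $ 1\<bar> = \<bar>s * fst p $ 1\<bar>" using s by auto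
  have ab: "A \<le> \<bar>A\<bar>" "- A \<le> \<bar>A\<bar>" "B \<le> \<bar>B\<bar>" "- B \<le> \<bar>B\<bar>" "C \<le> \<bar>C\<bar>" "- C \<le> \<bar>C\<bar>" by simp_all
  have "\<bar>s * fst p $ 1\<bar> \<le> 10 * (\<bar>A\<bar> + \<bar>B\<bar> + \<bar>C\<bar>)" unfolding e abs_le_iff by (intro conjI) (use ab in argo)+
  with \<open>\<bar>fst p $ 1\<bar> = \<bar>s * fst p $ 1\<bar>\<close> have "\<bar>fst p $ 1\<bar> \<le> 10 * (\<bar>A\<bar> + \<bar>B\<bar> + \<bar>C\<bar>)" by simp
  moreover have "\<bar>fst p $ 2\<bar> \<le> 10 * (\<bar>A\<bar> + \<bar>B\<bar> + \<bar>C\<bar>)" unfolding e abs_le_iff by (intro conjI) (use ab in argo)+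
  moreover have "\<bar>snd p\<bar> \<le> 10 * (\<bar>A\<bar> + \<bar>B\<bar> + \<bar>C\<bar>)" unfolding e abs_le_iff by (intro conjI) (use ab in argo)+
  ultimately show "norm p \<le> 40 * (\<bar>p \<bullet> va s\<bar> + \<bar>p \<bullet> vb s\<bar> + \<bar>p \<bullet> vc s\<bar>)"
    unfolding A_def[symmetric] B_def[symmetric] C_def[symmetric] using n by linarith
qed

text \<open>The half-angle parameter: \<open>tan (\<alpha> / 2)\<close> for \<open>s = 1\<close> and
  its reciprocal for \<open>s = - 1\<close>. On the half circle
  \<open>s * cos \<alpha> \<ge> 0\<close> it lies between -1 and 1, so that \<open>tpar\<close> lies
  between 1/4 and 3/4, well inside the root node.\<close>

definition st :: "real \<Rightarrow> real \<Rightarrow> real" where "st s \<alpha> = sin \<alpha> / (1 + s * cos \<alpha>)"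
definition tpar :: "real \<Rightarrow> real \<Rightarrow> real" where "tpar s \<alpha> = 1 / 2 + st s \<alpha> / 4"

lemma st_facts:
  assumes s: "s = 1 \<or> s = - 1" and c: "s * cos \<alpha> \<ge> 0"
  shows "\<bar>st s \<alpha>\<bar> \<le> 1" "s * cos \<alpha> = (1 - (st s \<alpha>)\<^sup>2) / (1 + (st s \<alpha>)\<^sup>2)" "sin \<alpha> = 2 * st s \<alpha> / (1 + (st s \<alpha>)\<^sup>2)"
proof -
  define \<mu> where "\<mu> = s * cos \<alpha>"
  have m: "\<mu> \<ge> 0" "1 + \<mu> > 0" "1 + \<mu> \<noteq> 0" using c by (auto simp: \<mu>_def)
  have "\<mu>\<^sup>2 = (cos \<alpha>)\<^sup>2" using s by (auto simp: \<mu>_def)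
  then have sm: "(sin \<alpha>)\<^sup>2 = 1 - \<mu>\<^sup>2" using sin_cos_squared_add[of \<alpha>] by linarith
  have t: "st s \<alpha> = sin \<alpha> / (1 + \<mu>)" by (simp add: st_def \<mu>_def)
  have t2: "(st s \<alpha>)\<^sup>2 = (1 - \<mu>) / (1 + \<mu>)"
  proof -
    have "(st s \<alpha>)\<^sup>2 = (1 - \<mu>) * (1 + \<mu>) / ((1 + \<mu>) * (1 + \<mu>))"
      unfolding t power_divide sm by (simp add: power2_eq_square algebra_simps)
    then show ?thesis using m by simp
  qed
  have "\<bar>sin \<alpha>\<bar> \<le> 1 + \<mu>" using m abs_sin_le_one[of \<alpha>] by linarith
  then show "\<bar>st s \<alpha>\<bar> \<le> 1" using m by (simp add: t)
  have one: "1 + (st s \<alpha>)\<^sup>2 = 2 / (1 + \<mu>)" unfolding t2 using m by (simp add: field_simps)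
  have "1 - (st s \<alpha>)\<^sup>2 = 2 * \<mu> / (1 + \<mu>)" unfolding t2 using m by (simp add: field_simps)
  then show "s * cos \<alpha> = (1 - (st s \<alpha>)\<^sup>2) / (1 + (st s \<alpha>)\<^sup>2)" unfolding one using m by (simp add: \<mu>_def)
  show "sin \<alpha> = 2 * st s \<alpha> / (1 + (st s \<alpha>)\<^sup>2)" unfolding one using m by (simp add: t)
qed

text \<open>Chord length in stereographic coordinates: the squared distance of the directions is
  \<open>4 * (t - u)\<^sup>2 / ((1 + t\<^sup>2) * (1 + u\<^sup>2))\<close>. It serves to show that
  separated directions have separated parameters.\<close>

lemma dir_le_st:
  assumes s: "s = 1 \<or> s = - 1" and c: "s * cos \<alpha> \<ge> 0" "s * cos \<beta> \<ge> 0"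
  shows "norm (dir \<alpha> - dir \<beta>) \<le> 2 * \<bar>st s \<alpha> - st s \<beta>\<bar>"
proof -
  define t where "t = st s \<alpha>"
  define u where "u = st s \<beta>"
  note T = st_facts[OF s c(1), folded t_def] and U = st_facts[OF s c(2), folded u_def]
  have p: "1 \<le> 1 + t\<^sup>2" "1 \<le> 1 + u\<^sup>2" "1 + t\<^sup>2 \<noteq> 0" "1 + u\<^sup>2 \<noteq> 0"
    using zero_le_power2[of t] zero_le_power2[of u] by linarith+
  have "(norm (dir \<alpha> - dir \<beta>))\<^sup>2 = (cos \<alpha> - cos \<beta>)\<^sup>2 + (sin \<alpha> - sin \<beta>)\<^sup>2"
    by (rule norm_dir_diff)
  also have "(cos \<alpha> - cos \<beta>)\<^sup>2 = (s * cos \<alpha> - s * cos \<beta>)\<^sup>2" using s by (auto simp: power2_commute)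
  also have "\<dots> + (sin \<alpha> - sin \<beta>)\<^sup>2 = 4 * (t - u)\<^sup>2 / ((1 + t\<^sup>2) * (1 + u\<^sup>2))"
  proof -
    have a: "s * cos \<alpha> - s * cos \<beta> = 2 * (u\<^sup>2 - t\<^sup>2) / ((1 + t\<^sup>2) * (1 + u\<^sup>2))"
      unfolding T(2) U(2) using p by (simp add: field_simps)
    have b: "sin \<alpha> - sin \<beta> = 2 * (t - u) * (1 - t * u) / ((1 + t\<^sup>2) * (1 + u\<^sup>2))"
      unfolding T(3) U(3) using p by (simp add: field_simps power2_eq_square)
    have "(2 * (u\<^sup>2 - t\<^sup>2))\<^sup>2 + (2 * (t - u) * (1 - t * u))\<^sup>2 = 4 * (t - u)\<^sup>2 * ((1 + t\<^sup>2) * (1 + u\<^sup>2))"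
      by (simp add: power2_eq_square algebra_simps)
    then show ?thesis unfolding a b power_divide add_divide_distrib[symmetric]
      using p by (simp add: power2_eq_square)
  qed
  also have "\<dots> \<le> (2 * \<bar>t - u\<bar>)\<^sup>2"
  proof -
    have "1 * 1 \<le> (1 + t\<^sup>2) * (1 + u\<^sup>2)" using p by (intro mult_mono) auto
    then show ?thesis using p by (simp add: divide_le_eq power_mult_distrib mult_left_le_one_le mult_right_le_one_le mult_le_cancel_left1)
  qed
  finally show ?thesis unfolding t_def u_def by (rule power2_le_imp_le) simp
qed

text \<open>A chord of length at most 1 keeps the cosine of the difference of angles at 1/2 or more,
  so the arctangent recovers an angle of comparable size.\<close>

lemma dir_near:
  assumes d: "norm (dir \<beta> - dir \<alpha>) \<le> \<eta>" and e: "\<eta> \<le> 1"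
  obtains \<phi> where "\<bar>\<phi>\<bar> \<le> 2 * \<eta>" "dir \<beta> = dir (\<alpha> + \<phi>)"
proof -
  define u where "u = cos (\<beta> - \<alpha>)"
  define v where "v = sin (\<beta> - \<alpha>)"
  have uv: "u\<^sup>2 + v\<^sup>2 = 1" by (simp add: u_def v_def)
  have n: "(norm (dir \<beta> - dir \<alpha>))\<^sup>2 = 2 - 2 * u"
  proof -
    have "(norm (dir \<beta> - dir \<alpha>))\<^sup>2 = (cos \<beta> - cos \<alpha>)\<^sup>2 + (sin \<beta> - sin \<alpha>)\<^sup>2"
      by (rule norm_dir_diff)
    also have "\<dots> = ((cos \<beta>)\<^sup>2 + (sin \<beta>)\<^sup>2) + ((cos \<alpha>)\<^sup>2 + (sin \<alpha>)\<^sup>2) - 2 * (cos \<beta> * cos \<alpha> + sin \<beta> * sin \<alpha>)"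
      by (simp only: power2_eq_square algebra_simps)
    finally show ?thesis by (simp add: u_def cos_diff)
  qed
  have e0: "\<eta> \<ge> 0" using d norm_ge_zero order.trans by blast
  have n2: "2 - 2 * u \<le> \<eta>\<^sup>2" using power_mono[OF d, of 2] n by simp
  moreover have "\<eta>\<^sup>2 \<le> 1" using e e0 by (simp add: power_le_one)
  ultimately have u: "1 / 2 \<le> u" by linarith
  have u1: "u \<le> 1" by (simp add: u_def)
  have v: "\<bar>v\<bar> \<le> \<eta>"
  proof (rule power2_le_imp_le[OF _ e0])
    have "v\<^sup>2 = (1 - u) * (1 + u)" using uv by (simp add: power2_eq_square algebra_simps)
    also have "\<dots> \<le> (1 - u) * 2" using u1 by (intro mult_left_mono) auto
    finally show "\<bar>v\<bar>\<^sup>2 \<le> \<eta>\<^sup>2" using n2 by simp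
  qed
  define \<phi> where "\<phi> = arctan (v / u)"
  have "1 + (v / u)\<^sup>2 = (1 / u)\<^sup>2" using uv u by (simp add: field_simps)
  then have sq: "sqrt (1 + (v / u)\<^sup>2) = 1 / u" using u by (simp add: real_sqrt_abs del: power_divide)
  have c: "cos \<phi> = u" "sin \<phi> = v" unfolding \<phi>_def cos_arctan sin_arctan sq using u by auto
  have "\<bar>\<phi>\<bar> \<le> \<bar>v / u\<bar>" unfolding \<phi>_def by (rule abs_arctan_le)
  also have "\<dots> = \<bar>v\<bar> / u" using u by simp
  also have "\<dots> \<le> \<eta> / (1 / 2)" using u v by (intro frac_le) auto
  finally have "\<bar>\<phi>\<bar> \<le> 2 * \<eta>" by simp
  moreover have "dir \<beta> = dir (\<alpha> + \<phi>)"
  proof -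
    have "cos (\<alpha> + \<phi>) = cos (\<alpha> + (\<beta> - \<alpha>))" "sin (\<alpha> + \<phi>) = sin (\<alpha> + (\<beta> - \<alpha>))"
      unfolding cos_add[of \<alpha>] sin_add[of \<alpha>] c u_def v_def by simp_all
    then show ?thesis by (simp add: dir_def)
  qed
  ultimately show thesis by (rule that)
qed

text \<open>The link between the two coordinate systems: at the parameter of angle \<alpha>,
  \<open>qd\<close> is a multiple of \<open>zf\<close>, both vanishing on the same tangent plane,
  and \<open>lin\<close> is a combination of \<open>yf\<close> and \<open>zf\<close>. The half-angle
  formulas reduce this to algebra.\<close>

lemma lin_qd_identity:
  assumes s: "s = 1 \<or> s = - 1" and c: "s * cos \<alpha> \<ge> 0"
  shows "p \<bullet> vb s - tpar s \<alpha> * (p \<bullet> va s) = (s * yf \<alpha> p - st s \<alpha> * zf \<alpha> p) / 4"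
    "p \<bullet> vc s - 2 * tpar s \<alpha> * (p \<bullet> vb s) + (tpar s \<alpha>)\<^sup>2 * (p \<bullet> va s) = (1 + (st s \<alpha>)\<^sup>2) * zf \<alpha> p / 16"
proof -
  define t where "t = st s \<alpha>"
  define \<mu> where "\<mu> = s * cos \<alpha>"
  define X where "X = s * fst p $ 1"
  note T = st_facts[OF s c, folded t_def \<mu>_def]
  have q: "1 + t\<^sup>2 \<noteq> 0" using zero_le_power2[of t] by linarith
  have ss: "s * s = 1" using s by auto
  have "s * (cos \<alpha> * s) = cos \<alpha>" using ss by (metis mult.left_commute mult.right_neutral)
  then have cX: "fst p $ 1 * cos \<alpha> = X * \<mu>" unfolding X_def \<mu>_def by (metis mult.assoc mult.commute)
  have y: "s * yf \<alpha> p = fst p $ 2 * \<mu> - X * sin \<alpha>" by (simp add: yf_def X_def \<mu>_def algebra_simps)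
  have z: "zf \<alpha> p = snd p - X * \<mu> - fst p $ 2 * sin \<alpha>" by (simp add: zf_def cX)
  have e1: "(1 + t\<^sup>2) * \<mu> = 1 - t\<^sup>2" "(1 + t\<^sup>2) * sin \<alpha> = 2 * t" using T(2,3) q by simp_all
  show "p \<bullet> vc s - 2 * tpar s \<alpha> * (p \<bullet> vb s) + (tpar s \<alpha>)\<^sup>2 * (p \<bullet> va s) = (1 + (st s \<alpha>)\<^sup>2) * zf \<alpha> p / 16"
  proof -
    have "(1 + t\<^sup>2) * zf \<alpha> p = (1 + t\<^sup>2) * snd p - X * ((1 + t\<^sup>2) * \<mu>) - fst p $ 2 * ((1 + t\<^sup>2) * sin \<alpha>)"
      unfolding z by (simp add: algebra_simps)
    also have "\<dots> = (1 + t\<^sup>2) * snd p - X * (1 - t\<^sup>2) - fst p $ 2 * (2 * t)" unfolding e1 ..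
    finally have "(1 + t\<^sup>2) * zf \<alpha> p = (1 + t\<^sup>2) * snd p - X * (1 - t\<^sup>2) - fst p $ 2 * (2 * t)" .
    then show ?thesis unfolding inner_v tpar_def t_def[symmetric] X_def[symmetric]
      by (simp add: field_simps power2_eq_square)
  qed
  show "p \<bullet> vb s - tpar s \<alpha> * (p \<bullet> va s) = (s * yf \<alpha> p - st s \<alpha> * zf \<alpha> p) / 4"
  proof -
    have m2: "\<mu> + t * sin \<alpha> = 1"
    proof -
      have "(1 + t\<^sup>2) * (\<mu> + t * sin \<alpha>) = (1 + t\<^sup>2) * \<mu> + t * ((1 + t\<^sup>2) * sin \<alpha>)" by (simp add: algebra_simps)
      also have "\<dots> = (1 + t\<^sup>2) * 1" unfolding e1 by (simp add: power2_eq_square)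
      finally show ?thesis using q by simp
    qed
    have m1: "sin \<alpha> - t * \<mu> = t"
    proof -
      have "(1 + t\<^sup>2) * (sin \<alpha> - t * \<mu>) = (1 + t\<^sup>2) * sin \<alpha> - t * ((1 + t\<^sup>2) * \<mu>)" by (simp add: algebra_simps)
      also have "\<dots> = (1 + t\<^sup>2) * t" unfolding e1 by (simp add: power2_eq_square algebra_simps)
      finally show ?thesis using q by simp
    qed
    have "s * yf \<alpha> p - t * zf \<alpha> p = fst p $ 2 * (\<mu> + t * sin \<alpha>) - X * (sin \<alpha> - t * \<mu>) - t * snd p"
      unfolding y z by (simp add: algebra_simps)
    also have "\<dots> = fst p $ 2 - X * t - t * snd p" unfolding m1 m2 by simp
    finally show ?thesis unfolding inner_v tpar_def t_def[symmetric] X_def[symmetric]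
      by (simp add: field_simps)
  qed
qed

text \<open>The number of levels has to be a multiple of 32. Rounding up to such a power of 2 loses
  at most the factor \<open>2 ^ 32\<close>, which goes into the constants.\<close>

lemma power_scale_exists:
  assumes "x \<ge> (1::real)"
  obtains \<kappa> :: nat where "x \<le> 2 ^ (32 * \<kappa>)" "2 ^ (32 * \<kappa>) \<le> 2 ^ 32 * x"
proof -
  obtain N :: nat where N: "x < (2 ^ 32) ^ N" using real_arch_pow[of "2 ^ 32" x] by auto
  define \<kappa> where "\<kappa> = (LEAST k. x \<le> (2 ^ 32) ^ k)"
  have 1: "x \<le> (2 ^ 32) ^ \<kappa>" unfolding \<kappa>_def by (rule LeastI[of _ N]) (use N in linarith)
  have 2: "(2 ^ 32) ^ \<kappa> \<le> 2 ^ 32 * x"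
  proof (cases \<kappa>)
    case 0
    then show ?thesis using assms by simp
  next
    case (Suc k)
    have "\<not> x \<le> (2 ^ 32) ^ k" using not_less_Least[of k "\<lambda>k. x \<le> (2 ^ 32) ^ k"] Suc unfolding \<kappa>_def by auto
    then show ?thesis unfolding Suc by simp
  qed
  show thesis using that[of \<kappa>] 1 2 unfolding power_mult by blast
qed

section \<open>From sectors to dyadic nodes\<close>

locale cone_sectors =
  fixes K \<delta> :: real and P :: "(real^2) set set" and B :: "spacetime set \<Rightarrow> rbox"
  assumes K1: "K \<ge> 1" and d0: "0 < \<delta>" and d1: "\<delta> < 1" and arcs: "arc_partition K \<delta> P"
    and boxes: "\<And>\<Theta>. \<Theta> \<in> sectors \<delta> P \<Longrightarrow> comparable_box K \<delta> \<Theta> (B \<Theta>)"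
begin

lemma finite_sectors: "finite (sectors \<delta> P)"
  using arcs by (simp add: arc_partition_def sectors_def)

lemma sqrt_d: "0 < sqrt \<delta>" "sqrt \<delta> < 1" "sqrt \<delta> * sqrt \<delta> = \<delta>"
  using d0 d1 by auto

text \<open>The bounds on the dilated box come from those on the sector, because the edges of the box are multiples of
  differences of points of the sector.\<close>

lemma angles_exist:
  "\<exists>ang. (\<forall>\<Theta>\<in>sectors \<delta> P. \<forall>p\<in>dilate 2 (B \<Theta>). \<bar>yf (ang \<Theta>) p\<bar> \<le> 14 * K\<^sup>2 * sqrt \<delta> \<and> \<bar>zf (ang \<Theta>) p\<bar> \<le> 21 * K ^ 3 * \<delta>)
     \<and> (\<forall>\<Theta>\<in>sectors \<delta> P. \<forall>\<Theta>'\<in>sectors \<delta> P. norm (dir (ang \<Theta>) - dir (ang \<Theta>')) < sqrt \<delta> / (4 * K) \<longrightarrow> \<Theta> = \<Theta>')"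
proof -
  define Q where "Q \<Theta> \<theta> l \<alpha> \<longleftrightarrow> \<Theta> = sector \<delta> \<theta> \<and> \<theta> \<in> P \<and> sqrt \<delta> / K \<le> l \<and> l \<le> K * sqrt \<delta> \<and>
      (\<forall>w\<in>\<theta>. \<exists>\<phi>. \<bar>\<phi>\<bar> \<le> l / 2 \<and> w = dir (\<alpha> + \<phi>)) \<and> (\<forall>\<phi>. \<bar>\<phi>\<bar> < l / 2 \<longrightarrow> dir (\<alpha> + \<phi>) \<in> \<theta>)" for \<Theta> \<theta> l \<alpha>
  have "\<exists>\<theta> l \<alpha>. Q \<Theta> \<theta> l \<alpha>" if S: "\<Theta> \<in> sectors \<delta> P" for \<Theta>
  proof -
    obtain \<theta> where th: "\<theta> \<in> P" "\<Theta> = sector \<delta> \<theta>" using S by (auto simp: sectors_def)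
    then obtain l where l: "sqrt \<delta> / K \<le> l" "l \<le> K * sqrt \<delta>" "arc_of_length l \<theta>"
      using arcs by (auto simp: arc_partition_def)
    obtain \<alpha> where "\<And>w. w \<in> \<theta> \<Longrightarrow> \<exists>\<phi>. \<bar>\<phi>\<bar> \<le> l / 2 \<and> w = dir (\<alpha> + \<phi>)" "\<And>\<phi>. \<bar>\<phi>\<bar> < l / 2 \<Longrightarrow> dir (\<alpha> + \<phi>) \<in> \<theta>"
      using arc_midpoint[OF l(3)] by blast
    then show ?thesis unfolding Q_def using th l by blast
  qed
  then obtain \<theta> l ang where Q: "\<And>\<Theta>. \<Theta> \<in> sectors \<delta> P \<Longrightarrow> Q \<Theta> (\<theta> \<Theta>) (l \<Theta>) (ang \<Theta>)" by metis
  have T: "\<And>\<Theta>. \<Theta> \<in> sectors \<delta> P \<Longrightarrow> \<Theta> = sector \<delta> (\<theta> \<Theta>)" "\<And>\<Theta>. \<Theta> \<in> sectors \<delta> P \<Longrightarrow> \<theta> \<Theta> \<in> P"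
    "\<And>\<Theta>. \<Theta> \<in> sectors \<delta> P \<Longrightarrow> sqrt \<delta> / K \<le> l \<Theta>" "\<And>\<Theta>. \<Theta> \<in> sectors \<delta> P \<Longrightarrow> l \<Theta> \<le> K * sqrt \<delta>"
    "\<And>\<Theta> w. \<Theta> \<in> sectors \<delta> P \<Longrightarrow> w \<in> \<theta> \<Theta> \<Longrightarrow> \<exists>\<phi>. \<bar>\<phi>\<bar> \<le> l \<Theta> / 2 \<and> w = dir (ang \<Theta> + \<phi>)"
    "\<And>\<Theta> \<phi>. \<Theta> \<in> sectors \<delta> P \<Longrightarrow> \<bar>\<phi>\<bar> < l \<Theta> / 2 \<Longrightarrow> dir (ang \<Theta> + \<phi>) \<in> \<theta> \<Theta>"
    using Q unfolding Q_def by blast+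
  have K0: "K > 0" "0 \<le> K" using K1 by auto
  have lpos: "0 < l \<Theta>" if "\<Theta> \<in> sectors \<delta> P" for \<Theta>
    using T(3)[OF that] sqrt_d(1) K0 divide_pos_pos[of "sqrt \<delta>" K] by linarith
  have KK: "K \<le> K\<^sup>2" "1 \<le> K\<^sup>2" using K1 power_increasing[of 1 2 K] by auto
  have 1: "\<bar>yf (ang \<Theta>) p\<bar> \<le> 14 * K\<^sup>2 * sqrt \<delta>" "\<bar>zf (ang \<Theta>) p\<bar> \<le> 21 * K ^ 3 * \<delta>"
    if S: "\<Theta> \<in> sectors \<delta> P" and p: "p \<in> dilate 2 (B \<Theta>)" for \<Theta> p
  proof -
    have sub: "dilate (1 / K) (B \<Theta>) \<subseteq> \<Theta>" using boxes[OF S] by (simp add: comparable_box_def)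
    have sb: "\<bar>yf (ang \<Theta>) p\<bar> \<le> 2 * l \<Theta>" "\<bar>zf (ang \<Theta>) p\<bar> \<le> 2 * \<delta> + (l \<Theta>)\<^sup>2" if p: "p \<in> \<Theta>" for p
    proof -
      have p': "p \<in> sector \<delta> (\<theta> \<Theta>)" using p T(1)[OF S] by simp
      show "\<bar>yf (ang \<Theta>) p\<bar> \<le> 2 * l \<Theta>" by (rule sector_bounds(1)[OF p' d0 d1]) (rule T(5)[OF S])
      show "\<bar>zf (ang \<Theta>) p\<bar> \<le> 2 * \<delta> + (l \<Theta>)\<^sup>2" by (rule sector_bounds(2)[OF p' d0 d1]) (rule T(5)[OF S])
    qed
    have y: "\<bar>yf (ang \<Theta>) p\<bar> \<le> 2 * (K * sqrt \<delta>)" if "p \<in> \<Theta>" for p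
      using sb(1)[OF that] T(4)[OF S] by linarith
    have z: "\<bar>zf (ang \<Theta>) p\<bar> \<le> 3 * K\<^sup>2 * \<delta>" if "p \<in> \<Theta>" for p
    proof -
      have "(l \<Theta>)\<^sup>2 \<le> (K * sqrt \<delta>)\<^sup>2" using T(4)[OF S] lpos[OF S] by (intro power_mono) auto
      also have "\<dots> = K\<^sup>2 * \<delta>" using d0 by (simp add: power_mult_distrib)
      finally have 1: "(l \<Theta>)\<^sup>2 \<le> K\<^sup>2 * \<delta>" .
      have "1 * \<delta> \<le> K\<^sup>2 * \<delta>" using KK d0 by (intro mult_right_mono) auto
      with 1 sb(2)[OF that] show ?thesis by linarith
    qed
    have k6: "1 + 6 * K \<le> 7 * K" using K1 by simp
    have "\<bar>yf (ang \<Theta>) p\<bar> \<le> (1 + 6 * K) * (2 * (K * sqrt \<delta>))"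
      by (rule dilate_linear_bound[OF linear_yf y sub K0(1) p])
    also have "\<dots> \<le> (7 * K) * (2 * (K * sqrt \<delta>))" using k6 K0 sqrt_d by (intro mult_right_mono) auto
    finally show "\<bar>yf (ang \<Theta>) p\<bar> \<le> 14 * K\<^sup>2 * sqrt \<delta>" by (simp add: power2_eq_square mult_ac)
    have "\<bar>zf (ang \<Theta>) p\<bar> \<le> (1 + 6 * K) * (3 * K\<^sup>2 * \<delta>)"
      by (rule dilate_linear_bound[OF linear_zf z sub K0(1) p])
    also have "\<dots> \<le> (7 * K) * (3 * K\<^sup>2 * \<delta>)" using k6 K0 d0 by (intro mult_right_mono) auto
    finally show "\<bar>zf (ang \<Theta>) p\<bar> \<le> 21 * K ^ 3 * \<delta>" by (simp add: power2_eq_square power3_eq_cube mult_ac)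
  qed
  \<comment> \<open>For midpoints closer than \<open>sqrt \<delta> / (4 * K)\<close> the angle
    between them is less than half the length of an arc. One midpoint then lies inside the other
    arc, and disjointness of the partition identifies the two.\<close>
  have 2: "\<Theta> = \<Theta>'" if S: "\<Theta> \<in> sectors \<delta> P" "\<Theta>' \<in> sectors \<delta> P" and n: "norm (dir (ang \<Theta>) - dir (ang \<Theta>')) < sqrt \<delta> / (4 * K)" for \<Theta> \<Theta>'
  proof -
    have "sqrt \<delta> / (4 * K) \<le> 1 / 1" using sqrt_d K1 by (intro frac_le) auto
    then have n1: "norm (dir (ang \<Theta>) - dir (ang \<Theta>')) \<le> 1" using n by simp
    obtain \<phi> where \<phi>: "\<bar>\<phi>\<bar> \<le> 2 * norm (dir (ang \<Theta>) - dir (ang \<Theta>'))" "dir (ang \<Theta>) = dir (ang \<Theta>' + \<phi>)"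
      using dir_near[OF order.refl n1] by blast
    have "sqrt \<delta> / (4 * K) = (sqrt \<delta> / K) / 4" by simp
    then have "\<bar>\<phi>\<bar> < l \<Theta>' / 2" using \<phi>(1) n T(3)[OF S(2)] by linarith
    then have "dir (ang \<Theta>) \<in> \<theta> \<Theta>'" unfolding \<phi>(2) by (rule T(6)[OF S(2)])
    moreover have "dir (ang \<Theta> + 0) \<in> \<theta> \<Theta>" by (rule T(6)[OF S(1)]) (use lpos[OF S(1)] in simp)
    ultimately have "\<theta> \<Theta> \<inter> \<theta> \<Theta>' \<noteq> {}" by auto
    moreover have "disjoint P" using arcs by (simp add: arc_partition_def partition_on_def)
    ultimately have "\<theta> \<Theta> = \<theta> \<Theta>'" using T(2)[OF S(1)] T(2)[OF S(2)] by (meson disjointD)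
    then show ?thesis using T(1)[OF S(1)] T(1)[OF S(2)] by simp
  qed
  show ?thesis by (intro exI[of _ ang] conjI ballI impI) (use 1 2 in blast)+
qed

definition ang :: "spacetime set \<Rightarrow> real" where
  "ang = (SOME ang. (\<forall>\<Theta>\<in>sectors \<delta> P. \<forall>p\<in>dilate 2 (B \<Theta>). \<bar>yf (ang \<Theta>) p\<bar> \<le> 14 * K\<^sup>2 * sqrt \<delta> \<and> \<bar>zf (ang \<Theta>) p\<bar> \<le> 21 * K ^ 3 * \<delta>)
     \<and> (\<forall>\<Theta>\<in>sectors \<delta> P. \<forall>\<Theta>'\<in>sectors \<delta> P. norm (dir (ang \<Theta>) - dir (ang \<Theta>')) < sqrt \<delta> / (4 * K) \<longrightarrow> \<Theta> = \<Theta>'))"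

lemma ang:
  "\<Theta> \<in> sectors \<delta> P \<Longrightarrow> p \<in> dilate 2 (B \<Theta>) \<Longrightarrow> \<bar>yf (ang \<Theta>) p\<bar> \<le> 14 * K\<^sup>2 * sqrt \<delta>"
  "\<Theta> \<in> sectors \<delta> P \<Longrightarrow> p \<in> dilate 2 (B \<Theta>) \<Longrightarrow> \<bar>zf (ang \<Theta>) p\<bar> \<le> 21 * K ^ 3 * \<delta>"
  "\<Theta> \<in> sectors \<delta> P \<Longrightarrow> \<Theta>' \<in> sectors \<delta> P \<Longrightarrow> norm (dir (ang \<Theta>) - dir (ang \<Theta>')) < sqrt \<delta> / (4 * K) \<Longrightarrow> \<Theta> = \<Theta>'"
  using someI_ex[OF angles_exist, folded ang_def] by blast+

text \<open>On each half \<open>st s\<close> stays bounded. Directions with vanishing cosine are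
  assigned to \<open>s = 1\<close>, which makes the halves disjoint.\<close>

definition half :: "real \<Rightarrow> spacetime set set" where
  "half s = {\<Theta> \<in> sectors \<delta> P. if s = 1 then cos (ang \<Theta>) \<ge> 0 else cos (ang \<Theta>) < 0}"

definition idx :: "real \<Rightarrow> nat \<Rightarrow> spacetime set \<Rightarrow> nat" where
  "idx s n \<Theta> = nat \<lfloor>tpar s (ang \<Theta>) * 2 ^ n\<rfloor>"

lemma half_cos: "s = 1 \<or> s = - 1 \<Longrightarrow> \<Theta> \<in> half s \<Longrightarrow> s * cos (ang \<Theta>) \<ge> 0"
  by (auto simp: half_def)

lemma half_Un: "half 1 \<union> half (- 1) = sectors \<delta> P" "half 1 \<inter> half (- 1) = {}"
  by (auto simp: half_def)

lemma half_sectors: "\<Theta> \<in> half s \<Longrightarrow> \<Theta> \<in> sectors \<delta> P"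
  by (simp add: half_def)

lemma idx:
  assumes s: "s = 1 \<or> s = - 1" and H: "\<Theta> \<in> half s"
  shows "idx s n \<Theta> < 2 ^ n" "real (idx s n \<Theta>) \<le> tpar s (ang \<Theta>) * 2 ^ n" "tpar s (ang \<Theta>) * 2 ^ n < real (idx s n \<Theta>) + 1"
proof -
  have "\<bar>st s (ang \<Theta>)\<bar> \<le> 1" by (rule st_facts(1)[OF s half_cos[OF s H]])
  then have t: "0 \<le> tpar s (ang \<Theta>)" "tpar s (ang \<Theta>) < 1" unfolding tpar_def by linarith+
  then have t0: "0 \<le> tpar s (ang \<Theta>) * 2 ^ n" by simp
  show 1: "real (idx s n \<Theta>) \<le> tpar s (ang \<Theta>) * 2 ^ n" "tpar s (ang \<Theta>) * 2 ^ n < real (idx s n \<Theta>) + 1"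
    using t0 unfolding idx_def by auto
  have "tpar s (ang \<Theta>) * 2 ^ n < 1 * 2 ^ n" using t(2) by (intro mult_strict_right_mono) auto
  then have "real (idx s n \<Theta>) < 2 ^ n" using 1(1) by linarith
  then show "idx s n \<Theta> < 2 ^ n" by simp
qed

lemma idx_dya:
  assumes s: "s = 1 \<or> s = - 1" and H: "\<Theta> \<in> half s"
  shows "\<bar>dya n (idx s n \<Theta>) - tpar s (ang \<Theta>)\<bar> \<le> 1 / 2 ^ n"
proof -
  have "\<bar>real (idx s n \<Theta>) - tpar s (ang \<Theta>) * 2 ^ n\<bar> \<le> 1" using idx(2,3)[OF s H, of n] by linarith
  then have "\<bar>real (idx s n \<Theta>) - tpar s (ang \<Theta>) * 2 ^ n\<bar> / 2 ^ n \<le> 1 / 2 ^ n" by (intro divide_right_mono) auto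
  moreover have "\<bar>real (idx s n \<Theta>) - tpar s (ang \<Theta>) * 2 ^ n\<bar> / 2 ^ n = \<bar>(real (idx s n \<Theta>) - tpar s (ang \<Theta>) * 2 ^ n) / 2 ^ n\<bar>" by simp
  moreover have "(real (idx s n \<Theta>) - tpar s (ang \<Theta>) * 2 ^ n) / 2 ^ n = dya n (idx s n \<Theta>) - tpar s (ang \<Theta>)"
    by (simp add: dya_def diff_divide_distrib)
  ultimately show ?thesis by simp
qed

text \<open>Two parameters in one node differ by less than \<open>1 / 2 ^ n\<close>, hence the
  values of \<open>st\<close> by less than four times and the directions by less than eight times
  that. The assumed size of \<open>2 ^ n\<close> puts this below the separation of the
  midpoints.\<close>

lemma inj_on_idx:
  assumes s: "s = 1 \<or> s = - 1" and n: "64 * K / sqrt \<delta> \<le> 2 ^ n"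
  shows "inj_on (idx s n) (half s)"
proof (rule inj_onI)
  fix \<Theta> \<Theta>' assume H: "\<Theta> \<in> half s" "\<Theta>' \<in> half s" and e: "idx s n \<Theta> = idx s n \<Theta>'"
  define w where "w = 1 / (2::real) ^ n"
  have w: "w > 0" by (simp add: w_def)
  have "\<bar>(tpar s (ang \<Theta>) - tpar s (ang \<Theta>')) * 2 ^ n\<bar> < 1"
    using idx(2,3)[OF s H(1), of n] idx(2,3)[OF s H(2), of n] e by (simp add: algebra_simps abs_less_iff)
  then have "\<bar>tpar s (ang \<Theta>) - tpar s (ang \<Theta>')\<bar> < w" by (simp add: w_def abs_mult less_divide_eq)
  moreover have "tpar s (ang \<Theta>) - tpar s (ang \<Theta>') = (st s (ang \<Theta>) - st s (ang \<Theta>')) / 4" by (simp add: tpar_def diff_divide_distrib)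
  ultimately have "\<bar>st s (ang \<Theta>) - st s (ang \<Theta>')\<bar> < 4 * w" by simp
  then have 1: "norm (dir (ang \<Theta>) - dir (ang \<Theta>')) < 8 * w"
    using dir_le_st[OF s half_cos[OF s H(1)] half_cos[OF s H(2)]] by argo
  have "64 * K \<le> 2 ^ n * sqrt \<delta>" using n sqrt_d by (simp add: divide_le_eq)
  then have "K * (64 * w) \<le> sqrt \<delta>" by (simp add: w_def divide_le_eq mult.commute)
  then have "64 * w \<le> sqrt \<delta> / K" using K1 by (simp add: le_divide_eq mult.commute)
  then have 2: "16 * w \<le> sqrt \<delta> / (4 * K)" by simp
  show "\<Theta> = \<Theta>'"
  proof (rule ang(3)[OF half_sectors[OF H(1)] half_sectors[OF H(2)]])
    show "norm (dir (ang \<Theta>) - dir (ang \<Theta>')) < sqrt \<delta> / (4 * K)"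
      using 1 2 w by linarith
  qed
qed

text \<open>\<open>p \<bullet> va s\<close> is \<open>\<tau> + s * \<xi>\<^sub>1\<close>, and
  \<open>\<xi>\<^sub>1\<close> equals \<open>\<tau> * cos \<alpha>\<close> up to \<open>yf\<close>
  and \<open>zf\<close>. The condition on the half makes the main term of
  \<open>s * \<xi>\<^sub>1\<close> nonnegative.\<close>

lemma va_lower:
  assumes s: "s = 1 \<or> s = - 1" and c: "s * cos \<alpha> \<ge> 0" and t: "snd p \<ge> 0"
  shows "p \<bullet> va s \<ge> snd p - \<bar>yf \<alpha> p\<bar> - \<bar>zf \<alpha> p\<bar>"
proof -
  define \<mu> where "\<mu> = s * cos \<alpha>"
  have m: "0 \<le> \<mu>" "\<bar>\<mu>\<bar> \<le> 1" using c s by (auto simp: \<mu>_def)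
  have "(snd p - zf \<alpha> p) * cos \<alpha> - yf \<alpha> p * sin \<alpha> = (fst p $ 1) * ((cos \<alpha>)\<^sup>2 + (sin \<alpha>)\<^sup>2)"
    unfolding yf_def zf_def by algebra
  then have "fst p $ 1 = (snd p - zf \<alpha> p) * cos \<alpha> - yf \<alpha> p * sin \<alpha>" by simp
  then have "s * fst p $ 1 = s * ((snd p - zf \<alpha> p) * cos \<alpha> - yf \<alpha> p * sin \<alpha>)" by simp
  also have "\<dots> = snd p * \<mu> - zf \<alpha> p * \<mu> - yf \<alpha> p * (s * sin \<alpha>)" by (simp add: \<mu>_def algebra_simps)
  finally have e: "s * fst p $ 1 = snd p * \<mu> - zf \<alpha> p * \<mu> - yf \<alpha> p * (s * sin \<alpha>)" .
  have "\<bar>s * sin \<alpha>\<bar> \<le> 1" using s by auto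
  then have "\<bar>yf \<alpha> p * (s * sin \<alpha>)\<bar> \<le> \<bar>yf \<alpha> p\<bar>" unfolding abs_mult[of "yf \<alpha> p"] by (intro mult_right_le_one_le) auto
  moreover have "\<bar>zf \<alpha> p * \<mu>\<bar> \<le> \<bar>zf \<alpha> p\<bar>" unfolding abs_mult using m by (intro mult_right_le_one_le) auto
  moreover have "0 \<le> snd p * \<mu>" using t m by simp
  ultimately show ?thesis unfolding inner_v e by (simp add: abs_le_iff)
qed

text \<open>This verifies the hypotheses of \<open>cone_family\<close> with one constant for all
  scales. \<open>p\<close> is a frequency of a piece, \<open>q\<close> the spread caused by the
  outer cutoff, and the nearby point \<open>r\<close> controls the size of \<xi> and \<tau>. The
  condition \<open>64 * K ^ 3 * sqrt \<delta> \<le> 1\<close> keeps \<open>yf\<close> and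
  \<open>zf\<close> so small that the coordinate \<open>va\<close> is at least 1/2; \<open>D\<close>
  converts \<open>sqrt \<delta>\<close> into \<open>1 / 2 ^ n\<close>.\<close>

lemma sector_cone_coords:
  assumes s: "s = 1 \<or> s = - 1" and H: "\<Theta> \<in> half s"
    and small: "64 * K ^ 3 * sqrt \<delta> \<le> 1" and D: "D \<ge> 1" "2 ^ n \<le> D / sqrt \<delta>"
    and p: "p \<in> dilate 2 (B \<Theta>)" and r: "r \<in> cone_nbhd \<delta>" "dist r p \<le> \<delta>" and q: "norm q \<le> \<delta>"
  defines "C \<equiv> 60 * K ^ 3 * D\<^sup>2" and "t \<equiv> dya n (idx s n \<Theta>)"
  shows "1 / C \<le> (p + q) \<bullet> va s" "(p + q) \<bullet> va s \<le> C"
    "\<bar>cone_coords.lin (va s) (vb s) t (p + q)\<bar> \<le> C / 2 ^ n"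
    "\<bar>cone_coords.qd (va s) (vb s) (vc s) t (p + q)\<bar> \<le> C / 4 ^ n"
proof -
  interpret cone_coords "va s" "vb s" "vc s" 40 by (rule cone_coords_v[OF s])
  define P where "P = p + q"
  define \<alpha> where "\<alpha> = ang \<Theta>"
  define e where "e = sqrt \<delta>"
  define w where "w = 1 / (2::real) ^ n"
  have e: "0 < e" "e < 1" "\<delta> = e * e" using sqrt_d by (auto simp: e_def)
  have c: "s * cos \<alpha> \<ge> 0" unfolding \<alpha>_def by (rule half_cos[OF s H])
  have Kp: "1 \<le> K ^ 3" "K\<^sup>2 \<le> K ^ 3" "1 \<le> K\<^sup>2" "0 \<le> K"
    using K1 by (auto intro: power_increasing)
  have K3e: "e \<le> K ^ 3 * e" "K\<^sup>2 * e \<le> K ^ 3 * e" "K ^ 3 * e \<le> 1 / 64"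
    using Kp e small unfolding e_def[symmetric] by (auto simp: mult.assoc)
  have de: "\<delta> \<le> e / 64" 
  proof -
    have "e \<le> 1 / 64" using K3e by linarith
    then have "e * e \<le> (1 / 64) * e" using e by (intro mult_right_mono) auto
    then show ?thesis using e by simp
  qed
  have K3d: "K ^ 3 * \<delta> \<le> e / 64" "\<delta> \<le> K ^ 3 * \<delta>"
  proof -
    have "(K ^ 3 * e) * e \<le> (1 / 64) * e" using e K3e by (intro mult_right_mono) auto
    then show "K ^ 3 * \<delta> \<le> e / 64" using e(3) by (simp add: mult.assoc)
    have "1 * \<delta> \<le> K ^ 3 * \<delta>" using Kp d0 by (intro mult_right_mono) auto
    then show "\<delta> \<le> K ^ 3 * \<delta>" by simp
  qed
  have y: "\<bar>yf \<alpha> P\<bar> \<le> 16 * (K\<^sup>2 * e)"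
  proof -
    have "\<bar>yf \<alpha> P\<bar> \<le> \<bar>yf \<alpha> p\<bar> + \<bar>yf \<alpha> q\<bar>" unfolding P_def linear_add[OF linear_yf] by (rule abs_triangle_ineq)
    also have "\<bar>yf \<alpha> p\<bar> \<le> 14 * (K\<^sup>2 * e)" using ang(1)[OF half_sectors[OF H] p] by (simp add: \<alpha>_def e_def mult.assoc)
    also have "\<bar>yf \<alpha> q\<bar> \<le> 2 * \<delta>" using yf_zf_le_norm(1)[of \<alpha> q] q by linarith
    also have "\<delta> \<le> K\<^sup>2 * e" using de e mult_right_mono[OF Kp(3), of e] by linarith
    finally show ?thesis by linarith
  qed
  have z: "\<bar>zf \<alpha> P\<bar> \<le> 24 * (K ^ 3 * \<delta>)"
  proof -
    have "\<bar>zf \<alpha> P\<bar> \<le> \<bar>zf \<alpha> p\<bar> + \<bar>zf \<alpha> q\<bar>" unfolding P_def linear_add[OF linear_zf] by (rule abs_triangle_ineq)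
    also have "\<bar>zf \<alpha> p\<bar> \<le> 21 * (K ^ 3 * \<delta>)" using ang(2)[OF half_sectors[OF H] p] by (simp add: \<alpha>_def mult.assoc)
    also have "\<bar>zf \<alpha> q\<bar> \<le> 3 * \<delta>" using yf_zf_le_norm(2)[of \<alpha> q] q by linarith
    finally show ?thesis using K3d by linarith
  qed
  have C60: "60 * (K ^ 3 * D) \<le> C" "60 \<le> C" "60 * (K ^ 3 * (D * D)) \<le> C" "60 * (K ^ 3) \<le> C"
  proof -
    have "D * 1 \<le> D * D" using D by (intro mult_left_mono) auto
    then have d: "1 \<le> D * D" "D \<le> D * D" using D by linarith+
    have "K ^ 3 * D \<le> K ^ 3 * (D * D)" using d Kp by (intro mult_left_mono) auto
    then show "60 * (K ^ 3 * D) \<le> C" by (simp add: C_def power2_eq_square mult.assoc)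
    have "1 * 1 \<le> K ^ 3 * (D * D)" using d Kp by (intro mult_mono) auto
    then show "60 \<le> C" by (simp add: C_def power2_eq_square mult.assoc)
    show "60 * (K ^ 3 * (D * D)) \<le> C" by (simp add: C_def power2_eq_square mult.assoc)
    have "K ^ 3 * 1 \<le> K ^ 3 * (D * D)" using d Kp by (intro mult_left_mono) auto
    then show "60 * (K ^ 3) \<le> C" by (simp add: C_def power2_eq_square mult.assoc)
  qed
  note near = cone_nbhd_near[OF r(1)]
  have dr: "dist (fst r) (fst p) \<le> \<delta>" "dist (snd r) (snd p) \<le> \<delta>"
    using r(2) dist_fst_le[of r p] dist_snd_le[of r p] by linarith+
  have dq: "norm (fst q) \<le> \<delta>" "\<bar>snd q\<bar> \<le> \<delta>"
    using q norm_fst_le[of "fst q" "snd q"] norm_snd_le[of "snd q" "fst q"] by auto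
  have tau: "1 - 3 * \<delta> \<le> snd P" "snd P \<le> 2 + 3 * \<delta>"
    using near(2,3) dr(2) dq(2) unfolding P_def dist_real_def by auto
  have "norm (fst P) \<le> norm (fst p) + norm (fst q)" unfolding P_def fst_add by (rule norm_triangle_ineq)
  also have "norm (fst p) \<le> norm (fst r) + dist (fst r) (fst p)"
    using norm_triangle_sub[of "fst p" "fst r"] by (simp add: dist_norm norm_minus_commute)
  finally have xi: "norm (fst P) \<le> 2 + 3 * \<delta>" using near(5) dr(1) dq(1) by linarith
  have a1: "1 / 2 \<le> P \<bullet> va s"
  proof -
    have "snd P - \<bar>yf \<alpha> P\<bar> - \<bar>zf \<alpha> P\<bar> \<le> P \<bullet> va s" by (rule va_lower[OF s c]) (use tau de e K3e in linarith)
    then show ?thesis using tau(1) y z K3d K3e de by linarith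
  qed
  have a2: "P \<bullet> va s \<le> 10"
  proof -
    have "\<bar>s * fst P $ 1\<bar> = \<bar>fst P $ 1\<bar>" using s by auto
    moreover have "\<bar>fst P $ 1\<bar> \<le> norm (fst P)" by (rule component_le_norm_cart)
    ultimately have "s * fst P $ 1 \<le> norm (fst P)" using abs_ge_self[of "s * fst P $ 1"] by linarith
    then show ?thesis unfolding inner_v using xi tau d1 by linarith
  qed
  have C0: "1 / C \<le> 1 / 2" using C60(2) by (intro divide_left_mono) auto
  show "1 / C \<le> (p + q) \<bullet> va s" "(p + q) \<bullet> va s \<le> C" using a1 a2 C0 C60(2) unfolding P_def by linarith+
  define u where "u = tpar s \<alpha>"
  define h where "h = t - u"
  have h: "\<bar>h\<bar> \<le> w" using idx_dya[OF s H, of n] by (simp add: h_def u_def \<alpha>_def t_def w_def)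
  have w0: "w > 0" by (simp add: w_def)
  have eD: "e \<le> D * w"
  proof -
    have "2 ^ n * e \<le> D" using D(2) e unfolding e_def[symmetric] by (simp add: le_divide_eq)
    then show ?thesis unfolding w_def by (simp add: le_divide_eq mult.commute)
  qed
  have st1: "\<bar>st s \<alpha>\<bar> \<le> 1" by (rule st_facts(1)[OF s c])
  have l0: "\<bar>lin u P\<bar> \<le> 10 * (K ^ 3 * e)"
  proof -
    have "lin u P = (s * yf \<alpha> P - st s \<alpha> * zf \<alpha> P) / 4"
      unfolding lin_def u_def by (rule lin_qd_identity(1)[OF s c])
    moreover have "\<bar>s * yf \<alpha> P\<bar> \<le> \<bar>yf \<alpha> P\<bar>" using s by auto
    moreover have "\<bar>st s \<alpha> * zf \<alpha> P\<bar> \<le> \<bar>zf \<alpha> P\<bar>" unfolding abs_mult using st1 by (intro mult_left_le_one_le) auto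
    ultimately have "\<bar>lin u P\<bar> \<le> (\<bar>yf \<alpha> P\<bar> + \<bar>zf \<alpha> P\<bar>) / 4" by argo
    then show ?thesis using y z K3d(1) K3e(1,2) e(1) by argo
  qed
  have q0: "\<bar>qd u P\<bar> \<le> 3 * (K ^ 3 * \<delta>)"
  proof -
    have "qd u P = (1 + (st s \<alpha>)\<^sup>2) * zf \<alpha> P / 16"
      unfolding qd_def u_def by (rule lin_qd_identity(2)[OF s c])
    moreover have "\<bar>(1 + (st s \<alpha>)\<^sup>2) * zf \<alpha> P\<bar> \<le> 2 * \<bar>zf \<alpha> P\<bar>"
    proof -
      have "(st s \<alpha>)\<^sup>2 \<le> 1" using st1 by (simp add: abs_square_le_1)
      then have "\<bar>1 + (st s \<alpha>)\<^sup>2\<bar> \<le> 2" by simp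
      then show ?thesis unfolding abs_mult by (intro mult_right_mono) auto
    qed
    ultimately have "\<bar>qd u P\<bar> \<le> 2 * \<bar>zf \<alpha> P\<bar> / 16" by simp
    then show ?thesis using z by linarith
  qed
  have Kw: "K ^ 3 * e \<le> (K ^ 3 * D) * w" using mult_left_mono[OF eD, of "K ^ 3"] Kp by (simp add: mult.assoc)
  have l1: "\<bar>lin t P\<bar> \<le> (10 * (K ^ 3 * D) + 10) * w"
  proof -
    have "\<bar>h * (P \<bullet> va s)\<bar> \<le> w * 10" unfolding abs_mult using h a1 a2 w0 by (intro mult_mono) auto
    moreover have "lin t P = lin u P - h * (P \<bullet> va s)" unfolding h_def by (rule lin_shift)
    ultimately have "\<bar>lin t P\<bar> \<le> 10 * (K ^ 3 * e) + w * 10" using l0 by argo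
    then show ?thesis using Kw by (simp add: algebra_simps)
  qed
  have "(10 * (K ^ 3 * D) + 10) * w \<le> C * w" using C60 w0 by (intro mult_right_mono) auto
  with l1 show "\<bar>lin t (p + q)\<bar> \<le> C / 2 ^ n" unfolding P_def w_def by simp
  have q1: "\<bar>qd t P\<bar> \<le> (3 * (K ^ 3 * (D * D)) + 20 * (K ^ 3 * D) + 10) * (w * w)"
  proof -
    have "\<bar>2 * h * lin u P\<bar> \<le> (2 * w) * (10 * ((K ^ 3 * D) * w))"
      unfolding abs_mult using h l0 Kw w0 by (intro mult_mono) auto
    then have 1: "\<bar>2 * h * lin u P\<bar> \<le> 20 * (K ^ 3 * D) * (w * w)" by (simp add: mult_ac)
    have "\<bar>h\<bar> * \<bar>h\<bar> \<le> w * w" using h by (intro mult_mono) auto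
    then have "\<bar>h\<^sup>2\<bar> \<le> w * w" by (simp add: power2_eq_square)
    then have 2: "\<bar>h\<^sup>2 * (P \<bullet> va s)\<bar> \<le> (w * w) * 10" unfolding abs_mult[of "h\<^sup>2"] using a1 a2 w0 by (intro mult_mono) auto
    have "e * e \<le> (D * w) * (D * w)" using eD e by (intro mult_mono) auto
    then have "K ^ 3 * \<delta> \<le> K ^ 3 * ((D * w) * (D * w))" unfolding e(3) using Kp by (intro mult_left_mono) auto
    then have 3: "\<bar>qd u P\<bar> \<le> 3 * (K ^ 3 * (D * D)) * (w * w)" using q0 by (simp add: mult_ac)
    have "qd t P = qd u P - 2 * h * lin u P + h\<^sup>2 * (P \<bullet> va s)" unfolding h_def by (rule qd_shift)
    then have "\<bar>qd t P\<bar> \<le> \<bar>qd u P\<bar> + \<bar>2 * h * lin u P\<bar> + \<bar>h\<^sup>2 * (P \<bullet> va s)\<bar>" by argo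
    then show ?thesis using 1 2 3 unfolding distrib_right by argo
  qed
  have "(3 * (K ^ 3 * (D * D)) + 20 * (K ^ 3 * D) + 10) * (w * w) \<le> C * (w * w)"
    using C60 w0 by (intro mult_right_mono) auto
  with q1 show "\<bar>qd t (p + q)\<bar> \<le> C / 4 ^ n" unfolding P_def w_def by (simp flip: power_mult_distrib)
qed

end

section \<open>The square function estimate\<close>

lemma nice_integrable_power4: "nice F \<Longrightarrow> integrable lborel (\<lambda>x. (cmod (F x)) ^ 4)"
  using nice_integrable_square(1)[OF nice_mult[of F F]]
  by (simp add: norm_mult power_mult_distrib flip: power_add)

lemma nice_integrable_square_sum:
  assumes "finite I" "\<And>i. i \<in> I \<Longrightarrow> nice (h i)"
  shows "integrable lborel (\<lambda>x. (\<Sum>i\<in>I. (cmod (h i x))\<^sup>2)\<^sup>2)"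
proof -
  have "nice (\<lambda>x. \<Sum>i\<in>I. h i x * cnj (h i x))" by (intro nice_sum nice_mult nice_cnj(1) assms)
  from nice_integrable_square(1)[OF this]
  have "integrable lborel (\<lambda>x. (cmod (of_real (\<Sum>i\<in>I. (cmod (h i x))\<^sup>2)))\<^sup>2)"
    by (simp only: complex_norm_square[symmetric] of_real_sum)
  then show ?thesis unfolding norm_of_real by simp
qed

text \<open>The constant of \<open>square_function_estimate\<close> for \<open>m = 32\<close>. The
  factor 16 is 8, from the fourth power of a sum of two halves, times 2, from adding their equal
  bounds.\<close>

definition gain :: "nat \<Rightarrow> real \<Rightarrow> real" where
  "gain \<kappa> C = 16 * ((C * 16 ^ \<kappa> + 3) ^ 4 * (kstep DIM(spacetime) C * (real (32 * \<kappa>) + 1)\<^sup>2) ^ 32)"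

context cone_sectors
begin

text \<open>Sectors are relabelled by nodes. Nodes without a sector carry the zero function, and
  injectivity of the labelling leaves the square function unchanged.\<close>

lemma half_estimate:
  assumes s: "s = 1 \<or> s = - 1" and nh: "\<And>\<Theta>. \<Theta> \<in> half s \<Longrightarrow> nice (h \<Theta>)"
    and C: "C \<ge> 1" and n: "64 * K / sqrt \<delta> \<le> 2 ^ (m * \<kappa>)"
    and supp: "\<And>\<Theta> p. \<Theta> \<in> half s \<Longrightarrow> fourier (h \<Theta>) p \<noteq> 0 \<Longrightarrow>
      1 / C \<le> p \<bullet> va s \<and> p \<bullet> va s \<le> C \<and> \<bar>cone_coords.lin (va s) (vb s) (dya (m * \<kappa>) (idx s (m * \<kappa>) \<Theta>)) p\<bar> \<le> C / 2 ^ (m * \<kappa>)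
       \<and> \<bar>cone_coords.qd (va s) (vb s) (vc s) (dya (m * \<kappa>) (idx s (m * \<kappa>) \<Theta>)) p\<bar> \<le> C / 4 ^ (m * \<kappa>)"
  shows "(\<integral>x. (cmod (\<Sum>\<Theta>\<in>half s. h \<Theta> x)) ^ 4 \<partial>lborel)
    \<le> (C * 16 ^ \<kappa> + 3) ^ 4 * (kstep DIM(spacetime) C * (real (m * \<kappa>) + 1)\<^sup>2) ^ m
       * (\<integral>x. (\<Sum>\<Theta>\<in>half s. (cmod (h \<Theta> x))\<^sup>2)\<^sup>2 \<partial>lborel)"
proof -
  let ?n = "m * \<kappa>"
  define J where "J = idx s ?n"
  have fin: "finite (half s)" using finite_sectors by (simp add: half_def)
  have inj: "inj_on J (half s)" unfolding J_def by (rule inj_on_idx[OF s n])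
  define g where "g j x = (\<Sum>\<Theta>\<in>{\<Theta>\<in>half s. J \<Theta> = j}. h \<Theta> x)" for j x
  have gJ: "g (J \<Theta>) x = h \<Theta> x" if "\<Theta> \<in> half s" for \<Theta> x
  proof -
    have "{\<Theta>'\<in>half s. J \<Theta>' = J \<Theta>} = {\<Theta>}" using inj that by (auto dest: inj_onD)
    then show ?thesis by (simp add: g_def)
  qed
  have g0: "g j x = 0" if "j \<notin> J ` half s" for j x
  proof -
    have "{\<Theta>\<in>half s. J \<Theta> = j} = {}" using that by auto
    then show ?thesis unfolding g_def by (simp only: sum.empty)
  qed
  have Jlt: "J ` half s \<subseteq> {..<2 ^ ?n}" unfolding J_def using idx(1)[OF s] by auto
  interpret cone_family "va s" "vb s" "vc s" 40 ?n g C
  proof (intro cone_family.intro cone_family_axioms.intro cone_coords_v s C)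
    show "nice (g j)" for j unfolding g_def[abs_def] by (intro nice_sum nh) auto
    fix j p assume "fourier (g j) p \<noteq> 0"
    moreover have "fourier (g j) p = (\<Sum>\<Theta>\<in>{\<Theta>\<in>half s. J \<Theta> = j}. fourier (h \<Theta>) p)"
      unfolding g_def[abs_def] by (rule fourier_sum) (auto intro: nice_integrable nh)
    ultimately obtain \<Theta> where "\<Theta> \<in> half s" "J \<Theta> = j" "fourier (h \<Theta>) p \<noteq> 0"
      by (auto dest: sum.not_neutral_contains_not_neutral[rotated] elim: sum.not_neutral_contains_not_neutral)
    then show "1 / C \<le> p \<bullet> va s \<and> p \<bullet> va s \<le> C \<and> \<bar>cone_coords.lin (va s) (vb s) (dya ?n j) p\<bar> \<le> C / 2 ^ ?n
       \<and> \<bar>cone_coords.qd (va s) (vb s) (vc s) (dya ?n j) p\<bar> \<le> C / 4 ^ ?n"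
      using supp[of \<Theta> p] unfolding J_def by blast
  qed
  have re: "(\<Sum>j<2 ^ ?n. F (g j x)) = (\<Sum>\<Theta>\<in>half s. F (h \<Theta> x))" if "F 0 = 0" for F :: "complex \<Rightarrow> 'z::comm_monoid_add" and x
  proof -
    have "(\<Sum>j<2 ^ ?n. F (g j x)) = (\<Sum>j\<in>J ` half s. F (g j x))"
      using Jlt g0 that by (intro sum.mono_neutral_right) auto
    also have "\<dots> = (\<Sum>\<Theta>\<in>half s. F (g (J \<Theta>) x))" by (simp add: sum.reindex[OF inj])
    also have "\<dots> = (\<Sum>\<Theta>\<in>half s. F (h \<Theta> x))" by (intro sum.cong) (simp_all add: gJ)
    finally show ?thesis .
  qed
  have 1: "(\<Sum>j<2 ^ ?n. g j x) = (\<Sum>\<Theta>\<in>half s. h \<Theta> x)" for x using re[of "\<lambda>z. z" x] by simp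
  have 2: "(\<Sum>j<2 ^ ?n. (cmod (g j x))\<^sup>2) = (\<Sum>\<Theta>\<in>half s. (cmod (h \<Theta> x))\<^sup>2)" for x using re[of "\<lambda>z. (cmod z)\<^sup>2" x] by simp
  show ?thesis using square_function_estimate[OF va_nonzero refl] unfolding 1 2 .
qed

lemma card_half:
  assumes s: "s = 1 \<or> s = - 1" and n: "64 * K / sqrt \<delta> \<le> 2 ^ n"
  shows "card (half s) \<le> 2 ^ n"
proof -
  have "card (half s) \<le> card {..<(2::nat) ^ n}"
    by (rule card_inj_on_le[OF inj_on_idx[OF s n]]) (use idx(1)[OF s] in auto)
  then show ?thesis by simp
qed

lemma card_sectors:
  assumes n: "64 * K / sqrt \<delta> \<le> 2 ^ n"
  shows "card (sectors \<delta> P) \<le> 2 * 2 ^ n"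
proof -
  have "card (sectors \<delta> P) \<le> card (half 1) + card (half (- 1))"
    unfolding half_Un(1)[symmetric] by (rule card_Un_le)
  then show ?thesis using card_half[OF _ n, of 1] card_half[OF _ n, of "- 1"] by simp
qed

lemma sectors_estimate:
  assumes nh: "\<And>\<Theta>. \<Theta> \<in> sectors \<delta> P \<Longrightarrow> nice (h \<Theta>)"
    and small: "64 * K ^ 3 * sqrt \<delta> \<le> 1" and D: "D \<ge> 1" "2 ^ (32 * \<kappa>) \<le> D / sqrt \<delta>"
    and n: "64 * K / sqrt \<delta> \<le> 2 ^ (32 * \<kappa>)"
    and supp: "\<And>\<Theta> \<xi>. \<Theta> \<in> sectors \<delta> P \<Longrightarrow> fourier (h \<Theta>) \<xi> \<noteq> 0 \<Longrightarrow>
      \<exists>p q. \<xi> = p + q \<and> p \<in> dilate 2 (B \<Theta>) \<and> (\<exists>r\<in>cone_nbhd \<delta>. dist r p \<le> \<delta>) \<and> norm q \<le> \<delta>"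
  shows "(\<integral>x. (cmod (\<Sum>\<Theta>\<in>sectors \<delta> P. h \<Theta> x)) ^ 4 \<partial>lborel)
    \<le> gain \<kappa> (60 * K ^ 3 * D\<^sup>2) * (\<integral>x. (\<Sum>\<Theta>\<in>sectors \<delta> P. (cmod (h \<Theta> x))\<^sup>2)\<^sup>2 \<partial>lborel)"
proof -
  define C where "C = 60 * K ^ 3 * D\<^sup>2"
  define A where "A = (C * 16 ^ \<kappa> + 3) ^ 4 * (kstep DIM(spacetime) C * (real (32 * \<kappa>) + 1)\<^sup>2) ^ 32"
  have "1 * 1 \<le> K ^ 3 * D\<^sup>2" using K1 D(1) by (intro mult_mono one_le_power) auto
  then have C1: "C \<ge> 1" by (simp add: C_def)
  have A0: "A \<ge> 0" using C1 unfolding A_def kstep_def by (intro mult_nonneg_nonneg zero_le_power add_nonneg_nonneg) auto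
  define X where "X = (\<integral>x. (\<Sum>\<Theta>\<in>sectors \<delta> P. (cmod (h \<Theta> x))\<^sup>2)\<^sup>2 \<partial>lborel)"
  have fin: "finite (half s)" for s using finite_sectors by (simp add: half_def)
  have iS: "integrable lborel (\<lambda>x. (\<Sum>\<Theta>\<in>sectors \<delta> P. (cmod (h \<Theta> x))\<^sup>2)\<^sup>2)"
    by (rule nice_integrable_square_sum[OF finite_sectors nh])
  have nice_half: "nice (\<lambda>x. \<Sum>\<Theta>\<in>half s. h \<Theta> x)" for s by (intro nice_sum nh half_sectors)
  have hs: "(\<integral>x. (cmod (\<Sum>\<Theta>\<in>half s. h \<Theta> x)) ^ 4 \<partial>lborel) \<le> A * X" if s: "s = 1 \<or> s = - 1" for s
  proof -
    have "(\<integral>x. (cmod (\<Sum>\<Theta>\<in>half s. h \<Theta> x)) ^ 4 \<partial>lborel) \<le> A * (\<integral>x. (\<Sum>\<Theta>\<in>half s. (cmod (h \<Theta> x))\<^sup>2)\<^sup>2 \<partial>lborel)"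
      unfolding A_def
    proof (rule half_estimate[OF s nh[OF half_sectors] C1 n])
      fix \<Theta> \<xi> assume H: "\<Theta> \<in> half s" and "fourier (h \<Theta>) \<xi> \<noteq> 0"
      then obtain p q r where pq: "\<xi> = p + q" "p \<in> dilate 2 (B \<Theta>)" "r \<in> cone_nbhd \<delta>" "dist r p \<le> \<delta>" "norm q \<le> \<delta>"
        using supp[OF half_sectors[OF H]] by blast
      show "1 / C \<le> \<xi> \<bullet> va s \<and> \<xi> \<bullet> va s \<le> C \<and> \<bar>cone_coords.lin (va s) (vb s) (dya (32 * \<kappa>) (idx s (32 * \<kappa>) \<Theta>)) \<xi>\<bar> \<le> C / 2 ^ (32 * \<kappa>)
       \<and> \<bar>cone_coords.qd (va s) (vb s) (vc s) (dya (32 * \<kappa>) (idx s (32 * \<kappa>) \<Theta>)) \<xi>\<bar> \<le> C / 4 ^ (32 * \<kappa>)"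
        using sector_cone_coords[OF s H small D pq(2-5)] unfolding pq(1) C_def by blast
    qed
    also have "\<dots> \<le> A * X"
      unfolding X_def
    proof (intro mult_left_mono integral_mono iS A0)
      show "integrable lborel (\<lambda>x. (\<Sum>\<Theta>\<in>half s. (cmod (h \<Theta> x))\<^sup>2)\<^sup>2)"
        by (rule nice_integrable_square_sum[OF fin nh[OF half_sectors]])
      show "(\<Sum>\<Theta>\<in>half s. (cmod (h \<Theta> x))\<^sup>2)\<^sup>2 \<le> (\<Sum>\<Theta>\<in>sectors \<delta> P. (cmod (h \<Theta> x))\<^sup>2)\<^sup>2" for x
        by (intro power_mono sum_mono2 finite_sectors sum_nonneg) (auto dest: half_sectors)
    qed
    finally show ?thesis .
  qed
  have "(\<integral>x. (cmod (\<Sum>\<Theta>\<in>sectors \<delta> P. h \<Theta> x)) ^ 4 \<partial>lborel)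
     \<le> (\<integral>x. 8 * ((cmod (\<Sum>\<Theta>\<in>half 1. h \<Theta> x)) ^ 4 + (cmod (\<Sum>\<Theta>\<in>half (- 1). h \<Theta> x)) ^ 4) \<partial>lborel)"
  proof (rule integral_mono)
    show "integrable lborel (\<lambda>x. (cmod (\<Sum>\<Theta>\<in>sectors \<delta> P. h \<Theta> x)) ^ 4)"
      by (intro nice_integrable_power4 nice_sum nh)
    show "integrable lborel (\<lambda>x. 8 * ((cmod (\<Sum>\<Theta>\<in>half 1. h \<Theta> x)) ^ 4 + (cmod (\<Sum>\<Theta>\<in>half (- 1). h \<Theta> x)) ^ 4))"
      by (intro integrable_mult_right Bochner_Integration.integrable_add nice_integrable_power4 nice_half)
    fix x
    have e: "(\<Sum>\<Theta>\<in>sectors \<delta> P. h \<Theta> x) = (\<Sum>i\<in>{True, False}. \<Sum>\<Theta>\<in>half (if i then 1 else - 1). h \<Theta> x)"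
      unfolding half_Un(1)[symmetric] by (subst sum.union_disjoint[OF fin fin half_Un(2)]) simp
    show "(cmod (\<Sum>\<Theta>\<in>sectors \<delta> P. h \<Theta> x)) ^ 4
       \<le> 8 * ((cmod (\<Sum>\<Theta>\<in>half 1. h \<Theta> x)) ^ 4 + (cmod (\<Sum>\<Theta>\<in>half (- 1). h \<Theta> x)) ^ 4)"
      unfolding e using sum_power4_le[of "{True, False}" "\<lambda>i. \<Sum>\<Theta>\<in>half (if i then 1 else - 1). h \<Theta> x"] by simp
  qed
  also have "\<dots> = 8 * ((\<integral>x. (cmod (\<Sum>\<Theta>\<in>half 1. h \<Theta> x)) ^ 4 \<partial>lborel) + (\<integral>x. (cmod (\<Sum>\<Theta>\<in>half (- 1). h \<Theta> x)) ^ 4 \<partial>lborel))"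
    by (subst Bochner_Integration.integral_mult_right_zero, subst Bochner_Integration.integral_add)
      (intro nice_integrable_power4 nice_half refl)+
  also have "\<dots> \<le> 8 * (A * X + A * X)" by (intro mult_left_mono add_mono hs) auto
  also have "\<dots> = gain \<kappa> C * X" by (simp add: gain_def A_def)
  finally show ?thesis unfolding C_def X_def .
qed

end

section \<open>Exponents and constants\<close>

lemma polynomial_le_power_powr:
  assumes e: "\<epsilon> > 0"
  shows "\<exists>A>0. \<forall>n::nat. (real n + 1) ^ 64 \<le> A * (2 ^ n) powr \<epsilon>"
proof (intro exI conjI allI)
  define c where "c = \<epsilon> * ln 2"
  have c: "c > 0" using e by (simp add: c_def)
  show "(64 / c) ^ 64 * exp c > 0" using c by simp
  fix n :: nat
  have "c * (real n + 1) / 64 \<le> exp (c * (real n + 1) / 64)" using exp_ge_add_one_self[of "c * (real n + 1) / 64"] by linarith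
  then have "(c * (real n + 1) / 64) ^ 64 \<le> exp (c * (real n + 1) / 64) ^ 64" using c by (intro power_mono) auto
  also have "\<dots> = exp (c * (real n + 1))" unfolding exp_of_nat_mult[symmetric] by simp
  also have "\<dots> = exp c * (2 ^ n) powr \<epsilon>"
    by (simp add: powr_def c_def ln_realpow algebra_simps exp_add)
  finally have "(64 / c) ^ 64 * (c * (real n + 1) / 64) ^ 64 \<le> (64 / c) ^ 64 * (exp c * (2 ^ n) powr \<epsilon>)"
    using c by (intro mult_left_mono) auto
  moreover have "(64 / c) ^ 64 * (c * (real n + 1) / 64) ^ 64 = (real n + 1) ^ 64"
  proof -
    have "64 / c * (c * (real n + 1) / 64) = real n + 1" using c by simp
    then show ?thesis by (simp only: power_mult_distrib[symmetric])
  qed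
  ultimately show "(real n + 1) ^ 64 \<le> (64 / c) ^ 64 * exp c * (2 ^ n) powr \<epsilon>" by (simp only: mult.assoc)
qed

lemma kstep_nonneg: "kstep d C \<ge> 0"
  unfolding kstep_def by (intro mult_nonneg_nonneg add_nonneg_nonneg) auto

text \<open>With \<open>N = 2 ^ (32 * \<kappa>)\<close> the slicing loss
  \<open>(16 ^ \<kappa>) ^ 4\<close> is exactly the square root of \<open>N\<close>, while the 32
  steps contribute the 64th power of a logarithm of \<open>N\<close>, absorbed in
  \<open>N powr \<epsilon>\<close>. As \<open>N\<close> will be comparable to
  \<open>1 / sqrt \<delta>\<close>, this becomes \<delta> to the power -1/4, up to the
  epsilon.\<close>

lemma gain_bound:
  assumes e: "\<epsilon> > 0" and C: "C \<ge> 1"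
  shows "\<exists>G>0. \<forall>\<kappa>. 0 \<le> gain \<kappa> C \<and> gain \<kappa> C \<le> G * (2 ^ (32 * \<kappa>)) powr (1 / 2 + \<epsilon>)"
proof -
  obtain A where A: "A > 0" "\<And>n::nat. (real n + 1) ^ 64 \<le> A * (2 ^ n) powr \<epsilon>"
    using polynomial_le_power_powr[OF e] by blast
  define L where "L = kstep DIM(spacetime) C"
  have L0: "L \<ge> 0" unfolding L_def by (rule kstep_nonneg)
  define G where "G = 16 * (C + 3) ^ 4 * (L + 1) ^ 32 * A"
  have G: "G > 0" using A L0 C unfolding G_def by (intro mult_pos_pos zero_less_power) auto
  have "0 \<le> gain \<kappa> C \<and> gain \<kappa> C \<le> G * (2 ^ (32 * \<kappa>)) powr (1 / 2 + \<epsilon>)" for \<kappa>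
  proof
    show "0 \<le> gain \<kappa> C" using L0 C unfolding gain_def L_def[symmetric]
      by (intro mult_nonneg_nonneg zero_le_power add_nonneg_nonneg) auto
    define N where "N = (2::real) ^ (32 * \<kappa>)"
    have "(1::real) \<le> 16 ^ \<kappa>" by (rule one_le_power) simp
    then have "C * 16 ^ \<kappa> + 3 \<le> (C + 3) * 16 ^ \<kappa>" by (simp add: algebra_simps)
    then have "(C * 16 ^ \<kappa> + 3) ^ 4 \<le> ((C + 3) * 16 ^ \<kappa>) ^ 4" using C by (intro power_mono) auto
    also have "\<dots> = (C + 3) ^ 4 * (16 ^ \<kappa>) ^ 4" by (rule power_mult_distrib)
    also have "((16::real) ^ \<kappa>) ^ 4 = N powr (1 / 2)"
    proof -
      have "((16::real) ^ \<kappa>) ^ 4 = 2 ^ (16 * \<kappa>)"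
      proof -
        have "(16::real) = 2 ^ 4" "4 * \<kappa> * 4 = 16 * \<kappa>" by simp_all
        then show ?thesis by (simp only: power_mult[symmetric])
      qed
      moreover have "N = (2 ^ (16 * \<kappa>))\<^sup>2" unfolding N_def by (simp flip: power_mult add: mult.commute)
      ultimately show ?thesis by (simp add: powr_half_sqrt)
    qed
    finally have 1: "(C * 16 ^ \<kappa> + 3) ^ 4 \<le> (C + 3) ^ 4 * N powr (1 / 2)" .
    have "(L * (real (32 * \<kappa>) + 1)\<^sup>2) ^ 32 = L ^ 32 * (real (32 * \<kappa>) + 1) ^ 64"
      by (simp add: power_mult_distrib flip: power_mult)
    also have "\<dots> \<le> (L + 1) ^ 32 * (A * N powr \<epsilon>)"
      unfolding N_def by (rule mult_mono[OF _ A(2)]) (use L0 in \<open>auto intro: power_mono\<close>)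
    finally have 2: "(L * (real (32 * \<kappa>) + 1)\<^sup>2) ^ 32 \<le> (L + 1) ^ 32 * (A * N powr \<epsilon>)" .
    have "gain \<kappa> C \<le> 16 * (((C + 3) ^ 4 * N powr (1 / 2)) * ((L + 1) ^ 32 * (A * N powr \<epsilon>)))"
      unfolding gain_def L_def[symmetric] using C L0
      by (intro mult_left_mono mult_mono 1 2 zero_le_power mult_nonneg_nonneg) auto
    also have "\<dots> = G * (N powr (1 / 2) * N powr \<epsilon>)" by (simp add: G_def mult_ac)
    also have "N powr (1 / 2) * N powr \<epsilon> = N powr (1 / 2 + \<epsilon>)" by (simp add: powr_add)
    finally show "gain \<kappa> C \<le> G * (2 ^ (32 * \<kappa>)) powr (1 / 2 + \<epsilon>)" by (simp add: N_def)
  qed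
  then show ?thesis using G by blast
qed

lemma Lp_norm4_le:
  assumes A: "A > 0" and le: "(\<integral>\<^sup>+x. ennreal (norm (f x) ^ 4) \<partial>lborel) \<le> ennreal A * (\<integral>\<^sup>+x. ennreal (norm (g x) ^ 4) \<partial>lborel)"
  shows "Lp_norm 4 f \<le> ennreal (A powr (1 / 4)) * Lp_norm 4 g"
proof -
  have p4: "norm z powr 4 = norm z ^ 4" for z :: "'z::real_normed_vector" by (simp add: powr_numeral)
  define I where "I = (\<integral>\<^sup>+x. ennreal (norm (f x) ^ 4) \<partial>lborel)"
  define J where "J = (\<integral>\<^sup>+x. ennreal (norm (g x) ^ 4) \<partial>lborel)"
  have Lf: "Lp_norm 4 f = (if I = \<infinity> then \<infinity> else ennreal (enn2real I powr (1 / 4)))"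
    by (simp add: Lp_norm_def p4 I_def)
  have Lg: "Lp_norm 4 g = (if J = \<infinity> then \<infinity> else ennreal (enn2real J powr (1 / 4)))"
    by (simp add: Lp_norm_def p4 J_def)
  show ?thesis
  \<comment> \<open>Positivity of \<open>A\<close> enters here: for an infinite norm on the right
    the product must be infinite, and zero times infinity would be zero.\<close>
  proof (cases "J = \<infinity>")
    case True
    then show ?thesis unfolding Lg using A by (simp add: ennreal_mult_eq_top_iff)
  next
    case False
    then obtain b where b: "J = ennreal b" "b \<ge> 0" by (cases J) auto
    have "I \<le> ennreal (A * b)" using le A b unfolding I_def[symmetric] J_def[symmetric] by (simp add: ennreal_mult)
    then obtain a where a: "I = ennreal a" "a \<ge> 0" by (cases I) (auto simp: top_unique)
    have "a \<le> A * b" using \<open>I \<le> ennreal (A * b)\<close> A b unfolding a(1) by (simp add: ennreal_le_iff)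
    then have "a powr (1 / 4) \<le> (A * b) powr (1 / 4)" using a by (intro powr_mono2) auto
    also have "\<dots> = A powr (1 / 4) * b powr (1 / 4)" using A b by (simp add: powr_mult)
    finally show ?thesis unfolding Lf Lg using a b by (simp flip: ennreal_mult')
  qed
qed

lemma cone_bounded: "bounded cone"
proof -
  have "norm p \<le> 4" if "p \<in> cone" for p
    using that norm_Pair_le[of "fst p" "snd p"] by (auto simp: cone_def)
  then show ?thesis unfolding bounded_iff by blast
qed

lemma cone_nbhd_bounded: "bounded (cone_nbhd \<delta>)"
proof -
  have "norm p \<le> 4 + 2 * \<delta>" if "p \<in> cone_nbhd \<delta>" for p
    using cone_nbhd_near[OF that] norm_Pair_le[of "fst p" "snd p"] by auto
  then show ?thesis unfolding bounded_iff by blast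
qed

lemma (in tempered) conv_sum:
  assumes "\<And>i. i \<in> I \<Longrightarrow> rapid (k i)"
  shows "conv f (\<lambda>x. \<Sum>i\<in>I. k i x) x = (\<Sum>i\<in>I. conv f (k i) x)"
  unfolding Defs.convolution_def sum_distrib_left
proof (rule Bochner_Integration.integral_sum)
  fix i assume "i \<in> I"
  from conv_weight[OF assms[OF this]] show "integrable lborel (\<lambda>y. f y * k i (x - y))" by blast
qed

locale cone_square_function = cone_sectors K \<delta> P B + tempered f N0
  for K \<delta> :: real and P :: "(real^2) set set" and B :: "spacetime set \<Rightarrow> rbox" and f :: "spacetime \<Rightarrow> complex" and N0 +
  fixes \<Xi> :: "spacetime set \<Rightarrow> spacetime \<Rightarrow> complex"
  assumes f_supp: "fourier_supported_in f (cone_nbhd \<delta>)"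
    and schwartz_\<Xi>: "\<And>\<Theta>. \<Theta> \<in> sectors \<delta> P \<Longrightarrow> schwartz (\<Xi> \<Theta>)"
    and supp_\<Xi>: "\<And>\<Theta>. \<Theta> \<in> sectors \<delta> P \<Longrightarrow> closure {p. fourier (\<Xi> \<Theta>) p \<noteq> 0} \<subseteq> dilate 2 (B \<Theta>)"
    and sum_\<Xi>: "\<And>p. p \<in> cone_nbhd \<delta> \<Longrightarrow> (\<Sum>\<Theta>\<in>sectors \<delta> P. fourier (\<Xi> \<Theta>) p) = 1"
begin

lemma rapid_\<Xi>: "\<Theta> \<in> sectors \<delta> P \<Longrightarrow> rapid (\<Xi> \<Theta>)"
  by (rule schwartz_rapid[OF schwartz_\<Xi>])

text \<open>The reproducing formula is applied to the single kernel formed by the sum of all \<Xi>,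
  whose transform is known to be 1 on the closed \<delta>-neighborhood but not beyond it.\<close>

lemma decomposition: "AE x in lborel. f x = (\<Sum>\<Theta>\<in>sectors \<delta> P. conv f (\<Xi> \<Theta>) x)"
proof -
  have "AE x in lborel. f x = conv f (\<lambda>x. \<Sum>\<Theta>\<in>sectors \<delta> P. \<Xi> \<Theta> x) x"
  proof (rule reproducing[OF f_supp[unfolded cone_nbhd_def] cone_bounded d0])
    show "rapid (\<lambda>x. \<Sum>\<Theta>\<in>sectors \<delta> P. \<Xi> \<Theta> x)" by (intro rapid_sum rapid_\<Xi>)
    fix q p assume "q \<in> cone" "dist q p \<le> \<delta>"
    then have "p \<in> cone_nbhd \<delta>" by (auto simp: cone_nbhd_def)
    then show "fourier (\<lambda>x. \<Sum>\<Theta>\<in>sectors \<delta> P. \<Xi> \<Theta> x) p = 1"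
      by (subst fourier_sum) (auto intro: rapid_integrable rapid_\<Xi> sum_\<Xi>)
  qed
  then show ?thesis by eventually_elim (simp add: conv_sum rapid_\<Xi>)
qed

lemma estimate_small_scale:
  assumes small: "64 * K ^ 3 * sqrt \<delta> \<le> 1" and D: "D \<ge> 1" "2 ^ (32 * \<kappa>) \<le> D / sqrt \<delta>"
    and n: "64 * K / sqrt \<delta> \<le> 2 ^ (32 * \<kappa>)" and G: "0 \<le> gain \<kappa> (60 * K ^ 3 * D\<^sup>2)"
  shows "(\<integral>\<^sup>+x. ennreal ((cmod (f x)) ^ 4) \<partial>lborel)
    \<le> ennreal (gain \<kappa> (60 * K ^ 3 * D\<^sup>2)) * (\<integral>\<^sup>+x. ennreal ((\<Sum>\<Theta>\<in>sectors \<delta> P. (cmod (conv f (\<Xi> \<Theta>) x))\<^sup>2)\<^sup>2) \<partial>lborel)"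
proof (rule transfer[OF f_supp cone_nbhd_bounded finite_sectors rapid_\<Xi> _ G decomposition])
  \<comment> \<open>Division by the dimension makes the spectrum of the outer cutoff, contained in a
    cube of half-side at most \<rho>, fit into the ball of radius \<delta>.\<close>
  define \<rho> where "\<rho> = \<delta> / real DIM(spacetime)"
  have r: "\<rho> > 0" "\<rho> \<le> \<delta>" "real DIM(spacetime) * \<rho> = \<delta>" using d0 by (auto simp: \<rho>_def)
  show "0 < \<delta> / real DIM(spacetime)" using d0 by simp
  fix u :: "spacetime \<Rightarrow> complex" and \<epsilon>
  assume u: "nice u" and near: "\<And>\<xi>. fourier u \<xi> \<noteq> 0 \<Longrightarrow> \<exists>p\<in>cone_nbhd \<delta>. dist p \<xi> \<le> \<delta> / real DIM(spacetime)"
    and e: "0 < \<epsilon>" "\<epsilon> \<le> \<delta> / real DIM(spacetime)"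
  have nc: "nice (conv u (\<Xi> \<Theta>))" if "\<Theta> \<in> sectors \<delta> P" for \<Theta>
    by (rule nice_convolution[OF u rapid_integrable[OF rapid_\<Xi>[OF that]]])
  have nh: "nice (\<lambda>x. conv u (\<Xi> \<Theta>) x * psi (\<epsilon> *\<^sub>R x))" if "\<Theta> \<in> sectors \<delta> P" for \<Theta>
    by (rule nice_mult[OF nc[OF that] nice_psi_scaled(1)[OF e(1)]])
  show "(\<integral>x. (cmod (\<Sum>i\<in>sectors \<delta> P. conv u (\<Xi> i) x * psi (\<epsilon> *\<^sub>R x))) ^ 4 \<partial>lborel)
       \<le> gain \<kappa> (60 * K ^ 3 * D\<^sup>2) * (\<integral>x. (\<Sum>i\<in>sectors \<delta> P. (cmod (conv u (\<Xi> i) x * psi (\<epsilon> *\<^sub>R x)))\<^sup>2)\<^sup>2 \<partial>lborel)"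
  proof (rule sectors_estimate[OF nh small D n])
    fix \<Theta> \<xi> assume S: "\<Theta> \<in> sectors \<delta> P" and nz: "fourier (\<lambda>x. conv u (\<Xi> \<Theta>) x * psi (\<epsilon> *\<^sub>R x)) \<xi> \<noteq> 0"
    obtain p q where pq: "\<xi> = p + q" "fourier (conv u (\<Xi> \<Theta>)) p \<noteq> 0" "fourier (\<lambda>x::spacetime. psi (\<epsilon> *\<^sub>R x)) q \<noteq> 0"
      by (rule fourier_mult_nonzeroD[OF nc[OF S] nice_psi_scaled(1)[OF e(1)] nz]) blast
    have "fourier u p * fourier (\<Xi> \<Theta>) p \<noteq> 0"
      using pq(2) fourier_convolution[OF u rapid_integrable[OF rapid_\<Xi>[OF S]], of p] by simp
    then have F: "fourier u p \<noteq> 0" "fourier (\<Xi> \<Theta>) p \<noteq> 0" by auto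
    have "p \<in> dilate 2 (B \<Theta>)" 
      by (rule subsetD[OF supp_\<Xi>[OF S]], rule subsetD[OF closure_subset]) (use F(2) in simp)
    moreover have "\<exists>r\<in>cone_nbhd \<delta>. dist r p \<le> \<delta>" using near[OF F(1)] r(2) unfolding \<rho>_def by (meson order.trans)
    moreover have "norm q \<le> \<delta>"
    proof -
      have "norm q \<le> real DIM(spacetime) * \<epsilon>" by (rule nice_psi_scaled(2)[OF e(1) pq(3)])
      also have "\<dots> \<le> real DIM(spacetime) * \<rho>" using e(2) unfolding \<rho>_def by (intro mult_left_mono) auto
      finally show ?thesis using r(3) by simp
    qed
    ultimately show "\<exists>p q. \<xi> = p + q \<and> p \<in> dilate 2 (B \<Theta>) \<and> (\<exists>r\<in>cone_nbhd \<delta>. dist r p \<le> \<delta>) \<and> norm q \<le> \<delta>"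
      using pq(1) by blast
  qed
qed

text \<open>Cauchy-Schwarz over all sectors. It serves the scales at which \<delta> is bounded below
  in terms of \<open>K\<close>, where the number of sectors is bounded.\<close>

lemma estimate_trivial:
  assumes N: "real (card (sectors \<delta> P)) \<le> N"
  shows "(\<integral>\<^sup>+x. ennreal ((cmod (f x)) ^ 4) \<partial>lborel)
    \<le> ennreal (N\<^sup>2) * (\<integral>\<^sup>+x. ennreal ((\<Sum>\<Theta>\<in>sectors \<delta> P. (cmod (conv f (\<Xi> \<Theta>) x))\<^sup>2)\<^sup>2) \<partial>lborel)"
proof -
  have km: "i \<in> sectors \<delta> P \<Longrightarrow> \<Xi> i \<in> borel_measurable borel" for i by (rule rapid_measurable[OF rapid_\<Xi>])
  have cm: "conv f (\<Xi> i) \<in> borel_measurable borel" if "i \<in> sectors \<delta> P" for i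
    using km[OF that] unfolding Defs.convolution_def[abs_def] by measurable
  have "(\<integral>\<^sup>+x. ennreal ((cmod (f x)) ^ 4) \<partial>lborel)
     \<le> (\<integral>\<^sup>+x. ennreal (N\<^sup>2) * ennreal ((\<Sum>\<Theta>\<in>sectors \<delta> P. (cmod (conv f (\<Xi> \<Theta>) x))\<^sup>2)\<^sup>2) \<partial>lborel)"
  proof (rule nn_integral_mono_AE)
    show "AE x in lborel. ennreal ((cmod (f x)) ^ 4) \<le> ennreal (N\<^sup>2) * ennreal ((\<Sum>\<Theta>\<in>sectors \<delta> P. (cmod (conv f (\<Xi> \<Theta>) x))\<^sup>2)\<^sup>2)"
      using decomposition
    proof eventually_elim
      fix x assume x: "f x = (\<Sum>\<Theta>\<in>sectors \<delta> P. conv f (\<Xi> \<Theta>) x)"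
      define S where "S = (\<Sum>\<Theta>\<in>sectors \<delta> P. (cmod (conv f (\<Xi> \<Theta>) x))\<^sup>2)"
      have S0: "S \<ge> 0" by (simp add: S_def sum_nonneg)
      have "(cmod (f x))\<^sup>2 \<le> (\<Sum>\<Theta>\<in>sectors \<delta> P. cmod (conv f (\<Xi> \<Theta>) x))\<^sup>2" unfolding x by (intro power_mono norm_sum) simp
      also have "\<dots> \<le> S * real (card (sectors \<delta> P))" unfolding S_def by (rule sum_squared_le_sum_of_squares)
      also have "\<dots> \<le> S * N" using S0 N by (intro mult_left_mono) auto
      finally have "((cmod (f x))\<^sup>2)\<^sup>2 \<le> (S * N)\<^sup>2" by (intro power_mono) auto
      then have "(cmod (f x)) ^ 4 \<le> N\<^sup>2 * S\<^sup>2" by (simp add: power_mult_distrib mult.commute flip: power_mult)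
      then show "ennreal ((cmod (f x)) ^ 4) \<le> ennreal (N\<^sup>2) * ennreal ((\<Sum>\<Theta>\<in>sectors \<delta> P. (cmod (conv f (\<Xi> \<Theta>) x))\<^sup>2)\<^sup>2)"
        unfolding S_def[symmetric] by (simp add: ennreal_leI flip: ennreal_mult')
    qed
  qed
  also have "\<dots> = ennreal (N\<^sup>2) * (\<integral>\<^sup>+x. ennreal ((\<Sum>\<Theta>\<in>sectors \<delta> P. (cmod (conv f (\<Xi> \<Theta>) x))\<^sup>2)\<^sup>2) \<partial>lborel)"
    by (rule nn_integral_cmult) (use cm in measurable)
  finally show ?thesis .
qed

end

theorem theorem1p1:
  fixes \<delta>\<^sub>0 :: real
    and arcs :: "real \<Rightarrow> (real^2) set set"
    and B :: "real \<Rightarrow> spacetime set \<Rightarrow> rbox"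
    and \<Xi> :: "real \<Rightarrow> spacetime set \<Rightarrow> spacetime \<Rightarrow> complex"
  assumes "0 < \<delta>\<^sub>0" and "\<delta>\<^sub>0 \<le> 1"
    and "sector_decomposition \<delta>\<^sub>0 arcs B"
    and "adapted_partition_of_unity \<delta>\<^sub>0 arcs B \<Xi>"
  shows "\<forall>\<epsilon>>0. \<exists>C>0. \<forall>\<delta>\<in>{0<..<\<delta>\<^sub>0}. \<forall>f :: spacetime \<Rightarrow> complex.
           tempered_function f \<and> fourier_supported_in f (cone_nbhd \<delta>) \<longrightarrow>
           Lp_norm 4 f \<le> ennreal (C * \<delta> powr (- (1 / 16) - \<epsilon>))
                          * Lp_norm 4 (square_function (sectors \<delta> (arcs \<delta>)) (\<Xi> \<delta>) f)"
proof (intro allI impI)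
  fix \<epsilon> :: real assume e: "\<epsilon> > 0"
  obtain K where K: "K \<ge> 1" "\<And>\<delta>. \<delta> \<in> {0<..<\<delta>\<^sub>0} \<Longrightarrow> arc_partition K \<delta> (arcs \<delta>)"
    "\<And>\<delta> \<Theta>. \<delta> \<in> {0<..<\<delta>\<^sub>0} \<Longrightarrow> \<Theta> \<in> sectors \<delta> (arcs \<delta>) \<Longrightarrow> comparable_box K \<delta> \<Theta> (B \<delta> \<Theta>)"
    using assms(3) unfolding sector_decomposition_def by blast
  \<comment> \<open>\<open>64 * K\<close> is what one sector per node requires,
    \<open>2 ^ 32\<close> the loss from rounding the number of levels to a multiple of 32.\<close>
  define D where "D = 2 ^ 32 * (64 * K)"
  have D: "D \<ge> 1" using K(1) by (simp add: D_def)
  define C where "C = 60 * K ^ 3 * D\<^sup>2"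
  have "1 * 1 \<le> K ^ 3 * D\<^sup>2" using K(1) D(1) by (intro mult_mono one_le_power) auto
  then have C1: "C \<ge> 1" by (simp add: C_def)
  \<comment> \<open>\<open>8 * \<epsilon>\<close> is halved because
    \<open>2 ^ (32 * \<kappa>)\<close> is comparable to \<open>1 / sqrt \<delta>\<close>, and
    divided by 4 by the fourth root, so that \<epsilon> remains.\<close>
  obtain G where G: "G > 0" "\<And>\<kappa>. 0 \<le> gain \<kappa> C" "\<And>\<kappa>. gain \<kappa> C \<le> G * (2 ^ (32 * \<kappa>)) powr (1 / 2 + 8 * \<epsilon>)"
    using gain_bound[of "8 * \<epsilon>" C] e C1 by auto
  \<comment> \<open>One summand for each of the two regimes of \<delta>.\<close>
  define A where "A = G * D powr (1 / 2 + 8 * \<epsilon>) + (128 * K ^ 3 * D)\<^sup>2"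
  have A: "A > 0" using G(1) D unfolding A_def by (intro add_pos_nonneg) auto
  show "\<exists>C>0. \<forall>\<delta>\<in>{0<..<\<delta>\<^sub>0}. \<forall>f :: spacetime \<Rightarrow> complex.
           tempered_function f \<and> fourier_supported_in f (cone_nbhd \<delta>) \<longrightarrow>
           Lp_norm 4 f \<le> ennreal (C * \<delta> powr (- (1 / 16) - \<epsilon>))
                          * Lp_norm 4 (square_function (sectors \<delta> (arcs \<delta>)) (\<Xi> \<delta>) f)"
  proof (intro exI[of _ "A powr (1 / 4)"] conjI ballI allI impI, goal_cases)
    case 1
    then show ?case using A by simp
  next
    case (2 \<delta> f)
    then have \<delta>: "0 < \<delta>" "\<delta> < 1" and dd: "\<delta> \<in> {0<..<\<delta>\<^sub>0}" using assms(2) by auto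
    obtain N0 where f: "f \<in> borel_measurable lborel" "integrable lborel (\<lambda>x. f x / of_real ((1 + norm x) ^ N0))"
      using 2 unfolding tempered_function_def by blast
    interpret cone_square_function K \<delta> "arcs \<delta>" "B \<delta>" f N0 "\<Xi> \<delta>"
    proof unfold_locales
      show "f \<in> borel_measurable borel" using f(1) by simp
    qed (use K \<delta> dd f 2 assms(4) in \<open>auto simp: adapted_partition_of_unity_def\<close>)
    have "sqrt \<delta> \<le> 64 * K" using K1 sqrt_d(2) by linarith
    then have "1 \<le> 64 * K / sqrt \<delta>" using sqrt_d(1) by (subst le_divide_eq) simp
    then obtain \<kappa> where k: "64 * K / sqrt \<delta> \<le> 2 ^ (32 * \<kappa>)" "2 ^ (32 * \<kappa>) \<le> 2 ^ 32 * (64 * K / sqrt \<delta>)"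
      using power_scale_exists by blast
    have kD: "2 ^ (32 * \<kappa>) \<le> D / sqrt \<delta>" using k(2) by (simp add: D_def)
    define R where "R = \<delta> powr (- (1 / 4) - 4 * \<epsilon>)"
    have R1: "R \<ge> 1" using \<delta> e unfolding R_def by (simp add: powr_def mult_nonpos_nonpos)
    have "(\<integral>\<^sup>+x. ennreal ((cmod (f x)) ^ 4) \<partial>lborel)
      \<le> ennreal (A * R) * (\<integral>\<^sup>+x. ennreal ((\<Sum>\<Theta>\<in>sectors \<delta> (arcs \<delta>). (cmod (conv f (\<Xi> \<delta> \<Theta>) x))\<^sup>2)\<^sup>2) \<partial>lborel)"
    proof (cases "64 * K ^ 3 * sqrt \<delta> \<le> 1")
      case True
      have "gain \<kappa> C \<le> G * (2 ^ (32 * \<kappa>)) powr (1 / 2 + 8 * \<epsilon>)" by (rule G(3))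
      also have "\<dots> \<le> G * (D / sqrt \<delta>) powr (1 / 2 + 8 * \<epsilon>)"
        using G(1) e kD by (intro mult_left_mono powr_mono2) auto
      also have "(D / sqrt \<delta>) powr (1 / 2 + 8 * \<epsilon>) = D powr (1 / 2 + 8 * \<epsilon>) * R"
      proof -
        have "(1 / 2 + 8 * \<epsilon>) / 2 = 1 / 4 + 4 * \<epsilon>" by simp
        moreover have "sqrt \<delta> powr (1 / 2 + 8 * \<epsilon>) = \<delta> powr ((1 / 2 + 8 * \<epsilon>) / 2)"
          using \<delta> unfolding powr_half_sqrt[symmetric, OF less_imp_le[OF \<delta>(1)]] by (simp add: powr_powr)
        ultimately have "sqrt \<delta> powr (1 / 2 + 8 * \<epsilon>) = \<delta> powr (1 / 4 + 4 * \<epsilon>)" by (simp only:)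
        moreover have "- (1 / 4 + 4 * \<epsilon>) = - (1 / 4) - 4 * \<epsilon>" by simp
        ultimately have "1 / sqrt \<delta> powr (1 / 2 + 8 * \<epsilon>) = R"
          unfolding R_def by (metis powr_minus_divide)
        moreover have "(D / sqrt \<delta>) powr (1 / 2 + 8 * \<epsilon>) = D powr (1 / 2 + 8 * \<epsilon>) * (1 / sqrt \<delta> powr (1 / 2 + 8 * \<epsilon>))"
          using D sqrt_d by (simp add: powr_divide)
        ultimately show ?thesis by simp
      qed
      also have "G * (D powr (1 / 2 + 8 * \<epsilon>) * R) \<le> A * R"
        using R1 unfolding A_def by (simp add: algebra_simps)
      finally have "ennreal (gain \<kappa> C) \<le> ennreal (A * R)" by (rule ennreal_leI)
      with estimate_small_scale[OF True D kD k(1) G(2)[unfolded C_def]] show ?thesis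
        unfolding C_def by (meson mult_right_mono order.trans zero_le)
    next
      \<comment> \<open>Here \<open>sqrt \<delta>\<close> exceeds \<open>1 / (64 * K ^ 3)\<close>,
        so there are boundedly many sectors; \<open>R \<ge> 1\<close> allows the constant to be
        multiplied by the same power of \<delta> as in the other regime.\<close>
      case False
      have "real (card (sectors \<delta> (arcs \<delta>))) \<le> real (2 * 2 ^ (32 * \<kappa>))" using card_sectors[OF k(1)] by (intro of_nat_mono)
      also have "\<dots> \<le> 2 * (D / sqrt \<delta>)" using kD by simp
      also have "\<dots> \<le> 128 * K ^ 3 * D"
      proof -
        have "D * 1 \<le> D * (64 * K ^ 3 * sqrt \<delta>)" using False D by (intro mult_left_mono) auto
        then show ?thesis using sqrt_d by (simp add: divide_le_eq mult_ac)
      qed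
      finally have "(\<integral>\<^sup>+x. ennreal ((cmod (f x)) ^ 4) \<partial>lborel)
        \<le> ennreal ((128 * K ^ 3 * D)\<^sup>2) * (\<integral>\<^sup>+x. ennreal ((\<Sum>\<Theta>\<in>sectors \<delta> (arcs \<delta>). (cmod (conv f (\<Xi> \<delta> \<Theta>) x))\<^sup>2)\<^sup>2) \<partial>lborel)"
        by (rule estimate_trivial)
      moreover have "ennreal ((128 * K ^ 3 * D)\<^sup>2) \<le> ennreal (A * R)"
      proof (rule ennreal_leI)
        have "(128 * K ^ 3 * D)\<^sup>2 * 1 \<le> A * R" using G(1) A R1 unfolding A_def by (intro mult_mono) auto
        then show "(128 * K ^ 3 * D)\<^sup>2 \<le> A * R" by simp
      qed
      ultimately show ?thesis by (meson mult_right_mono order.trans zero_le)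
    qed
    also have "(\<lambda>x. (\<Sum>\<Theta>\<in>sectors \<delta> (arcs \<delta>). (cmod (conv f (\<Xi> \<delta> \<Theta>) x))\<^sup>2)\<^sup>2)
      = (\<lambda>x. norm (square_function (sectors \<delta> (arcs \<delta>)) (\<Xi> \<delta>) f x) ^ 4)"
    proof (rule ext, goal_cases)
      case (1 x)
      define S where "S = (\<Sum>\<Theta>\<in>sectors \<delta> (arcs \<delta>). (cmod (conv f (\<Xi> \<delta> \<Theta>) x))\<^sup>2)"
      have "S \<ge> 0" by (simp add: S_def sum_nonneg)
      then have "S\<^sup>2 = norm (sqrt S) ^ 4" using power_mult[of "sqrt S" 2 2] by simp
      then show ?case
        by (simp add: square_function_def S_def)
    qed
    finally have "Lp_norm 4 f \<le> ennreal ((A * R) powr (1 / 4)) * Lp_norm 4 (square_function (sectors \<delta> (arcs \<delta>)) (\<Xi> \<delta>) f)"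
      using A R1 by (intro Lp_norm4_le) auto
    moreover have "(A * R) powr (1 / 4) = A powr (1 / 4) * \<delta> powr (- (1 / 16) - \<epsilon>)"
      using A R1 by (simp add: powr_mult R_def powr_powr algebra_simps)
    ultimately show ?case by simp
  qed
qed

end
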